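(* Let $\alpha\in(0,2]$ and let $X$ be an $(N,d)$-linear multifractional stable sheet in the broad sense whose Hurst functional index $H=(h_1,\ldots,h_N)$ satisfies the standing assumptions $\mathcal H_1$, $\mathcal H_2$ below. Let $I=[\epsilon,T]^N$ with $0<\epsilon<T$. If $d<\inf_{v\in I}\sum_{l=1}^N 1/h_l(v)$, then $X$ has a jointly continuous local time on $I$, i.e. the local time $L(x,[(\epsilon,\ldots,\epsilon),t])$ (has a version that) is almost surely continuous as a function of $(x,t)\in\mathbb R^d\times I$.
   Context: Let $\alpha\in(0,2]$. For $\alpha<2$, $M_\alpha$ denotes a rotationally invariant (symmetric) $\alpha$-stable random measure on $\mathbb R^N$ with Lebesgue control measure; for $\alpha=2$, $M_\alpha$ is the standard Gaussian white noise on $\mathbb R^N$. Let $H(u)=(h_1(u),\ldots,h_N(u))$, $u\in\mathbb R_+^N=[0,\infty)^N$, be a deterministic function with values in $(0,1)^N$. For $u\in\mathbb R_+^N$, $v\in\mathbb R^N$ put $g^{H(u)}(u,v)=c_{H(1)}\prod_{l=1}^N\big[(u_l-v_l)_+^{h_l(u)-1/\alpha}-(-v_l)_+^{h_l(u)-1/\alpha}\big]$, where $a_+=\max\{a,0\}$ and $c_{H(1)}>0$ is a normalizing constant. The real-valued LMSS is $X_0(u)=\int_{\mathbb R^N}g^{H(u)}(u,v)M_\alpha(\mathrm dv)$; for $a_j\in\mathbb R$, $u^j\in\mathbb R_+^N$ one sets $\|\sum_j a_jX_0(u^j)\|_\alpha^\alpha=\int_{\mathbb R^N}|\sum_j a_j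 g^{H(u^j)}(u^j,v)|^\alpha\mathrm dv$, and $\mathbb E e^{i\sum_j a_jX_0(u^j)}=e^{-\|\sum_ja_jX_0(u^j)\|_\alpha^\alpha}$; $c_{H(1)}$ is chosen so that $\|X_0(1,\ldots,1)\|_\alpha=1$. An $(N,d)$-LMSS is $X(u)=(X_1(u),\ldots,X_d(u))$ with $X_1,\ldots,X_d$ independent copies of $X_0$. Standing assumptions: ($\mathcal H_1$) there are constants $0<m_l<M_l<1$ with $m_l\le h_l(u)\le M_l$ for all $u\in\mathbb R_+^N$; ($\mathcal H_2$) for each compact $I\subseteq\mathbb R_+^N$ there is $c=c(I)>0$ such that $|h_l(u)-h_l(v)|\le c\,\rho(u,v)$ for all $u,v\in I$, all $l$, where $\rho(u,v)=\sum_{l=1}^N\min\{|u_l-v_l|^{m_l},|u_l-v_l|^{M_l}\}$. Local time: for a Borel set $J$, the occupation measure is $\mu_J(B)=\lambda_N\{t\in J:X(t)\in B\}$; if $\mu_J\ll\lambda_d$, the local time is $L(x,J)=\frac{\mathrm d\mu_J}{\mathrm d\lambda_d}(x)$. For a rectangle $[a,b]$, $X$ has a jointly continuous local time on $[a,b]$ if $L(x,[a,t])$ is a.s. continuous in $(x,t)\in\mathbb R^d\times[a,b]$. *)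

theory Defs
  imports "HOL-Probability.Probability"
begin

definition pospow :: "real \<Rightarrow> real \<Rightarrow> real" where
  "pospow x p = (if x > 0 then x powr p else 0)"

definition lmss_kernel0 ::
  "real \<Rightarrow> (real^'n \<Rightarrow> real^'n) \<Rightarrow> real^'n \<Rightarrow> real^'n \<Rightarrow> real" where
  "lmss_kernel0 alpha H u v =
     (\<Prod>l\<in>UNIV. pospow (u$l - v$l) (H u $ l - 1/alpha) - pospow (- v$l) (H u $ l - 1/alpha))"

text \<open>Normalizing constant c_{H(1)}, chosen so that the alpha-norm of X_0(1,...,1) is 1.\<close>
definition lmss_const :: "real \<Rightarrow> (real^'n \<Rightarrow> real^'n) \<Rightarrow> real" where
  "lmss_const alpha H =
     1 / ((LINT v|lborel. \<bar>lmss_kernel0 alpha H (\<chi> l. 1) v\<bar> powr alpha) powr (1/alpha))"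

definition lmss_kernel ::
  "real \<Rightarrow> (real^'n \<Rightarrow> real^'n) \<Rightarrow> real^'n \<Rightarrow> real^'n \<Rightarrow> real" where
  "lmss_kernel alpha H u v = lmss_const alpha H * lmss_kernel0 alpha H u v"

definition nonneg_orthant :: "(real^'n) set" where
  "nonneg_orthant = {u. \<forall>l. 0 \<le> u$l}"

definition rho_dist :: "real^'n \<Rightarrow> real^'n \<Rightarrow> real^'n \<Rightarrow> real^'n \<Rightarrow> real" where
  "rho_dist m Mx u v = (\<Sum>l\<in>UNIV. min (\<bar>u$l - v$l\<bar> powr (m$l)) (\<bar>u$l - v$l\<bar> powr (Mx$l)))"

text \<open>(N,d)-LMSS, characterized by its finite-dimensional distributions: the components
  X_1,...,X_d are independent copies of X_0, whose joint characteristic functions are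
  E exp(i sum_j a_j X_0(u^j)) = exp(-int |sum_j a_j g(u^j,v)|^alpha dv).
  Jointly: E exp(i sum_{(k,u) in S} a(k,u) X_k(u)) = prod_k exp(-||...||_alpha^alpha).
  Paths are required to be jointly measurable in (u,omega) (needed to define the occupation measure).\<close>
definition is_LMSS ::
  "'w measure \<Rightarrow> real \<Rightarrow> (real^'n \<Rightarrow> real^'n) \<Rightarrow> ('d::finite \<Rightarrow> real^'n \<Rightarrow> 'w \<Rightarrow> real) \<Rightarrow> bool" where
  "is_LMSS M alpha H X \<longleftrightarrow>
     prob_space M \<and>
     (\<forall>k. (\<lambda>(u,w). X k u w) \<in> borel_measurable (lborel \<Otimes>\<^sub>M M)) \<and>
     (\<forall>S a. finite S \<longrightarrow> S \<subseteq> UNIV \<times> nonneg_orthant \<longrightarrow>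
        prob_space.expectation M (\<lambda>w. cis (\<Sum>(k,u)\<in>S. a (k,u) * X k u w)) =
        complex_of_real (\<Prod>k\<in>UNIV.
           exp (- (LINT v|lborel. \<bar>\<Sum>u\<in>{u. (k,u) \<in> S}. a (k,u) * lmss_kernel alpha H u v\<bar> powr alpha))))"

definition path_val :: "('d::finite \<Rightarrow> real^'n \<Rightarrow> 'w \<Rightarrow> real) \<Rightarrow> real^'n \<Rightarrow> 'w \<Rightarrow> real^'d" where
  "path_val X t w = (\<chi> k. X k t w)"

definition occupation :: "('d::finite \<Rightarrow> real^'n \<Rightarrow> 'w \<Rightarrow> real) \<Rightarrow> 'w \<Rightarrow> (real^'n) set \<Rightarrow> (real^'d) set \<Rightarrow> ennreal" where
  "occupation X w J B = emeasure lborel {t \<in> J. path_val X t w \<in> B}"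

definition has_joint_cont_local_time ::
  "'w measure \<Rightarrow> ('d::finite \<Rightarrow> real^'n \<Rightarrow> 'w \<Rightarrow> real) \<Rightarrow> real^'n \<Rightarrow> real^'n \<Rightarrow> bool" where
  "has_joint_cont_local_time M X a b \<longleftrightarrow>
     (\<exists>L :: 'w \<Rightarrow> real^'d \<Rightarrow> real^'n \<Rightarrow> real.
       AE w in M.
         (\<forall>t\<in>cbox a b. \<forall>x. 0 \<le> L w x t) \<and>
         (\<forall>t\<in>cbox a b. \<forall>B\<in>sets borel.
             occupation X w (cbox a t) B = (\<integral>\<^sup>+ x\<in>B. ennreal (L w x t) \<partial>lborel)) \<and>
         continuous_on (UNIV \<times> cbox a b) (\<lambda>(x,t). L w x t))"

end

theory Submission
  imports Defs "HOL-Computational_Algebra.Polynomial" "HOL-Real_Asymp.Real_Asymp"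
begin

text \<open>The occupation density is the limit of the mollified densities
  \<open>F \<epsilon> x t = \<integral> \<phi>\<^sub>\<epsilon> (X s - x) ds\<close> over the box from \<open>(eps, \<dots>, eps)\<close> to \<open>t\<close>, where \<open>\<phi>\<^sub>\<epsilon>\<close> is a Gaussian.
  By Fourier inversion the \<open>p\<close>-th moment of \<open>F \<epsilon> x t - F (\<epsilon>/2) x t\<close> is an integral over times and
  frequencies of the joint characteristic function, and it is \<open>O(\<epsilon> powr (\<gamma> * p))\<close> for some \<open>\<gamma> > 0\<close>
  independent of \<open>p\<close>. A union bound over polynomially many grid points with \<open>p\<close> large, together with the
  Lipschitz continuity of each \<open>F \<epsilon>\<close>, makes the convergence uniform along \<open>\<epsilon> = (1/2) ^ n\<close>.

  The moment bound rests on local nondeterminism in every coordinate: if the \<open>l\<close>-th coordinates of the other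
  points stay \<open>\<delta>\<close> away from that of \<open>s j\<close>, then the norm of \<open>\<Sum>i. x i * g (s i)\<close> is at least
  \<open>c * \<bar>x j\<bar> * \<delta> powr H (s j) $ l\<close>. In one variable this holds because a
  sum of \<open>n\<close> real powers with base points outside an interval has boundedly many zeros there and cannot mimic the
  cut-off power at \<open>s j\<close>. A weighted geometric mean over the coordinates gives the total exponent
  \<open>1 / (\<Sum>l. 1 / H (s j) $ l)\<close>, so the dimension condition makes the resulting singularities integrable.\<close>

section \<open>Zeros of sums of real powers\<close>

text \<open>The times cannot be sorted: in general no numbering of the points \<open>s i\<close> is
  increasing in all coordinates. The kernels of points with larger l-th coordinate are nonzero and
  smooth around \<open>s j $ l\<close> and might cancel the cut-off power there, so a bound that
  looks only at smaller coordinates is not enough; hence the one-variable bound is two-sided and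
  rests on counting zeros. As H varies from point to point, the count must be uniform in the
  exponents too. Of the paths only joint measurability is known, so every estimate is an
  expectation, and continuity in (x, t) never comes from increments of the local time: it is
  inherited from the continuous approximations. The exponent \<gamma> is paid for by the slack in
  the dimension condition: the difference of two scales cancels low frequencies and yields
  \<open>\<epsilon> powr \<gamma>\<close> at the price of frequency weights of order
  \<gamma>.\<close>

definition few_zeros :: "nat \<Rightarrow> (real \<Rightarrow> real) \<Rightarrow> bool" where
  "few_zeros Z f \<longleftrightarrow> (\<forall>w\<in>{-1<..<1}. f w = 0) \<or>
     (finite {w\<in>{-1<..<1}. f w = 0} \<and> card {w\<in>{-1<..<1}. f w = 0} \<le> Z)"

lemma few_zeros_mult:
  assumes "few_zeros Z f" "\<And>w. w \<in> {-1<..<1} \<Longrightarrow> g w = c w * f w" "\<And>w. w \<in> {-1<..<1} \<Longrightarrow> c w \<noteq> (0::real)"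
  shows "few_zeros Z g"
proof -
  have "{w\<in>{-1<..<1}. g w = 0} = {w\<in>{-1<..<1}. f w = 0}"
    using assms(2,3) by auto
  then show ?thesis using assms unfolding few_zeros_def by auto
qed

lemma few_zeros_subset_card:
  assumes "few_zeros Z f" "Y \<subseteq> {w\<in>{-1<..<1}. f w = 0}" "finite Y" "Z < card Y" "w \<in> {-1<..<1}"
  shows "f w = 0"
  using assms card_mono[of "{w\<in>{-1<..<1}. f w = 0}" Y] unfolding few_zeros_def by fastforce

text \<open>Rolle's theorem by induction: the largest zero is removed and the mean value theorem is
  applied between it and its neighbour. The clause \<open>y < Max W\<close> makes the point found in
  each step differ from those already collected.\<close>

lemma interlacing_zeros:
  fixes f f' :: "real \<Rightarrow> real"
  assumes d: "\<And>w. w \<in> {-1<..<1} \<Longrightarrow> (f has_real_derivative f' w) (at w)"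
  shows "W \<subseteq> {w\<in>{-1<..<1}. f w = 0} \<Longrightarrow> finite W \<Longrightarrow> card W = Suc m \<Longrightarrow>
    \<exists>Y. Y \<subseteq> {w\<in>{-1<..<1}. f' w = 0} \<and> finite Y \<and> card Y = m \<and> (\<forall>y\<in>Y. y < Max W)"
proof (induction m arbitrary: W)
  case 0
  then show ?case by (intro exI[of _ "{}"]) auto
next
  case (Suc m)
  define W' where "W' = W - {Max W}"
  have ne: "W \<noteq> {}" using Suc.prems by auto
  have M: "Max W \<in> W" using ne Suc.prems by simp
  have c': "card W' = Suc m" "finite W'" "W' \<subseteq> {w\<in>{-1<..<1}. f w = 0}"
    using Suc.prems M unfolding W'_def by auto
  then have ne': "W' \<noteq> {}" by auto
  have M': "Max W' \<in> W'" using ne' c' by simp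
  have lt: "Max W' < Max W"
  proof -
    have "Max W' \<in> W" "Max W' \<noteq> Max W" using M' unfolding W'_def by blast+
    then show ?thesis using Suc.prems(2) by (simp add: order_less_le)
  qed
  obtain Y where Y: "Y \<subseteq> {w\<in>{-1<..<1}. f' w = 0}" "finite Y" "card Y = m" "\<forall>y\<in>Y. y < Max W'"
    using Suc.IH[OF c'(3,2,1)] by blast
  have in1: "Max W' \<in> {-1<..<1}" "f (Max W') = 0" using M' c' by auto
  have in2: "Max W \<in> {-1<..<1}" "f (Max W) = 0" using M Suc.prems by auto
  have "\<exists>z>Max W'. z < Max W \<and> f (Max W) - f (Max W') = (Max W - Max W') * f' z"
    using lt in1 in2 by (intro MVT2) (auto intro!: d)
  then obtain z where z: "Max W' < z" "z < Max W" "f' z = 0" using in1 in2 lt by auto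
  have "z \<notin> Y" using Y z by fastforce
  then show ?case using Y z in1 in2 lt
    by (intro exI[of _ "insert z Y"]) fastforce
qed

text \<open>\<open>Z + 2\<close> zeros of f give \<open>Z + 1\<close> zeros of f', so f' vanishes
  identically and f is a constant with a zero. The alternative of vanishing identically in
  \<open>few_zeros\<close> is what lets the count pass through differentiation; it also covers sums
  whose terms cancel.\<close>

lemma few_zeros_derivative:
  assumes d: "\<And>w. w \<in> {-1<..<1} \<Longrightarrow> (f has_real_derivative f' w) (at w)"
    and f': "few_zeros Z f'"
  shows "few_zeros (Suc Z) f"
proof (rule ccontr)
  assume neg: "\<not> few_zeros (Suc Z) f"
  let ?W = "{w\<in>{-1<..<1}. f w = 0}"
  have "\<exists>W. W \<subseteq> ?W \<and> finite W \<and> card W = Suc (Suc Z)"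
  proof (cases "finite ?W")
    case True
    then have "Suc (Suc Z) \<le> card ?W" using neg unfolding few_zeros_def by auto
    then show ?thesis by (elim obtain_subset_with_card_n) blast
  next
    case False
    then show ?thesis using infinite_arbitrarily_large by blast
  qed
  then obtain W where W: "W \<subseteq> ?W" "finite W" "card W = Suc (Suc Z)" by blast
  obtain Y where Y: "Y \<subseteq> {w\<in>{-1<..<1}. f' w = 0}" "finite Y" "card Y = Suc Z"
    using interlacing_zeros[OF d W] by blast
  have f'0: "f' w = 0" if "w \<in> {-1<..<1}" for w
    using few_zeros_subset_card[OF f' Y(1,2) _ that] Y by simp
  have "\<exists>c. \<forall>x\<in>{-1<..<1}. f x = c"
    using d f'0 by (intro has_field_derivative_zero_constant) (auto intro: has_field_derivative_at_within)
  then obtain c where c: "\<forall>x\<in>{-1<..<1}. f x = c" by blast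
  obtain w0 where "w0 \<in> W" using W(3) by fastforce
  then have "c = 0" using c W(1) by auto
  then have "f w = 0" if "w \<in> {-1<..<1}" for w using that c by blast
  then show False using neg unfolding few_zeros_def by auto
qed

text \<open>All terms share the base points \<open>b\<close> and differ only in the exponent vector.
  Dividing one term by another shifts exponent vectors, and differentiation lowers every exponent by
  one up to a polynomial factor, so sums of such terms with polynomial coefficients stay in one
  class.\<close>

definition powr_prod :: "nat \<Rightarrow> (nat \<Rightarrow> real) \<Rightarrow> (nat \<Rightarrow> real) \<Rightarrow> real \<Rightarrow> real" where
  "powr_prod m b e w = (\<Prod>k<m. (b k - w) powr e k)"

lemma powr_prod_pos:
  assumes "\<forall>k<m. 1 \<le> b k" "w < 1"
  shows "powr_prod m b e w > 0"
  unfolding powr_prod_def using assms by (intro prod_pos) fastforce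

lemma powr_prod_diff:
  assumes "\<forall>k<m. 1 \<le> b k" "w < 1"
  shows "powr_prod m b (\<lambda>k. e k - e' k) w * powr_prod m b e' w = powr_prod m b e w"
  unfolding powr_prod_def prod.distrib[symmetric]
  by (intro prod.cong) (auto simp: powr_add[symmetric])

lemma powr_prod_minus_one:
  assumes "\<forall>k<m. 1 \<le> b k" "w < 1"
  shows "powr_prod m b e w = powr_prod m b (\<lambda>k. e k - 1) w * poly (\<Prod>k<m. [:b k, -1:]) w"
  unfolding powr_prod_def poly_prod prod.distrib[symmetric]
proof (intro prod.cong refl)
  fix k assume "k \<in> {..<m}"
  then have "b k - w > 0" using assms by fastforce
  then show "(b k - w) powr e k = (b k - w) powr (e k - 1) * poly [:b k, -1:] w"
    by (simp add: powr_diff)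
qed

lemma degree_linear_prod: "degree (\<Prod>k<m. [:b k :: real, -1:]) \<le> m"
proof (induction m)
  case (Suc m)
  then show ?case using degree_mult_le[of "\<Prod>k<m. [:b k, -1:]" "[:b m, -1:]"] by simp
qed simp

lemma powr_prod_derivative:
  "(\<forall>k<m. 1 \<le> b k) \<Longrightarrow> \<exists>R. degree R \<le> m \<and> (\<forall>w\<in>{-1<..<1}.
     (powr_prod m b e has_real_derivative powr_prod m b (\<lambda>k. e k - 1) w * poly R w) (at w))"
proof (induction m)
  case 0
  have "powr_prod 0 b e = (\<lambda>w. 1)" for e by (simp add: powr_prod_def fun_eq_iff)
  then show ?case by (intro exI[of _ 0]) auto
next
  case (Suc m)
  then obtain R where R: "degree R \<le> m" "\<And>w. w\<in>{-1<..<1} \<Longrightarrow>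
     (powr_prod m b e has_real_derivative powr_prod m b (\<lambda>k. e k - 1) w * poly R w) (at w)"
    by fastforce
  have S: "powr_prod (Suc m) b e' = (\<lambda>w. powr_prod m b e' w * (b m - w) powr e' m)" for e'
    by (simp add: powr_prod_def fun_eq_iff)
  let ?L = "\<Prod>k<m. [:b k, -1:]"
  let ?R = "R * [:b m, -1:] + smult (- e m) ?L"
  have "degree (R * [:b m, -1:]) \<le> Suc m"
    using degree_mult_le[of R "[:b m, -1:]"] R(1) by simp
  moreover have "degree (smult (- e m) ?L) \<le> Suc m"
    using degree_linear_prod[of b m] degree_smult_le[of "- e m" ?L] by linarith
  ultimately have deg: "degree ?R \<le> Suc m" by (rule degree_add_le)
  have "(powr_prod (Suc m) b e has_real_derivative powr_prod (Suc m) b (\<lambda>k. e k - 1) w * poly ?R w) (at w)"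
    if w: "w \<in> {-1<..<1}" for w
  proof -
    have pos: "b m - w > 0" using Suc.prems w by fastforce
    have e1: "(b m - w) powr e m = (b m - w) powr (e m - 1) * (b m - w)"
      using pos by (simp add: powr_diff)
    have e2: "powr_prod m b e w = powr_prod m b (\<lambda>k. e k - 1) w * poly ?L w"
      using Suc.prems w by (intro powr_prod_minus_one) auto
    have "((\<lambda>w. powr_prod m b e w * (b m - w) powr e m) has_real_derivative
       powr_prod m b (\<lambda>k. e k - 1) w * poly R w * (b m - w) powr e m
       + (e m * (b m - w) powr (e m - 1) * (-1)) * powr_prod m b e w) (at w)"
      using pos by (intro DERIV_mult R w) (auto intro!: derivative_eq_intros)
    then show ?thesis unfolding S
      by (rule DERIV_cong) (simp add: e1 e2 algebra_simps)
  qed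
  then show ?case using deg by blast
qed

lemma poly_powr_prod_derivative:
  assumes "\<forall>k<m. 1 \<le> b k" "degree P \<le> D"
  shows "\<exists>P'. degree P' \<le> D + m \<and> (\<forall>w\<in>{-1<..<1}.
     ((\<lambda>w. poly P w * powr_prod m b e w) has_real_derivative
        poly P' w * powr_prod m b (\<lambda>k. e k - 1) w) (at w))"
proof -
  obtain R where R: "degree R \<le> m" "\<And>w. w\<in>{-1<..<1} \<Longrightarrow>
     (powr_prod m b e has_real_derivative powr_prod m b (\<lambda>k. e k - 1) w * poly R w) (at w)"
    using powr_prod_derivative[OF assms(1)] by blast
  let ?L = "\<Prod>k<m. [:b k, -1:]"
  let ?P = "pderiv P * ?L + P * R"
  have "degree (pderiv P * ?L) \<le> D + m"
    using degree_mult_le[of "pderiv P" ?L] degree_linear_prod[of b m] assms(2)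
      degree_pderiv[of P] by linarith
  moreover have "degree (P * R) \<le> D + m"
    using degree_mult_le[of P R] assms(2) R(1) by linarith
  ultimately have deg: "degree ?P \<le> D + m" by (rule degree_add_le)
  have "((\<lambda>w. poly P w * powr_prod m b e w) has_real_derivative
        poly ?P w * powr_prod m b (\<lambda>k. e k - 1) w) (at w)" if w: "w \<in> {-1<..<1}" for w
  proof -
    have e2: "powr_prod m b e w = powr_prod m b (\<lambda>k. e k - 1) w * poly ?L w"
      using assms w by (intro powr_prod_minus_one) auto
    show ?thesis
      by (rule DERIV_cong[OF DERIV_mult[OF poly_DERIV R(2)[OF w]]]) (simp add: e2 algebra_simps)
  qed
  then show ?thesis using deg by blast
qed

text \<open>A class of functions closed under the Rolle argument: dividing by the \<open>powr_prod\<close> of one term turns that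
  term into the free polynomial \<open>p\<close>, and \<open>r\<close> differentiations remove \<open>p\<close>. The number \<open>Z\<close> is uniform in the
  base points \<open>b\<close> and the exponents \<open>e\<close>.\<close>

definition genpoly_few_zeros :: "nat \<Rightarrow> nat \<Rightarrow> nat \<Rightarrow> nat \<Rightarrow> nat \<Rightarrow> bool" where
  "genpoly_few_zeros m n D r Z \<longleftrightarrow> (\<forall>T b e P p. finite T \<and> card T = n \<and> (\<forall>k<m. 1 \<le> b k)
     \<and> (\<forall>i\<in>(T::nat set). degree (P i) \<le> D) \<and> (p = 0 \<or> degree p < r) \<longrightarrow>
     few_zeros Z (\<lambda>w. poly p w + (\<Sum>i\<in>T. poly (P i) w * powr_prod m b (e i) w)))"

lemma genpoly_few_zerosD:
  assumes "genpoly_few_zeros m n D r Z" "finite T" "card T = n" "\<forall>k<m. 1 \<le> b k"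
    "\<And>i. i \<in> (T::nat set) \<Longrightarrow> degree (P i) \<le> D" "p = 0 \<or> degree p < r"
  shows "few_zeros Z (\<lambda>w. poly p w + (\<Sum>i\<in>T. poly (P i) w * powr_prod m b (e i) w))"
  using assms unfolding genpoly_few_zeros_def by blast

text \<open>Lexicographic induction, outer on the number n of power terms, inner on the degree bound
  r of the free polynomial. D stays arbitrary in both: a differentiation raises it by m, and a
  division removes one power term while D becomes the new bound \<open>Suc D\<close> for the free
  polynomial.\<close>

lemma few_zeros_generalised_polynomial:
  "\<exists>Z. genpoly_few_zeros m n D r Z"
proof (induction n arbitrary: D r)
  case 0
  show ?case
  proof (induction r arbitrary: D)
    case 0
    show ?case by (auto simp: genpoly_few_zeros_def few_zeros_def)
  next
    case (Suc r)
    then obtain Z where "genpoly_few_zeros m 0 D r Z" by blast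
    then have Z: "few_zeros Z (poly p)" if "p = 0 \<or> degree p < r" for p
      using genpoly_few_zerosD[of m 0 D r Z "{}" "\<lambda>_. 1" "\<lambda>_. 0" p] that by simp
    have "few_zeros (Suc Z) (poly p)" if "p = 0 \<or> degree p < Suc r" for p
    proof (rule few_zeros_derivative[OF poly_DERIV])
      show "few_zeros Z (poly (pderiv p))"
        using that by (intro Z) (auto simp: pderiv_eq_0_iff degree_pderiv)
    qed
    moreover have "few_zeros (Suc Z) (\<lambda>w. 0)" by (simp add: few_zeros_def)
    ultimately show ?case unfolding genpoly_few_zeros_def by (intro exI[of _ "Suc Z"]) auto
  qed
next
  case (Suc n)
  show ?case
  proof (induction r arbitrary: D)
    case 0
    \<comment> \<open>Here the free polynomial is 0, so one term can be divided out; its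
      coefficient, of degree at most D, becomes the free polynomial of a sum with n terms.\<close>
    obtain Z where Z: "genpoly_few_zeros m n D (Suc D) Z"
      using Suc.IH by blast
    have "few_zeros Z (\<lambda>w. \<Sum>i\<in>T. poly (P i) w * powr_prod m b (e i) w)"
      if h: "finite T" "card T = Suc n" "\<forall>k<m. 1 \<le> b k" "\<forall>i\<in>(T::nat set). degree (P i) \<le> D" for T b e P
    proof -
      obtain i0 where i0: "i0 \<in> T" using h by fastforce
      show ?thesis
      proof (rule few_zeros_mult)
        show "few_zeros Z (\<lambda>w. poly (P i0) w +
          (\<Sum>i\<in>T - {i0}. poly (P i) w * powr_prod m b ((\<lambda>i k. e i k - e i0 k) i) w))"
          using h i0 by (intro genpoly_few_zerosD[OF Z]) (auto simp: less_Suc_eq_le)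
        fix w :: real assume w: "w \<in> {-1<..<1}"
        then have w1: "w < 1" by auto
        show "powr_prod m b (e i0) w \<noteq> 0" using powr_prod_pos[OF h(3) w1, of "e i0"] by simp
        show "(\<Sum>i\<in>T. poly (P i) w * powr_prod m b (e i) w) = powr_prod m b (e i0) w *
          (poly (P i0) w + (\<Sum>i\<in>T - {i0}. poly (P i) w * powr_prod m b (\<lambda>k. e i k - e i0 k) w))"
          unfolding sum.remove[OF h(1) i0] distrib_left sum_distrib_left
          by (subst powr_prod_diff[OF h(3) w1, of _ "e i0", symmetric]) (simp add: mult_ac)
      qed
    qed
    then show ?case unfolding genpoly_few_zeros_def by (intro exI[of _ Z]) auto
  next
    case (Suc r)
    obtain Z where Z: "genpoly_few_zeros m (Suc n) (D + m) r Z"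
      using Suc.IH by blast
    have "few_zeros (Suc Z) (\<lambda>w. poly p w + (\<Sum>i\<in>T. poly (P i) w * powr_prod m b (e i) w))"
      if h: "finite T" "card T = Suc n" "\<forall>k<m. 1 \<le> b k" "\<forall>i\<in>(T::nat set). degree (P i) \<le> D"
        "p = 0 \<or> degree p < Suc r" for T b e P p
    proof -
      have "\<forall>i\<in>T. \<exists>P'. degree P' \<le> D + m \<and> (\<forall>w\<in>{-1<..<1}.
         ((\<lambda>w. poly (P i) w * powr_prod m b (e i) w) has_real_derivative
        poly P' w * powr_prod m b (\<lambda>k. e i k - 1) w) (at w))"
        using poly_powr_prod_derivative[OF h(3)] h(4) by metis
      then obtain P' where P': "\<And>i. i \<in> T \<Longrightarrow> degree (P' i) \<le> D + m"
        "\<And>i w. i \<in> T \<Longrightarrow> w\<in>{-1<..<1} \<Longrightarrow>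
         ((\<lambda>w. poly (P i) w * powr_prod m b (e i) w) has_real_derivative
        poly (P' i) w * powr_prod m b (\<lambda>k. e i k - 1) w) (at w)"
        by metis
      show ?thesis
      proof (rule few_zeros_derivative)
        show "few_zeros Z (\<lambda>w. poly (pderiv p) w + (\<Sum>i\<in>T. poly (P' i) w * powr_prod m b ((\<lambda>i k. e i k - 1) i) w))"
          using h P' by (intro genpoly_few_zerosD[OF Z]) (auto simp: pderiv_eq_0_iff degree_pderiv)
        fix w :: real assume w: "w \<in> {-1<..<1}"
        show "((\<lambda>w. poly p w + (\<Sum>i\<in>T. poly (P i) w * powr_prod m b (e i) w)) has_real_derivative
          poly (pderiv p) w + (\<Sum>i\<in>T. poly (P' i) w * powr_prod m b (\<lambda>k. e i k - 1) w)) (at w)"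
          using P' w by (intro DERIV_add poly_DERIV DERIV_sum) auto
      qed
    qed
    then show ?case unfolding genpoly_few_zeros_def by (intro exI[of _ "Suc Z"]) auto
  qed
qed

text \<open>A single power is the product whose exponent vector is supported at one index, so
  constant coefficients and no free polynomial suffice. That Z depends on n alone makes the later
  constants independent of the times and of H.\<close>

lemma few_zeros_powr_sum:
  fixes n :: nat
  shows "\<exists>Z. \<forall>b e y. (\<forall>k<n. 1 \<le> b k) \<longrightarrow> few_zeros Z (\<lambda>w. \<Sum>i<n. y i * (b i - w) powr e i)"
proof -
  obtain Z where Z: "genpoly_few_zeros n n 0 0 Z"
    using few_zeros_generalised_polynomial by blast
  have "few_zeros Z (\<lambda>w. \<Sum>i<n. y i * (b i - w) powr e i)" if b: "\<forall>k<n. 1 \<le> b k" for b e y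
  proof -
    have "few_zeros Z (\<lambda>w. poly 0 w + (\<Sum>i<n. poly [:y i:] w * powr_prod n b ((\<lambda>i k. if k = i then e i else 0) i) w))"
      using b by (intro genpoly_few_zerosD[OF Z]) auto
    then show ?thesis
    proof (rule few_zeros_mult[where c = "\<lambda>_. 1"])
      fix w :: real assume w: "w \<in> {-1<..<1}"
      have "powr_prod n b (\<lambda>k. if k = i then e i else 0) w = (b i - w) powr e i" if "i < n" for i
      proof -
        have "powr_prod n b (\<lambda>k. if k = i then e i else 0) w = (\<Prod>k<n. if k = i then (b i - w) powr e i else 1)"
          unfolding powr_prod_def using b w by (intro prod.cong refl) fastforce
        then show ?thesis using that by simp
      qed
      then show "(\<Sum>i<n. y i * (b i - w) powr e i) = 1 * (poly 0 w + (\<Sum>i<n. poly [:y i:] w * powr_prod n b (\<lambda>k. if k = i then e i else 0) w))"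
        by simp
    qed simp
  qed
  then show ?thesis by blast
qed

section \<open>Local nondeterminism in one variable\<close>

text \<open>A derivative bounded away from 0 has constant sign, so the function is monotone with a
  definite slope and can be small only near one point. Seen from the midpoint, the outer quarter at
  the end towards which the modulus grows avoids that point. Descending through j derivatives costs
  j factors 1/4 in length.\<close>

lemma large_on_subinterval:
  fixes u :: "nat \<Rightarrow> real \<Rightarrow> real"
  assumes "\<And>i w. i \<le> j \<Longrightarrow> w \<in> {A<..<B} \<Longrightarrow> (u i has_real_derivative u (Suc i) w) (at w)"
    and "\<And>w. w \<in> {A<..<B} \<Longrightarrow> \<kappa> \<le> \<bar>u j w\<bar>" "A < B" "\<kappa> > 0"
  shows "\<exists>A' B'. A \<le> A' \<and> B' \<le> B \<and> B' - A' = (B - A) / 4 ^ j \<and>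
    (\<forall>w\<in>{A'<..<B'}. \<kappa> * ((B - A) / 4 ^ j) ^ j \<le> \<bar>u 0 w\<bar>)"
  using assms
proof (induction j arbitrary: u)
  case 0
  then show ?case by (intro exI[of _ A] exI[of _ B]) auto
next
  case (Suc j)
  define \<delta> where "\<delta> = (B - A) / 4 ^ j"
  have \<delta>: "\<delta> > 0" "(B - A) / 4 ^ Suc j = \<delta> / 4" using Suc.prems(3) by (auto simp: \<delta>_def)
  define \<kappa>1 where "\<kappa>1 = \<kappa> * \<delta> ^ j"
  have \<kappa>1: "\<kappa>1 > 0" using \<delta> Suc.prems by (simp add: \<kappa>1_def)
  have "\<exists>A' B'. A \<le> A' \<and> B' \<le> B \<and> B' - A' = (B - A) / 4 ^ j \<and>
    (\<forall>w\<in>{A'<..<B'}. \<kappa> * ((B - A) / 4 ^ j) ^ j \<le> \<bar>u (Suc 0) w\<bar>)"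
    using Suc.prems by (intro Suc.IH[of "\<lambda>i. u (Suc i)"]) auto
  then obtain A1 B1 where 1: "A \<le> A1" "B1 \<le> B" "B1 - A1 = \<delta>"
    "\<And>w. w\<in>{A1<..<B1} \<Longrightarrow> \<kappa>1 \<le> \<bar>u 1 w\<bar>"
    by (auto simp: \<delta>_def \<kappa>1_def)
  have d0: "(u 0 has_real_derivative u 1 w) (at w)" "(u 1 has_real_derivative u 2 w) (at w)"
    if "w \<in> {A1<..<B1}" for w
    using Suc.prems(1)[of 0 w] Suc.prems(1)[of 1 w] that 1 by (auto simp: numeral_2_eq_2)
  have bound: "\<kappa> * (\<delta> / 4) ^ Suc j \<le> \<kappa>1 * (\<delta> / 4)"
  proof -
    have "(\<delta> / 4) ^ j \<le> \<delta> ^ j" using \<delta> by (intro power_mono) auto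
    then show ?thesis unfolding \<kappa>1_def using \<delta> Suc.prems(4) by (simp add: mult_left_mono)
  qed
  have sgn: "(\<forall>w\<in>{A1<..<B1}. u 1 w \<ge> \<kappa>1) \<or> (\<forall>w\<in>{A1<..<B1}. u 1 w \<le> - \<kappa>1)"
  proof (rule ccontr)
    assume "\<not> ?thesis"
    then obtain x y where xy: "x \<in> {A1<..<B1}" "y \<in> {A1<..<B1}" "u 1 x < \<kappa>1" "u 1 y > - \<kappa>1" by force
    then have "u 1 x \<le> - \<kappa>1" "u 1 y \<ge> \<kappa>1" using 1(4)[of x] 1(4)[of y] by auto
    have "continuous_on {A1<..<B1} (u 1)"
      using d0(2) by (meson DERIV_continuous continuous_at_imp_continuous_on)
    then have "connected (u 1 ` {A1<..<B1})" by (intro connected_continuous_image) auto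
    then have "0 \<in> u 1 ` {A1<..<B1}"
      using \<open>u 1 x \<le> - \<kappa>1\<close> \<open>u 1 y \<ge> \<kappa>1\<close> \<kappa>1 xy
      by (elim connectedD_interval[where x = "u 1 x" and y = "u 1 y"]) auto
    then obtain z where "z \<in> {A1<..<B1}" "u 1 z = 0" by auto
    then show False using 1(4)[of z] \<kappa>1 by simp
  qed
  \<comment> \<open>Both outer quarters keep distance at least \<open>\<delta> / 4\<close> from the
    midpoint. For an increasing function the right one is used if the value at the midpoint is
    nonnegative, otherwise the left one.\<close>
  define c where "c = (A1 + B1) / 2"
  have c2: "2 * c = A1 + B1" by (simp add: c_def)
  have c: "c \<in> {A1<..<B1}" using 1 \<delta> by (auto simp: c_def)
  have key: "\<exists>A' B'. A1 \<le> A' \<and> B' \<le> B1 \<and> B' - A' = \<delta> / 4 \<and> (\<forall>w\<in>{A'<..<B'}. \<kappa>1 * (\<delta> / 4) \<le> \<bar>v w\<bar>)"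
    if v: "\<And>w. w \<in> {A1<..<B1} \<Longrightarrow> (v has_real_derivative v' w) (at w)"
      "\<And>w. w \<in> {A1<..<B1} \<Longrightarrow> v' w \<ge> \<kappa>1" for v v' :: "real \<Rightarrow> real"
  proof -
    have grow: "v y - v x \<ge> \<kappa>1 * (y - x)" if "x \<in> {A1<..<B1}" "y \<in> {A1<..<B1}" "x < y" for x y
    proof -
      have "\<exists>z. x < z \<and> z < y \<and> v y - v x = (y - x) * v' z"
      proof -
        have "\<exists>z>x. z < y \<and> v y - v x = (y - x) * v' z"
          by (rule MVT2) (use that v(1) in auto)
        then show ?thesis by blast
      qed
      then obtain z where "x < z" "z < y" "v y - v x = (y - x) * v' z" by blast
      moreover from this have "v' z \<ge> \<kappa>1" using v(2)[of z] that by auto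
      ultimately show ?thesis using that by (simp add: mult.commute mult_left_mono)
    qed
    show ?thesis
    proof (cases "v c \<ge> 0")
      case True
      have "\<kappa>1 * (\<delta> / 4) \<le> \<bar>v w\<bar>" if "w \<in> {B1 - \<delta>/4<..<B1}" for w
      proof -
        have "c < w" "w - c \<ge> \<delta> / 4" "w \<in> {A1<..<B1}"
          using that 1(3) \<delta>(1) c2 unfolding greaterThanLessThan_iff by linarith+
        then have "\<kappa>1 * (\<delta> / 4) \<le> \<kappa>1 * (w - c)" "v w - v c \<ge> \<kappa>1 * (w - c)"
          using \<kappa>1 grow[OF c] by auto
        then show ?thesis using True by linarith
      qed
      then show ?thesis using 1 \<delta> by (intro exI[of _ "B1 - \<delta>/4"] exI[of _ B1]) auto
    next
      case False
      have "\<kappa>1 * (\<delta> / 4) \<le> \<bar>v w\<bar>" if "w \<in> {A1<..<A1 + \<delta>/4}" for w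
      proof -
        have "w < c" "c - w \<ge> \<delta> / 4" "w \<in> {A1<..<B1}"
          using that 1(3) \<delta>(1) c2 unfolding greaterThanLessThan_iff by linarith+
        then have "\<kappa>1 * (\<delta> / 4) \<le> \<kappa>1 * (c - w)" "v c - v w \<ge> \<kappa>1 * (c - w)"
          using \<kappa>1 grow[OF _ c] by auto
        then show ?thesis using False by linarith
      qed
      then show ?thesis using 1 \<delta> by (intro exI[of _ A1] exI[of _ "A1 + \<delta>/4"]) auto
    qed
  qed
  have "\<exists>A' B'. A1 \<le> A' \<and> B' \<le> B1 \<and> B' - A' = \<delta> / 4 \<and> (\<forall>w\<in>{A'<..<B'}. \<kappa>1 * (\<delta> / 4) \<le> \<bar>u 0 w\<bar>)"
    using sgn
  proof
    assume "\<forall>w\<in>{A1<..<B1}. u 1 w \<ge> \<kappa>1"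
    then show ?thesis using key[OF d0(1)] by blast
  next
    assume "\<forall>w\<in>{A1<..<B1}. u 1 w \<le> - \<kappa>1"
    then have "\<exists>A' B'. A1 \<le> A' \<and> B' \<le> B1 \<and> B' - A' = \<delta> / 4 \<and> (\<forall>w\<in>{A'<..<B'}. \<kappa>1 * (\<delta> / 4) \<le> \<bar>- u 0 w\<bar>)"
    proof (intro key[of "\<lambda>w. - u 0 w" "\<lambda>w. - u 1 w"] DERIV_minus d0)
      fix w assume "w \<in> {A1<..<B1}"
      then show "\<kappa>1 \<le> - u 1 w" using \<open>\<forall>w\<in>{A1<..<B1}. u 1 w \<le> - \<kappa>1\<close> by (metis le_minus_iff)
    qed
    then show ?thesis by simp
  qed
  then obtain A' B' where "A1 \<le> A'" "B' \<le> B1" "B' - A' = \<delta> / 4" "\<forall>w\<in>{A'<..<B'}. \<kappa>1 * (\<delta> / 4) \<le> \<bar>u 0 w\<bar>"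
    by blast
  then have "A \<le> A' \<and> B' \<le> B \<and> B' - A' = \<delta> / 4 \<and> (\<forall>w\<in>{A'<..<B'}. \<kappa> * (\<delta> / 4) ^ Suc j \<le> \<bar>u 0 w\<bar>)"
    using 1(1,2) bound by (meson order_trans)
  then show ?case unfolding \<delta>(2) by blast
qed

text \<open>Used in contrapositive form: if the integral over a short interval is below a constant
  depending only on J, \<kappa>, \<delta> and \<alpha>, then each derivative up to order J is
  smaller than \<kappa> in absolute value somewhere on that interval. Replacing j by J lets one
  constant serve all orders.\<close>

lemma nn_integral_large_derivative:
  fixes u :: "nat \<Rightarrow> real \<Rightarrow> real"
  assumes d: "\<And>i w. i \<le> j \<Longrightarrow> w \<in> {A<..<B} \<Longrightarrow> (u i has_real_derivative u (Suc i) w) (at w)"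
    and big: "\<And>w. w \<in> {A<..<B} \<Longrightarrow> \<kappa> \<le> \<bar>u j w\<bar>"
    and "B - A = \<delta>" "0 < \<delta>" "\<delta> \<le> 1" "\<kappa> > 0" "j \<le> J" "\<alpha> > 0"
  shows "ennreal ((\<kappa> * (\<delta> / 4 ^ J) ^ J) powr \<alpha> * (\<delta> / 4 ^ J)) \<le>
    (\<integral>\<^sup>+ w. ennreal (\<bar>u 0 w\<bar> powr \<alpha>) * indicator {A<..<B} w \<partial>lborel)"
proof -
  obtain A' B' where 1: "A \<le> A'" "B' \<le> B" "B' - A' = \<delta> / 4 ^ j"
    "\<And>w. w\<in>{A'<..<B'} \<Longrightarrow> \<kappa> * (\<delta> / 4 ^ j) ^ j \<le> \<bar>u 0 w\<bar>"
    using large_on_subinterval[where u = u and j = j and A = A and B = B and \<kappa> = \<kappa>, OF d big] assms(3,4,6)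
    by fastforce
  have le: "\<delta> / 4 ^ J \<le> \<delta> / 4 ^ j" using assms by (intro divide_left_mono power_increasing) auto
  have "(\<delta> / 4 ^ J) ^ J \<le> (\<delta> / 4 ^ J) ^ j"
  proof (intro power_decreasing)
    have "\<delta> / 4 ^ J \<le> \<delta> / 1" using assms by (intro divide_left_mono) auto
    then show "\<delta> / 4 ^ J \<le> 1" using assms(5) by linarith
  qed (use assms in auto)
  also have "\<dots> \<le> (\<delta> / 4 ^ j) ^ j" using le assms by (intro power_mono) auto
  finally have pw: "\<kappa> * (\<delta> / 4 ^ J) ^ J \<le> \<kappa> * (\<delta> / 4 ^ j) ^ j" using assms by simp
  let ?c = "(\<kappa> * (\<delta> / 4 ^ J) ^ J) powr \<alpha>"
  have "ennreal (?c * (\<delta> / 4 ^ J)) \<le> ennreal (?c * (\<delta> / 4 ^ j))"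
    using le by (intro ennreal_leI mult_left_mono) auto
  also have "\<dots> = (\<integral>\<^sup>+ w. ennreal ?c * indicator {A'<..<B'} w \<partial>lborel)"
  proof -
    have "A' \<le> B'" using 1(3) assms(4) by (smt (verit) zero_less_divide_iff zero_less_power)
    then show ?thesis using 1(3) by (simp add: nn_integral_cmult ennreal_mult'' flip: 1(3))
  qed
  also have "\<dots> \<le> (\<integral>\<^sup>+ w. ennreal (\<bar>u 0 w\<bar> powr \<alpha>) * indicator {A<..<B} w \<partial>lborel)"
  proof (intro nn_integral_mono)
    fix w
    show "ennreal ?c * indicator {A'<..<B'} w \<le> ennreal (\<bar>u 0 w\<bar> powr \<alpha>) * indicator {A<..<B} w"
    proof (cases "w \<in> {A'<..<B'}")
      case True
      have "?c \<le> \<bar>u 0 w\<bar> powr \<alpha>"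
        using order_trans[OF pw 1(4)[OF True]] assms by (intro powr_mono2) auto
      then show ?thesis using True 1(1,2) by (auto simp: indicator_def intro: ennreal_leI)
    qed simp
  qed
  finally show ?thesis .
qed

text \<open>Adding the end values at \<open>l j\<close> and \<open>r j\<close> to the \<open>j\<close> alternating values of \<open>E j\<close> and applying the mean
  value theorem between neighbours gives \<open>j + 1\<close> alternating values of \<open>E (Suc j)\<close>; each step loses a factor
  \<open>2\<close>, the length of \<open>{-1<..<1}\<close>.\<close>

lemma alternating_derivatives:
  fixes E :: "nat \<Rightarrow> real \<Rightarrow> real"
  assumes d: "\<And>i w. w \<in> {-1<..<1} \<Longrightarrow> (E i has_real_derivative E (Suc i) w) (at w)"
    and l: "\<And>i. i < K \<Longrightarrow> l (Suc i) < l i" "\<And>i. i \<le> K \<Longrightarrow> l i > -1"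
    and r: "\<And>i. i < K \<Longrightarrow> r i < r (Suc i)" "\<And>i. i \<le> K \<Longrightarrow> r i < 1" "l 0 < r 0"
    and start: "E 0 (l 0) \<ge> c"
    and left: "\<And>i. 0 < i \<Longrightarrow> i \<le> K \<Longrightarrow> E i (l i) > - \<kappa>"
    and right: "\<And>i. i \<le> K \<Longrightarrow> \<bar>E i (r i)\<bar> < \<kappa>"
    and c: "c \<ge> 2 ^ (K + 1) * \<kappa>"
  shows "0 < j \<Longrightarrow> j \<le> K \<Longrightarrow> \<exists>q. (\<forall>i\<in>{1..j}. (-1) ^ i * E j (q i) \<ge> c / 2 ^ j - \<kappa>) \<and>
     (\<forall>i\<in>{1..<j}. q i < q (Suc i)) \<and> (\<forall>i\<in>{1..j}. l (j - 1) < q i \<and> q i < r (j - 1))"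
proof (induction j rule: nat_induct_non_zero)
  case 1
  have \<kappa>: "\<kappa> > 0" using right[of 0] by auto
  have "(2::real) * 1 \<le> 2 ^ (K + 1)" by (simp add: mult_left_mono)
  then have "2 * 1 * \<kappa> \<le> 2 ^ (K + 1) * \<kappa>" using \<kappa> by (intro mult_right_mono) auto
  then have c2: "c \<ge> 2 * \<kappa>" using c by simp
  obtain z where z: "l 0 < z" "z < r 0" "E 0 (r 0) - E 0 (l 0) = (r 0 - l 0) * E 1 z"
    using MVT2[of "l 0" "r 0" "E 0" "E 1"] d l(2)[of 0] r(2)[of 0] r(3) by auto
  have "(r 0 - l 0) * (- E 1 z) \<ge> c - \<kappa>" using z(3) start right[of 0] by (simp add: algebra_simps)
  moreover have "c - \<kappa> > 0" using c2 \<kappa> by simp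
  ultimately have p: "- E 1 z > 0" using r(3) by (smt (verit) mult_nonneg_nonpos)
  have "(r 0 - l 0) * (- E 1 z) \<le> 2 * (- E 1 z)"
    using p l(2)[of 0] r(2)[of 0] by (intro mult_right_mono) auto
  then have "- E 1 z \<ge> c / 2 - \<kappa>" using \<open>(r 0 - l 0) * (- E 1 z) \<ge> c - \<kappa>\<close> \<kappa> by simp
  then show ?case using z by (intro exI[of _ "\<lambda>_. z"]) auto
next
  case (Suc j)
  have \<kappa>: "\<kappa> > 0" using right[of 0] by auto
  obtain q where q: "\<And>i. i\<in>{1..j} \<Longrightarrow> (-1) ^ i * E j (q i) \<ge> c / 2 ^ j - \<kappa>"
     "\<And>i. i\<in>{1..<j} \<Longrightarrow> q i < q (Suc i)" "\<And>i. i\<in>{1..j} \<Longrightarrow> l (j - 1) < q i \<and> q i < r (j - 1)"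
    using Suc by (metis Suc_leD)
  have j: "0 < j" "Suc j \<le> K" using Suc by auto
  have lj: "l j < l (j - 1)" "r (j - 1) < r j" using l(1)[of "j - 1"] r(1)[of "j - 1"] j by auto
  \<comment> \<open>The alternating points are padded with the left point at index 0 and the right
    point at index \<open>Suc j\<close>, so that every gap between neighbours yields one point for
    the next derivative.\<close>
  define Q where "Q i = (if i = 0 then l j else if i = Suc j then r j else q i)" for i
  have pos: "c / 2 ^ j - 2 * \<kappa> \<ge> 0"
  proof -
    have "2 ^ (j + 1) * \<kappa> \<le> 2 ^ (K + 1) * \<kappa>" using j \<kappa> by (intro mult_right_mono power_increasing) auto
    then have "2 ^ (j + 1) * \<kappa> \<le> c" using c by simp
    then show ?thesis by (simp add: field_simps)
  qed
  have Qlt: "Q (i - 1) < Q i" if "i \<in> {1..Suc j}" for i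
  proof -
    consider "i = 1" | "i = Suc j" "1 < i" | "i \<in> {2..j}" using \<open>i \<in> {1..Suc j}\<close> by fastforce
    then show ?thesis
    proof cases
      case 1
      then show ?thesis using lj q(3)[of 1] j by (auto simp: Q_def)
    next
      case 2
      then show ?thesis using lj q(3)[of j] j by (auto simp: Q_def)
    next
      case 3
      then have "i - 1 \<in> {1..<j}" "Suc (i - 1) = i" by auto
      then show ?thesis using q(2)[of "i - 1"] 3 by (auto simp: Q_def)
    qed
  qed
  have Qin: "l j \<le> Q i \<and> Q i \<le> r j" if "i \<le> Suc j" for i
    using that lj q(3)[of i] r(3) q(3)[of 1] j by (cases "i = 0"; cases "i = Suc j") (auto simp: Q_def)
  have diff: "(-1) ^ i * (E j (Q i) - E j (Q (i - 1))) \<ge> c / 2 ^ j - 2 * \<kappa>" if i: "i \<in> {1..Suc j}" for i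
  proof -
    have E: "(-1) ^ i * (E j (Q i) - E j (Q (i - 1))) = (-1) ^ i * E j (Q i) + (-1) ^ (i - 1) * E j (Q (i - 1))"
      using i by (cases i) (auto simp: algebra_simps)
    have a: "(-1) ^ i * E j (Q i) \<ge> c / 2 ^ j - \<kappa>" if "i \<in> {1..j}" for i
      using q(1)[OF that] that by (auto simp: Q_def)
    \<comment> \<open>At the left end the sign is \<open>(-1) ^ 0\<close>, so the one-sided bound
      \<open>left\<close> suffices. At the right end the sign depends on the parity of j, so
      \<open>right\<close> bounds the absolute value.\<close>
    have b0: "E j (Q 0) > - \<kappa>" using left[of j] j by (auto simp: Q_def)
    have b1: "(-1) ^ k * E j (Q (Suc j)) > - \<kappa>" for k :: nat
      using right[of j] j by (cases "even k") (auto simp: Q_def)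
    consider "i = 1" | "i = Suc j" "1 < i" | "i \<in> {2..j}" using i by fastforce
    then show ?thesis unfolding E
    proof cases
      case 1
      then show "c / 2 ^ j - 2 * \<kappa> \<le> (-1) ^ i * E j (Q i) + (-1) ^ (i - 1) * E j (Q (i - 1))"
        using a[of 1] b0 j by simp
    next
      case 2
      have "c / 2 ^ j - \<kappa> \<le> (-1) ^ (i - 1) * E j (Q (i - 1))" using 2 j by (intro a) auto
      moreover have "(-1) ^ i * E j (Q i) > - \<kappa>" using b1[of i] 2 by simp
      ultimately show "c / 2 ^ j - 2 * \<kappa> \<le> (-1) ^ i * E j (Q i) + (-1) ^ (i - 1) * E j (Q (i - 1))"
        by linarith
    next
      case 3
      have "c / 2 ^ j - \<kappa> \<le> (-1) ^ (i - 1) * E j (Q (i - 1))" using 3 by (intro a) auto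
      moreover have "c / 2 ^ j - \<kappa> \<le> (-1) ^ i * E j (Q i)" using 3 by (intro a) auto
      ultimately show "c / 2 ^ j - 2 * \<kappa> \<le> (-1) ^ i * E j (Q i) + (-1) ^ (i - 1) * E j (Q (i - 1))"
        using pos \<kappa> by linarith
    qed
  qed
  \<comment> \<open>An end value costs at most \<kappa>, so the differences are at least
    \<open>c / 2 ^ j - 2 * \<kappa>\<close>; dividing by a gap of length at most 2 restores the form
    \<open>c / 2 ^ Suc j - \<kappa>\<close>.\<close>
  have "\<exists>z. Q (i - 1) < z \<and> z < Q i \<and> (-1) ^ i * E (Suc j) z \<ge> c / 2 ^ Suc j - \<kappa>" if i: "i \<in> {1..Suc j}" for i
  proof -
    have in1: "-1 < Q (i - 1)" "Q i < 1" proof -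
      have "i - 1 \<le> Suc j" "i \<le> Suc j" using i by auto
      then show "-1 < Q (i - 1)" "Q i < 1" using Qin[of "i - 1"] Qin[of i] j l(2)[of j] r(2)[of j] by linarith+
    qed
    obtain z where z: "Q (i - 1) < z" "z < Q i" "E j (Q i) - E j (Q (i - 1)) = (Q i - Q (i - 1)) * E (Suc j) z"
      using MVT2[OF Qlt[OF i], of "E j" "E (Suc j)"] d in1 by auto
    let ?e = "(-1) ^ i * E (Suc j) z"
    have ge: "(Q i - Q (i - 1)) * ?e \<ge> c / 2 ^ j - 2 * \<kappa>"
      using diff[OF i] unfolding z(3) by (simp add: mult_ac)
    have "?e \<ge> 0" using ge pos Qlt[OF i] by (smt (verit) mult_pos_neg)
    then have "(Q i - Q (i - 1)) * ?e \<le> 2 * ?e" using in1 by (intro mult_right_mono) auto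
    then have "2 * ?e \<ge> c / 2 ^ j - 2 * \<kappa>" using ge by linarith
    then show ?thesis using z by (intro exI[of _ z]) auto
  qed
  then obtain q' where q': "\<And>i. i \<in> {1..Suc j} \<Longrightarrow> Q (i - 1) < q' i \<and> q' i < Q i \<and> (-1) ^ i * E (Suc j) (q' i) \<ge> c / 2 ^ Suc j - \<kappa>"
    by metis
  show ?case
  proof (intro exI[of _ q'] conjI ballI)
    fix i assume i: "i \<in> {1..Suc j}"
    show "c / 2 ^ Suc j - \<kappa> \<le> (-1) ^ i * E (Suc j) (q' i)" using q'[OF i] by blast
    show "l (Suc j - 1) < q' i" "q' i < r (Suc j - 1)"
    proof -
      have "i - 1 \<le> Suc j" "i \<le> Suc j" using i by auto
      then show "l (Suc j - 1) < q' i" "q' i < r (Suc j - 1)"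
        using q'[OF i] Qin[of i] Qin[of "i - 1"] by auto
    qed
  next
    fix i assume "i \<in> {1..<Suc j}"
    then show "q' i < q' (Suc i)" using q'[of i] q'[of "Suc i"] by auto
  qed
qed

text \<open>Between \<open>Z + 2\<close> points of alternating sign lie \<open>Z + 1\<close> zeros,
  and the nonzero value at \<open>q 1\<close> excludes that g vanishes identically.\<close>

lemma not_few_zeros_alternating:
  fixes g :: "real \<Rightarrow> real"
  assumes q: "\<And>i. i\<in>{1..Z + 2} \<Longrightarrow> (-1) ^ i * g (q i) > 0" "\<And>i. i\<in>{1..<Z + 2} \<Longrightarrow> q i < q (Suc i)"
     "\<And>i. i\<in>{1..Z + 2} \<Longrightarrow> -1 < q i \<and> q i < 1"
    and cont: "continuous_on {-1<..<1} g"
  shows "\<not> few_zeros Z g"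
proof
  assume fz: "few_zeros Z g"
  have "\<exists>z. q i < z \<and> z < q (Suc i) \<and> g z = 0" if i: "i \<in> {1..<Z + 2}" for i
  proof -
    have s: "g (q i) * g (q (Suc i)) < 0"
      using q(1)[of i] q(1)[of "Suc i"] i by (cases "even i") (auto simp: mult_less_0_iff)
    have in1: "-1 < q i" "q (Suc i) < 1" "q i < q (Suc i)" using q(2,3)[of i] q(3)[of "Suc i"] i by auto
    have c: "continuous_on {q i..q (Suc i)} g" by (rule continuous_on_subset[OF cont]) (use in1 in auto)
    have "\<exists>x\<ge>q i. x \<le> q (Suc i) \<and> g x = 0"
      using s IVT'[of g "q i" 0 "q (Suc i)"] IVT2'[of g "q (Suc i)" 0 "q i"] c in1
      by (auto simp: mult_less_0_iff)
    then obtain x where x: "q i \<le> x" "x \<le> q (Suc i)" "g x = 0" by blast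
    then have "x \<noteq> q i" "x \<noteq> q (Suc i)" using s by auto
    then show ?thesis using x by (intro exI[of _ x]) auto
  qed
  then obtain z where z: "\<And>i. i \<in> {1..<Z + 2} \<Longrightarrow> q i < z i \<and> z i < q (Suc i) \<and> g (z i) = 0" by metis
  have qmono: "i \<le> j \<Longrightarrow> j \<le> Z + 2 \<Longrightarrow> 1 \<le> i \<Longrightarrow> q i \<le> q j" for i j
  proof (induction j rule: dec_induct)
    case (step n)
    then show ?case using q(2)[of n] by auto
  qed simp
  have zless: "z i < z j" if "i \<in> {1..<Z + 2}" "j \<in> {1..<Z + 2}" "i < j" for i j
    using z[OF that(1)] z[OF that(2)] qmono[of "Suc i" j] that by auto
  have "inj_on z {1..<Z + 2}"
    by (rule linorder_inj_onI) (use zless in \<open>auto simp: less_le\<close>)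
  then have "card (z ` {1..<Z + 2}) = Z + 1" by (simp add: card_image)
  moreover have "z ` {1..<Z + 2} \<subseteq> {w\<in>{-1<..<1}. g w = 0}"
  proof
    fix x assume "x \<in> z ` {1..<Z + 2}"
    then obtain i where i: "i \<in> {1..<Z + 2}" "x = z i" by blast
    then show "x \<in> {w\<in>{-1<..<1}. g w = 0}" using z[OF i(1)] q(3)[of i] q(3)[of "Suc i"] by auto
  qed
  ultimately have "g (q 1) = 0"
    using q(3)[of 1] by (intro few_zeros_subset_card[OF fz, of "z ` {1..<Z + 2}"]) auto
  then show False using q(1)[of 1] by simp
qed

text \<open>The k-th derivative of \<open>(b - w) powr a\<close> in w. The inner derivative -1 is
  absorbed in the factors \<open>t - a\<close>, which puts the sign of every derivative in
  evidence.\<close>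

definition powr_deriv :: "real \<Rightarrow> real \<Rightarrow> nat \<Rightarrow> real \<Rightarrow> real" where
  "powr_deriv b a k w = (\<Prod>t<k. real t - a) * (b - w) powr (a - real k)"

lemma powr_deriv_0: "powr_deriv b a 0 w = (b - w) powr a"
  by (simp add: powr_deriv_def)

lemma powr_deriv_derivative:
  assumes "w < b"
  shows "(powr_deriv b a k has_real_derivative powr_deriv b a (Suc k) w) (at w)"
proof -
  have "((\<lambda>w. (\<Prod>t<k. real t - a) * (b - w) powr (a - real k)) has_real_derivative
    (\<Prod>t<k. real t - a) * ((a - real k) * (b - w) powr (a - real k - 1) * (-1))) (at w)"
    using assms by (intro DERIV_cmult) (auto intro!: derivative_eq_intros)
  moreover have "a - real k - 1 = a - real (Suc k)" by simp
  ultimately show ?thesis unfolding powr_deriv_def by (auto simp: algebra_simps)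
qed

lemma powr_deriv_nonneg:
  assumes "a \<le> 0"
  shows "0 \<le> powr_deriv b a k w"
  using assms unfolding powr_deriv_def by (intro mult_nonneg_nonneg prod_nonneg) auto

text \<open>Among the factors \<open>t - a\<close> only the one with t = 0 is negative. Since
  \<open>a = H - 1/\<alpha>\<close> is below 1 in the application, the two sign lemmas together
  cover all exponents that occur.\<close>

lemma powr_deriv_nonpos:
  assumes "0 < a" "a \<le> 1"
  shows "powr_deriv b a (Suc k) w \<le> 0"
proof -
  have "(\<Prod>t<Suc k. real t - a) = - a * (\<Prod>t\<in>{1..<Suc k}. real t - a)"
    by (simp only: lessThan_atLeast0 prod.atLeast_Suc_lessThan[of 0 "Suc k"] zero_less_Suc) simp
  moreover have "(\<Prod>t\<in>{1..<Suc k}. real t - a) \<ge> 0" using assms by (intro prod_nonneg) auto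
  ultimately have "(\<Prod>t<Suc k. real t - a) \<le> 0" using assms by (simp add: mult_nonneg_nonneg)
  then show ?thesis unfolding powr_deriv_def by (simp add: mult_nonpos_nonneg)
qed

lemma nn_integral_indicator_mono:
  fixes f g :: "real \<Rightarrow> real"
  assumes "A \<subseteq> B" "\<And>w. w \<in> A \<Longrightarrow> f w = g w"
  shows "(\<integral>\<^sup>+ w. ennreal (f w) * indicator A w \<partial>lborel) \<le> (\<integral>\<^sup>+ w. ennreal (g w) * indicator B w \<partial>lborel)"
  using assms by (intro nn_integral_mono) (auto simp: indicator_def)

text \<open>Suppose the integral is small. Left of \<open>0\<close> the derivatives of the smooth part \<open>G\<close> then follow those of
  the power \<open>(-w) powr a\<close>, right of \<open>0\<close> they almost vanish. As the derivatives of the power have a fixed sign, this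
  forces more sign changes on some derivative of \<open>G\<close>, again a sum of \<open>n\<close> powers, than \<open>few_zeros_powr_sum\<close> allows.\<close>

lemma two_sided_nondeterminism_unit:
  fixes n :: nat
  assumes \<alpha>: "\<alpha> > 0"
  shows "\<exists>c>0. \<forall>a b e y. a \<le> 1 \<and> (\<forall>i<n. 1 \<le> b i) \<longrightarrow>
    ennreal c \<le> (\<integral>\<^sup>+ w. ennreal (\<bar>pospow (- w) a + (\<Sum>i<n. y i * pospow (b i - w) (e i))\<bar> powr \<alpha>)
        * indicator {-1<..<1} w \<partial>lborel)"
proof -
  obtain Z where Z: "\<And>b e y. (\<forall>k<n. 1 \<le> b k) \<Longrightarrow> few_zeros Z (\<lambda>w. \<Sum>i<n. y i * (b i - w) powr e i)"
    using few_zeros_powr_sum[of n] by blast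
  \<comment> \<open>\<open>Z + 2\<close> alternating points are needed for a contradiction. One more
    order is reserved in J for positive exponents, where the argument starts from the derivative of
    G.\<close>
  define K where "K = Z + 2"
  define J where "J = K + 1"
  \<comment> \<open>\<open>J + 1\<close> disjoint intervals of length \<delta> fit into a segment of
    length 1/2 on each side of 0.\<close>
  define \<delta> :: real where "\<delta> = 1 / (2 * (real J + 1))"
  have \<delta>: "0 < \<delta>" "\<delta> \<le> 1" "\<delta> * (real J + 1) = 1 / 2" by (auto simp: \<delta>_def field_simps)
  \<comment> \<open>Chosen with \<open>1 / 8 = 2 ^ (K + 1) * \<kappa>\<close>, so that after K steps
    of losses the alternating values are still at least \<kappa>.\<close>
  define \<kappa> :: real where "\<kappa> = 1 / 8 / 2 ^ (K + 1)"
  have \<kappa>: "\<kappa> > 0" "1 / 8 \<ge> 2 ^ (K + 1) * \<kappa>" "\<kappa> \<le> 1 / 8" "1 / 8 / 2 ^ K - \<kappa> = \<kappa>"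
  proof -
    have "(1::real) \<le> 2 ^ (K + 1)" by (rule one_le_power) simp
    then show "\<kappa> \<le> 1 / 8" by (simp add: \<kappa>_def divide_le_eq)
  qed (auto simp: \<kappa>_def field_simps)
  define c where "c = (\<kappa> * (\<delta> / 4 ^ J) ^ J) powr \<alpha> * (\<delta> / 4 ^ J)"
  have c: "c > 0" using \<delta> \<kappa> by (auto simp: c_def)
  \<comment> \<open>Intervals for higher derivatives lie further from 0 on both sides, which orders
    the test points as \<open>alternating_derivatives\<close> requires. The left ones begin at -1/2
    so that the power is at least 1/2 at the starting point.\<close>
  define Lf where "Lf j = {- 1/2 - (real j + 1) * \<delta> <..< - 1/2 - real j * \<delta>}" for j :: nat
  define Rt where "Rt j = {real j * \<delta> <..< (real j + 1) * \<delta>}" for j :: nat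
  have jJ: "(real j + 1) * \<delta> \<le> 1 / 2" if "j \<le> J" for j
  proof -
    have "(real j + 1) * \<delta> \<le> (real J + 1) * \<delta>" using that \<delta> by (intro mult_right_mono) auto
    then show ?thesis using \<delta>(3) by (simp add: mult.commute)
  qed
  have sub: "Lf j \<subseteq> {-1<..<0}" "Rt j \<subseteq> {0<..<1}" if "j \<le> J" for j
  proof -
    have "0 \<le> real j * \<delta>" using \<delta> by simp
    then show "Lf j \<subseteq> {-1<..<0}" "Rt j \<subseteq> {0<..<1}" using jJ[OF that] by (auto simp: Lf_def Rt_def)
  qed
  show ?thesis
  proof (intro exI[of _ c] conjI allI impI c, elim conjE, rule ccontr)
    fix a :: real and b e y :: "nat \<Rightarrow> real"
    assume a: "a \<le> 1" and b: "\<forall>i<n. 1 \<le> b i"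
    define h where "h w = pospow (- w) a + (\<Sum>i<n. y i * pospow (b i - w) (e i))" for w
    assume "\<not> ennreal c \<le> (\<integral>\<^sup>+ w. ennreal (\<bar>pospow (- w) a + (\<Sum>i<n. y i * pospow (b i - w) (e i))\<bar> powr \<alpha>)
        * indicator {-1<..<1} w \<partial>lborel)"
    then have small: "(\<integral>\<^sup>+ w. ennreal (\<bar>h w\<bar> powr \<alpha>) * indicator {-1<..<1} w \<partial>lborel) < ennreal c"
      by (simp add: h_def not_le)
    define G where "G k w = - (\<Sum>i<n. y i * powr_deriv (b i) (e i) k w)" for k w
    have bw: "w < b i" if "i < n" "w < 1" for i w using b that by fastforce
    have dG: "(G k has_real_derivative G (Suc k) w) (at w)" if "w \<in> {-1<..<1}" for k w
      unfolding G_def using that bw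
      by (intro DERIV_minus DERIV_sum DERIV_cmult powr_deriv_derivative) auto
    have hL: "h w = powr_deriv 0 a 0 w - G 0 w" if "w \<in> {-1<..<0}" for w
    proof -
      have "(\<Sum>i<n. y i * pospow (b i - w) (e i)) = (\<Sum>i<n. y i * powr_deriv (b i) (e i) 0 w)"
        using bw that by (intro sum.cong refl) (simp add: powr_deriv_0 pospow_def)
      then show ?thesis using that by (simp add: h_def G_def powr_deriv_0 pospow_def)
    qed
    have hR: "h w = - G 0 w" if "w \<in> {0<..<1}" for w
    proof -
      have "(\<Sum>i<n. y i * pospow (b i - w) (e i)) = (\<Sum>i<n. y i * powr_deriv (b i) (e i) 0 w)"
        using bw that by (intro sum.cong refl) (simp add: powr_deriv_0 pospow_def)
      then show ?thesis using that by (simp add: h_def G_def pospow_def)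
    qed
    have left: "\<exists>w\<in>Lf j. \<bar>powr_deriv 0 a j w - G j w\<bar> < \<kappa>" if j: "j \<le> J" for j
    proof (rule ccontr)
      assume "\<not> ?thesis"
      then have big: "\<And>w. w \<in> Lf j \<Longrightarrow> \<kappa> \<le> \<bar>powr_deriv 0 a j w - G j w\<bar>" by force
      have "ennreal c \<le> (\<integral>\<^sup>+ w. ennreal (\<bar>powr_deriv 0 a 0 w - G 0 w\<bar> powr \<alpha>) * indicator (Lf j) w \<partial>lborel)"
        unfolding c_def Lf_def
      proof (rule nn_integral_large_derivative[where u = "\<lambda>i w. powr_deriv 0 a i w - G i w" and j = j])
        fix i w assume w: "w \<in> {- 1/2 - (real j + 1) * \<delta> <..< - 1/2 - real j * \<delta>}"
        then have "w \<in> {-1<..<0}" using sub[OF j] by (auto simp: Lf_def)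
        then show "((\<lambda>w. powr_deriv 0 a i w - G i w) has_real_derivative powr_deriv 0 a (Suc i) w - G (Suc i) w) (at w)"
          by (intro DERIV_diff dG powr_deriv_derivative) auto
        show "\<kappa> \<le> \<bar>powr_deriv 0 a j w - G j w\<bar>" using big w by (auto simp: Lf_def)
      qed (use \<delta> \<kappa> j \<alpha> in \<open>auto simp: algebra_simps\<close>)
      also have "\<dots> \<le> (\<integral>\<^sup>+ w. ennreal (\<bar>h w\<bar> powr \<alpha>) * indicator {-1<..<1} w \<partial>lborel)"
        using sub[OF j] by (intro nn_integral_indicator_mono) (auto simp: subset_eq hL)
      finally show False using small by simp
    qed
    have right: "\<exists>w\<in>Rt j. \<bar>G j w\<bar> < \<kappa>" if j: "j \<le> J" for j
    proof (rule ccontr)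
      assume "\<not> ?thesis"
      then have big: "\<And>w. w \<in> Rt j \<Longrightarrow> \<kappa> \<le> \<bar>G j w\<bar>" by force
      have "ennreal c \<le> (\<integral>\<^sup>+ w. ennreal (\<bar>G 0 w\<bar> powr \<alpha>) * indicator (Rt j) w \<partial>lborel)"
        unfolding c_def Rt_def
      proof (rule nn_integral_large_derivative[where u = G and j = j])
        fix i w assume w: "w \<in> {real j * \<delta> <..< (real j + 1) * \<delta>}"
        then have "w \<in> {0<..<1}" using sub[OF j] by (auto simp: Rt_def)
        then show "(G i has_real_derivative G (Suc i) w) (at w)" by (intro dG) auto
        show "\<kappa> \<le> \<bar>G j w\<bar>" using big w by (auto simp: Rt_def)
      qed (use \<delta> \<kappa> j \<alpha> in \<open>auto simp: algebra_simps\<close>)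
      also have "\<dots> \<le> (\<integral>\<^sup>+ w. ennreal (\<bar>h w\<bar> powr \<alpha>) * indicator {-1<..<1} w \<partial>lborel)"
        using sub[OF j] by (intro nn_integral_indicator_mono) (auto simp: subset_eq hR)
      finally show False using small by simp
    qed
    obtain l where l: "\<And>j. j \<le> J \<Longrightarrow> l j \<in> Lf j" "\<And>j. j \<le> J \<Longrightarrow> \<bar>powr_deriv 0 a j (l j) - G j (l j)\<bar> < \<kappa>"
      using left by metis
    obtain r where r: "\<And>j. j \<le> J \<Longrightarrow> r j \<in> Rt j" "\<And>j. j \<le> J \<Longrightarrow> \<bar>G j (r j)\<bar> < \<kappa>"
      using right by metis
    have lr: "l j \<in> {-1<..<0}" "r j \<in> {0<..<1}" if "j \<le> J" for j
      using l(1)[OF that] r(1)[OF that] sub[OF that] by auto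
    have mono: "l (Suc j) < l j" "r j < r (Suc j)" if "j < J" for j
      using l(1)[of j] l(1)[of "Suc j"] r(1)[of j] r(1)[of "Suc j"] that
      by (auto simp: Lf_def Rt_def algebra_simps)
    have l0: "- 1 < l 0" "l 0 < - 1/2" using l(1)[of 0] lr(1)[of 0] by (auto simp: Lf_def)
    have l0r0: "l 0 < r 0" using lr[of 0] by auto
    have no_alt: False
      if E: "\<And>i w. w \<in> {-1<..<1} \<Longrightarrow> (E i has_real_derivative E (Suc i) w) (at w)"
        "few_zeros Z (E K)" "\<And>i. i < K \<Longrightarrow> l' (Suc i) < l' i" "\<And>i. i \<le> K \<Longrightarrow> l' i > -1"
        "\<And>i. i < K \<Longrightarrow> r' i < r' (Suc i)" "\<And>i. i \<le> K \<Longrightarrow> r' i < 1" "l' 0 < r' 0" "E 0 (l' 0) \<ge> 1 / 8"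
        "\<And>i. 0 < i \<Longrightarrow> i \<le> K \<Longrightarrow> E i (l' i) > - \<kappa>" "\<And>i. i \<le> K \<Longrightarrow> \<bar>E i (r' i)\<bar> < \<kappa>" for E l' r'
    proof -
      obtain q where q: "\<And>i. i\<in>{1..K} \<Longrightarrow> (-1) ^ i * E K (q i) \<ge> 1 / 8 / 2 ^ K - \<kappa>"
        "\<And>i. i\<in>{1..<K} \<Longrightarrow> q i < q (Suc i)" "\<And>i. i\<in>{1..K} \<Longrightarrow> l' (K - 1) < q i \<and> q i < r' (K - 1)"
      proof -
        have "\<exists>q. (\<forall>i\<in>{1..K}. (-1) ^ i * E K (q i) \<ge> 1 / 8 / 2 ^ K - \<kappa>) \<and>
          (\<forall>i\<in>{1..<K}. q i < q (Suc i)) \<and> (\<forall>i\<in>{1..K}. l' (K - 1) < q i \<and> q i < r' (K - 1))"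
          by (rule alternating_derivatives[where E = E and l = l' and r = r' and K = K, OF E(1,3-10) \<kappa>(2)])
            (auto simp: K_def)
        then show thesis using that by blast
      qed
      have "\<not> few_zeros Z (E K)"
      proof (rule not_few_zeros_alternating)
        show "continuous_on {-1<..<1} (E K)"
          using E(1) by (meson DERIV_continuous continuous_at_imp_continuous_on)
        fix i assume i: "i \<in> {1..Z + 2}"
        show "0 < (-1) ^ i * E K (q i)" using q(1)[of i] i \<kappa> by (auto simp: K_def)
        show "-1 < q i \<and> q i < 1" using q(3)[of i] E(4)[of "K - 1"] E(6)[of "K - 1"] i by (auto simp: K_def)
      qed (use q(2) in \<open>auto simp: K_def\<close>)
      then show False using E(2) by simp
    qed
    have fz: "few_zeros Z (\<lambda>w. s * G k w)" for k s
    proof -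
      have "few_zeros Z (\<lambda>w. \<Sum>i<n. (- s * y i * (\<Prod>t<k. real t - e i)) * (b i - w) powr (e i - real k))"
        using b by (intro Z) auto
      then show ?thesis
        by (rule few_zeros_mult[where c = "\<lambda>_. 1"])
          (auto simp: G_def powr_deriv_def sum_distrib_left sum_negf mult_ac)
    qed
    show False
    proof (cases "a \<le> 0")
      case True
      \<comment> \<open>For a \<le> 0 all derivatives of the power are nonnegative, so those of G
        stay above \<open>- \<kappa>\<close> at the left points, while \<open>G 0\<close> is large
        at the start.\<close>
      have "(- l 0) powr a \<ge> 1"
        using l0 True powr_mono2'[of a "- l 0" 1] by simp
      moreover have "G 0 (l 0) > powr_deriv 0 a 0 (l 0) - \<kappa>" using l(2)[of 0] by simp
      ultimately have st: "G 0 (l 0) \<ge> 1 / 8" using \<kappa>(3) by (simp add: powr_deriv_0)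
      have lf: "G i (l i) > - \<kappa>" if "i \<le> K" for i
        using l(2)[of i] powr_deriv_nonneg[OF True, of 0 i "l i"] that by (simp add: J_def)
      have f: "few_zeros Z (G K)" using fz[of 1 K] by simp
      show False
        by (rule no_alt[of G l r]) (use dG f st lf r(2) lr l0r0 mono in \<open>auto simp: J_def\<close>)
    next
      case False
      \<comment> \<open>For 0 < a \<le> 1 the derivatives of the power are nonpositive, so the
        argument runs with the negated derivatives of G. It starts at a point p: G drops by at least
        1/4 over a length of at most 2, hence \<open>- G 1 p\<close> is at least 1/8. This is the
        origin of the value 1/8.\<close>
      have "(1/2) powr 1 \<le> (1/2::real) powr a" using a by (intro powr_mono') auto
      also have "\<dots> \<le> (- l 0) powr a" using l0 False by (intro powr_mono2) auto
      finally have "G 0 (l 0) > 1/2 - \<kappa>" using l(2)[of 0] by (simp add: powr_deriv_0)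
      moreover have "G 0 (r 0) < \<kappa>" using r(2)[of 0] by simp
      ultimately have drop: "G 0 (r 0) - G 0 (l 0) < - 1/4" using \<kappa>(3) by simp
      obtain p where p: "l 0 < p" "p < r 0" "G 0 (r 0) - G 0 (l 0) = (r 0 - l 0) * G 1 p"
      proof -
        have "\<exists>z>l 0. z < r 0 \<and> G 0 (r 0) - G 0 (l 0) = (r 0 - l 0) * G 1 z"
          unfolding One_nat_def by (rule MVT2[OF l0r0 dG]) (use lr[of 0] in auto)
        then show thesis using that by blast
      qed
      have "G 1 p < 0"
      proof (rule ccontr)
        assume "\<not> G 1 p < 0"
        then have "0 \<le> (r 0 - l 0) * G 1 p" using l0r0 by (intro mult_nonneg_nonneg) auto
        then show False using drop p(3) by linarith
      qed
      moreover have "r 0 - l 0 \<le> 2" using lr[of 0] by auto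
      ultimately have "2 * G 1 p \<le> (r 0 - l 0) * G 1 p" by (intro mult_right_mono_neg) auto
      then have st: "- G 1 p \<ge> 1 / 8" using drop p(3) by linarith
      have lf: "- G (Suc i) (l (Suc i)) > - \<kappa>" if "i \<le> K" for i
        using l(2)[of "Suc i"] powr_deriv_nonpos[of a 0 i "l (Suc i)"] that a False by (auto simp: J_def)
      have f: "few_zeros Z (\<lambda>w. - G (Suc K) w)" using fz[of "-1" "Suc K"] by simp
      \<comment> \<open>The starting point p takes the place of the left point of order 1; it lies
        to the right of \<open>l 0\<close>, so the ordering is kept.\<close>
      define l' where "l' i = (if i = 0 then p else l (Suc i))" for i
      have l'1: "l' (Suc i) < l' i" if "i < K" for i
        using that mono[of 0] mono[of "Suc i"] mono[of 1] p by (auto simp: l'_def J_def)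
      have l'2: "-1 < l' i" if "i \<le> K" for i
        using that lr(1)[of "Suc i"] lr(1)[of 0] p by (auto simp: l'_def J_def)
      have l'3: "l' 0 < r (Suc 0)" using p mono[of 0] by (auto simp: l'_def J_def)
      show False
      proof (rule no_alt[of "\<lambda>i w. - G (Suc i) w" l' "\<lambda>i. r (Suc i)"])
        show "((\<lambda>w. - G (Suc i) w) has_real_derivative - G (Suc (Suc i)) w) (at w)"
          if "w \<in> {-1<..<1}" for i w using that by (intro DERIV_minus dG)
        show "\<bar>- G (Suc i) (r (Suc i))\<bar> < \<kappa>" if "i \<le> K" for i
          using r(2)[of "Suc i"] that by (simp add: J_def)
        show "- \<kappa> < - G (Suc i) (l' i)" if "0 < i" "i \<le> K" for i
          using lf[of i] that by (simp add: l'_def)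
        show "r (Suc i) < 1" if "i \<le> K" for i using lr(2)[of "Suc i"] that by (simp add: J_def)
        show "r (Suc i) < r (Suc (Suc i))" if "i < K" for i using mono(2)[of "Suc i"] that by (simp add: J_def)
        show "1 / 8 \<le> - G (Suc 0) (l' 0)" using st by (simp add: l'_def)
      qed (use f l'1 l'2 l'3 in simp_all)
    qed
  qed
qed

section \<open>Rescaling to an arbitrary point and gap\<close>

lemma pospow_measurable [measurable]: "(\<lambda>x. pospow x p) \<in> borel_measurable borel"
  unfolding pospow_def by measurable

lemma pospow_scale: "\<delta> > 0 \<Longrightarrow> pospow (\<delta> * x) p = \<delta> powr p * pospow x p"
  by (auto simp: pospow_def powr_mult zero_less_mult_iff)

lemma pospow_nonneg: "0 \<le> pospow x p"
  by (simp add: pospow_def)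

text \<open>The substitution \<open>r = s j + \<delta> * w\<close> reduces to the unit window:
  powers of points at distance \<delta> or more on the left vanish there, and points on the right
  get base points b \<ge> 1. Points with vanishing coefficient may be arbitrarily close, which the
  triangular bound for the frequencies exploits. The exponent \<open>\<alpha> * e j + 1\<close>
  collects the scaling of the power and the Jacobian.\<close>

lemma two_sided_nondeterminism:
  fixes p :: nat
  assumes \<alpha>: "\<alpha> > 0"
  shows "\<exists>c>0. \<forall>s y e j \<delta>. j < p \<and> 0 < \<delta> \<and> e j \<le> 1 \<and> (\<forall>i<p. i \<noteq> j \<longrightarrow> y i \<noteq> 0 \<longrightarrow> \<delta> \<le> \<bar>s i - s j\<bar>) \<longrightarrow>
    ennreal (c * \<bar>y j\<bar> powr \<alpha> * \<delta> powr (\<alpha> * e j + 1)) \<le>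
      (\<integral>\<^sup>+ r. ennreal (\<bar>\<Sum>i<p. y i * pospow (s i - r) (e i)\<bar> powr \<alpha>) * indicator {s j - \<delta><..<s j + \<delta>} r \<partial>lborel)"
proof -
  obtain c where c: "c > 0" and unit: "\<And>a b e y. a \<le> 1 \<Longrightarrow> (\<forall>i<p. 1 \<le> b i) \<Longrightarrow>
    ennreal c \<le> (\<integral>\<^sup>+ w. ennreal (\<bar>pospow (- w) a + (\<Sum>i<p. y i * pospow (b i - w) (e i))\<bar> powr \<alpha>)
        * indicator {-1<..<1} w \<partial>lborel)"
    using two_sided_nondeterminism_unit[OF \<alpha>, of p] by blast
  show ?thesis
  proof (intro exI[of _ c] conjI c allI impI, elim conjE)
    fix s y e :: "nat \<Rightarrow> real" and j \<delta>
    assume j: "j < p" and \<delta>: "0 < \<delta>" and e: "e j \<le> 1"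
      and sep: "\<forall>i<p. i \<noteq> j \<longrightarrow> y i \<noteq> 0 \<longrightarrow> \<delta> \<le> \<bar>s i - s j\<bar>"
    show "ennreal (c * \<bar>y j\<bar> powr \<alpha> * \<delta> powr (\<alpha> * e j + 1)) \<le>
      (\<integral>\<^sup>+ r. ennreal (\<bar>\<Sum>i<p. y i * pospow (s i - r) (e i)\<bar> powr \<alpha>) * indicator {s j - \<delta><..<s j + \<delta>} r \<partial>lborel)"
    proof (cases "y j = 0")
      case False
      define B where "B i = (s i - s j) / \<delta>" for i
      \<comment> \<open>Terms absent from the smooth part, including i = j, get coefficient 0 and
        the admissible base point 1.\<close>
      define b where "b i = (if i \<noteq> j \<and> 1 \<le> B i then B i else 1)" for i
      define Y where "Y i = (if i \<noteq> j \<and> 1 \<le> B i then y i * \<delta> powr e i / (y j * \<delta> powr e j) else 0)" for i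
      define k where "k = y j * \<delta> powr e j"
      have k: "k \<noteq> 0" using False \<delta> by (simp add: k_def)
      have eq: "(\<Sum>i<p. y i * pospow (s i - (s j + \<delta> * w)) (e i)) =
        k * (pospow (- w) (e j) + (\<Sum>i<p. Y i * pospow (b i - w) (e i)))" if w: "w \<in> {-1<..<1}" for w
      proof -
        have t: "y i * pospow (s i - (s j + \<delta> * w)) (e i) =
          k * (if i = j then pospow (- w) (e j) else 0) + k * (Y i * pospow (b i - w) (e i))" if i: "i < p" for i
        proof -
          have "s i - (s j + \<delta> * w) = \<delta> * (B i - w)" using \<delta> by (simp add: B_def field_simps)
          then have 1: "pospow (s i - (s j + \<delta> * w)) (e i) = \<delta> powr e i * pospow (B i - w) (e i)"
            using pospow_scale[OF \<delta>] by simp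
          show ?thesis
          proof (cases "i = j")
            case True
            then show ?thesis unfolding 1 by (simp add: B_def Y_def k_def)
          next
            case False
            show ?thesis
            proof (cases "1 \<le> B i")
              case True
              then show ?thesis using False k unfolding 1 by (simp add: Y_def b_def k_def)
            next
              case nB: False
              have "y i * pospow (B i - w) (e i) = 0"
              proof (cases "y i = 0")
                case ny: False
                then have "\<delta> \<le> \<bar>s i - s j\<bar>" using sep i False by auto
                then have "1 \<le> \<bar>B i\<bar>" using \<delta> by (simp add: B_def)
                then have "B i - w \<le> 0" using nB w by auto
                then show ?thesis by (simp add: pospow_def)
              qed simp
              then show ?thesis using False nB unfolding 1 by (auto simp: Y_def)
            qed
          qed
        qed
        have "(\<Sum>i<p. y i * pospow (s i - (s j + \<delta> * w)) (e i)) =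
          (\<Sum>i<p. k * (if i = j then pospow (- w) (e j) else 0) + k * (Y i * pospow (b i - w) (e i)))"
          by (intro sum.cong t) auto
        also have "\<dots> = k * (pospow (- w) (e j) + (\<Sum>i<p. Y i * pospow (b i - w) (e i)))"
          using j by (simp add: sum.distrib sum_distrib_left[symmetric] distrib_left)
        finally show ?thesis .
      qed
      have kp: "\<bar>k\<bar> powr \<alpha> = \<bar>y j\<bar> powr \<alpha> * \<delta> powr (\<alpha> * e j)"
        using \<delta> by (simp add: k_def abs_mult powr_mult powr_powr mult.commute)
      have "ennreal (c * \<bar>y j\<bar> powr \<alpha> * \<delta> powr (\<alpha> * e j + 1)) = ennreal \<delta> * (ennreal (\<bar>k\<bar> powr \<alpha>) * ennreal c)"
        using \<delta> c by (simp add: kp powr_add ennreal_mult[symmetric] mult_ac)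
      also have "\<dots> \<le> ennreal \<delta> * (ennreal (\<bar>k\<bar> powr \<alpha>) *
         (\<integral>\<^sup>+ w. ennreal (\<bar>pospow (- w) (e j) + (\<Sum>i<p. Y i * pospow (b i - w) (e i))\<bar> powr \<alpha>)
        * indicator {-1<..<1} w \<partial>lborel))"
        by (intro mult_left_mono unit e) (auto simp: b_def)
      also have "\<dots> = ennreal \<delta> * (\<integral>\<^sup>+ w. ennreal (\<bar>k\<bar> powr \<alpha>) * (ennreal (\<bar>pospow (- w) (e j) + (\<Sum>i<p. Y i * pospow (b i - w) (e i))\<bar> powr \<alpha>)
        * indicator {-1<..<1} w) \<partial>lborel)"
        by (subst nn_integral_cmult) auto
      also have "\<dots> = ennreal \<delta> * (\<integral>\<^sup>+ w. ennreal (\<bar>\<Sum>i<p. y i * pospow (s i - (s j + \<delta> * w)) (e i)\<bar> powr \<alpha>)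
        * indicator {s j - \<delta><..<s j + \<delta>} (s j + \<delta> * w) \<partial>lborel)"
      proof (rule arg_cong[where f = "\<lambda>x. ennreal \<delta> * x"], rule nn_integral_cong)
        fix w :: real
        have "indicator {s j - \<delta><..<s j + \<delta>} (s j + \<delta> * w) = (indicator {-1<..<1} w :: ennreal)"
        proof -
          have "- \<delta> < \<delta> * w \<longleftrightarrow> -1 < w" "\<delta> * w < \<delta> \<longleftrightarrow> w < 1"
            using mult_less_cancel_left_pos[OF \<delta>, of "-1" w] mult_less_cancel_left_pos[OF \<delta>, of w 1] by auto
          then show ?thesis by (auto simp: indicator_def)
        qed
        then show "ennreal (\<bar>k\<bar> powr \<alpha>) * (ennreal (\<bar>pospow (- w) (e j) + (\<Sum>i<p. Y i * pospow (b i - w) (e i))\<bar> powr \<alpha>)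
          * indicator {-1<..<1} w) = ennreal (\<bar>\<Sum>i<p. y i * pospow (s i - (s j + \<delta> * w)) (e i)\<bar> powr \<alpha>)
          * indicator {s j - \<delta><..<s j + \<delta>} (s j + \<delta> * w)"
          by (cases "w \<in> {-1<..<1}") (simp_all add: eq abs_mult powr_mult ennreal_mult)
      qed
      also have "\<dots> = (\<integral>\<^sup>+ r. ennreal (\<bar>\<Sum>i<p. y i * pospow (s i - r) (e i)\<bar> powr \<alpha>) * indicator {s j - \<delta><..<s j + \<delta>} r \<partial>lborel)"
        using \<delta> by (subst nn_integral_real_affine[where c = \<delta> and t = "s j"]) auto
      finally show ?thesis .
    qed simp
  qed
qed

section \<open>Inequalities and integrals for the kernel\<close>

lemma nn_integral_lborel_vec_prod:
  fixes f :: "'n::finite \<Rightarrow> real \<Rightarrow> ennreal"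
  assumes [measurable]: "\<And>l. f l \<in> borel_measurable borel"
  shows "(\<integral>\<^sup>+ v. (\<Prod>l\<in>UNIV. f l (v $ l)) \<partial>(lborel :: (real^'n) measure)) = (\<Prod>l\<in>UNIV. \<integral>\<^sup>+ r. f l r \<partial>lborel)"
proof -
  define idx where "idx b = (THE l. b = axis l (1::real))" for b :: "real^'n"
  have idx: "idx (axis l 1) = l" for l unfolding idx_def by (rule the_equality) (auto simp: axis_eq_axis)
  have B: "(Basis :: (real^'n) set) = (\<lambda>l. axis l 1) ` UNIV" by (auto simp: Basis_vec_def)
  have inj: "inj (\<lambda>l::'n. axis l (1::real))" by (auto simp: inj_def axis_eq_axis)
  have "(\<integral>\<^sup>+ v. (\<Prod>b\<in>Basis. f (idx b) (v \<bullet> b)) \<partial>(lborel :: (real^'n) measure)) = (\<Prod>b\<in>(Basis :: (real^'n) set). \<integral>\<^sup>+ r. f (idx b) r \<partial>lborel)"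
    by (rule nn_integral_lborel_prod) auto
  then show ?thesis unfolding B by (simp add: prod.reindex[OF inj] idx inner_axis)
qed

lemma abs_add_powr_le:
  fixes x y :: real
  assumes "0 < \<alpha>" "\<alpha> \<le> 2"
  shows "\<bar>x + y\<bar> powr \<alpha> \<le> 4 * (\<bar>x\<bar> powr \<alpha> + \<bar>y\<bar> powr \<alpha>)"
proof -
  define m where "m = max \<bar>x\<bar> \<bar>y\<bar>"
  have "\<bar>x + y\<bar> powr \<alpha> \<le> (2 * m) powr \<alpha>" using assms by (intro powr_mono2) (auto simp: m_def)
  also have "\<dots> = 2 powr \<alpha> * m powr \<alpha>" by (simp add: powr_mult m_def)
  also have "\<dots> \<le> 2 powr 2 * m powr \<alpha>" using assms by (intro mult_right_mono powr_mono) auto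
  also have "m powr \<alpha> \<le> \<bar>x\<bar> powr \<alpha> + \<bar>y\<bar> powr \<alpha>" by (auto simp: m_def max_def)
  finally show ?thesis by (simp add: mult_left_mono)
qed

lemma nn_integral_powr_from_0:
  assumes "a > -1" "c \<ge> 0"
  shows "(\<integral>\<^sup>+ x. ennreal (x powr a) * indicator {0..c} x \<partial>lborel) < \<infinity>"
proof -
  have "(\<integral>\<^sup>+ x. ennreal (indicator {0..c} x * x powr a) \<partial>lborel) = ennreal (c powr (a + 1) / (a + 1))"
    using nn_integral_has_integral_lebesgue[OF _ has_integral_powr_from_0[OF assms]] by simp
  then show ?thesis by (simp add: ennreal_mult' ennreal_indicator mult.commute)
qed

lemma nn_integral_powr_at_top:
  assumes "a < -1"
  shows "(\<integral>\<^sup>+ x. ennreal (x powr a) * indicator {1..} x \<partial>lborel) < \<infinity>"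
proof -
  have lim: "((\<lambda>x. x powr (a + 1) / (a + 1)) \<longlongrightarrow> 0) at_top"
    using assms by real_asymp
  have "(\<integral>\<^sup>+ x. ennreal (x powr a) * indicator {1..} x \<partial>lborel) = ennreal (0 - 1 powr (a + 1) / (a + 1))"
    using assms by (intro nn_integral_FTC_atLeast[where F = "\<lambda>x. x powr (a + 1) / (a + 1)", OF _ _ _ lim])
      (auto intro!: derivative_eq_intros)
  then show ?thesis by simp
qed

section \<open>Local nondeterminism of the sheet\<close>

lemma lmss_kernel0_measurable [measurable]:
  fixes H :: "real^'n \<Rightarrow> real^'n"
  shows "lmss_kernel0 \<alpha> H u \<in> borel_measurable borel"
proof -
  have m: "(\<lambda>v. v $ l) \<in> borel_measurable (borel :: (real^'n) measure)" for l
    by (intro borel_measurable_continuous_onI continuous_intros)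
  have "(\<lambda>v. \<Prod>l\<in>UNIV. pospow (u$l - v$l) (H u $ l - 1/\<alpha>) - pospow (- v$l) (H u $ l - 1/\<alpha>)) \<in> borel_measurable borel"
    using m by (intro borel_measurable_prod borel_measurable_diff measurable_compose[OF _ pospow_measurable]) auto
  then show ?thesis unfolding lmss_kernel0_def[abs_def] .
qed

lemma lmss_kernel_measurable [measurable]:
  "lmss_kernel \<alpha> H u \<in> borel_measurable borel"
  unfolding lmss_kernel_def[abs_def] by measurable

text \<open>Gains one power of w in the far past, where the two terms of the kernel almost
  cancel.\<close>

lemma powr_increment_le:
  fixes a u w :: real
  assumes "a \<le> 1" "u \<ge> 0" "w \<ge> 1"
  shows "\<bar>(u + w) powr a - w powr a\<bar> \<le> \<bar>a\<bar> * u * w powr (a - 1)"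
proof (cases "u = 0")
  case False
  have "\<exists>z>w. z < u + w \<and> (u + w) powr a - w powr a = (u + w - w) * (a * z powr (a - 1))"
    using False assms by (intro MVT2) (auto intro!: derivative_eq_intros)
  then obtain z where z: "z > w" "(u + w) powr a - w powr a = u * (a * z powr (a - 1))" by auto
  have "z powr (a - 1) \<le> w powr (a - 1)" using z assms by (intro powr_mono2') auto
  then show ?thesis unfolding z using assms by (simp add: abs_mult mult_left_mono mult_ac)
qed simp

text \<open>The two bounds on h are the two integrability conditions: h > 0 gives
  \<open>\<alpha> * a > -1\<close> at the singularities, and h < 1 gives
  \<open>\<alpha> * (a - 1) < -1\<close> at minus infinity, where the increment decays one order
  faster than each term.\<close>

lemma nn_integral_pospow_increment:
  fixes u h \<alpha> :: real
  assumes \<alpha>: "0 < \<alpha>" "\<alpha> \<le> 2" and h: "0 < h" "h < 1" and u: "0 \<le> u"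
  shows "(\<integral>\<^sup>+ r. ennreal (\<bar>pospow (u - r) (h - 1/\<alpha>) - pospow (- r) (h - 1/\<alpha>)\<bar> powr \<alpha>) \<partial>lborel) < \<infinity>"
proof -
  define a where "a = h - 1/\<alpha>"
  have \<alpha>a: "\<alpha> * a > -1" "\<alpha> * (a - 1) < -1" using \<alpha> h by (auto simp: a_def field_simps)
  have "1 / \<alpha> > 0" using \<alpha> by simp
  then have a1: "a \<le> 1" using h unfolding a_def by linarith
  define I1 where "I1 r = ennreal (r powr (\<alpha> * a)) * indicator {0..u + 1} r" for r :: real
  define I2 where "I2 r = ennreal (r powr (\<alpha> * (a - 1))) * indicator {1..} r" for r :: real
  have [measurable]: "I1 \<in> borel_measurable borel" "I2 \<in> borel_measurable borel"
    unfolding I1_def I2_def by measurable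
  have fin: "(\<integral>\<^sup>+ r. I1 r \<partial>lborel) < \<infinity>" "(\<integral>\<^sup>+ r. I2 r \<partial>lborel) < \<infinity>"
    using nn_integral_powr_from_0[OF \<alpha>a(1), of "u + 1"] nn_integral_powr_at_top[OF \<alpha>a(2)] u
    by (auto simp: I1_def I2_def)
  define C where "C = (\<bar>a\<bar> * u) powr \<alpha>"
  have bound: "ennreal (\<bar>pospow (u - r) a - pospow (- r) a\<bar> powr \<alpha>)
     \<le> 4 * I1 (u - r) + (4 * I1 (- r) + ennreal C * I2 (- r))" for r
  proof (cases "r < - 1")
    case True
    have "\<bar>(u + (- r)) powr a - (- r) powr a\<bar> \<le> \<bar>a\<bar> * u * (- r) powr (a - 1)"
      using True u a1 by (intro powr_increment_le) auto
    then have "\<bar>(u - r) powr a - (- r) powr a\<bar> powr \<alpha> \<le> (\<bar>a\<bar> * u * (- r) powr (a - 1)) powr \<alpha>"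
      using \<alpha> by (intro powr_mono2) auto
    also have "\<dots> = C * (- r) powr (\<alpha> * (a - 1))"
      using u by (simp add: C_def powr_mult powr_powr mult.commute)
    finally have "\<bar>pospow (u - r) a - pospow (- r) a\<bar> powr \<alpha> \<le> C * (- r) powr (\<alpha> * (a - 1))"
      using True u by (simp add: pospow_def)
    then have "ennreal (\<bar>pospow (u - r) a - pospow (- r) a\<bar> powr \<alpha>) \<le> ennreal C * I2 (- r)"
      using True by (simp add: I2_def C_def ennreal_mult[symmetric] ennreal_leI)
    then show ?thesis by (meson add_increasing zero_le)
  next
    case False
    have e: "ennreal (pospow (x - r) a powr \<alpha>) \<le> I1 (x - r)" if "x = u \<or> x = 0" for x
      using False that u by (auto simp: pospow_def I1_def powr_powr mult.commute)
    have "\<bar>pospow (u - r) a + - pospow (- r) a\<bar> powr \<alpha> \<le> 4 * (\<bar>pospow (u - r) a\<bar> powr \<alpha> + \<bar>- pospow (- r) a\<bar> powr \<alpha>)"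
      by (rule abs_add_powr_le[OF \<alpha>])
    then have "\<bar>pospow (u - r) a - pospow (- r) a\<bar> powr \<alpha> \<le> 4 * (pospow (u - r) a powr \<alpha> + pospow (- r) a powr \<alpha>)"
      by (simp add: pospow_nonneg)
    then have "ennreal (\<bar>pospow (u - r) a - pospow (- r) a\<bar> powr \<alpha>) \<le> ennreal (4 * (pospow (u - r) a powr \<alpha> + pospow (- r) a powr \<alpha>))"
      by (rule ennreal_leI)
    also have "\<dots> = 4 * ennreal (pospow (u - r) a powr \<alpha>) + 4 * ennreal (pospow (- r) a powr \<alpha>)"
      by (simp add: ennreal_mult' distrib_left ennreal_plus)
    also have "\<dots> \<le> 4 * I1 (u - r) + 4 * I1 (0 - r)"
      using e[of u] e[of 0] by (intro add_mono mult_left_mono) auto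
    also have "\<dots> \<le> 4 * I1 (u - r) + (4 * I1 (- r) + ennreal C * I2 (- r))"
      by (intro add_left_mono) simp
    finally show ?thesis .
  qed
  have shift: "(\<integral>\<^sup>+ r. f (x - r) \<partial>lborel) = (\<integral>\<^sup>+ r. f r \<partial>lborel)"
    if [measurable]: "f \<in> borel_measurable borel" for f :: "real \<Rightarrow> ennreal" and x
    using nn_integral_real_affine[of f "-1" x] by simp
  have "(\<integral>\<^sup>+ r. ennreal (\<bar>pospow (u - r) a - pospow (- r) a\<bar> powr \<alpha>) \<partial>lborel)
    \<le> (\<integral>\<^sup>+ r. 4 * I1 (u - r) + (4 * I1 (- r) + ennreal C * I2 (- r)) \<partial>lborel)"
    by (intro nn_integral_mono bound)
  also have "\<dots> = 4 * (\<integral>\<^sup>+ r. I1 r \<partial>lborel) + (4 * (\<integral>\<^sup>+ r. I1 r \<partial>lborel) + ennreal C * (\<integral>\<^sup>+ r. I2 r \<partial>lborel))"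
    using shift[of I1 u] shift[of I1 0] shift[of I2 0]
    by (simp add: nn_integral_add nn_integral_cmult)
  also have "\<dots> < \<infinity>" using fin by (simp add: ennreal_mult_less_top)
  finally show ?thesis by (simp add: a_def)
qed

text \<open>The Bochner integral of a non-integrable function is 0 by convention, whereas the lower
  bounds are obtained for nonnegative integrals; integrability identifies the two.\<close>

lemma integrable_lmss_kernel0:
  fixes H :: "real^'n \<Rightarrow> real^'n"
  assumes \<alpha>: "0 < \<alpha>" "\<alpha> \<le> 2" and u: "\<And>l. 0 \<le> u $ l" and h: "\<And>l. 0 < H u $ l \<and> H u $ l < 1"
  shows "integrable lborel (\<lambda>v. \<bar>lmss_kernel0 \<alpha> H u v\<bar> powr \<alpha>)"
proof (rule integrableI_nonneg)
  have "(\<integral>\<^sup>+ v. ennreal (\<bar>lmss_kernel0 \<alpha> H u v\<bar> powr \<alpha>) \<partial>lborel) =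
    (\<integral>\<^sup>+ v. (\<Prod>l\<in>UNIV. ennreal (\<bar>pospow (u$l - v$l) (H u $ l - 1/\<alpha>) - pospow (- v$l) (H u $ l - 1/\<alpha>)\<bar> powr \<alpha>)) \<partial>lborel)"
    by (simp add: lmss_kernel0_def abs_prod prod_ennreal prod_powr_distrib)
  also have "\<dots> = (\<Prod>l\<in>UNIV. \<integral>\<^sup>+ r. ennreal (\<bar>pospow (u$l - r) (H u $ l - 1/\<alpha>) - pospow (- r) (H u $ l - 1/\<alpha>)\<bar> powr \<alpha>) \<partial>lborel)"
    by (rule nn_integral_lborel_vec_prod) measurable
  also have "\<dots> < \<infinity>"
  proof -
    have "(\<integral>\<^sup>+ r. ennreal (\<bar>pospow (u$l - r) (H u $ l - 1/\<alpha>) - pospow (- r) (H u $ l - 1/\<alpha>)\<bar> powr \<alpha>) \<partial>lborel) \<noteq> \<top>" for l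
      using nn_integral_pospow_increment[OF \<alpha>, of "H u $ l" "u $ l"] h[of l] u[of l] by auto
    then show ?thesis by (simp add: less_top[symmetric] ennreal_prod_eq_top)
  qed
  finally show "(\<integral>\<^sup>+ v. ennreal (\<bar>lmss_kernel0 \<alpha> H u v\<bar> powr \<alpha>) \<partial>lborel) < \<infinity>" .
qed auto

lemma integrable_abs_powr_add:
  fixes f g :: "'a \<Rightarrow> real"
  assumes \<alpha>: "0 < \<alpha>" "\<alpha> \<le> 2" and [measurable]: "f \<in> borel_measurable M" "g \<in> borel_measurable M"
    and "integrable M (\<lambda>v. \<bar>f v\<bar> powr \<alpha>)" "integrable M (\<lambda>v. \<bar>g v\<bar> powr \<alpha>)"
  shows "integrable M (\<lambda>v. \<bar>f v + g v\<bar> powr \<alpha>)"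
proof (rule Bochner_Integration.integrable_bound)
  show "integrable M (\<lambda>v. 4 * (\<bar>f v\<bar> powr \<alpha> + \<bar>g v\<bar> powr \<alpha>))" using assms by auto
  show "AE v in M. norm (\<bar>f v + g v\<bar> powr \<alpha>) \<le> norm (4 * (\<bar>f v\<bar> powr \<alpha> + \<bar>g v\<bar> powr \<alpha>))"
  proof (rule AE_I2)
    fix v
    show "norm (\<bar>f v + g v\<bar> powr \<alpha>) \<le> norm (4 * (\<bar>f v\<bar> powr \<alpha> + \<bar>g v\<bar> powr \<alpha>))"
      using abs_add_powr_le[OF \<alpha>, of "f v" "g v"] by simp
  qed
qed measurable

lemma integrable_lmss_kernel0_sum:
  fixes H :: "real^'n \<Rightarrow> real^'n" and s :: "'i \<Rightarrow> real^'n"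
  assumes \<alpha>: "0 < \<alpha>" "\<alpha> \<le> 2" and "finite A"
    and u: "\<And>i l. i \<in> A \<Longrightarrow> 0 \<le> s i $ l" and h: "\<And>i l. i \<in> A \<Longrightarrow> 0 < H (s i) $ l \<and> H (s i) $ l < 1"
  shows "integrable lborel (\<lambda>v. \<bar>\<Sum>i\<in>A. x i * lmss_kernel0 \<alpha> H (s i) v\<bar> powr \<alpha>)"
  using assms(3-)
proof (induction A rule: finite_induct)
  case empty
  then show ?case using \<alpha> by simp
next
  case (insert i A)
  have 1: "integrable lborel (\<lambda>v. \<bar>x i * lmss_kernel0 \<alpha> H (s i) v\<bar> powr \<alpha>)"
    using integrable_lmss_kernel0[OF \<alpha>, of "s i" H] insert.prems[of i]
    by (simp add: abs_mult powr_mult)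
  have 2: "integrable lborel (\<lambda>v. \<bar>\<Sum>i\<in>A. x i * lmss_kernel0 \<alpha> H (s i) v\<bar> powr \<alpha>)"
    using insert by auto
  show ?case using integrable_abs_powr_add[OF \<alpha> _ _ 1 2] insert.hyps by simp
qed

lemma nn_integral_lborel_shift:
  fixes f :: "'a::euclidean_space \<Rightarrow> ennreal"
  assumes [measurable]: "f \<in> borel_measurable borel"
  shows "(\<integral>\<^sup>+ v. f (c + v) \<partial>lborel) = (\<integral>\<^sup>+ v. f v \<partial>lborel)"
  by (subst (2) lborel_distr_plus[symmetric, of c]) (simp add: nn_integral_distr)

text \<open>Averaging over translations along a coordinate axis gives Fubini along that axis.\<close>

lemma nn_integral_ge_line_integrals:
  fixes f :: "real^'n \<Rightarrow> ennreal"
  assumes f [measurable]: "f \<in> borel_measurable borel" and [measurable]: "B \<in> sets borel"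
    and unit: "\<And>v. v \<in> B \<Longrightarrow> 0 < v $ l \<and> v $ l < 1"
  shows "(\<integral>\<^sup>+ v. (\<integral>\<^sup>+ r. f (v + r *\<^sub>R axis l 1) \<partial>lborel) * indicator B v \<partial>lborel) \<le> (\<integral>\<^sup>+ v. f v \<partial>lborel)"
proof -
  let ?e = "axis l (1::real) :: real^'n"
  have "(\<integral>\<^sup>+ v. (\<integral>\<^sup>+ r. f (v + r *\<^sub>R ?e) \<partial>lborel) * indicator B v \<partial>lborel) =
    (\<integral>\<^sup>+ v. \<integral>\<^sup>+ r. f (v + r *\<^sub>R ?e) * indicator B v \<partial>lborel \<partial>lborel)"
    by (intro nn_integral_cong nn_integral_multc[symmetric]) measurable
  also have "\<dots> = (\<integral>\<^sup>+ r. \<integral>\<^sup>+ v. f (v + r *\<^sub>R ?e) * indicator B v \<partial>lborel \<partial>lborel)"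
    by (rule lborel_pair.Fubini') measurable
  also have "\<dots> = (\<integral>\<^sup>+ r. \<integral>\<^sup>+ v. f v * indicator B (v - r *\<^sub>R ?e) \<partial>lborel \<partial>lborel)"
  proof (rule nn_integral_cong)
    fix r :: real
    have "(\<integral>\<^sup>+ v. f (r *\<^sub>R ?e + v) * indicator B (r *\<^sub>R ?e + v - r *\<^sub>R ?e) \<partial>lborel) = (\<integral>\<^sup>+ v. f v * indicator B (v - r *\<^sub>R ?e) \<partial>lborel)"
      by (rule nn_integral_lborel_shift) measurable
    then show "(\<integral>\<^sup>+ v. f (v + r *\<^sub>R ?e) * indicator B v \<partial>lborel) = (\<integral>\<^sup>+ v. f v * indicator B (v - r *\<^sub>R ?e) \<partial>lborel)"
      by (simp add: add.commute)
  qed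
  also have "\<dots> = (\<integral>\<^sup>+ v. \<integral>\<^sup>+ r. f v * indicator B (v - r *\<^sub>R ?e) \<partial>lborel \<partial>lborel)"
    by (rule lborel_pair.Fubini') measurable
  also have "\<dots> \<le> (\<integral>\<^sup>+ v. f v * 1 \<partial>lborel)"
  proof (intro nn_integral_mono)
    fix v :: "real^'n"
    \<comment> \<open>For given v the admissible shifts r lie in an interval of length 1, because
      the l-th coordinate of points of B lies between 0 and 1; hence v is counted with total weight
      at most 1.\<close>
    have "(\<integral>\<^sup>+ r. f v * indicator B (v - r *\<^sub>R ?e) \<partial>lborel) \<le> (\<integral>\<^sup>+ r. f v * indicator {v $ l - 1..v $ l} r \<partial>lborel)"
    proof (intro nn_integral_mono mult_left_mono)
      fix r :: real
      show "indicator B (v - r *\<^sub>R ?e) \<le> (indicator {v $ l - 1..v $ l} r :: ennreal)"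
        using unit[of "v - r *\<^sub>R ?e"] by (auto simp: indicator_def axis_def)
    qed simp
    also have "\<dots> = f v * 1" by (subst nn_integral_cmult_indicator) auto
    finally show "(\<integral>\<^sup>+ r. f v * indicator B (v - r *\<^sub>R ?e) \<partial>lborel) \<le> f v * 1" .
  qed
  finally show ?thesis by simp
qed

lemma powr_bounded_below:
  fixes r a e T A :: real
  assumes "0 < e" "e \<le> 1" "1 \<le> T" "e \<le> r" "r \<le> T" "- A \<le> a" "a \<le> 1"
  shows "min e (T powr (- A)) \<le> r powr a"
proof (cases "a \<ge> 0")
  case True
  have "e = e powr 1" using assms by simp
  also have "\<dots> \<le> e powr a" using assms by (intro powr_mono') auto
  also have "\<dots> \<le> r powr a" using assms True by (intro powr_mono2) auto
  finally show ?thesis by simp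
next
  case False
  have "T powr (- A) \<le> T powr a" using assms by (intro powr_mono) auto
  also have "\<dots> \<le> r powr a" using assms False by (intro powr_mono2') auto
  finally show ?thesis by simp
qed

text \<open>On a small box B in the positive orthant the subtracted terms
  \<open>pospow (- v $ k)\<close> vanish and the factors of the other coordinates are positive, so
  along direction l the sum becomes a one-variable sum with coefficients \<open>x i * K v i\<close>.
  Only the factor of \<open>s j\<close> needs a quantitative lower bound. The constant is the same
  for all H, s, x, j, l and \<delta>.\<close>

lemma nn_integral_lmss_kernel0_sum_ge:
  fixes e T \<alpha> :: real and p :: nat
  assumes \<alpha>: "0 < \<alpha>" "\<alpha> \<le> 2" and e: "0 < e"
  shows "\<exists>c>0. \<forall>(H :: real^'n \<Rightarrow> real^'n) s x j l \<delta>. j < p \<and>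
    (\<forall>i<p. \<forall>k. e \<le> s i $ k \<and> s i $ k \<le> T \<and> 0 < H (s i) $ k \<and> H (s i) $ k < 1) \<and>
    0 < \<delta> \<and> \<delta> \<le> e / 2 \<and> (\<forall>i<p. i \<noteq> j \<longrightarrow> x i \<noteq> 0 \<longrightarrow> \<delta> \<le> \<bar>s i $ l - s j $ l\<bar>) \<longrightarrow>
    ennreal (c * \<bar>x j\<bar> powr \<alpha> * \<delta> powr (\<alpha> * H (s j) $ l)) \<le>
      (\<integral>\<^sup>+ v. ennreal (\<bar>\<Sum>i<p. x i * lmss_kernel0 \<alpha> H (s i) v\<bar> powr \<alpha>) \<partial>lborel)"
proof -
  obtain c1 where c1: "c1 > 0" and two: "\<And>s y (a :: nat \<Rightarrow> real) j \<delta>. j < p \<Longrightarrow> 0 < \<delta> \<Longrightarrow> a j \<le> 1 \<Longrightarrow>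
    (\<forall>i<p. i \<noteq> j \<longrightarrow> y i \<noteq> 0 \<longrightarrow> \<delta> \<le> \<bar>s i - s j\<bar>) \<Longrightarrow>
    ennreal (c1 * \<bar>y j\<bar> powr \<alpha> * \<delta> powr (\<alpha> * a j + 1)) \<le>
      (\<integral>\<^sup>+ r. ennreal (\<bar>\<Sum>i<p. y i * pospow (s i - r) (a i)\<bar> powr \<alpha>) * indicator {s j - \<delta><..<s j + \<delta>} r \<partial>lborel)"
    using two_sided_nondeterminism[OF \<alpha>(1), of p] by blast
  \<comment> \<open>\<open>e' \<le> e / 2\<close> keeps the coordinates of B at distance at least e'
    from those of the points; \<open>e' \<le> 1\<close> makes B narrow enough for the averaging over
    translations.\<close>
  define e' where "e' = min 1 (e / 2)"
  define T' where "T' = max 1 T"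
  define \<kappa> where "\<kappa> = min e' (T' powr (- (1 / \<alpha>)))"
  have e': "0 < e'" "e' \<le> 1" "e' \<le> e / 2" using e by (auto simp: e'_def)
  have T': "1 \<le> T'" "T \<le> T'" by (auto simp: T'_def)
  have \<kappa>: "0 < \<kappa>" "\<kappa> \<le> 1" using e' T' by (auto simp: \<kappa>_def)
  let ?N = "CARD('n)"
  define c where "c = c1 * (\<kappa> ^ ?N) powr \<alpha> * e' ^ ?N"
  have c: "c > 0" using c1 \<kappa> e' by (simp add: c_def)
  show ?thesis
  proof (intro exI[of _ c] conjI c allI impI, elim conjE)
    fix H :: "real^'n \<Rightarrow> real^'n" and s :: "nat \<Rightarrow> real^'n" and x :: "nat \<Rightarrow> real" and j l \<delta>
    assume j: "j < p" and sH: "\<forall>i<p. \<forall>k. e \<le> s i $ k \<and> s i $ k \<le> T \<and> 0 < H (s i) $ k \<and> H (s i) $ k < 1"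
      and \<delta>: "0 < \<delta>" "\<delta> \<le> e / 2" and sep: "\<forall>i<p. i \<noteq> j \<longrightarrow> x i \<noteq> 0 \<longrightarrow> \<delta> \<le> \<bar>s i $ l - s j $ l\<bar>"
    let ?f = "\<lambda>v. ennreal (\<bar>\<Sum>i<p. x i * lmss_kernel0 \<alpha> H (s i) v\<bar> powr \<alpha>)"
    define B :: "(real^'n) set" where "B = box 0 (\<chi> k. e')"
    have B: "v \<in> B \<longleftrightarrow> (\<forall>k. 0 < v $ k \<and> v $ k < e')" for v
      by (auto simp: B_def mem_box_cart)
    have emB: "emeasure lborel B = ennreal (e' ^ ?N)"
    proof -
      have "emeasure lborel B = (\<Prod>b\<in>(Basis :: (real^'n) set). ((\<chi> k. e') - 0) \<bullet> b)"
        unfolding B_def using e' by (intro emeasure_lborel_box) (auto simp: Basis_vec_def inner_axis)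
      also have "(\<Prod>b\<in>(Basis :: (real^'n) set). ((\<chi> k. e') - 0) \<bullet> b) = (\<Prod>b\<in>(Basis :: (real^'n) set). e')"
        by (intro prod.cong) (auto simp: Basis_vec_def inner_axis)
      finally show ?thesis by simp
    qed
    define K where "K v i = (\<Prod>k\<in>UNIV - {l}. (s i $ k - v $ k) powr (H (s i) $ k - 1/\<alpha>))" for v i
    let ?R = "ennreal (c1 * (\<kappa> ^ ?N) powr \<alpha> * \<bar>x j\<bar> powr \<alpha> * \<delta> powr (\<alpha> * H (s j) $ l))"
    have line: "?R \<le> (\<integral>\<^sup>+ r. ?f (v + r *\<^sub>R axis l 1) \<partial>lborel)" if v: "v \<in> B" for v
    proof -
      define y where "y i = x i * K v i" for i
      have dist: "e' \<le> s i $ k - v $ k" "s i $ k - v $ k \<le> T'" if "i < p" for i k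
      proof -
        have "e \<le> s i $ k" "s i $ k \<le> T" "0 < v $ k" "v $ k < e'" using sH v that by (auto simp: B)
        then show "e' \<le> s i $ k - v $ k" "s i $ k - v $ k \<le> T'" using e' T' by linarith+
      qed
      have Kpos: "K v i > 0" if "i < p" for i
      proof -
        have "(s i $ k - v $ k) powr (H (s i) $ k - 1/\<alpha>) > 0" for k
          unfolding powr_gt_zero using dist(1)[OF that, of k] e'(1) by linarith
        then show ?thesis unfolding K_def by (intro prod_pos) blast
      qed
      have Kge: "\<kappa> ^ ?N \<le> K v j"
      proof -
        have "card (UNIV - {l}) \<le> ?N" by (rule card_mono) simp_all
        then have "\<kappa> ^ ?N \<le> \<kappa> ^ card (UNIV - {l})"
          by (rule power_decreasing) (use \<kappa> in linarith)+
        also have "\<dots> = (\<Prod>k\<in>UNIV - {l}. \<kappa>)" by simp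
        also have "\<dots> \<le> K v j" unfolding K_def
        proof (intro prod_mono conjI)
          fix k
          have "0 < H (s j) $ k" "H (s j) $ k < 1" using sH j by auto
          moreover have "1 / \<alpha> > 0" using \<alpha> by simp
          ultimately have "- (1/\<alpha>) \<le> H (s j) $ k - 1/\<alpha>" "H (s j) $ k - 1/\<alpha> \<le> 1" by linarith+
          then show "\<kappa> \<le> (s j $ k - v $ k) powr (H (s j) $ k - 1/\<alpha>)"
            unfolding \<kappa>_def using e' T' dist[OF j] by (intro powr_bounded_below) auto
        qed (use \<kappa> in auto)
        finally show ?thesis .
      qed
      define F where "F \<rho> = ?f (v + (\<rho> - v $ l) *\<^sub>R axis l 1)" for \<rho>
      have [measurable]: "F \<in> borel_measurable borel" unfolding F_def by measurable
      have comp: "(v + (\<rho> - v $ l) *\<^sub>R axis l 1) $ k = (if k = l then \<rho> else v $ k)" for \<rho> k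
        by (simp add: axis_def)
      have Feq: "F \<rho> = ennreal (\<bar>\<Sum>i<p. y i * pospow (s i $ l - \<rho>) (H (s i) $ l - 1/\<alpha>)\<bar> powr \<alpha>)"
        if "\<rho> \<in> {s j $ l - \<delta><..<s j $ l + \<delta>}" for \<rho>
      proof -
        \<comment> \<open>\<open>\<delta> \<le> e / 2\<close> keeps the window in the positive
          half-line, where the subtracted term of the kernel vanishes in direction l as
          well.\<close>
        have \<rho>: "\<rho> > 0" using that sH j \<delta> e by (auto simp: field_simps) (smt (verit))
        have "x i * lmss_kernel0 \<alpha> H (s i) (v + (\<rho> - v $ l) *\<^sub>R axis l 1) = y i * pospow (s i $ l - \<rho>) (H (s i) $ l - 1/\<alpha>)"
          if i: "i < p" for i
        proof -
          have "lmss_kernel0 \<alpha> H (s i) (v + (\<rho> - v $ l) *\<^sub>R axis l 1) =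
            (pospow (s i $ l - \<rho>) (H (s i) $ l - 1/\<alpha>) - pospow (- \<rho>) (H (s i) $ l - 1/\<alpha>)) *
            (\<Prod>k\<in>UNIV - {l}. pospow (s i $ k - v $ k) (H (s i) $ k - 1/\<alpha>) - pospow (- v $ k) (H (s i) $ k - 1/\<alpha>))"
            unfolding lmss_kernel0_def comp by (subst prod.remove[of _ l]) (auto intro!: prod.cong)
          also have "(\<Prod>k\<in>UNIV - {l}. pospow (s i $ k - v $ k) (H (s i) $ k - 1/\<alpha>) - pospow (- v $ k) (H (s i) $ k - 1/\<alpha>)) = K v i"
            unfolding K_def
          proof (intro prod.cong refl)
            fix k
            have "s i $ k - v $ k > 0" using dist(1)[OF i, of k] e' by linarith
            moreover have "v $ k > 0" using v B by auto
            ultimately show "pospow (s i $ k - v $ k) (H (s i) $ k - 1/\<alpha>) - pospow (- v $ k) (H (s i) $ k - 1/\<alpha>) = (s i $ k - v $ k) powr (H (s i) $ k - 1/\<alpha>)"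
              by (simp add: pospow_def)
          qed
          also have "pospow (- \<rho>) (H (s i) $ l - 1/\<alpha>) = 0" using \<rho> by (simp add: pospow_def)
          finally show ?thesis by (simp add: y_def)
        qed
        then show ?thesis unfolding F_def by (intro arg_cong[where f = "\<lambda>t. ennreal (\<bar>t\<bar> powr \<alpha>)"] sum.cong) auto
      qed
      have "1 / \<alpha> > 0" "H (s j) $ l < 1" using \<alpha> sH j by auto
      then have a1: "H (s j) $ l - 1/\<alpha> \<le> 1" by linarith
      \<comment> \<open>With the exponent \<open>H - 1/\<alpha>\<close> the Jacobian exactly
        compensates the \<open>1/\<alpha>\<close>, leaving \<delta> to the power
        \<open>\<alpha> * H\<close>.\<close>
      have expo: "\<alpha> * (H (s j) $ l - 1/\<alpha>) + 1 = \<alpha> * H (s j) $ l" using \<alpha> by (simp add: field_simps)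
      have "?R \<le> ennreal (c1 * \<bar>y j\<bar> powr \<alpha> * \<delta> powr (\<alpha> * (H (s j) $ l - 1/\<alpha>) + 1))"
      proof (intro ennreal_leI)
        have "(\<kappa> ^ ?N) powr \<alpha> \<le> K v j powr \<alpha>" using Kge \<kappa> \<alpha> by (intro powr_mono2) auto
        then have "c1 * (\<kappa> ^ ?N) powr \<alpha> * \<bar>x j\<bar> powr \<alpha> * \<delta> powr (\<alpha> * H (s j) $ l) \<le> c1 * K v j powr \<alpha> * \<bar>x j\<bar> powr \<alpha> * \<delta> powr (\<alpha> * H (s j) $ l)"
          using c1 by (intro mult_right_mono mult_left_mono) auto
        also have "\<dots> = c1 * \<bar>y j\<bar> powr \<alpha> * \<delta> powr (\<alpha> * H (s j) $ l)"
          using Kpos[OF j] by (simp add: y_def abs_mult powr_mult)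
        finally show "c1 * (\<kappa> ^ ?N) powr \<alpha> * \<bar>x j\<bar> powr \<alpha> * \<delta> powr (\<alpha> * H (s j) $ l) \<le>
          c1 * \<bar>y j\<bar> powr \<alpha> * \<delta> powr (\<alpha> * (H (s j) $ l - 1/\<alpha>) + 1)" unfolding expo .
      qed
      also have "\<dots> \<le> (\<integral>\<^sup>+ r. ennreal (\<bar>\<Sum>i<p. y i * pospow (s i $ l - r) (H (s i) $ l - 1/\<alpha>)\<bar> powr \<alpha>) *
          indicator {s j $ l - \<delta><..<s j $ l + \<delta>} r \<partial>lborel)"
        using sep a1
        by (intro two[where a = "\<lambda>i. H (s i) $ l - 1/\<alpha>" and y = y and s = "\<lambda>i. s i $ l", OF j \<delta>(1)]) (auto simp: y_def)
      also have "\<dots> \<le> (\<integral>\<^sup>+ r. F r \<partial>lborel)"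
        by (intro nn_integral_mono) (simp add: indicator_def Feq)
      also have "\<dots> = (\<integral>\<^sup>+ r. F (v $ l + r) \<partial>lborel)"
        by (subst nn_integral_real_affine[where c = 1 and t = "v $ l"]) auto
      also have "\<dots> = (\<integral>\<^sup>+ r. ?f (v + r *\<^sub>R axis l 1) \<partial>lborel)" by (simp add: F_def)
      finally show ?thesis .
    qed
    have "ennreal (c * \<bar>x j\<bar> powr \<alpha> * \<delta> powr (\<alpha> * H (s j) $ l)) = ?R * emeasure lborel B"
      unfolding emB c_def using c1 e' by (subst ennreal_mult[symmetric]) (auto simp: mult_ac)
    also have "\<dots> = (\<integral>\<^sup>+ v. ?R * indicator B v \<partial>lborel)"
      by (subst nn_integral_cmult_indicator) (auto simp: B_def)
    also have "\<dots> \<le> (\<integral>\<^sup>+ v. (\<integral>\<^sup>+ r. ?f (v + r *\<^sub>R axis l 1) \<partial>lborel) * indicator B v \<partial>lborel)"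
      using line by (intro nn_integral_mono) (auto simp: indicator_def)
    also have "\<dots> \<le> (\<integral>\<^sup>+ v. ?f v \<partial>lborel)"
    proof (rule nn_integral_ge_line_integrals)
      show "0 < v $ l \<and> v $ l < 1" if "v \<in> B" for v
        using that e'(2) B[of v] by (metis order_less_le_trans)
    qed (auto simp: B_def)
    finally show "ennreal (c * \<bar>x j\<bar> powr \<alpha> * \<delta> powr (\<alpha> * H (s j) $ l)) \<le> (\<integral>\<^sup>+ v. ?f v \<partial>lborel)" .
  qed
qed

text \<open>The normalising integral is positive by the nondeterminism bound for the single point
  (1, ..., 1), and finite by integrability. With an integral equal to 0, by value or by the
  convention for divergence, the constant would be 1/0 = 0.\<close>

lemma lmss_const_pos:
  fixes H :: "real^'n \<Rightarrow> real^'n"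
  assumes \<alpha>: "0 < \<alpha>" "\<alpha> \<le> 2" and H: "\<And>l. 0 < H (\<chi> l. 1) $ l \<and> H (\<chi> l. 1) $ l < 1"
  shows "lmss_const \<alpha> H > 0"
proof -
  let ?u = "\<chi> l. 1 :: real^'n"
  obtain c where c: "c > 0" and lb: "\<forall>(H :: real^'n \<Rightarrow> real^'n) s x j l \<delta>. j < Suc 0 \<and>
    (\<forall>i<Suc 0. \<forall>k. 1 \<le> s i $ k \<and> s i $ k \<le> 1 \<and> 0 < H (s i) $ k \<and> H (s i) $ k < 1) \<and>
    0 < \<delta> \<and> \<delta> \<le> 1 / 2 \<and> (\<forall>i<Suc 0. i \<noteq> j \<longrightarrow> x i \<noteq> 0 \<longrightarrow> \<delta> \<le> \<bar>s i $ l - s j $ l\<bar>) \<longrightarrow>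
    ennreal (c * \<bar>x j\<bar> powr \<alpha> * \<delta> powr (\<alpha> * H (s j) $ l)) \<le>
      (\<integral>\<^sup>+ v. ennreal (\<bar>\<Sum>i<Suc 0. x i * lmss_kernel0 \<alpha> H (s i) v\<bar> powr \<alpha>) \<partial>lborel)"
    using nn_integral_lmss_kernel0_sum_ge[OF \<alpha> zero_less_one, where p = "Suc 0" and T = 1] by blast
  let ?I = "LINT v|lborel. \<bar>lmss_kernel0 \<alpha> H ?u v\<bar> powr \<alpha>"
  have int: "integrable lborel (\<lambda>v. \<bar>lmss_kernel0 \<alpha> H ?u v\<bar> powr \<alpha>)"
    using H by (intro integrable_lmss_kernel0[OF \<alpha>]) auto
  define l :: 'n where "l = undefined"
  have "ennreal 0 < ennreal (c * \<bar>1\<bar> powr \<alpha> * (1/2) powr (\<alpha> * H ?u $ l))"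
    using c by (simp add: ennreal_less_iff)
  also have "\<dots> \<le> (\<integral>\<^sup>+ v. ennreal (\<bar>lmss_kernel0 \<alpha> H ?u v\<bar> powr \<alpha>) \<partial>lborel)"
    using lb[rule_format, of 0 "\<lambda>_. ?u" H "1/2" "\<lambda>_. 1" l] H by simp
  also have "\<dots> = ennreal ?I" using int by (intro nn_integral_eq_integral) auto
  finally have "?I > 0" by (simp add: ennreal_less_iff)
  then show ?thesis unfolding lmss_const_def by simp
qed

text \<open>The \<alpha>-th power of the scale of the stable variable with coefficients x at the
  times s, that is, minus the logarithm of its joint characteristic function.\<close>

definition lmss_form :: "real \<Rightarrow> (real^'n \<Rightarrow> real^'n) \<Rightarrow> nat \<Rightarrow> (nat \<Rightarrow> real^'n) \<Rightarrow> (nat \<Rightarrow> real) \<Rightarrow> real" where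
  "lmss_form \<alpha> H p s x = (LINT v|lborel. \<bar>\<Sum>i<p. x i * lmss_kernel \<alpha> H (s i) v\<bar> powr \<alpha>)"

lemma sum_lmss_kernel:
  "(\<Sum>i\<in>A. x i * lmss_kernel \<alpha> H (s i) v) = lmss_const \<alpha> H * (\<Sum>i\<in>A. x i * lmss_kernel0 \<alpha> H (s i) v)"
  by (simp add: lmss_kernel_def sum_distrib_left mult.left_commute)

lemma lmss_form_nonneg: "0 \<le> lmss_form \<alpha> H p s x"
  unfolding lmss_form_def by (intro Bochner_Integration.integral_nonneg) auto

lemma lmss_form_scale: "lmss_form \<alpha> H p s (\<lambda>i. t * x i) = \<bar>t\<bar> powr \<alpha> * lmss_form \<alpha> H p s x"
proof -
  have "\<bar>\<Sum>i<p. t * x i * lmss_kernel \<alpha> H (s i) v\<bar> powr \<alpha> = \<bar>t\<bar> powr \<alpha> * \<bar>\<Sum>i<p. x i * lmss_kernel \<alpha> H (s i) v\<bar> powr \<alpha>" for v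
    by (simp add: mult.assoc sum_distrib_left[symmetric] abs_mult powr_mult)
  then show ?thesis by (simp add: lmss_form_def)
qed

lemma integrable_lmss_form:
  fixes H :: "real^'n \<Rightarrow> real^'n" and p :: nat
  assumes \<alpha>: "0 < \<alpha>" "\<alpha> \<le> 2"
    and "\<And>i l. i < p \<Longrightarrow> 0 \<le> s i $ l" "\<And>i l. i < p \<Longrightarrow> 0 < H (s i) $ l \<and> H (s i) $ l < 1"
  shows "integrable lborel (\<lambda>v. \<bar>\<Sum>i<p. x i * lmss_kernel \<alpha> H (s i) v\<bar> powr \<alpha>)"
proof -
  have "\<bar>\<Sum>i<p. x i * lmss_kernel \<alpha> H (s i) v\<bar> powr \<alpha> =
      \<bar>lmss_const \<alpha> H\<bar> powr \<alpha> * \<bar>\<Sum>i<p. x i * lmss_kernel0 \<alpha> H (s i) v\<bar> powr \<alpha>" for v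
    by (simp add: sum_lmss_kernel abs_mult powr_mult)
  then show ?thesis using integrable_lmss_kernel0_sum[OF \<alpha> finite_lessThan, of p s H x] assms by simp
qed

lemma lmss_form_add:
  fixes H :: "real^'n \<Rightarrow> real^'n"
  assumes \<alpha>: "0 < \<alpha>" "\<alpha> \<le> 2"
    and s: "\<And>i l. i < p \<Longrightarrow> 0 \<le> s i $ l" and H: "\<And>i l. i < p \<Longrightarrow> 0 < H (s i) $ l \<and> H (s i) $ l < 1"
  shows "lmss_form \<alpha> H p s (\<lambda>i. x i + y i) \<le> 4 * (lmss_form \<alpha> H p s x + lmss_form \<alpha> H p s y)"
proof -
  note int = integrable_lmss_form[where s = s and H = H and p = p, OF \<alpha> s H]
  let ?g = "\<lambda>x v. \<Sum>i<p. x i * lmss_kernel \<alpha> H (s i) v"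
  have "lmss_form \<alpha> H p s (\<lambda>i. x i + y i) \<le> (LINT v|lborel. 4 * (\<bar>?g x v\<bar> powr \<alpha> + \<bar>?g y v\<bar> powr \<alpha>))"
    unfolding lmss_form_def
  proof (rule integral_mono)
    fix v
    show "\<bar>?g (\<lambda>i. x i + y i) v\<bar> powr \<alpha> \<le> 4 * (\<bar>?g x v\<bar> powr \<alpha> + \<bar>?g y v\<bar> powr \<alpha>)"
      using abs_add_powr_le[OF \<alpha>, of "?g x v" "?g y v"] by (simp add: distrib_right sum.distrib)
  qed (use int in auto)
  also have "\<dots> = 4 * (lmss_form \<alpha> H p s x + lmss_form \<alpha> H p s y)"
    unfolding lmss_form_def using int[of x] int[of y] by simp
  finally show ?thesis .
qed

text \<open>Weighted geometric mean of the bounds \<open>le\<close>: the weights \<open>1 / (h l * (\<Sum>k. 1 / h k))\<close> equalise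
  the exponents over all coordinates.\<close>

lemma prod_powr_le_of_all_le:
  fixes \<delta> h :: "'n::finite \<Rightarrow> real"
  assumes \<delta>: "\<And>l. 0 < \<delta> l \<and> \<delta> l \<le> 1" and h: "\<And>l. 0 < h l" and S: "0 < S" "S \<le> (\<Sum>l\<in>UNIV. 1 / h l)"
    and \<alpha>: "0 < \<alpha>" and le: "\<And>l. \<delta> l powr (\<alpha> * h l) \<le> \<mu>"
  shows "(\<Prod>l\<in>UNIV. \<delta> l) powr (\<alpha> / S) \<le> \<mu>"
proof -
  define S' where "S' = (\<Sum>l\<in>UNIV. 1 / h l)"
  have S': "0 < S'" "S \<le> S'" using S by (auto simp: S'_def)
  have \<mu>: "0 < \<mu>"
  proof -
    have "0 < \<delta> undefined powr (\<alpha> * h undefined)" using \<delta>[of undefined] by simp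
    also have "\<dots> \<le> \<mu>" by (rule le)
    finally show ?thesis .
  qed
  let ?P = "\<Prod>l\<in>UNIV. \<delta> l"
  have "0 < ?P" by (rule prod_pos) (use \<delta> in blast)
  moreover have "?P \<le> 1" by (rule prod_le_1) (use \<delta> less_imp_le in blast)
  ultimately have P: "0 < ?P" "?P \<le> 1" by auto
  have "?P powr (\<alpha> / S) \<le> ?P powr (\<alpha> / S')"
    using P S S' \<alpha> by (intro powr_mono') (auto simp: frac_le)
  also have "\<dots> = (\<Prod>l\<in>UNIV. \<delta> l powr (\<alpha> / S'))" by (rule prod_powr_distrib)
  also have "\<dots> \<le> (\<Prod>l\<in>UNIV. \<mu> powr (1 / (h l * S')))"
  proof (intro prod_mono conjI)
    fix l
    have "\<delta> l powr (\<alpha> / S') = (\<delta> l powr (\<alpha> * h l)) powr (1 / (h l * S'))"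
      using h[of l] S' by (simp add: powr_powr)
    also have "\<dots> \<le> \<mu> powr (1 / (h l * S'))"
      using le[of l] h[of l] S' by (intro powr_mono2) auto
    finally show "\<delta> l powr (\<alpha> / S') \<le> \<mu> powr (1 / (h l * S'))" .
  qed auto
  also have "\<dots> = \<mu> powr (\<Sum>l\<in>UNIV. 1 / (h l * S'))" using \<mu> by (simp add: powr_sum)
  also have "(\<Sum>l\<in>UNIV. 1 / (h l * S')) = S' / S'"
    unfolding S'_def sum_divide_distrib by (intro sum.cong) auto
  finally show ?thesis using S' \<mu> by simp
qed

text \<open>The gaps may differ from coordinate to coordinate because the spacings in different
  coordinates are unrelated; only their product enters. Replacing the sum of the 1/h at
  \<open>s j\<close> by its lower bound S gives one exponent \<open>\<alpha> / S\<close> for all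
  points and removes H from the left-hand side.\<close>

lemma lmss_form_ge:
  fixes H :: "real^'n \<Rightarrow> real^'n" and e T S :: real
  assumes \<alpha>: "0 < \<alpha>" "\<alpha> \<le> 2" and e: "0 < e" and S: "0 < S"
    and H: "\<And>u l. u \<in> nonneg_orthant \<Longrightarrow> 0 < H u $ l \<and> H u $ l < 1"
    and SH: "\<And>u. u \<in> cbox (\<chi> l. e) (\<chi> l. T) \<Longrightarrow> S \<le> (\<Sum>l\<in>UNIV. 1 / H u $ l)"
  shows "\<exists>c>0. \<forall>s x j \<delta>. j < p \<and> (\<forall>i<p. s i \<in> cbox (\<chi> l. e) (\<chi> l. T)) \<and>
    (\<forall>l. 0 < \<delta> l \<and> \<delta> l \<le> 1 \<and> \<delta> l \<le> e / 2) \<and> (\<forall>i<p. i \<noteq> j \<longrightarrow> x i \<noteq> 0 \<longrightarrow> (\<forall>l. \<delta> l \<le> \<bar>s i $ l - s j $ l\<bar>)) \<longrightarrow>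
    c * (\<Prod>l\<in>UNIV. \<delta> l) powr (\<alpha> / S) * \<bar>x j\<bar> powr \<alpha> \<le> lmss_form \<alpha> H p s x"
proof -
  obtain c0 where c0: "c0 > 0" and lb: "\<forall>(H :: real^'n \<Rightarrow> real^'n) s x j l \<delta>. j < p \<and>
    (\<forall>i<p. \<forall>k. e \<le> s i $ k \<and> s i $ k \<le> T \<and> 0 < H (s i) $ k \<and> H (s i) $ k < 1) \<and>
    0 < \<delta> \<and> \<delta> \<le> e / 2 \<and> (\<forall>i<p. i \<noteq> j \<longrightarrow> x i \<noteq> 0 \<longrightarrow> \<delta> \<le> \<bar>s i $ l - s j $ l\<bar>) \<longrightarrow>
    ennreal (c0 * \<bar>x j\<bar> powr \<alpha> * \<delta> powr (\<alpha> * H (s j) $ l)) \<le>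
      (\<integral>\<^sup>+ v. ennreal (\<bar>\<Sum>i<p. x i * lmss_kernel0 \<alpha> H (s i) v\<bar> powr \<alpha>) \<partial>lborel)"
    using nn_integral_lmss_kernel0_sum_ge[OF \<alpha> e, where p = p and T = T] by blast
  define k where "k = lmss_const \<alpha> H"
  have k: "k > 0" unfolding k_def using H by (intro lmss_const_pos[OF \<alpha>]) (auto simp: nonneg_orthant_def)
  define c where "c = k powr \<alpha> * c0"
  have c: "c > 0" using c0 k by (simp add: c_def)
  show ?thesis
  proof (intro exI[of _ c] conjI c allI impI, elim conjE)
    fix s and x :: "nat \<Rightarrow> real" and j and \<delta> :: "'n \<Rightarrow> real"
    assume j: "j < p" and s: "\<forall>i<p. s i \<in> cbox (\<chi> l. e) (\<chi> l. T)"
      and \<delta>: "\<forall>l. 0 < \<delta> l \<and> \<delta> l \<le> 1 \<and> \<delta> l \<le> e / 2"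
      and sep: "\<forall>i<p. i \<noteq> j \<longrightarrow> x i \<noteq> 0 \<longrightarrow> (\<forall>l. \<delta> l \<le> \<bar>s i $ l - s j $ l\<bar>)"
    have sb: "e \<le> s i $ l" "s i $ l \<le> T" if "i < p" for i l
      using s that by (auto simp: mem_box_cart)
    have sn: "s i \<in> nonneg_orthant" if "i < p" for i
      unfolding nonneg_orthant_def using sb(1)[OF that] e by (auto intro: order_trans[OF less_imp_le])
    let ?Q = "lmss_form \<alpha> H p s x"
    have low: "c * \<bar>x j\<bar> powr \<alpha> * \<delta> l powr (\<alpha> * H (s j) $ l) \<le> ?Q" for l
    proof -
      have "ennreal (c * \<bar>x j\<bar> powr \<alpha> * \<delta> l powr (\<alpha> * H (s j) $ l)) =
        ennreal (k powr \<alpha>) * ennreal (c0 * \<bar>x j\<bar> powr \<alpha> * \<delta> l powr (\<alpha> * H (s j) $ l))"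
        using c0 by (simp add: c_def ennreal_mult[symmetric] mult_ac)
      also have "\<dots> \<le> ennreal (k powr \<alpha>) * (\<integral>\<^sup>+ v. ennreal (\<bar>\<Sum>i<p. x i * lmss_kernel0 \<alpha> H (s i) v\<bar> powr \<alpha>) \<partial>lborel)"
        using lb[rule_format, of j s H "\<delta> l" x l] j sb H sn \<delta> sep by (intro mult_left_mono) auto
      also have "\<dots> = (\<integral>\<^sup>+ v. ennreal (k powr \<alpha>) * ennreal (\<bar>\<Sum>i<p. x i * lmss_kernel0 \<alpha> H (s i) v\<bar> powr \<alpha>) \<partial>lborel)"
        by (rule nn_integral_cmult[symmetric]) measurable
      also have "\<dots> = (\<integral>\<^sup>+ v. ennreal (\<bar>\<Sum>i<p. x i * lmss_kernel \<alpha> H (s i) v\<bar> powr \<alpha>) \<partial>lborel)"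
        using k by (intro nn_integral_cong) (simp add: sum_lmss_kernel k_def[symmetric] abs_mult powr_mult ennreal_mult)
      also have "\<dots> = ennreal ?Q" unfolding lmss_form_def
        using H sn sb e by (intro nn_integral_eq_integral integrable_lmss_form[OF \<alpha>]) (auto intro: order_trans[OF less_imp_le])
      finally show ?thesis by (simp add: lmss_form_nonneg)
    qed
    show "c * (\<Prod>l\<in>UNIV. \<delta> l) powr (\<alpha> / S) * \<bar>x j\<bar> powr \<alpha> \<le> ?Q"
    proof (cases "x j = 0")
      case True
      then show ?thesis using lmss_form_nonneg by simp
    next
      case False
      then have pos: "c * \<bar>x j\<bar> powr \<alpha> > 0" using c by simp
      have "(\<Prod>l\<in>UNIV. \<delta> l) powr (\<alpha> / S) \<le> ?Q / (c * \<bar>x j\<bar> powr \<alpha>)"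
        using \<delta> H[OF sn[OF j]] SH s j low pos
        by (intro prod_powr_le_of_all_le[OF _ _ S _ \<alpha>(1), where h = "\<lambda>l. H (s j) $ l"])
          (auto simp: pos_le_divide_eq mult.commute mult.left_commute)
      then show ?thesis using pos by (simp add: pos_le_divide_eq mult_ac)
    qed
  qed
qed

section \<open>Integrals over frequencies\<close>

text \<open>Gram--Schmidt for a quasi-norm: \<open>z\<close> is an almost minimiser of \<open>Q\<close> among the vectors with last
  coordinate \<open>1\<close>, and subtracting \<open>x p * z\<close> from \<open>x\<close> costs only a constant factor.\<close>

lemma triangular_lower_bound:
  fixes Q :: "(nat \<Rightarrow> real) \<Rightarrow> real"
  assumes nonneg: "\<And>x. 0 \<le> Q x"
    and homog: "\<And>t x. Q (\<lambda>i. t * x i) = \<bar>t\<bar> powr \<alpha> * Q x"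
    and quasi: "\<And>x y. Q (\<lambda>i. x i + y i) \<le> 4 * (Q x + Q y)"
  shows "(\<And>j x. j < p \<Longrightarrow> (\<forall>i>j. x i = 0) \<Longrightarrow> D j * \<bar>x j\<bar> powr \<alpha> \<le> Q x) \<Longrightarrow> (\<And>j. j < p \<Longrightarrow> 0 < D j) \<Longrightarrow>
    \<exists>C. \<forall>x. (\<forall>i\<ge>p. x i = 0) \<longrightarrow>
      (1/24) ^ p * (\<Sum>j<p. D j * \<bar>x j + (\<Sum>i\<in>{j<..<p}. C j i * x i)\<bar> powr \<alpha>) \<le> Q x"
proof (induction p)
  case 0
  then show ?case using nonneg by simp
next
  case (Suc p)
  obtain C where C: "\<And>x. (\<forall>i\<ge>p. x i = 0) \<Longrightarrow>
      (1/24) ^ p * (\<Sum>j<p. D j * \<bar>x j + (\<Sum>i\<in>{j<..<p}. C j i * x i)\<bar> powr \<alpha>) \<le> Q x"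
    using Suc.IH Suc.prems by auto
  let ?S = "Q ` {z. z p = 1 \<and> (\<forall>i>p. z i = 0)}"
  define m where "m = Inf ?S"
  have ne: "?S \<noteq> {}" by (auto intro!: exI[of _ "\<lambda>i. if i = p then 1 else 0"])
  have lb: "D p \<le> q" if q: "q \<in> ?S" for q
  proof -
    obtain x where "q = Q x" "x p = 1" "\<forall>i>p. x i = 0" using q by auto
    then show ?thesis using Suc.prems(1)[of p x] by simp
  qed
  have bdd: "bdd_below ?S" using lb by (rule bdd_belowI)
  have Dm: "D p \<le> m" unfolding m_def using ne lb by (rule cInf_greatest)
  have mpos: "0 < m" using Dm Suc.prems(2)[of p] by simp
  \<comment> \<open>The infimum need not be attained, but it is at least \<open>D p > 0\<close>, so
    some z comes within a factor 2 of it.\<close>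
  have "\<exists>q\<in>?S. q < 2 * m"
    using cInf_lessD[OF ne, of "2 * m"] mpos by (auto simp: m_def)
  then obtain z where z: "z p = 1" "\<forall>i>p. z i = 0" "Q z < 2 * m" by auto
  \<comment> \<open>Forced by the identity \<open>eq\<close>: the linear forms of x with
    coefficients C' are those of \<open>y = x - x p * z\<close> with coefficients C.\<close>
  define C' where "C' j i = (if i = p then - z j - (\<Sum>i\<in>{j<..<p}. C j i * z i) else C j i)" for j i
  show ?case
  proof (intro exI[of _ C'] allI impI)
    fix x :: "nat \<Rightarrow> real" assume x: "\<forall>i\<ge>Suc p. x i = 0"
    define t where "t = x p"
    have 1: "m * \<bar>t\<bar> powr \<alpha> \<le> Q x"
    proof (cases "t = 0")
      case False
      have "m \<le> Q (\<lambda>i. inverse t * x i)"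
        unfolding m_def using False x bdd by (intro cInf_lower imageI) (auto simp: t_def)
      then have "m * \<bar>t\<bar> powr \<alpha> \<le> \<bar>inverse t\<bar> powr \<alpha> * Q x * \<bar>t\<bar> powr \<alpha>"
        unfolding homog by (intro mult_right_mono) auto
      also have "\<dots> = (\<bar>inverse t\<bar> * \<bar>t\<bar>) powr \<alpha> * Q x" by (simp add: powr_mult)
      also have "\<dots> = Q x" using False by (simp add: abs_mult[symmetric])
      finally show ?thesis .
    qed (simp add: nonneg)
    define y where "y i = x i + (- t) * z i" for i
    have y0: "\<forall>i\<ge>p. y i = 0"
    proof (intro allI impI)
      fix i assume "p \<le> i"
      then have "i = p \<or> Suc p \<le> i" by auto
      then show "y i = 0" using x z by (auto simp: y_def t_def)
    qed
    have "Q y \<le> 4 * (Q x + \<bar>t\<bar> powr \<alpha> * Q z)"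
      unfolding y_def using quasi[of x "\<lambda>i. (- t) * z i"] unfolding homog by simp
    also have "\<dots> \<le> 4 * (Q x + \<bar>t\<bar> powr \<alpha> * (2 * m))" using z by (intro mult_left_mono add_left_mono) auto
    also have "\<dots> \<le> 12 * Q x" using 1 by (simp add: mult_ac)
    finally have 2: "Q y \<le> 12 * Q x" .
    have eq: "y j + (\<Sum>i\<in>{j<..<p}. C j i * y i) = x j + (\<Sum>i\<in>{j<..<Suc p}. C' j i * x i)" if "j < p" for j
    proof -
      have "{j<..<Suc p} = insert p {j<..<p}" using that by auto
      then have "(\<Sum>i\<in>{j<..<Suc p}. C' j i * x i) = C' j p * t + (\<Sum>i\<in>{j<..<p}. C' j i * x i)"
        by (simp add: t_def)
      also have "(\<Sum>i\<in>{j<..<p}. C' j i * x i) = (\<Sum>i\<in>{j<..<p}. C j i * x i)"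
        by (intro sum.cong) (auto simp: C'_def)
      finally show ?thesis
        by (simp add: C'_def y_def algebra_simps sum.distrib sum_distrib_left sum_distrib_right sum_subtractf)
    qed
    have "(\<Sum>j<Suc p. D j * \<bar>x j + (\<Sum>i\<in>{j<..<Suc p}. C' j i * x i)\<bar> powr \<alpha>) =
      (\<Sum>j<p. D j * \<bar>y j + (\<Sum>i\<in>{j<..<p}. C j i * y i)\<bar> powr \<alpha>) + D p * \<bar>t\<bar> powr \<alpha>"
    proof -
      have "{p<..<Suc p} = {}" by auto
      then show ?thesis using eq by (simp add: t_def)
    qed
    then have "(1/24) ^ Suc p * (\<Sum>j<Suc p. D j * \<bar>x j + (\<Sum>i\<in>{j<..<Suc p}. C' j i * x i)\<bar> powr \<alpha>) =
      1/24 * ((1/24) ^ p * (\<Sum>j<p. D j * \<bar>y j + (\<Sum>i\<in>{j<..<p}. C j i * y i)\<bar> powr \<alpha>))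
       + (1/24) ^ Suc p * (D p * \<bar>t\<bar> powr \<alpha>)"
      by (simp add: algebra_simps)
    \<comment> \<open>The 12 is 4 * (1 + 2), from the quasi-triangle inequality and the factor 2 of
      the almost minimiser; 24 leaves half of \<open>Q x\<close> for the last coordinate.\<close>
    also have "\<dots> \<le> 1/24 * (12 * Q x) + 1 / 24 * Q x"
    proof (intro add_mono mult_left_mono)
      show "(1/24) ^ p * (\<Sum>j<p. D j * \<bar>y j + (\<Sum>i\<in>{j<..<p}. C j i * y i)\<bar> powr \<alpha>) \<le> 12 * Q x"
        using C[OF y0] 2 by linarith
      have "D p * \<bar>t\<bar> powr \<alpha> \<le> m * \<bar>t\<bar> powr \<alpha>" using Dm by (intro mult_right_mono) auto
      then have "D p * \<bar>t\<bar> powr \<alpha> \<le> Q x" using 1 by linarith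
      moreover have "(1/24::real) ^ Suc p \<le> 1 / 24" by (simp add: power_le_one)
      ultimately show "(1/24) ^ Suc p * (D p * \<bar>t\<bar> powr \<alpha>) \<le> 1 / 24 * Q x"
        using nonneg[of x] Suc.prems(2)[of p] by (intro mult_mono) auto
    qed auto
    also have "\<dots> \<le> Q x" using nonneg[of x] by simp
    finally show "(1/24) ^ Suc p * (\<Sum>j<Suc p. D j * \<bar>x j + (\<Sum>i\<in>{j<..<Suc p}. C' j i * x i)\<bar> powr \<alpha>) \<le> Q x" .
  qed
qed

section \<open>Product measures over the frequencies\<close>

abbreviation coord_measure :: "('d::finite \<Rightarrow> real) measure" where
  "coord_measure \<equiv> PiM UNIV (\<lambda>_. lborel)"

lemma product_sigma_finite_lborel: "product_sigma_finite (\<lambda>_. lborel :: 'a::euclidean_space measure)"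
  by (rule product_sigma_finite.intro) (rule sigma_finite_lborel)

lemma sigma_finite_coord_measure: "sigma_finite_measure (coord_measure :: ('d::finite \<Rightarrow> real) measure)"
proof -
  interpret product_sigma_finite "\<lambda>_::'d. lborel :: real measure" by (rule product_sigma_finite_lborel)
  show ?thesis by (rule sigma_finite) simp
qed

lemma product_sigma_finite_coord: "product_sigma_finite (\<lambda>_. coord_measure :: ('d::finite \<Rightarrow> real) measure)"
  by (rule product_sigma_finite.intro) (rule sigma_finite_coord_measure)

text \<open>The substitution is unipotent, so its Jacobian is 1. The form with index j involves only
  indices from j on, hence the least index n occurs in one factor only and \<open>\<xi> n\<close>
  can be integrated out by translation invariance with the later variables held fixed.\<close>

lemma nn_integral_triangular:
  fixes f :: "nat \<Rightarrow> real \<Rightarrow> ennreal"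
  assumes [measurable]: "\<And>j. f j \<in> borel_measurable borel"
  shows "n \<le> p \<Longrightarrow> (\<integral>\<^sup>+ \<xi>. (\<Prod>j\<in>{n..<p}. \<Prod>k\<in>UNIV. f j (\<xi> j k + (\<Sum>i\<in>{j<..<p}. C j i * \<xi> i k)))
      \<partial>PiM {n..<p} (\<lambda>_. coord_measure :: ('d::finite \<Rightarrow> real) measure)) =
    (\<Prod>j\<in>{n..<p}. (\<integral>\<^sup>+ r. f j r \<partial>lborel) ^ CARD('d))"
proof (induction n rule: inc_induct)
  case base
  interpret product_sigma_finite "\<lambda>_::nat. coord_measure :: ('d \<Rightarrow> real) measure"
    by (rule product_sigma_finite_coord)
  show ?case by (simp add: PiM_empty nn_integral_count_space_finite)
next
  case (step n)
  interpret c: product_sigma_finite "\<lambda>_::'d. lborel :: real measure" by (rule product_sigma_finite_lborel)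
  interpret product_sigma_finite "\<lambda>_::nat. coord_measure :: ('d \<Rightarrow> real) measure"
    by (rule product_sigma_finite_coord)
  let ?g = "\<lambda>(\<xi> :: nat \<Rightarrow> 'd \<Rightarrow> real) j k. f j (\<xi> j k + (\<Sum>i\<in>{j<..<p}. C j i * \<xi> i k))"
  have ins: "{n..<p} = insert n {Suc n..<p}" using step by auto
  have comp: "(\<lambda>\<xi>. \<xi> j k) \<in> borel_measurable (PiM {n..<p} (\<lambda>_. coord_measure :: ('d \<Rightarrow> real) measure))"
    if "j \<in> {n..<p}" for j k
    using measurable_compose[OF measurable_component_singleton[OF that, of "\<lambda>_. coord_measure :: ('d \<Rightarrow> real) measure"]
        measurable_component_singleton[of k UNIV "\<lambda>_. lborel"]] by simp
  have "(\<lambda>\<xi>. \<Prod>j\<in>{n..<p}. \<Prod>k\<in>UNIV. ?g \<xi> j k) \<in> borel_measurable (PiM {n..<p} (\<lambda>_. coord_measure :: ('d \<Rightarrow> real) measure))"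
    by (intro borel_measurable_prod_ennreal measurable_compose[OF _ assms] borel_measurable_add borel_measurable_sum
        borel_measurable_times borel_measurable_const comp) auto
  then have "(\<integral>\<^sup>+ \<xi>. (\<Prod>j\<in>{n..<p}. \<Prod>k\<in>UNIV. ?g \<xi> j k) \<partial>PiM {n..<p} (\<lambda>_. coord_measure :: ('d \<Rightarrow> real) measure)) =
    (\<integral>\<^sup>+ x. \<integral>\<^sup>+ y. (\<Prod>j\<in>{n..<p}. \<Prod>k\<in>UNIV. ?g (x(n := y)) j k) \<partial>coord_measure \<partial>PiM {Suc n..<p} (\<lambda>_. coord_measure))"
    unfolding ins by (intro product_nn_integral_insert) auto
  also have "\<dots> = (\<integral>\<^sup>+ x. (\<Prod>j\<in>{Suc n..<p}. \<Prod>k\<in>UNIV. ?g x j k) * (\<integral>\<^sup>+ r. f n r \<partial>lborel) ^ CARD('d) \<partial>PiM {Suc n..<p} (\<lambda>_. coord_measure))"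
  proof (intro nn_integral_cong)
    fix x :: "nat \<Rightarrow> 'd \<Rightarrow> real"
    define c where "c k = (\<Sum>i\<in>{n<..<p}. C n i * x i k)" for k
    have "(\<Prod>j\<in>{n..<p}. \<Prod>k\<in>UNIV. ?g (x(n := y)) j k) = (\<Prod>j\<in>{Suc n..<p}. \<Prod>k\<in>UNIV. ?g x j k) * (\<Prod>k\<in>UNIV. f n (c k + y k))" for y
    proof -
      have "(\<Prod>j\<in>{n..<p}. \<Prod>k\<in>UNIV. ?g (x(n := y)) j k) = (\<Prod>k\<in>UNIV. ?g (x(n := y)) n k) * (\<Prod>j\<in>{Suc n..<p}. \<Prod>k\<in>UNIV. ?g (x(n := y)) j k)"
        unfolding ins by (subst prod.insert) auto
      also have "(\<Prod>k\<in>UNIV. ?g (x(n := y)) n k) = (\<Prod>k\<in>UNIV. f n (c k + y k))"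
      proof (intro prod.cong refl)
        fix k
        have "(\<Sum>i\<in>{n<..<p}. C n i * (x(n := y)) i k) = c k" unfolding c_def by (intro sum.cong) auto
        then show "?g (x(n := y)) n k = f n (c k + y k)" by (simp add: add.commute)
      qed
      also have "(\<Prod>j\<in>{Suc n..<p}. \<Prod>k\<in>UNIV. ?g (x(n := y)) j k) = (\<Prod>j\<in>{Suc n..<p}. \<Prod>k\<in>UNIV. ?g x j k)"
      proof (intro prod.cong refl)
        fix j k assume j: "j \<in> {Suc n..<p}"
        have "(\<Sum>i\<in>{j<..<p}. C j i * (x(n := y)) i k) = (\<Sum>i\<in>{j<..<p}. C j i * x i k)"
          using j by (intro sum.cong) auto
        then show "?g (x(n := y)) j k = ?g x j k" using j by auto
      qed
      finally show ?thesis by (simp add: mult.commute)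
    qed
    then have "(\<integral>\<^sup>+ y. (\<Prod>j\<in>{n..<p}. \<Prod>k\<in>UNIV. ?g (x(n := y)) j k) \<partial>coord_measure) =
      (\<Prod>j\<in>{Suc n..<p}. \<Prod>k\<in>UNIV. ?g x j k) * (\<integral>\<^sup>+ y. (\<Prod>k\<in>UNIV. f n (c k + y k)) \<partial>coord_measure)"
      by (simp add: nn_integral_cmult)
    also have "(\<integral>\<^sup>+ y. (\<Prod>k\<in>UNIV. f n (c k + y k)) \<partial>coord_measure) = (\<Prod>k\<in>(UNIV::'d set). \<integral>\<^sup>+ r. f n (c k + r) \<partial>lborel)"
      by (rule c.product_nn_integral_prod) auto
    also have "\<dots> = (\<Prod>k\<in>(UNIV::'d set). \<integral>\<^sup>+ r. f n r \<partial>lborel)"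
      by (intro prod.cong refl) (subst nn_integral_real_affine[where c = 1 and f = "f n"], auto)
    finally show "(\<integral>\<^sup>+ y. (\<Prod>j\<in>{n..<p}. \<Prod>k\<in>UNIV. ?g (x(n := y)) j k) \<partial>coord_measure) =
      (\<Prod>j\<in>{Suc n..<p}. \<Prod>k\<in>UNIV. ?g x j k) * (\<integral>\<^sup>+ r. f n r \<partial>lborel) ^ CARD('d)" by simp
  qed
  also have "\<dots> = (\<integral>\<^sup>+ x. (\<Prod>j\<in>{Suc n..<p}. \<Prod>k\<in>UNIV. ?g x j k) \<partial>PiM {Suc n..<p} (\<lambda>_. coord_measure)) * (\<integral>\<^sup>+ r. f n r \<partial>lborel) ^ CARD('d)"
  proof (rule nn_integral_multc)
    have comp': "(\<lambda>\<xi>. \<xi> j k) \<in> borel_measurable (PiM {Suc n..<p} (\<lambda>_. coord_measure :: ('d \<Rightarrow> real) measure))"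
      if "j \<in> {Suc n..<p}" for j k
      using measurable_compose[OF measurable_component_singleton[OF that, of "\<lambda>_. coord_measure :: ('d \<Rightarrow> real) measure"]
        measurable_component_singleton[of k UNIV "\<lambda>_. lborel"]] by simp
    show "(\<lambda>\<xi>. \<Prod>j\<in>{Suc n..<p}. \<Prod>k\<in>UNIV. ?g \<xi> j k) \<in> borel_measurable (PiM {Suc n..<p} (\<lambda>_. coord_measure :: ('d \<Rightarrow> real) measure))"
      by (intro borel_measurable_prod_ennreal measurable_compose[OF _ assms] borel_measurable_add borel_measurable_sum
        borel_measurable_times borel_measurable_const comp') auto
  qed
  also have "\<dots> = (\<Prod>j\<in>{n..<p}. (\<integral>\<^sup>+ r. f j r \<partial>lborel) ^ CARD('d))"
    unfolding ins step.IH by (subst prod.insert) (auto simp: mult.commute)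
  finally show ?case .
qed

section \<open>Frequency weights against the exponential\<close>

lemma powr_exp_bounded:
  fixes c \<alpha> m :: real
  assumes "c > 0" "\<alpha> > 0" "m \<ge> 0"
  shows "\<exists>K>0. \<forall>q\<ge>0. (1 + (q / c) powr (1 / \<alpha>)) powr m \<le> K * exp (q / 2)"
proof -
  define n where "n = nat \<lceil>m / \<alpha>\<rceil> + 1"
  let ?f = "\<lambda>q. (1 + (q / c) powr (1 / \<alpha>)) powr m * exp (- q / 2)"
  have lim: "(?f \<longlongrightarrow> 0) at_top"
  proof -
    define a where "a = 1 / \<alpha>"
    have "a > 0" using assms by (simp add: a_def)
    then have "((\<lambda>q. (1 + (q / c) powr a) powr m * exp (- q / 2)) \<longlongrightarrow> 0) at_top"
      using assms by real_asymp
    then show ?thesis by (simp add: a_def)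
  qed
  have "eventually (\<lambda>q. ?f q < 1) at_top" using lim by (rule order_tendstoD) simp
  then obtain b where b: "\<And>q. q \<ge> b \<Longrightarrow> ?f q < 1" by (auto simp: eventually_at_top_linorder)
  define b' where "b' = max b 0"
  have "continuous_on {0..b'} ?f"
    using assms by (intro continuous_on_mult continuous_on_powr' continuous_on_add continuous_on_divide
        continuous_on_const continuous_on_exp continuous_on_minus continuous_on_id ballI) (auto simp: add_nonneg_eq_0_iff)
  then have "compact (?f ` {0..b'})" by (rule compact_continuous_image) simp
  then obtain K where K: "\<And>q. q \<in> {0..b'} \<Longrightarrow> ?f q \<le> K"
    by (metis (no_types, lifting) bounded_imp_bdd_above bdd_above.E compact_imp_bounded imageI)
  have bd: "?f q \<le> max 1 K" if "q \<ge> 0" for q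
  proof (cases "q \<le> b'")
    case True
    then show ?thesis using K[of q] that by simp
  next
    case False
    then have "q \<ge> b" by (simp add: b'_def)
    then show ?thesis using b[of q] by linarith
  qed
  show ?thesis
  proof (intro exI[of _ "max 1 K"] conjI allI impI)
    fix q :: real assume "q \<ge> 0"
    then have "?f q * exp (q / 2) \<le> max 1 K * exp (q / 2)" using bd by (intro mult_right_mono) auto
    then show "(1 + (q / c) powr (1 / \<alpha>)) powr m \<le> max 1 K * exp (q / 2)"
      by (simp add: mult.assoc exp_minus)
  qed auto
qed

lemma nn_integral_exp_abs_powr:
  fixes c \<alpha> :: real
  assumes c: "c > 0" and \<alpha>: "\<alpha> > 0"
  shows "(\<integral>\<^sup>+ r. ennreal (exp (- c * \<bar>r\<bar> powr \<alpha>)) \<partial>lborel) < \<infinity>"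
proof -
  have "((\<lambda>r. exp (- c * r powr \<alpha>) * r powr 2) \<longlongrightarrow> 0) at_top" using assms by real_asymp
  then have "eventually (\<lambda>r. exp (- c * r powr \<alpha>) * r powr 2 < 1) at_top" by (rule order_tendstoD) simp
  then obtain b0 where b0: "\<And>r. r \<ge> b0 \<Longrightarrow> exp (- c * r powr \<alpha>) * r powr 2 < 1" by (auto simp: eventually_at_top_linorder)
  define b where "b = max b0 1"
  have b: "exp (- c * r powr \<alpha>) \<le> r powr - 2" if "r \<ge> b" for r
    using b0[of r] that by (simp add: b_def powr_minus field_simps)
  define g where "g r = indicator {-b..b} r + ennreal (r powr - 2) * indicator {1..} r + ennreal ((- r) powr - 2) * indicator {1..} (- r)" for r :: real
  have top: "(\<integral>\<^sup>+ x. ennreal (x powr - 2) * indicator {1..} x \<partial>lborel) < \<infinity>"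
    by (rule nn_integral_powr_at_top) simp
  have "ennreal (exp (- c * \<bar>r\<bar> powr \<alpha>)) \<le> g r" for r
  proof (cases "\<bar>r\<bar> \<le> b")
    case True
    have "ennreal (exp (- c * \<bar>r\<bar> powr \<alpha>)) \<le> 1" using c by (simp add: ennreal_le_1)
    moreover have "(1::ennreal) \<le> g r" using True unfolding g_def
      by (auto simp: indicator_def intro!: add_increasing2)
    ultimately show ?thesis by (rule order_trans)
  next
    case False
    then have "ennreal (exp (- c * \<bar>r\<bar> powr \<alpha>)) \<le> ennreal (\<bar>r\<bar> powr - 2)" using b[of "\<bar>r\<bar>"] by (intro ennreal_leI) auto
    also have "\<dots> \<le> g r" using False unfolding g_def b_def by (cases "r \<ge> 0") (auto simp: indicator_def)
    finally show ?thesis .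
  qed
  then have "(\<integral>\<^sup>+ r. ennreal (exp (- c * \<bar>r\<bar> powr \<alpha>)) \<partial>lborel) \<le> (\<integral>\<^sup>+ r. g r \<partial>lborel)"
    by (intro nn_integral_mono) auto
  also have "\<dots> = (\<integral>\<^sup>+ r. indicator {-b..b} r \<partial>lborel) + (\<integral>\<^sup>+ x. ennreal (x powr - 2) * indicator {1..} x \<partial>lborel)
     + (\<integral>\<^sup>+ r. ennreal ((- r) powr - 2) * indicator {1..} (- r) \<partial>lborel)"
    unfolding g_def by (subst nn_integral_add; (subst nn_integral_add)?) auto
  also have "(\<integral>\<^sup>+ r. ennreal ((- r) powr - 2) * indicator {1..} (- r) \<partial>lborel) = (\<integral>\<^sup>+ x. ennreal (x powr - 2) * indicator {1..} x \<partial>lborel)"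
    using nn_integral_real_affine[of "\<lambda>x. ennreal (x powr - 2) * indicator {1..} x" "-1" 0] by simp
  also have "(\<integral>\<^sup>+ r. indicator {-b..b} r \<partial>lborel) + (\<integral>\<^sup>+ x. ennreal (x powr - 2) * indicator {1..} x \<partial>lborel)
     + (\<integral>\<^sup>+ x. ennreal (x powr - 2) * indicator {1..} x \<partial>lborel) < \<infinity>"
    using top by (simp add: b_def)
  finally show ?thesis .
qed

lemma nn_integral_exp_abs_powr_scale:
  fixes c \<alpha> d :: real
  assumes d: "d > 0"
  shows "(\<integral>\<^sup>+ r. ennreal (exp (- c * (d * \<bar>r\<bar>) powr \<alpha>)) \<partial>lborel) =
    ennreal (1 / d) * (\<integral>\<^sup>+ r. ennreal (exp (- c * \<bar>r\<bar> powr \<alpha>)) \<partial>lborel)"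
  using nn_integral_real_affine[of "\<lambda>r. ennreal (exp (- c * (d * \<bar>r\<bar>) powr \<alpha>))" "1 / d" 0] d
  by (simp add: abs_mult)

text \<open>Since \<open>\<bar>x j\<bar> \<le> (Q / c) powr (1 / \<alpha>) / da j\<close>, all
  weights together are bounded by a power of Q, up to a constant shift, times powers of da. Half of
  the exponential absorbs the growth in Q, the other half is left for the integration.\<close>

lemma prod_weight_exp_le:
  fixes p :: nat and \<alpha> c \<gamma> :: real
  assumes \<alpha>: "\<alpha> > 0" and c: "c > 0" and \<gamma>: "\<gamma> \<ge> 0"
  shows "\<exists>K>0. \<forall>Q x da. (\<forall>j<p. 0 < da j \<and> da j \<le> 1) \<and> 0 \<le> Q \<and> (\<forall>j<p. c * (da j * \<bar>x j\<bar>) powr \<alpha> \<le> Q) \<longrightarrow>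
    (\<Prod>j<p. (1 + \<bar>x j\<bar>) powr \<gamma>) * exp (- Q) \<le> K * (\<Prod>j<p. da j powr (- \<gamma>)) * exp (- Q / 2)"
proof -
  obtain K where K: "K > 0" "\<And>q. q \<ge> 0 \<Longrightarrow> (1 + (q / c) powr (1 / \<alpha>)) powr (real p * \<gamma>) \<le> K * exp (q / 2)"
    using powr_exp_bounded[OF c \<alpha>, of "real p * \<gamma>"] \<gamma> by auto
  show ?thesis
  proof (intro exI[of _ K] conjI K(1) allI impI, elim conjE)
    fix Q and x da :: "nat \<Rightarrow> real"
    assume da: "\<forall>j<p. 0 < da j \<and> da j \<le> 1" and Q: "0 \<le> Q" "\<forall>j<p. c * (da j * \<bar>x j\<bar>) powr \<alpha> \<le> Q"
    define q where "q = (Q / c) powr (1 / \<alpha>)"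
    have q0: "q \<ge> 0" by (simp add: q_def)
    have each: "(1 + \<bar>x j\<bar>) powr \<gamma> \<le> da j powr (- \<gamma>) * (1 + q) powr \<gamma>" if j: "j < p" for j
    proof -
      have d: "0 < da j" "da j \<le> 1" using da j by auto
      have "(da j * \<bar>x j\<bar>) powr \<alpha> \<le> Q / c" using Q(2) j c by (simp add: pos_le_divide_eq mult.commute)
      then have "((da j * \<bar>x j\<bar>) powr \<alpha>) powr (1 / \<alpha>) \<le> q" unfolding q_def using \<alpha> by (intro powr_mono2) auto
      then have "da j * \<bar>x j\<bar> \<le> q" using d \<alpha> by (simp add: powr_powr)
      then have "da j * (1 + \<bar>x j\<bar>) \<le> 1 + q" using d by (simp add: algebra_simps)
      then have "1 + \<bar>x j\<bar> \<le> inverse (da j) * (1 + q)" using d by (simp add: field_simps)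
      then have "(1 + \<bar>x j\<bar>) powr \<gamma> \<le> (inverse (da j) * (1 + q)) powr \<gamma>" using \<gamma> by (intro powr_mono2) auto
      also have "\<dots> = da j powr (- \<gamma>) * (1 + q) powr \<gamma>" using d q0 by (simp add: powr_mult powr_minus inverse_powr)
      finally show ?thesis .
    qed
    have "(\<Prod>j<p. (1 + \<bar>x j\<bar>) powr \<gamma>) \<le> (\<Prod>j<p. da j powr (- \<gamma>) * (1 + q) powr \<gamma>)"
      using each by (intro prod_mono) auto
    also have "\<dots> = (\<Prod>j<p. da j powr (- \<gamma>)) * (1 + q) powr (real p * \<gamma>)"
      using q0 by (simp add: prod.distrib powr_powr[symmetric] powr_realpow mult.commute)
    also have "\<dots> \<le> (\<Prod>j<p. da j powr (- \<gamma>)) * (K * exp (Q / 2))"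
      unfolding q_def using K(2)[OF Q(1)] by (intro mult_left_mono prod_nonneg) auto
    finally have "(\<Prod>j<p. (1 + \<bar>x j\<bar>) powr \<gamma>) * exp (- Q) \<le> (\<Prod>j<p. da j powr (- \<gamma>)) * (K * exp (Q / 2)) * exp (- Q)"
      by (intro mult_right_mono) auto
    also have "\<dots> = K * (\<Prod>j<p. da j powr (- \<gamma>)) * (exp (Q / 2) * exp (- Q))" by (simp add: mult_ac)
    also have "exp (Q / 2) * exp (- Q) = exp (- Q / 2)" by (simp add: exp_add[symmetric])
    finally show "(\<Prod>j<p. (1 + \<bar>x j\<bar>) powr \<gamma>) * exp (- Q) \<le> K * (\<Prod>j<p. da j powr (- \<gamma>)) * exp (- Q / 2)" .
  qed
qed

text \<open>Two kinds of lower bounds enter. dp compares an index with the earlier ones only and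
  feeds the triangular bound, which gives a factor \<open>1 / dp j\<close> per component; da
  compares it with all others and controls the weights. Q must ignore the indices from p on because
  points of the product space are \<open>undefined\<close> there.\<close>

lemma frequency_integral_le:
  fixes \<alpha> c \<gamma> :: real and p :: nat
  assumes \<alpha>: "\<alpha> > 0" and c: "c > 0" and \<gamma>: "\<gamma> \<ge> 0"
  shows "\<exists>K>0. \<forall>(Q :: (nat \<Rightarrow> real) \<Rightarrow> real) dp da.
    (\<forall>x. 0 \<le> Q x) \<and> (\<forall>t x. Q (\<lambda>i. t * x i) = \<bar>t\<bar> powr \<alpha> * Q x) \<and> (\<forall>x y. Q (\<lambda>i. x i + y i) \<le> 4 * (Q x + Q y)) \<and>
    (\<forall>x. Q (\<lambda>i. if i < p then x i else 0) = Q x) \<and> (\<forall>j<p. 0 < dp j) \<and> (\<forall>j<p. 0 < da j \<and> da j \<le> 1) \<and>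
    (\<forall>j<p. \<forall>x. (\<forall>i>j. x i = 0) \<longrightarrow> c * (dp j * \<bar>x j\<bar>) powr \<alpha> \<le> Q x) \<and>
    (\<forall>j<p. \<forall>x. c * (da j * \<bar>x j\<bar>) powr \<alpha> \<le> Q x) \<longrightarrow>
    (\<integral>\<^sup>+ \<xi>. ennreal (\<Prod>k\<in>UNIV. (\<Prod>j<p. (1 + \<bar>\<xi> j k\<bar>) powr \<gamma>) * exp (- Q (\<lambda>j. \<xi> j k)))
      \<partial>PiM {..<p} (\<lambda>_. coord_measure :: ('d::finite \<Rightarrow> real) measure)) \<le>
    ennreal (K * (\<Prod>j<p. (1 / dp j) ^ CARD('d) * da j powr (- \<gamma> * CARD('d))))"
proof -
  let ?d = "CARD('d)"
  obtain K1 where K1: "K1 > 0" and w: "\<And>Q x da. (\<forall>j<p. 0 < da j \<and> da j \<le> 1) \<Longrightarrow> 0 \<le> Q \<Longrightarrow> (\<forall>j<p. c * (da j * \<bar>x j\<bar>) powr \<alpha> \<le> Q) \<Longrightarrow>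
    (\<Prod>j<p. (1 + \<bar>x j\<bar>) powr \<gamma>) * exp (- Q) \<le> K1 * (\<Prod>j<p. da j powr (- \<gamma>)) * exp (- Q / 2)"
    using prod_weight_exp_le[OF \<alpha> c \<gamma>, of p] by blast
  \<comment> \<open>The 2 stands for the half of the exponential that remains after the weights,
    \<open>(1/24) ^ p\<close> for the loss in the triangular bound.\<close>
  define c' where "c' = c * (1/24) ^ p / 2"
  have c': "c' > 0" using c by (simp add: c'_def)
  obtain G where G: "G \<ge> 0" "(\<integral>\<^sup>+ r. ennreal (exp (- c' * \<bar>r\<bar> powr \<alpha>)) \<partial>lborel) = ennreal G"
    using nn_integral_exp_abs_powr[OF c' \<alpha>] by (auto simp: less_top_ennreal)
  define K where "K = K1 ^ ?d * (max 1 G) ^ (?d * p)"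
  have K: "K > 0" using K1 by (simp add: K_def)
  show ?thesis
  proof (intro exI[of _ K] conjI K allI impI, elim conjE)
    fix Q :: "(nat \<Rightarrow> real) \<Rightarrow> real" and dp da :: "nat \<Rightarrow> real"
    assume Q: "\<forall>x. 0 \<le> Q x" "\<forall>t x. Q (\<lambda>i. t * x i) = \<bar>t\<bar> powr \<alpha> * Q x" "\<forall>x y. Q (\<lambda>i. x i + y i) \<le> 4 * (Q x + Q y)"
      and Qp: "\<forall>x. Q (\<lambda>i. if i < p then x i else 0) = Q x"
      and dp: "\<forall>j<p. 0 < dp j" and da: "\<forall>j<p. 0 < da j \<and> da j \<le> 1"
      and low: "\<forall>j<p. \<forall>x. (\<forall>i>j. x i = 0) \<longrightarrow> c * (dp j * \<bar>x j\<bar>) powr \<alpha> \<le> Q x"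
      and low': "\<forall>j<p. \<forall>x. c * (da j * \<bar>x j\<bar>) powr \<alpha> \<le> Q x"
    obtain C where C: "\<And>x. (\<forall>i\<ge>p. x i = 0) \<Longrightarrow>
      (1/24) ^ p * (\<Sum>j<p. (c * dp j powr \<alpha>) * \<bar>x j + (\<Sum>i\<in>{j<..<p}. C j i * x i)\<bar> powr \<alpha>) \<le> Q x"
    proof -
      have "\<exists>C. \<forall>x. (\<forall>i\<ge>p. x i = 0) \<longrightarrow>
        (1/24) ^ p * (\<Sum>j<p. (c * dp j powr \<alpha>) * \<bar>x j + (\<Sum>i\<in>{j<..<p}. C j i * x i)\<bar> powr \<alpha>) \<le> Q x"
      proof (rule triangular_lower_bound)
        show "c * dp j powr \<alpha> * \<bar>x j\<bar> powr \<alpha> \<le> Q x" if "j < p" "\<forall>i>j. x i = 0" for j x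
          using low that dp by (auto simp: powr_mult less_imp_le mult.assoc)
        show "0 < c * dp j powr \<alpha>" if "j < p" for j using c dp that by auto
      qed (use Q in auto)
      then show thesis using that by blast
    qed
    let ?L = "\<lambda>(\<xi> :: nat \<Rightarrow> 'd \<Rightarrow> real) j k. \<xi> j k + (\<Sum>i\<in>{j<..<p}. C j i * \<xi> i k)"
    define E where "E j r = ennreal (exp (- c' * (dp j * \<bar>r\<bar>) powr \<alpha>))" for j r
    have Em [measurable]: "E j \<in> borel_measurable borel" for j unfolding E_def by measurable
    have expQ: "exp (- Q x / 2) \<le> (\<Prod>j<p. exp (- c' * (dp j * \<bar>x j + (\<Sum>i\<in>{j<..<p}. C j i * x i)\<bar>) powr \<alpha>))" for x
    proof -
      let ?x = "\<lambda>i. if i < p then x i else 0"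
      have "(1/24) ^ p * (\<Sum>j<p. (c * dp j powr \<alpha>) * \<bar>?x j + (\<Sum>i\<in>{j<..<p}. C j i * ?x i)\<bar> powr \<alpha>) \<le> Q x"
        using C[of ?x] Qp by simp
      also have "(\<Sum>j<p. (c * dp j powr \<alpha>) * \<bar>?x j + (\<Sum>i\<in>{j<..<p}. C j i * ?x i)\<bar> powr \<alpha>) =
        (\<Sum>j<p. c * (dp j * \<bar>x j + (\<Sum>i\<in>{j<..<p}. C j i * x i)\<bar>) powr \<alpha>)"
      proof (intro sum.cong refl)
        fix j assume j: "j \<in> {..<p}"
        have "(\<Sum>i\<in>{j<..<p}. C j i * ?x i) = (\<Sum>i\<in>{j<..<p}. C j i * x i)" by (intro sum.cong) auto
        then show "(c * dp j powr \<alpha>) * \<bar>?x j + (\<Sum>i\<in>{j<..<p}. C j i * ?x i)\<bar> powr \<alpha> = c * (dp j * \<bar>x j + (\<Sum>i\<in>{j<..<p}. C j i * x i)\<bar>) powr \<alpha>"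
          using j dp by (simp add: powr_mult less_imp_le)
      qed
      finally have "(1/24) ^ p * (\<Sum>j<p. c * (dp j * \<bar>x j + (\<Sum>i\<in>{j<..<p}. C j i * x i)\<bar>) powr \<alpha>) / 2 \<le> Q x / 2"
        by (rule divide_right_mono) simp
      also have "(1/24) ^ p * (\<Sum>j<p. c * (dp j * \<bar>x j + (\<Sum>i\<in>{j<..<p}. C j i * x i)\<bar>) powr \<alpha>) / 2 =
        (\<Sum>j<p. c' * (dp j * \<bar>x j + (\<Sum>i\<in>{j<..<p}. C j i * x i)\<bar>) powr \<alpha>)"
        unfolding c'_def sum_distrib_left sum_divide_distrib by (intro sum.cong refl) simp
      finally have "(\<Sum>j<p. c' * (dp j * \<bar>x j + (\<Sum>i\<in>{j<..<p}. C j i * x i)\<bar>) powr \<alpha>) \<le> Q x / 2" .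
      then have "exp (- (Q x / 2)) \<le> exp (- (\<Sum>j<p. c' * (dp j * \<bar>x j + (\<Sum>i\<in>{j<..<p}. C j i * x i)\<bar>) powr \<alpha>))" by simp
      then show ?thesis by (simp add: sum_negf[symmetric] exp_sum)
    qed
    define A where "A = (K1 * (\<Prod>j<p. da j powr (- \<gamma>))) ^ ?d"
    have A: "A \<ge> 0" using K1 by (auto simp: A_def intro!: zero_le_power mult_nonneg_nonneg prod_nonneg)
    have "(\<integral>\<^sup>+ \<xi>. ennreal (\<Prod>k\<in>UNIV. (\<Prod>j<p. (1 + \<bar>\<xi> j k\<bar>) powr \<gamma>) * exp (- Q (\<lambda>j. \<xi> j k)))
      \<partial>PiM {..<p} (\<lambda>_. coord_measure :: ('d::finite \<Rightarrow> real) measure)) \<le>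
      (\<integral>\<^sup>+ \<xi>. ennreal A * (\<Prod>j\<in>{0..<p}. \<Prod>k\<in>UNIV. E j (?L \<xi> j k)) \<partial>PiM {0..<p} (\<lambda>_. coord_measure))"
      unfolding lessThan_atLeast0
    proof (intro nn_integral_mono)
      fix \<xi> :: "nat \<Rightarrow> 'd \<Rightarrow> real"
      have "(\<Prod>k\<in>UNIV. (\<Prod>j<p. (1 + \<bar>\<xi> j k\<bar>) powr \<gamma>) * exp (- Q (\<lambda>j. \<xi> j k))) \<le>
        (\<Prod>k\<in>(UNIV::'d set). (K1 * (\<Prod>j<p. da j powr (- \<gamma>))) * (\<Prod>j<p. exp (- c' * (dp j * \<bar>?L \<xi> j k\<bar>) powr \<alpha>)))"
      proof (intro prod_mono conjI)
        fix k
        have "(\<Prod>j<p. (1 + \<bar>\<xi> j k\<bar>) powr \<gamma>) * exp (- Q (\<lambda>j. \<xi> j k)) \<le> K1 * (\<Prod>j<p. da j powr (- \<gamma>)) * exp (- Q (\<lambda>j. \<xi> j k) / 2)"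
          using da Q low' by (intro w) auto
        also have "\<dots> \<le> K1 * (\<Prod>j<p. da j powr (- \<gamma>)) * (\<Prod>j<p. exp (- c' * (dp j * \<bar>?L \<xi> j k\<bar>) powr \<alpha>))"
          using expQ[of "\<lambda>j. \<xi> j k"] K1 by (intro mult_left_mono mult_nonneg_nonneg prod_nonneg) auto
        finally show "(\<Prod>j<p. (1 + \<bar>\<xi> j k\<bar>) powr \<gamma>) * exp (- Q (\<lambda>j. \<xi> j k)) \<le> K1 * (\<Prod>j<p. da j powr (- \<gamma>)) * (\<Prod>j<p. exp (- c' * (dp j * \<bar>?L \<xi> j k\<bar>) powr \<alpha>))" .
      qed (auto intro!: mult_nonneg_nonneg prod_nonneg)
      also have "\<dots> = A * (\<Prod>k\<in>UNIV. \<Prod>j<p. exp (- c' * (dp j * \<bar>?L \<xi> j k\<bar>) powr \<alpha>))"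
        by (simp add: prod.distrib A_def)
      also have "\<dots> = A * (\<Prod>j<p. \<Prod>k\<in>UNIV. exp (- c' * (dp j * \<bar>?L \<xi> j k\<bar>) powr \<alpha>))"
        by (subst prod.swap) simp
      finally have "ennreal (\<Prod>k\<in>UNIV. (\<Prod>j<p. (1 + \<bar>\<xi> j k\<bar>) powr \<gamma>) * exp (- Q (\<lambda>j. \<xi> j k))) \<le>
        ennreal (A * (\<Prod>j<p. \<Prod>k\<in>UNIV. exp (- c' * (dp j * \<bar>?L \<xi> j k\<bar>) powr \<alpha>)))" by (rule ennreal_leI)
      also have "\<dots> = ennreal A * (\<Prod>j<p. \<Prod>k\<in>UNIV. E j (?L \<xi> j k))"
        unfolding E_def using A by (simp add: ennreal_mult prod_ennreal prod_nonneg)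
      finally show "ennreal (\<Prod>k\<in>UNIV. (\<Prod>j\<in>{0..<p}. (1 + \<bar>\<xi> j k\<bar>) powr \<gamma>) * exp (- Q (\<lambda>j. \<xi> j k))) \<le>
         ennreal A * (\<Prod>j\<in>{0..<p}. \<Prod>k\<in>UNIV. E j (?L \<xi> j k))" by (simp add: lessThan_atLeast0)
    qed
    also have "\<dots> = ennreal A * (\<integral>\<^sup>+ \<xi>. (\<Prod>j\<in>{0..<p}. \<Prod>k\<in>UNIV. E j (?L \<xi> j k)) \<partial>PiM {0..<p} (\<lambda>_. coord_measure))"
    proof (rule nn_integral_cmult)
      have comp: "(\<lambda>\<xi>. \<xi> j k) \<in> borel_measurable (PiM {0..<p} (\<lambda>_. coord_measure :: ('d \<Rightarrow> real) measure))"
        if "j \<in> {0..<p}" for j k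
        using measurable_compose[OF measurable_component_singleton[OF that, of "\<lambda>_. coord_measure :: ('d \<Rightarrow> real) measure"]
          measurable_component_singleton[of k UNIV "\<lambda>_. lborel"]] by simp
      show "(\<lambda>\<xi>. \<Prod>j\<in>{0..<p}. \<Prod>k\<in>UNIV. E j (?L \<xi> j k)) \<in> borel_measurable (PiM {0..<p} (\<lambda>_. coord_measure :: ('d \<Rightarrow> real) measure))"
        by (intro borel_measurable_prod_ennreal measurable_compose[OF _ Em] borel_measurable_add borel_measurable_sum
          borel_measurable_times borel_measurable_const comp) auto
    qed
    also have "\<dots> = ennreal A * (\<Prod>j\<in>{0..<p}. (\<integral>\<^sup>+ r. E j r \<partial>lborel) ^ ?d)"
      by (subst nn_integral_triangular) auto
    also have "\<dots> = ennreal A * (\<Prod>j\<in>{0..<p}. ennreal ((1 / dp j * G) ^ ?d))"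
    proof (intro arg_cong2[where f = "(*)"] refl prod.cong)
      fix j assume "j \<in> {0..<p}"
      then have "dp j > 0" using dp by auto
      then have "(\<integral>\<^sup>+ r. E j r \<partial>lborel) = ennreal (1 / dp j * G)"
        unfolding E_def using nn_integral_exp_abs_powr_scale[of "dp j" c' \<alpha>] G
        by (simp add: ennreal_mult[symmetric])
      then show "(\<integral>\<^sup>+ r. E j r \<partial>lborel) ^ ?d = ennreal ((1 / dp j * G) ^ ?d)"
        using \<open>dp j > 0\<close> G by (simp add: ennreal_power)
    qed
    also have "\<dots> = ennreal (A * (\<Prod>j<p. (1 / dp j * G) ^ ?d))"
      using A G dp by (subst prod_ennreal) (auto simp: ennreal_mult lessThan_atLeast0 less_imp_le intro!: prod_nonneg ennreal_mult[symmetric])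
    also have "\<dots> \<le> ennreal (K * (\<Prod>j<p. (1 / dp j) ^ ?d * da j powr (- \<gamma> * ?d)))"
    proof (intro ennreal_leI)
      have "(\<Prod>j<p. (1 / dp j * G) ^ ?d) \<le> (\<Prod>j<p. (1 / dp j) ^ ?d * (max 1 G) ^ ?d)"
        unfolding power_mult_distrib using dp G by (intro prod_mono) (auto intro!: mult_left_mono power_mono simp: less_imp_le)
      also have "\<dots> = (\<Prod>j<p. (1 / dp j) ^ ?d) * (max 1 G) ^ (?d * p)"
        by (simp add: prod.distrib power_mult)
      finally have "A * (\<Prod>j<p. (1 / dp j * G) ^ ?d) \<le> A * ((\<Prod>j<p. (1 / dp j) ^ ?d) * (max 1 G) ^ (?d * p))"
        using A by (rule mult_left_mono)
      also have "\<dots> = K * (\<Prod>j<p. (1 / dp j) ^ ?d * da j powr (- \<gamma> * ?d))"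
      proof -
        have "(\<Prod>j<p. da j powr (- \<gamma> * ?d)) = (\<Prod>j<p. da j powr (- \<gamma>)) ^ ?d"
          unfolding prod_power_distrib using da
          by (intro prod.cong refl) (auto simp: powr_power mult.commute)
        then show ?thesis by (simp add: A_def K_def prod.distrib power_mult_distrib mult_ac)
      qed
      finally show "A * (\<Prod>j<p. (1 / dp j * G) ^ ?d) \<le> K * (\<Prod>j<p. (1 / dp j) ^ ?d * da j powr (- \<gamma> * ?d))" .
    qed
    finally show "(\<integral>\<^sup>+ \<xi>. ennreal (\<Prod>k\<in>UNIV. (\<Prod>j<p. (1 + \<bar>\<xi> j k\<bar>) powr \<gamma>) * exp (- Q (\<lambda>j. \<xi> j k)))
      \<partial>PiM {..<p} (\<lambda>_. coord_measure :: ('d::finite \<Rightarrow> real) measure)) \<le>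
      ennreal (K * (\<Prod>j<p. (1 / dp j) ^ ?d * da j powr (- \<gamma> * ?d)))" .
  qed
qed

section \<open>Singular integrals over the times\<close>

definition inv_dist :: "real \<Rightarrow> real \<Rightarrow> ennreal" where
  "inv_dist \<beta> r = (if r = 0 then \<top> else ennreal (\<bar>r\<bar> powr (- \<beta>)))"

lemma inv_dist_measurable [measurable]: "inv_dist \<beta> \<in> borel_measurable borel"
  unfolding inv_dist_def[abs_def] by measurable

text \<open>D must not depend on the position a of the singularity, since a will be a coordinate of
  another time point.\<close>

lemma nn_integral_inv_dist:
  fixes e T \<beta> :: real
  assumes \<beta>: "0 \<le> \<beta>" "\<beta> < 1"
  shows "\<exists>D. \<forall>a. (\<integral>\<^sup>+ r. inv_dist \<beta> (r - a) * indicator {e..T} r \<partial>lborel) \<le> ennreal D"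
proof -
  define g where "g x = ennreal (x powr (- \<beta>)) * indicator {0..1} x" for x :: real
  have [measurable]: "g \<in> borel_measurable borel" unfolding g_def by measurable
  define h where "h r = indicator {e..T} r + (g r + g (- r))" for r
  have fin: "(\<integral>\<^sup>+ r. g r \<partial>lborel) < \<infinity>"
    unfolding g_def using \<beta> by (intro nn_integral_powr_from_0) auto
  have "(\<integral>\<^sup>+ r. indicator {e..T} r \<partial>lborel) + ((\<integral>\<^sup>+ r. g r \<partial>lborel) + (\<integral>\<^sup>+ r. g r \<partial>lborel)) < \<infinity>"
    using fin by (simp add: emeasure_lborel_Icc_eq)
  then obtain D where D: "(\<integral>\<^sup>+ r. indicator {e..T} r \<partial>lborel) + ((\<integral>\<^sup>+ r. g r \<partial>lborel) + (\<integral>\<^sup>+ r. g r \<partial>lborel)) = ennreal D"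
    by (cases "(\<integral>\<^sup>+ r. indicator {e..T} r \<partial>lborel) + ((\<integral>\<^sup>+ r. g r \<partial>lborel) + (\<integral>\<^sup>+ r. g r \<partial>lborel))") auto
  have "(\<integral>\<^sup>+ r. inv_dist \<beta> (r - a) * indicator {e..T} r \<partial>lborel) \<le> ennreal D" for a
  proof -
    have "(\<integral>\<^sup>+ r. inv_dist \<beta> (r - a) * indicator {e..T} r \<partial>lborel) \<le> (\<integral>\<^sup>+ r. indicator {e..T} r + (g (- a + 1 * r) + g (a + (-1) * r)) \<partial>lborel)"
    proof (rule nn_integral_mono_AE, rule AE_mp[OF AE_lborel_singleton[of a]], rule AE_I2, rule impI)
      fix r assume r: "r \<noteq> a"
      show "inv_dist \<beta> (r - a) * indicator {e..T} r \<le> indicator {e..T} r + (g (- a + 1 * r) + g (a + (-1) * r))"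
      proof (cases "\<bar>r - a\<bar> \<le> 1")
        case True
        then have "inv_dist \<beta> (r - a) \<le> g (- a + 1 * r) + g (a + (-1) * r)"
          using r by (cases "r > a") (auto simp: inv_dist_def g_def indicator_def)
        then have "inv_dist \<beta> (r - a) * indicator {e..T} r \<le> g (- a + 1 * r) + g (a + (-1) * r)"
          by (auto simp: indicator_def)
        then show ?thesis by (rule add_increasing[rotated]) simp
      next
        case False
        then have "\<bar>r - a\<bar> powr (- \<beta>) \<le> \<bar>r - a\<bar> powr 0" using \<beta> by (intro powr_mono) auto
        then have "inv_dist \<beta> (r - a) \<le> 1" using False by (auto simp: inv_dist_def ennreal_le_1)
        then have "inv_dist \<beta> (r - a) * indicator {e..T} r \<le> 1 * indicator {e..T} r" by (rule mult_right_mono) simp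
        then show ?thesis by (intro add_increasing2) auto
      qed
    qed
    also have "\<dots> = ennreal D"
      unfolding D[symmetric] using nn_integral_real_affine[of g 1 "-a"] nn_integral_real_affine[of g "-1" a]
      by (simp add: nn_integral_add)
    finally show ?thesis .
  qed
  then show ?thesis by blast
qed

text \<open>A majorant for products of minimal gaps to the power -\<beta>: a minimum of several
  distances, capped by \<eta>, to a negative power is at most the sum of the single powers. R
  selects the indices with which j is compared: smaller ones for \<open><\<close>, larger ones for
  \<open>>\<close>.\<close>

definition inv_dist_prod :: "(nat \<Rightarrow> nat \<Rightarrow> bool) \<Rightarrow> real \<Rightarrow> real \<Rightarrow> nat set \<Rightarrow> (nat \<Rightarrow> real^'n) \<Rightarrow> ennreal" where
  "inv_dist_prod R \<beta> \<eta> K s =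
     (\<Prod>j\<in>K. \<Prod>l\<in>UNIV. ennreal (\<eta> powr (- \<beta>)) + (\<Sum>i\<in>{i\<in>K. R i j}. inv_dist \<beta> (s j $ l - s i $ l)))"

lemma PiM_component_measurable:
  "j \<in> K \<Longrightarrow> (\<lambda>s. s j $ l) \<in> borel_measurable (PiM K (\<lambda>_. lborel :: (real^'n) measure))"
  using measurable_compose[OF measurable_component_singleton[of j K "\<lambda>_. lborel :: (real^'n) measure"], of "\<lambda>v. v $ l" borel]
  by simp

lemma inv_dist_prod_measurable:
  "inv_dist_prod R \<beta> \<eta> K \<in> borel_measurable (PiM K (\<lambda>_. lborel :: (real^'n) measure))"
  unfolding inv_dist_prod_def[abs_def]
  by (intro borel_measurable_prod_ennreal borel_measurable_add borel_measurable_const borel_measurable_sum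
      measurable_compose[OF _ inv_dist_measurable] borel_measurable_diff PiM_component_measurable) auto

text \<open>The index \<open>b\<close> supplied by the hypothesis \<open>R\<close> occurs in no factor but its own, so the variable \<open>s b\<close> can be
  integrated out first.\<close>

lemma nn_integral_inv_dist_prod:
  fixes e T \<beta> \<eta> :: real and R :: "nat \<Rightarrow> nat \<Rightarrow> bool"
  assumes \<beta>: "0 \<le> \<beta>" "\<beta> < 1" and R: "\<And>K. finite K \<Longrightarrow> K \<noteq> {} \<Longrightarrow> \<exists>b\<in>K. \<forall>i\<in>K. \<not> R b i"
  shows "\<exists>C. \<forall>K. finite K \<and> card K = p \<longrightarrow>
    (\<integral>\<^sup>+ s. (\<Prod>j\<in>K. indicator (cbox (\<chi> l. e) (\<chi> l. T)) (s j)) * inv_dist_prod R \<beta> \<eta> K s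
      \<partial>PiM K (\<lambda>_. lborel :: (real^'n) measure)) \<le> ennreal C"
proof (induction p)
  case 0
  show ?case by (auto intro!: exI[of _ 1] simp: inv_dist_prod_def PiM_empty nn_integral_count_space_finite)
next
  case (Suc p)
  let ?I = "cbox (\<chi> l. e) (\<chi> l. T) :: (real^'n) set"
  obtain C where C: "\<And>K. finite K \<Longrightarrow> card K = p \<Longrightarrow>
    (\<integral>\<^sup>+ s. (\<Prod>j\<in>K. indicator ?I (s j)) * inv_dist_prod R \<beta> \<eta> K s \<partial>PiM K (\<lambda>_. lborel)) \<le> ennreal C"
    using Suc by blast
  obtain D where D: "\<And>a. (\<integral>\<^sup>+ r. inv_dist \<beta> (r - a) * indicator {e..T} r \<partial>lborel) \<le> ennreal D"
    using nn_integral_inv_dist[OF \<beta>] by blast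
  define M where "M = ennreal (\<eta> powr (- \<beta>)) * emeasure lborel {e..T} + of_nat (Suc p) * ennreal D"
  have M: "M < \<top>" unfolding M_def by (simp add: ennreal_mult_less_top emeasure_lborel_Icc_eq of_nat_less_top)
  have "M ^ CARD('n) * ennreal C < \<top>" using M by (simp add: ennreal_mult_less_top power_less_top_ennreal)
  then obtain C' where C': "M ^ CARD('n) * ennreal C = ennreal C'" by (cases "M ^ CARD('n) * ennreal C") auto
  interpret product_sigma_finite "\<lambda>_::nat. lborel :: (real^'n) measure" by (rule product_sigma_finite_lborel)
  show ?case
  proof (intro exI[of _ C'] allI impI, elim conjE)
    fix K :: "nat set" assume K: "finite K" "card K = Suc p"
    then have "K \<noteq> {}" by auto
    then obtain b where b: "b \<in> K" "\<forall>i\<in>K. \<not> R b i" using R[OF K(1)] by blast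
    define K' where "K' = K - {b}"
    have K': "finite K'" "card K' = p" "b \<notin> K'" "K = insert b K'" using K b by (auto simp: K'_def)
    let ?F = "\<lambda>K s. (\<Prod>j\<in>K. indicator ?I (s j)) * inv_dist_prod R \<beta> \<eta> K s"
    have Fm: "?F K \<in> borel_measurable (PiM K (\<lambda>_. lborel))" for K
      by (intro borel_measurable_times_ennreal inv_dist_prod_measurable borel_measurable_prod_ennreal
          measurable_compose[OF measurable_component_singleton]) auto
    \<comment> \<open>The part that carries the variable u = s b, cut off to the box. It is a
      product over the coordinates, so its integral factorises and is bounded independently of the
      remaining points.\<close>
    define w where "w s u = (\<Prod>l\<in>UNIV. (ennreal (\<eta> powr (- \<beta>)) + (\<Sum>i\<in>{i\<in>K'. R i b}. inv_dist \<beta> (u $ l - s i $ l))) * indicator {e..T} (u $ l))"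
      for s :: "nat \<Rightarrow> real^'n" and u :: "real^'n"
    have split: "?F K (s(b := u)) = ?F K' s * w s u" for s u
    proof -
      have ind: "(\<Prod>j\<in>K. indicator ?I ((s(b := u)) j)) = (\<Prod>j\<in>K'. indicator ?I (s j)) * (indicator ?I u :: ennreal)"
      proof -
        have "(\<Prod>j\<in>K'. indicator ?I ((s(b := u)) j)) = (\<Prod>j\<in>K'. indicator ?I (s j) :: ennreal)"
          using K'(3) by (intro prod.cong) auto
        then show ?thesis unfolding K'(4) using K' by (simp add: mult.commute)
      qed
      have indu: "(indicator ?I u :: ennreal) = (\<Prod>l\<in>UNIV. indicator {e..T} (u $ l))"
        by (auto simp: indicator_def mem_box_cart prod.If_cases intro!: prod_zero[symmetric])
      have a: "(\<Prod>l\<in>UNIV. ennreal (\<eta> powr (- \<beta>)) + (\<Sum>i\<in>{i\<in>K. R i j}. inv_dist \<beta> ((s(b := u)) j $ l - (s(b := u)) i $ l)))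
        = (\<Prod>l\<in>UNIV. ennreal (\<eta> powr (- \<beta>)) + (\<Sum>i\<in>{i\<in>K'. R i j}. inv_dist \<beta> (s j $ l - s i $ l)))" if j: "j \<in> K'" for j
      proof -
        have "{i\<in>K. R i j} = {i\<in>K'. R i j}" using b j K' by auto
        moreover have "(\<Sum>i\<in>{i\<in>K'. R i j}. inv_dist \<beta> ((s(b := u)) j $ l - (s(b := u)) i $ l)) = (\<Sum>i\<in>{i\<in>K'. R i j}. inv_dist \<beta> (s j $ l - s i $ l))" for l
          using j K'(3) by (intro sum.cong) auto
        ultimately show ?thesis by simp
      qed
      have bb: "(\<Sum>i\<in>{i\<in>K. R i b}. inv_dist \<beta> ((s(b := u)) b $ l - (s(b := u)) i $ l)) = (\<Sum>i\<in>{i\<in>K'. R i b}. inv_dist \<beta> (u $ l - s i $ l))" for l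
        using b K' by (intro sum.cong) auto
      have "inv_dist_prod R \<beta> \<eta> K (s(b := u)) =
        (\<Prod>l\<in>UNIV. ennreal (\<eta> powr (- \<beta>)) + (\<Sum>i\<in>{i\<in>K. R i b}. inv_dist \<beta> ((s(b := u)) b $ l - (s(b := u)) i $ l))) *
        (\<Prod>j\<in>K'. \<Prod>l\<in>UNIV. ennreal (\<eta> powr (- \<beta>)) + (\<Sum>i\<in>{i\<in>K. R i j}. inv_dist \<beta> ((s(b := u)) j $ l - (s(b := u)) i $ l)))"
        unfolding inv_dist_prod_def by (subst (1) K'(4), subst prod.insert) (use K' in auto)
      also have "\<dots> = (\<Prod>l\<in>UNIV. ennreal (\<eta> powr (- \<beta>)) + (\<Sum>i\<in>{i\<in>K'. R i b}. inv_dist \<beta> (u $ l - s i $ l))) * inv_dist_prod R \<beta> \<eta> K' s"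
        unfolding bb inv_dist_prod_def by (rule arg_cong[OF prod.cong[OF refl a]])
      finally show ?thesis unfolding ind indu w_def prod.distrib by (simp add: mult_ac)
    qed
    have wint: "(\<integral>\<^sup>+ u. w s u \<partial>lborel) \<le> M ^ CARD('n)" for s
    proof -
      have "(\<integral>\<^sup>+ u. w s u \<partial>lborel) = (\<Prod>l\<in>(UNIV::'n set). \<integral>\<^sup>+ r. (ennreal (\<eta> powr (- \<beta>)) + (\<Sum>i\<in>{i\<in>K'. R i b}. inv_dist \<beta> (r - s i $ l))) * indicator {e..T} r \<partial>lborel)"
        unfolding w_def by (rule nn_integral_lborel_vec_prod) measurable
      also have "\<dots> \<le> (\<Prod>l\<in>(UNIV::'n set). M)"
      proof (intro prod_mono_ennreal)
        fix l
        have "(\<integral>\<^sup>+ r. (ennreal (\<eta> powr (- \<beta>)) + (\<Sum>i\<in>{i\<in>K'. R i b}. inv_dist \<beta> (r - s i $ l))) * indicator {e..T} r \<partial>lborel) =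
          (\<integral>\<^sup>+ r. ennreal (\<eta> powr (- \<beta>)) * indicator {e..T} r + (\<Sum>i\<in>{i\<in>K'. R i b}. inv_dist \<beta> (r - s i $ l) * indicator {e..T} r) \<partial>lborel)"
          by (simp add: distrib_right sum_distrib_right)
        also have "\<dots> = ennreal (\<eta> powr (- \<beta>)) * emeasure lborel {e..T} + (\<Sum>i\<in>{i\<in>K'. R i b}. \<integral>\<^sup>+ r. inv_dist \<beta> (r - s i $ l) * indicator {e..T} r \<partial>lborel)"
          by (simp add: nn_integral_add nn_integral_sum nn_integral_cmult_indicator)
        also have "\<dots> \<le> M" unfolding M_def
        proof (intro add_mono order_refl)
          have "(\<Sum>i\<in>{i\<in>K'. R i b}. \<integral>\<^sup>+ r. inv_dist \<beta> (r - s i $ l) * indicator {e..T} r \<partial>lborel) \<le> (\<Sum>i\<in>{i\<in>K'. R i b}. ennreal D)"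
            by (intro sum_mono D)
          also have "\<dots> = of_nat (card {i\<in>K'. R i b}) * ennreal D" by simp
          also have "\<dots> \<le> of_nat (Suc p) * ennreal D"
          proof (intro mult_right_mono)
            have "card {i\<in>K'. R i b} \<le> card K'" using K' by (intro card_mono) auto
            then show "(of_nat (card {i\<in>K'. R i b}) :: ennreal) \<le> of_nat (Suc p)"
              unfolding of_nat_le_iff using K' by simp
          qed simp
          finally show "(\<Sum>i\<in>{i\<in>K'. R i b}. \<integral>\<^sup>+ r. inv_dist \<beta> (r - s i $ l) * indicator {e..T} r \<partial>lborel) \<le> of_nat (Suc p) * ennreal D" .
        qed
        finally show "(\<integral>\<^sup>+ r. (ennreal (\<eta> powr (- \<beta>)) + (\<Sum>i\<in>{i\<in>K'. R i b}. inv_dist \<beta> (r - s i $ l))) * indicator {e..T} r \<partial>lborel) \<le> M" .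
      qed
      finally show ?thesis by simp
    qed
    have "(\<integral>\<^sup>+ s. ?F K s \<partial>PiM K (\<lambda>_. lborel)) = (\<integral>\<^sup>+ s. \<integral>\<^sup>+ u. ?F K (s(b := u)) \<partial>lborel \<partial>PiM K' (\<lambda>_. lborel))"
      using Fm[of K] unfolding K'(4) by (intro product_nn_integral_insert[OF K'(1,3)])
    also have "\<dots> = (\<integral>\<^sup>+ s. ?F K' s * (\<integral>\<^sup>+ u. w s u \<partial>lborel) \<partial>PiM K' (\<lambda>_. lborel))"
      unfolding split by (intro nn_integral_cong nn_integral_cmult) (simp add: w_def)
    also have "\<dots> \<le> (\<integral>\<^sup>+ s. ?F K' s * M ^ CARD('n) \<partial>PiM K' (\<lambda>_. lborel))"
      by (intro nn_integral_mono mult_left_mono wint) auto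
    also have "\<dots> = (\<integral>\<^sup>+ s. ?F K' s \<partial>PiM K' (\<lambda>_. lborel)) * M ^ CARD('n)"
      using Fm by (intro nn_integral_multc)
    also have "\<dots> \<le> ennreal C * M ^ CARD('n)" by (intro mult_right_mono C K') auto
    also have "\<dots> = ennreal C'" using C' by (simp add: mult.commute)
    finally show "(\<integral>\<^sup>+ s. ?F K s \<partial>PiM K (\<lambda>_. lborel)) \<le> ennreal C'" .
  qed
qed

section \<open>Moments of mollified occupation densities\<close>

text \<open>The characteristic function of the standard normal law at \<open>y / \<epsilon>\<close>
  is, up to a constant, the density to be represented; rescaling the integration variable by
  \<epsilon> turns this into Fourier inversion.\<close>

lemma normal_density_fourier:
  fixes \<epsilon> y :: real
  assumes \<epsilon>: "\<epsilon> > 0"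
  shows "complex_of_real (normal_density 0 \<epsilon> y) =
      (LINT \<xi>|lborel. complex_of_real (exp (- (\<epsilon> * \<xi>)\<^sup>2 / 2) / (2 * pi)) * cis (\<xi> * y))"
    and "integrable lborel (\<lambda>\<xi>. exp (- (\<epsilon> * \<xi>)\<^sup>2 / 2) / (2 * pi))"
proof -
  have std: "integrable lborel std_normal_density" by (rule integrable_normal_density) simp
  have e: "exp (- (\<epsilon> * \<xi>)\<^sup>2 / 2) / (2 * pi) = std_normal_density (0 + \<epsilon> * \<xi>) / sqrt (2 * pi)" for \<xi>
    by (simp add: std_normal_density_def field_simps real_sqrt_mult)
  have "integrable lborel (\<lambda>\<xi>. std_normal_density (0 + \<epsilon> * \<xi>))"
    using std \<epsilon> by (subst lborel_integrable_real_affine_iff) auto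
  then show "integrable lborel (\<lambda>\<xi>. exp (- (\<epsilon> * \<xi>)\<^sup>2 / 2) / (2 * pi))"
    unfolding e by simp
  have "complex_of_real (exp (- ((y / \<epsilon>)\<^sup>2) / 2)) = char std_normal_distribution (y / \<epsilon>)"
    by (simp add: char_std_normal_distribution)
  also have "\<dots> = (LINT x|lborel. std_normal_density x *\<^sub>R cis (y / \<epsilon> * x))"
    unfolding char_def by (subst integral_density) (auto simp: cis_conv_exp)
  also have "\<dots> = \<bar>\<epsilon>\<bar> *\<^sub>R (LINT \<xi>|lborel. std_normal_density (0 + \<epsilon> * \<xi>) *\<^sub>R cis (y / \<epsilon> * (0 + \<epsilon> * \<xi>)))"
    using \<epsilon> by (subst lborel_integral_real_affine[where c = \<epsilon> and t = 0]) auto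
  also have "(LINT \<xi>|lborel. std_normal_density (0 + \<epsilon> * \<xi>) *\<^sub>R cis (y / \<epsilon> * (0 + \<epsilon> * \<xi>))) =
    (LINT \<xi>|lborel. complex_of_real (sqrt (2 * pi)) * (complex_of_real (exp (- (\<epsilon> * \<xi>)\<^sup>2 / 2) / (2 * pi)) * cis (\<xi> * y)))"
    unfolding e using \<epsilon> by (intro Bochner_Integration.integral_cong refl) (simp add: scaleR_conv_of_real mult.commute)
  also have "\<dots> = complex_of_real (sqrt (2 * pi)) * (LINT \<xi>|lborel. complex_of_real (exp (- (\<epsilon> * \<xi>)\<^sup>2 / 2) / (2 * pi)) * cis (\<xi> * y))"
    by simp
  finally have eq: "complex_of_real (exp (- ((y / \<epsilon>)\<^sup>2) / 2)) = complex_of_real (\<epsilon> * sqrt (2 * pi)) *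
     (LINT \<xi>|lborel. complex_of_real (exp (- (\<epsilon> * \<xi>)\<^sup>2 / 2) / (2 * pi)) * cis (\<xi> * y))"
    using \<epsilon> by (simp add: scaleR_conv_of_real mult.assoc)
  have "normal_density 0 \<epsilon> y = exp (- ((y / \<epsilon>)\<^sup>2) / 2) / (\<epsilon> * sqrt (2 * pi))"
    using \<epsilon> by (simp add: normal_density_def real_sqrt_mult power_divide mult_ac)
  then have "complex_of_real (normal_density 0 \<epsilon> y) = complex_of_real (exp (- ((y / \<epsilon>)\<^sup>2) / 2)) / complex_of_real (\<epsilon> * sqrt (2 * pi))"
    by (simp only: of_real_divide)
  also have "\<dots> = (LINT \<xi>|lborel. complex_of_real (exp (- (\<epsilon> * \<xi>)\<^sup>2 / 2) / (2 * pi)) * cis (\<xi> * y))"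
    unfolding eq using \<epsilon> by simp
  finally show "complex_of_real (normal_density 0 \<epsilon> y) =
      (LINT \<xi>|lborel. complex_of_real (exp (- (\<epsilon> * \<xi>)\<^sup>2 / 2) / (2 * pi)) * cis (\<xi> * y))" .
qed

section \<open>Gaussian mollifiers and their Fourier transforms\<close>

definition mollifier :: "real \<Rightarrow> real^'d::finite \<Rightarrow> real" where
  "mollifier \<epsilon> y = (\<Prod>k\<in>UNIV. normal_density 0 \<epsilon> (y $ k))"

text \<open>The factor \<open>1 / (2 * pi)\<close> of the inversion formula is included for each
  component, so later frequency integrals carry no extra constant.\<close>

definition mollifier_ft :: "real \<Rightarrow> ('d::finite \<Rightarrow> real) \<Rightarrow> real" where
  "mollifier_ft \<epsilon> \<xi> = (\<Prod>k\<in>UNIV. exp (- (\<epsilon> * \<xi> k)\<^sup>2 / 2) / (2 * pi))"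

lemma prod_cis: "finite A \<Longrightarrow> (\<Prod>k\<in>A. cis (f k)) = cis (\<Sum>k\<in>A. f k)"
  by (induction A rule: finite_induct) (auto simp: cis_mult)

lemma mollifier_fourier:
  fixes y :: "real^'d::finite"
  assumes \<epsilon>: "\<epsilon> > 0"
  shows "complex_of_real (mollifier \<epsilon> y) =
      (LINT \<xi>|coord_measure. complex_of_real (mollifier_ft \<epsilon> \<xi>) * cis (\<Sum>k\<in>UNIV. \<xi> k * y $ k))"
    and "integrable (coord_measure :: ('d \<Rightarrow> real) measure) (mollifier_ft \<epsilon>)"
proof -
  interpret product_sigma_finite "\<lambda>_::'d. lborel :: real measure" by (rule product_sigma_finite_lborel)
  note f = normal_density_fourier[OF \<epsilon>]
  show "integrable (coord_measure :: ('d \<Rightarrow> real) measure) (mollifier_ft \<epsilon>)"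
    unfolding mollifier_ft_def[abs_def] using f(2) by (intro product_integrable_prod) auto
  have "complex_of_real (mollifier \<epsilon> y) = (\<Prod>k\<in>UNIV. LINT \<xi>|lborel. complex_of_real (exp (- (\<epsilon> * \<xi>)\<^sup>2 / 2) / (2 * pi)) * cis (\<xi> * y $ k))"
    unfolding mollifier_def of_real_prod f(1) ..
  also have "\<dots> = (LINT \<xi>|coord_measure. (\<Prod>k\<in>UNIV. complex_of_real (exp (- (\<epsilon> * \<xi> k)\<^sup>2 / 2) / (2 * pi)) * cis (\<xi> k * y $ k)))"
  proof (rule product_integral_prod[symmetric])
    fix k
    show "integrable lborel (\<lambda>\<xi>. complex_of_real (exp (- (\<epsilon> * \<xi>)\<^sup>2 / 2) / (2 * pi)) * cis (\<xi> * y $ k))"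
      by (rule Bochner_Integration.integrable_bound[OF f(2)])
        (auto simp: norm_mult cis_conv_exp simp del: of_real_mult of_real_exp of_real_divide)
  qed simp
  also have "\<dots> = (LINT \<xi>|coord_measure. complex_of_real (mollifier_ft \<epsilon> \<xi>) * cis (\<Sum>k\<in>UNIV. \<xi> k * y $ k))"
    by (simp only: mollifier_ft_def prod.distrib prod_cis finite of_real_prod)
  finally show "complex_of_real (mollifier \<epsilon> y) =
      (LINT \<xi>|coord_measure. complex_of_real (mollifier_ft \<epsilon> \<xi>) * cis (\<Sum>k\<in>UNIV. \<xi> k * y $ k))" .
qed

definition mollifier_diff :: "real \<Rightarrow> real^'d::finite \<Rightarrow> real" where
  "mollifier_diff \<epsilon> y = mollifier \<epsilon> y - mollifier (\<epsilon> / 2) y"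

definition mollifier_diff_ft :: "real \<Rightarrow> ('d::finite \<Rightarrow> real) \<Rightarrow> real" where
  "mollifier_diff_ft \<epsilon> \<xi> = mollifier_ft \<epsilon> \<xi> - mollifier_ft (\<epsilon> / 2) \<xi>"

lemma integrable_times_cis:
  assumes "integrable M f" "g \<in> borel_measurable M"
  shows "integrable M (\<lambda>x. complex_of_real (f x) * cis (g x))"
proof (rule Bochner_Integration.integrable_bound[OF assms(1)])
  have [measurable]: "f \<in> borel_measurable M" "g \<in> borel_measurable M" using assms by auto
  show "(\<lambda>x. complex_of_real (f x) * cis (g x)) \<in> borel_measurable M" unfolding cis_conv_exp by measurable
qed (auto simp: norm_mult)

lemma coord_measurable [measurable]: "(\<lambda>\<xi>. \<xi> k) \<in> borel_measurable (coord_measure :: ('d::finite \<Rightarrow> real) measure)"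
  using measurable_component_singleton[of k UNIV "\<lambda>_. lborel :: real measure"] by simp

lemma mollifier_diff_fourier:
  fixes y :: "real^'d::finite"
  assumes \<epsilon>: "\<epsilon> > 0"
  shows "complex_of_real (mollifier_diff \<epsilon> y) =
      (LINT \<xi>|coord_measure. complex_of_real (mollifier_diff_ft \<epsilon> \<xi>) * cis (\<Sum>k\<in>UNIV. \<xi> k * y $ k))"
    and "integrable (coord_measure :: ('d \<Rightarrow> real) measure) (mollifier_diff_ft \<epsilon>)"
proof -
  have \<epsilon>2: "\<epsilon> / 2 > 0" using \<epsilon> by simp
  note 1 = mollifier_fourier[OF \<epsilon>] and 2 = mollifier_fourier[OF \<epsilon>2]
  show "integrable (coord_measure :: ('d \<Rightarrow> real) measure) (mollifier_diff_ft \<epsilon>)"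
    unfolding mollifier_diff_ft_def[abs_def] using 1(2) 2(2) by (rule Bochner_Integration.integrable_diff)
  have [measurable]: "(\<lambda>\<xi>. \<Sum>k\<in>UNIV. \<xi> k * y $ k) \<in> borel_measurable (coord_measure :: ('d \<Rightarrow> real) measure)" by measurable
  show "complex_of_real (mollifier_diff \<epsilon> y) =
      (LINT \<xi>|coord_measure. complex_of_real (mollifier_diff_ft \<epsilon> \<xi>) * cis (\<Sum>k\<in>UNIV. \<xi> k * y $ k))"
    unfolding mollifier_diff_def mollifier_diff_ft_def of_real_diff 1(1) 2(1) left_diff_distrib
    by (rule Bochner_Integration.integral_diff[symmetric]) (intro integrable_times_cis 1(2) 2(2); measurable)+
qed

lemma sum_le_prod_one_plus:
  fixes a :: "'a \<Rightarrow> real"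
  assumes "finite A" "\<And>i. i \<in> A \<Longrightarrow> 0 \<le> a i"
  shows "(\<Sum>i\<in>A. a i) \<le> (\<Prod>i\<in>A. 1 + a i) \<and> 1 \<le> (\<Prod>i\<in>A. 1 + a i)"
  using assms
proof (induction A rule: finite_induct)
  case (insert i A)
  let ?P = "\<Prod>i\<in>A. 1 + a i"
  have h: "sum a A \<le> ?P" "1 \<le> ?P" "0 \<le> a i" using insert by auto
  have "a i \<le> a i * ?P" using h by (simp add: mult_le_cancel_left1)
  then have "a i + sum a A \<le> (1 + a i) * ?P" using h by (simp add: algebra_simps)
  moreover have "1 * 1 \<le> (1 + a i) * ?P" using h by (intro mult_mono) auto
  ultimately show ?case using insert by simp
qed simp

text \<open>With q = \<epsilon>^2 |\<xi>|^2 the two exponentials differ by at most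
  \<open>min 1 q\<close>, hence by at most \<open>q powr (\<gamma> / 2)\<close>: low frequencies
  cancel, high ones are merely bounded. Replacing |\<xi>| by a product over the components makes the
  weight factorise in the later integrals.\<close>

lemma abs_mollifier_diff_ft_le:
  fixes \<xi> :: "'d::finite \<Rightarrow> real"
  assumes \<epsilon>: "0 < \<epsilon>" and \<gamma>: "0 < \<gamma>" "\<gamma> \<le> 1"
  shows "\<bar>mollifier_diff_ft \<epsilon> \<xi>\<bar> \<le> \<epsilon> powr \<gamma> * (\<Prod>k\<in>UNIV. (1 + \<bar>\<xi> k\<bar>) powr \<gamma>)"
proof -
  define q where "q = \<epsilon>\<^sup>2 * (\<Sum>k\<in>UNIV. (\<xi> k)\<^sup>2)"
  have q0: "q \<ge> 0" unfolding q_def by (intro mult_nonneg_nonneg sum_nonneg) auto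
  have ft: "mollifier_ft e \<xi> = exp (- (e\<^sup>2 * (\<Sum>k\<in>UNIV. (\<xi> k)\<^sup>2)) / 2) / (2 * pi) ^ CARD('d)" for e
  proof -
    have "(\<Prod>k\<in>UNIV. exp (- (e * \<xi> k)\<^sup>2 / 2)) = exp (\<Sum>k\<in>UNIV. - (e * \<xi> k)\<^sup>2 / 2)" by (simp add: exp_sum)
    also have "(\<Sum>k\<in>UNIV. - (e * \<xi> k)\<^sup>2 / 2) = - (e\<^sup>2 * (\<Sum>k\<in>UNIV. (\<xi> k)\<^sup>2)) / 2"
      by (simp add: power_mult_distrib sum_distrib_left sum_negf sum_divide_distrib)
    finally show ?thesis by (simp add: mollifier_ft_def prod_dividef)
  qed
  have eq: "mollifier_diff_ft \<epsilon> \<xi> = (exp (- q / 2) - exp (- q / 8)) / (2 * pi) ^ CARD('d)"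
    unfolding mollifier_diff_ft_def ft by (simp add: q_def power_divide diff_divide_distrib)
  have e1: "exp (- q / 2) \<le> exp (- q / 8)" "exp (- q / 8) \<le> 1" using q0 by auto
  have "1 - q / 2 \<le> exp (- q / 2)" using exp_ge_add_one_self[of "- q / 2"] by simp
  then have d: "\<bar>exp (- q / 2) - exp (- q / 8)\<bar> \<le> min 1 q"
  proof -
    have "0 \<le> exp (- q / 2)" by simp
    then show ?thesis using e1 q0 \<open>1 - q / 2 \<le> exp (- q / 2)\<close> by linarith
  qed
  also have "\<dots> \<le> q powr (\<gamma> / 2)"
  proof (cases "q \<le> 1")
    case True
    have "q \<le> q powr (\<gamma> / 2)"
    proof (cases "q = 0")
      case False
      then have "q powr 1 \<le> q powr (\<gamma> / 2)" using True q0 \<gamma> by (intro powr_mono') auto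
      then show ?thesis using q0 by simp
    qed simp
    then show ?thesis by simp
  next
    case False
    then have "1 \<le> q powr (\<gamma> / 2)" using \<gamma> by (intro ge_one_powr_ge_zero) auto
    then show ?thesis by simp
  qed
  also have "\<dots> \<le> (\<epsilon>\<^sup>2 * (\<Prod>k\<in>UNIV. (1 + \<bar>\<xi> k\<bar>)\<^sup>2)) powr (\<gamma> / 2)"
  proof (intro powr_mono2)
    have "(\<Sum>k\<in>UNIV. (\<xi> k)\<^sup>2) \<le> (\<Prod>k\<in>UNIV. 1 + (\<xi> k)\<^sup>2)"
      using sum_le_prod_one_plus[of UNIV "\<lambda>k. (\<xi> k)\<^sup>2"] by auto
    also have "\<dots> \<le> (\<Prod>k\<in>UNIV. (1 + \<bar>\<xi> k\<bar>)\<^sup>2)"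
      by (intro prod_mono) (auto simp: power2_sum)
    finally show "q \<le> \<epsilon>\<^sup>2 * (\<Prod>k\<in>UNIV. (1 + \<bar>\<xi> k\<bar>)\<^sup>2)" unfolding q_def by (intro mult_left_mono) auto
  qed (use \<gamma> q0 in auto)
  also have "\<dots> = \<epsilon> powr \<gamma> * (\<Prod>k\<in>UNIV. (1 + \<bar>\<xi> k\<bar>) powr \<gamma>)"
  proof -
    have sq: "(x\<^sup>2) powr (\<gamma> / 2) = x powr \<gamma>" if "x > 0" for x :: real
      using that by (simp add: powr_powr flip: powr_numeral)
    have "(\<Prod>k\<in>UNIV. (1 + \<bar>\<xi> k\<bar>)\<^sup>2) powr (\<gamma> / 2) = (\<Prod>k\<in>UNIV. (1 + \<bar>\<xi> k\<bar>) powr \<gamma>)"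
      unfolding prod_powr_distrib by (intro prod.cong refl sq) auto
    then show ?thesis using sq[OF \<epsilon>] by (simp add: powr_mult prod_nonneg)
  qed
  finally have main: "\<bar>exp (- q / 2) - exp (- q / 8)\<bar> \<le> \<epsilon> powr \<gamma> * (\<Prod>k\<in>UNIV. (1 + \<bar>\<xi> k\<bar>) powr \<gamma>)" .
  have "(1::real) \<le> (2 * pi) ^ CARD('d)" using pi_gt3 by (intro one_le_power) auto
  then have "\<bar>mollifier_diff_ft \<epsilon> \<xi>\<bar> \<le> \<bar>exp (- q / 2) - exp (- q / 8)\<bar> / 1"
    unfolding eq abs_divide by (intro divide_left_mono) auto
  then show ?thesis using main by simp
qed

text \<open>\<open>is_LMSS\<close> attaches coefficients to pairs of a component and a time, not to
  indices, so the points \<open>s j\<close> must be distinct; the inverse of s on the index range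
  recovers the coefficient.\<close>

lemma expectation_cis_lmss:
  fixes X :: "'d::finite \<Rightarrow> real^'n \<Rightarrow> 'w \<Rightarrow> real"
  assumes X: "is_LMSS M \<alpha> H X" and s: "inj_on s {..<p}" "\<And>j. j < p \<Longrightarrow> s j \<in> nonneg_orthant"
  shows "(LINT w|M. cis (\<Sum>j<p. \<Sum>k\<in>UNIV. \<xi> j k * X k (s j) w)) =
    complex_of_real (\<Prod>k\<in>UNIV. exp (- lmss_form \<alpha> H p s (\<lambda>j. \<xi> j k)))"
proof -
  define S where "S = (UNIV :: 'd set) \<times> s ` {..<p}"
  define a where "a = (\<lambda>(k, u). \<xi> (the_inv_into {..<p} s u) k)"
  have S: "finite S" "S \<subseteq> UNIV \<times> nonneg_orthant" using s by (auto simp: S_def)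
  have inv: "the_inv_into {..<p} s (s j) = j" if "j < p" for j
    using the_inv_into_f_f[OF s(1)] that by auto
  have "(\<Sum>(k,u)\<in>S. a (k,u) * X k u w) = (\<Sum>j<p. \<Sum>k\<in>UNIV. \<xi> j k * X k (s j) w)" for w
    unfolding S_def sum.cartesian_product[symmetric]
    by (subst sum.swap) (simp add: sum.reindex[OF s(1)] a_def inv)
  moreover have "{u. (k, u) \<in> S} = s ` {..<p}" for k by (auto simp: S_def)
  moreover have "(\<Sum>u\<in>s ` {..<p}. a (k,u) * lmss_kernel \<alpha> H u v) = (\<Sum>j<p. \<xi> j k * lmss_kernel \<alpha> H (s j) v)" for k v
    by (simp add: sum.reindex[OF s(1)] a_def inv)
  moreover have "(LINT w|M. cis (\<Sum>(k,u)\<in>S. a (k,u) * X k u w)) = complex_of_real (\<Prod>k\<in>UNIV.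
      exp (- (LINT v|lborel. \<bar>\<Sum>u\<in>{u. (k,u) \<in> S}. a (k,u) * lmss_kernel \<alpha> H u v\<bar> powr \<alpha>)))"
    using X S unfolding is_LMSS_def by blast
  ultimately show ?thesis unfolding lmss_form_def by simp
qed

lemma PiM_coord_measurable:
  "j \<in> K \<Longrightarrow> (\<lambda>\<xi>. \<xi> j k) \<in> borel_measurable (PiM K (\<lambda>_. coord_measure :: ('d::finite \<Rightarrow> real) measure))"
  using measurable_compose[OF measurable_component_singleton[of j K "\<lambda>_. coord_measure :: ('d \<Rightarrow> real) measure"]
    coord_measurable[of k]] by simp

lemma mollifier_diff_ft_measurable [measurable]:
  "mollifier_diff_ft \<epsilon> \<in> borel_measurable (coord_measure :: ('d::finite \<Rightarrow> real) measure)"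
  unfolding mollifier_diff_ft_def[abs_def] mollifier_ft_def by measurable

lemma is_LMSS_measurable:
  fixes X :: "'d::finite \<Rightarrow> real^'n \<Rightarrow> 'w \<Rightarrow> real"
  assumes "is_LMSS M \<alpha> H X"
  shows "X k u \<in> borel_measurable M"
proof -
  have "(\<lambda>(u,w). X k u w) \<in> borel_measurable (lborel \<Otimes>\<^sub>M M)" using assms by (auto simp: is_LMSS_def)
  from measurable_Pair2[OF this, of u] show ?thesis by simp
qed

text \<open>Fourier inversion at each of the p times, and Fubini. The level x contributes only a
  factor of modulus 1, which makes the bound uniform in x; independence of the components appears as
  the product over k.\<close>

lemma expectation_prod_mollifier_diff_le:
  fixes X :: "'d::finite \<Rightarrow> real^'n \<Rightarrow> 'w \<Rightarrow> real" and p :: nat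
  assumes X: "is_LMSS M \<alpha> H X" and s: "inj_on s {..<p}" "\<And>j. j < p \<Longrightarrow> s j \<in> nonneg_orthant" and \<epsilon>: "\<epsilon> > 0"
  shows "ennreal \<bar>(LINT w|M. (\<Prod>j<p. mollifier_diff \<epsilon> (path_val X (s j) w - x)))\<bar> \<le>
    (\<integral>\<^sup>+ \<xi>. ennreal ((\<Prod>j<p. \<bar>mollifier_diff_ft \<epsilon> (\<xi> j)\<bar>) * (\<Prod>k\<in>UNIV. exp (- lmss_form \<alpha> H p s (\<lambda>j. \<xi> j k))))
      \<partial>PiM {..<p} (\<lambda>_. coord_measure :: ('d \<Rightarrow> real) measure))"
proof -
  interpret M: prob_space M using X by (simp add: is_LMSS_def)
  interpret P: product_sigma_finite "\<lambda>_::nat. coord_measure :: ('d \<Rightarrow> real) measure" by (rule product_sigma_finite_coord)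
  let ?P = "PiM {..<p} (\<lambda>_. coord_measure :: ('d \<Rightarrow> real) measure)"
  interpret PS: sigma_finite_measure ?P by (rule P.sigma_finite) simp
  interpret MP: pair_sigma_finite M ?P ..
  note [measurable] = is_LMSS_measurable[OF X]
  define A where "A \<xi> = (\<Prod>j<p. mollifier_diff_ft \<epsilon> (\<xi> j))" for \<xi> :: "nat \<Rightarrow> 'd \<Rightarrow> real"
  define \<theta> where "\<theta> w \<xi> = (\<Sum>j<p. \<Sum>k\<in>UNIV. \<xi> j k * (X k (s j) w - x $ k))" for w and \<xi> :: "nat \<Rightarrow> 'd \<Rightarrow> real"
  define f where "f w \<xi> = complex_of_real (A \<xi>) * cis (\<theta> w \<xi>)" for w \<xi>
  have A_int: "integrable ?P A"
    unfolding A_def[abs_def] using mollifier_diff_fourier(2)[OF \<epsilon>] by (intro P.product_integrable_prod) auto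
  then have [measurable]: "A \<in> borel_measurable ?P" by simp
  have coord: "(\<lambda>z. snd z j k) \<in> borel_measurable (M \<Otimes>\<^sub>M ?P)" if "j \<in> {..<p}" for j k
    by (rule measurable_compose[OF measurable_snd PiM_coord_measurable[OF that]])
  have \<theta>_m [measurable]: "(\<lambda>z. \<theta> (fst z) (snd z)) \<in> borel_measurable (M \<Otimes>\<^sub>M ?P)"
    unfolding \<theta>_def by (intro borel_measurable_sum borel_measurable_times borel_measurable_diff coord) measurable
  have f_m [measurable]: "(\<lambda>(w, \<xi>). f w \<xi>) \<in> borel_measurable (M \<Otimes>\<^sub>M ?P)"
    unfolding f_def split_beta' cis_conv_exp by measurable
  have nf: "norm (f w \<xi>) = \<bar>A \<xi>\<bar>" for w \<xi> by (simp add: f_def norm_mult)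
  have f_int: "integrable (M \<Otimes>\<^sub>M ?P) (\<lambda>(w, \<xi>). f w \<xi>)"
  proof (rule MP.Fubini_integrable[OF f_m])
    show "integrable M (\<lambda>w. LINT \<xi>|?P. norm (case (w, \<xi>) of (w, \<xi>) \<Rightarrow> f w \<xi>))" by (simp add: nf)
    have "(\<theta> w) \<in> borel_measurable ?P" for w
      unfolding \<theta>_def[abs_def]
      by (intro borel_measurable_sum borel_measurable_times PiM_coord_measurable borel_measurable_const)
    then show "AE w in M. integrable ?P (\<lambda>\<xi>. case (w, \<xi>) of (w, \<xi>) \<Rightarrow> f w \<xi>)"
      by (simp add: f_def integrable_times_cis A_int)
  qed
  have prod_eq: "complex_of_real (\<Prod>j<p. mollifier_diff \<epsilon> (path_val X (s j) w - x)) = (LINT \<xi>|?P. f w \<xi>)" for w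
  proof -
    let ?y = "\<lambda>j. path_val X (s j) w - x"
    have "complex_of_real (\<Prod>j<p. mollifier_diff \<epsilon> (?y j)) =
      (\<Prod>j<p. (LINT \<xi>|coord_measure. complex_of_real (mollifier_diff_ft \<epsilon> \<xi>) * cis (\<Sum>k\<in>UNIV. \<xi> k * ?y j $ k)))"
      unfolding of_real_prod mollifier_diff_fourier(1)[OF \<epsilon>] ..
    also have "\<dots> = (LINT \<xi>|?P. (\<Prod>j<p. complex_of_real (mollifier_diff_ft \<epsilon> (\<xi> j)) * cis (\<Sum>k\<in>UNIV. \<xi> j k * ?y j $ k)))"
      by (rule P.product_integral_prod[symmetric]) (auto intro!: integrable_times_cis mollifier_diff_fourier(2)[OF \<epsilon>])
    also have "\<dots> = (LINT \<xi>|?P. f w \<xi>)"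
      by (simp add: f_def A_def \<theta>_def prod.distrib prod_cis path_val_def)
    finally show ?thesis .
  qed
  have expf: "norm (LINT w|M. f w \<xi>) = (\<Prod>j<p. \<bar>mollifier_diff_ft \<epsilon> (\<xi> j)\<bar>) * (\<Prod>k\<in>UNIV. exp (- lmss_form \<alpha> H p s (\<lambda>j. \<xi> j k)))" for \<xi>
  proof -
    let ?c = "\<Sum>j<p. \<Sum>k\<in>UNIV. \<xi> j k * x $ k"
    let ?t = "\<lambda>w. \<Sum>j<p. \<Sum>k\<in>UNIV. \<xi> j k * X k (s j) w"
    have "f w \<xi> = complex_of_real (A \<xi>) * cis (- ?c) * cis (?t w)" for w
      unfolding f_def \<theta>_def by (simp add: cis_mult right_diff_distrib sum_subtractf mult.assoc)
    then have "(LINT w|M. f w \<xi>) = complex_of_real (A \<xi>) * cis (- ?c) * (LINT w|M. cis (?t w))"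
      by simp
    also have "\<dots> = complex_of_real (A \<xi>) * cis (- ?c) * complex_of_real (\<Prod>k\<in>UNIV. exp (- lmss_form \<alpha> H p s (\<lambda>j. \<xi> j k)))"
      by (rule arg_cong[OF expectation_cis_lmss[OF X s]]) simp
    finally show ?thesis
      by (simp add: norm_mult A_def abs_prod prod_norm[symmetric])
  qed
  have "complex_of_real (LINT w|M. (\<Prod>j<p. mollifier_diff \<epsilon> (path_val X (s j) w - x))) = (LINT w|M. LINT \<xi>|?P. f w \<xi>)"
    by (simp only: prod_eq[symmetric] integral_complex_of_real)
  also have "\<dots> = (LINT \<xi>|?P. LINT w|M. f w \<xi>)"
    by (rule MP.Fubini_integral[OF f_int, symmetric])
  finally have "norm (LINT w|M. (\<Prod>j<p. mollifier_diff \<epsilon> (path_val X (s j) w - x))) = norm (LINT \<xi>|?P. LINT w|M. f w \<xi>)"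
    by (metis norm_of_real real_norm_def)
  then have "ennreal \<bar>(LINT w|M. (\<Prod>j<p. mollifier_diff \<epsilon> (path_val X (s j) w - x)))\<bar> = ennreal (norm (LINT \<xi>|?P. LINT w|M. f w \<xi>))"
    by simp
  also have "\<dots> \<le> (\<integral>\<^sup>+ \<xi>. norm (LINT w|M. f w \<xi>) \<partial>?P)"
  proof (rule integral_norm_bound_ennreal)
    show "integrable ?P (\<lambda>\<xi>. LINT w|M. f w \<xi>)" using MP.integrable_snd[OF f_int] by simp
  qed
  finally show ?thesis unfolding expf .
qed

text \<open>Inserting \<eta> keeps the set nonempty when there is nothing to compare with, and caps
  the gap as the nondeterminism estimate demands.\<close>

lemma Min_insert_powr_le:
  fixes f :: "'i \<Rightarrow> real"
  assumes "finite A" "0 < \<eta>" "\<And>i. i \<in> A \<Longrightarrow> 0 < f i"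
  shows "0 < Min (insert \<eta> (f ` A))" "Min (insert \<eta> (f ` A)) \<le> \<eta>" "\<And>i. i \<in> A \<Longrightarrow> Min (insert \<eta> (f ` A)) \<le> f i"
    and "Min (insert \<eta> (f ` A)) powr (- \<beta>) \<le> \<eta> powr (- \<beta>) + (\<Sum>i\<in>A. f i powr (- \<beta>))"
proof -
  let ?m = "Min (insert \<eta> (f ` A))"
  have "?m \<in> insert \<eta> (f ` A)" using assms(1) by (intro Min_in) auto
  then consider "?m = \<eta>" | i where "i \<in> A" "?m = f i" by blast
  then show "?m powr (- \<beta>) \<le> \<eta> powr (- \<beta>) + (\<Sum>i\<in>A. f i powr (- \<beta>))"
  proof cases
    case 1
    have "0 \<le> (\<Sum>i\<in>A. f i powr (- \<beta>))" by (intro sum_nonneg) auto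
    then show ?thesis unfolding 1 by simp
  next
    case 2
    have "f i powr (- \<beta>) \<le> (\<Sum>i\<in>A. f i powr (- \<beta>))" using assms(1) 2 by (intro member_le_sum) auto
    then show ?thesis unfolding 2(2) by (intro add_increasing) auto
  qed
qed (use assms in auto)

text \<open>Young's inequality for the conjugate exponents 1 + \<kappa> and 1 + 1/\<kappa>, without
  constants: comparing b with \<open>a powr \<kappa>\<close> tells which term dominates.\<close>

lemma mult_le_powr_add_powr:
  fixes a b \<kappa> :: real
  assumes "0 < a" "0 < b" "0 < \<kappa>"
  shows "a * b \<le> a powr (1 + \<kappa>) + b powr (1 + 1 / \<kappa>)"
proof (cases "b \<le> a powr \<kappa>")
  case True
  then have "a * b \<le> a * a powr \<kappa>" using assms by (intro mult_left_mono) auto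
  also have "\<dots> = a powr (1 + \<kappa>)" using assms by (simp add: powr_add)
  finally show ?thesis by (simp add: add_increasing2)
next
  case False
  then have "(a powr \<kappa>) powr (1 / \<kappa>) \<le> b powr (1 / \<kappa>)" using assms by (intro powr_mono2) auto
  then have "a \<le> b powr (1 / \<kappa>)" using assms by (simp add: powr_powr)
  then have "a * b \<le> b powr (1 / \<kappa>) * b" using assms by (intro mult_right_mono) auto
  also have "\<dots> = b powr (1 + 1 / \<kappa>)" using assms by (simp add: powr_add mult.commute)
  finally show ?thesis by (simp add: add_increasing)
qed

lemma inv_dist_prod_ge:
  fixes s :: "nat \<Rightarrow> real^'n"
  assumes K: "finite K" and \<eta>: "0 < \<eta>" and distinct: "\<And>i j l. i \<in> K \<Longrightarrow> j \<in> K \<Longrightarrow> R i j \<Longrightarrow> s i $ l \<noteq> s j $ l"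
  shows "ennreal (\<Prod>j\<in>K. \<Prod>l\<in>UNIV. Min (insert \<eta> ((\<lambda>i. \<bar>s j $ l - s i $ l\<bar>) ` {i\<in>K. R i j})) powr (- \<beta>))
    \<le> inv_dist_prod R \<beta> \<eta> K s"
proof -
  let ?m = "\<lambda>j l. Min (insert \<eta> ((\<lambda>i. \<bar>s j $ l - s i $ l\<bar>) ` {i\<in>K. R i j}))"
  have "(\<Prod>j\<in>K. \<Prod>l\<in>UNIV. ?m j l powr (- \<beta>)) \<le>
    (\<Prod>j\<in>K. \<Prod>l\<in>UNIV. \<eta> powr (- \<beta>) + (\<Sum>i\<in>{i\<in>K. R i j}. \<bar>s j $ l - s i $ l\<bar> powr (- \<beta>)))"
    (is "_ \<le> ?r")
  proof (intro prod_mono conjI prod_nonneg)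
    fix j l assume j: "j \<in> K"
    show "?m j l powr (- \<beta>) \<le> \<eta> powr (- \<beta>) + (\<Sum>i\<in>{i\<in>K. R i j}. \<bar>s j $ l - s i $ l\<bar> powr (- \<beta>))"
    proof (rule Min_insert_powr_le(4))
      show "0 < \<bar>s j $ l - s i $ l\<bar>" if "i \<in> {i \<in> K. R i j}" for i using distinct[of i j l] that j by auto
    qed (use K \<eta> in auto)
  qed auto
  then have "ennreal (\<Prod>j\<in>K. \<Prod>l\<in>UNIV. ?m j l powr (- \<beta>)) \<le> ennreal ?r" by (rule ennreal_leI)
  also have "\<dots> = (\<Prod>j\<in>K. \<Prod>l\<in>UNIV. ennreal (\<eta> powr (- \<beta>)) + (\<Sum>i\<in>{i\<in>K. R i j}. ennreal (\<bar>s j $ l - s i $ l\<bar> powr (- \<beta>))))"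
    by (simp add: prod_ennreal[symmetric] prod_nonneg sum_nonneg add_nonneg_nonneg ennreal_plus sum_ennreal)
  also have "\<dots> = inv_dist_prod R \<beta> \<eta> K s"
    unfolding inv_dist_prod_def
  proof (intro prod.cong refl arg_cong2[where f = "(+)"] sum.cong)
    fix j l i assume "j \<in> K" "i \<in> {i \<in> K. R i j}"
    then show "ennreal (\<bar>s j $ l - s i $ l\<bar> powr (- \<beta>)) = inv_dist \<beta> (s j $ l - s i $ l)"
      using distinct[of i j l] by (auto simp: inv_dist_def)
  qed
  finally show ?thesis .
qed

text \<open>\<open>inv_dist\<close> is \<open>\<top>\<close> at 0, where the real power would be 0
  by convention. Configurations with a common coordinate thus make the majorant infinite and satisfy
  the moment estimate trivially; being a null set they do not disturb the integrals.\<close>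

lemma inv_dist_prod_eq_top:
  fixes s :: "nat \<Rightarrow> real^'n"
  assumes "finite K" "0 < \<eta>" "i \<in> K" "j \<in> K" "R i j" "s i $ l = s j $ l"
  shows "inv_dist_prod R \<beta> \<eta> K s = \<top>"
proof -
  let ?f = "\<lambda>j l. ennreal (\<eta> powr (- \<beta>)) + (\<Sum>i\<in>{i\<in>K. R i j}. inv_dist \<beta> (s j $ l - s i $ l))"
  \<comment> \<open>The cap \<eta> keeps every factor nonzero, so the infinite one is not
    annihilated by \<open>0 * \<top> = 0\<close>.\<close>
  have nz: "?f j l \<noteq> 0" for j l using assms(2) by (simp add: add_eq_0_iff_both_eq_0)
  have "(\<Sum>i\<in>{i\<in>K. R i j}. inv_dist \<beta> (s j $ l - s i $ l)) = \<top>"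
    using assms by (auto simp: ennreal_sum_eq_top inv_dist_def intro!: bexI[of _ i])
  then have "?f j l = \<top>" by simp
  then have "(\<Prod>l\<in>UNIV. ?f j l) = \<top>" using nz by (auto simp: ennreal_prod_eq_top)
  then show ?thesis unfolding inv_dist_prod_def using assms nz by (auto simp: ennreal_prod_eq_top)
qed

text \<open>The Jacobian of the triangular substitution involves only the distances to earlier points, the growth of the single
  frequencies involves all distances. Young's inequality with \<open>\<kappa>\<close> separates the distances to later points, so that each
  summand can be integrated one variable at a time.\<close>

lemma expectation_prod_mollifier_diff_bound:
  fixes X :: "'d::finite \<Rightarrow> real^'n \<Rightarrow> 'w \<Rightarrow> real" and p :: nat and e T S \<gamma> \<kappa> :: real
  assumes X: "is_LMSS M \<alpha> H X" and \<alpha>: "0 < \<alpha>" "\<alpha> \<le> 2" and e: "0 < e" and S: "0 < S"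
    and H: "\<And>u l. u \<in> nonneg_orthant \<Longrightarrow> 0 < H u $ l \<and> H u $ l < 1"
    and SH: "\<And>u. u \<in> cbox (\<chi> l. e) (\<chi> l. T) \<Longrightarrow> S \<le> (\<Sum>l\<in>UNIV. 1 / H u $ l)"
    and \<gamma>: "0 < \<gamma>" "\<gamma> \<le> 1" and \<kappa>: "0 < \<kappa>"
  shows "\<exists>K>0. \<forall>\<epsilon> x s. 0 < \<epsilon> \<and> (\<forall>j<p. s j \<in> cbox (\<chi> l. e) (\<chi> l. T)) \<longrightarrow>
    ennreal \<bar>(LINT w|M. (\<Prod>j<p. mollifier_diff \<epsilon> (path_val X (s j) w - x)))\<bar> \<le>
    ennreal (K * \<epsilon> powr (\<gamma> * p)) *
      (inv_dist_prod (<) (CARD('d) / S * (1 + \<gamma>) * (1 + \<kappa>)) (min 1 (e / 2)) {..<p} s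
      + inv_dist_prod (>) (CARD('d) / S * \<gamma> * (1 + 1 / \<kappa>)) (min 1 (e / 2)) {..<p} s)"
proof -
  let ?d = "real CARD('d)"
  define \<eta> where "\<eta> = min 1 (e / 2)"
  have \<eta>: "0 < \<eta>" "\<eta> \<le> 1" "\<eta> \<le> e / 2" using e by (auto simp: \<eta>_def)
  define \<beta>1 where "\<beta>1 = ?d / S * (1 + \<gamma>)"
  define \<beta>2 where "\<beta>2 = ?d / S * \<gamma>"
  have "\<exists>c>0. \<forall>s x j \<delta>. j < p \<and> (\<forall>i<p. s i \<in> cbox (\<chi> l. e) (\<chi> l. T)) \<and>
    (\<forall>l. 0 < \<delta> l \<and> \<delta> l \<le> 1 \<and> \<delta> l \<le> e / 2) \<and> (\<forall>i<p. i \<noteq> j \<longrightarrow> x i \<noteq> 0 \<longrightarrow> (\<forall>l. \<delta> l \<le> \<bar>s i $ l - s j $ l\<bar>)) \<longrightarrow>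
    c * (\<Prod>l\<in>UNIV. \<delta> l) powr (\<alpha> / S) * \<bar>x j\<bar> powr \<alpha> \<le> lmss_form \<alpha> H p s x"
    by (rule lmss_form_ge[OF \<alpha> e S]) (use H SH in auto)
  then obtain c where c: "c > 0" and low0: "\<forall>s x j \<delta>. j < p \<and> (\<forall>i<p. s i \<in> cbox (\<chi> l. e) (\<chi> l. T)) \<and>
    (\<forall>l. 0 < \<delta> l \<and> \<delta> l \<le> 1 \<and> \<delta> l \<le> e / 2) \<and> (\<forall>i<p. i \<noteq> j \<longrightarrow> x i \<noteq> 0 \<longrightarrow> (\<forall>l. \<delta> l \<le> \<bar>s i $ l - s j $ l\<bar>)) \<longrightarrow>
    c * (\<Prod>l\<in>UNIV. \<delta> l) powr (\<alpha> / S) * \<bar>x j\<bar> powr \<alpha> \<le> lmss_form \<alpha> H p s x"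
    by (elim exE conjE)
  have low: "c * (\<Prod>l\<in>UNIV. \<delta> l) powr (\<alpha> / S) * \<bar>x j\<bar> powr \<alpha> \<le> lmss_form \<alpha> H p s x"
    if "j < p" "\<forall>i<p. s i \<in> cbox (\<chi> l. e) (\<chi> l. T)" "\<forall>l. 0 < \<delta> l \<and> \<delta> l \<le> 1 \<and> \<delta> l \<le> e / 2"
      "\<forall>i<p. i \<noteq> j \<longrightarrow> x i \<noteq> 0 \<longrightarrow> (\<forall>l. \<delta> l \<le> \<bar>s i $ l - s j $ l\<bar>)"
    for s x j and \<delta> :: "'n \<Rightarrow> real"
    by (rule low0[THEN spec[of _ s], THEN spec[of _ x], THEN spec[of _ j], THEN spec[of _ \<delta>], THEN mp])
      (intro conjI that)
  obtain K where K: "K > 0" and freq0: "\<forall>(Q :: (nat \<Rightarrow> real) \<Rightarrow> real) dp da.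
    (\<forall>x. 0 \<le> Q x) \<and> (\<forall>t x. Q (\<lambda>i. t * x i) = \<bar>t\<bar> powr \<alpha> * Q x) \<and> (\<forall>x y. Q (\<lambda>i. x i + y i) \<le> 4 * (Q x + Q y)) \<and>
    (\<forall>x. Q (\<lambda>i. if i < p then x i else 0) = Q x) \<and> (\<forall>j<p. 0 < dp j) \<and> (\<forall>j<p. 0 < da j \<and> da j \<le> 1) \<and>
    (\<forall>j<p. \<forall>x. (\<forall>i>j. x i = 0) \<longrightarrow> c * (dp j * \<bar>x j\<bar>) powr \<alpha> \<le> Q x) \<and>
    (\<forall>j<p. \<forall>x. c * (da j * \<bar>x j\<bar>) powr \<alpha> \<le> Q x) \<longrightarrow>
    (\<integral>\<^sup>+ \<xi>. ennreal (\<Prod>k\<in>UNIV. (\<Prod>j<p. (1 + \<bar>\<xi> j k\<bar>) powr \<gamma>) * exp (- Q (\<lambda>j. \<xi> j k)))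
      \<partial>PiM {..<p} (\<lambda>_. coord_measure :: ('d::finite \<Rightarrow> real) measure)) \<le>
    ennreal (K * (\<Prod>j<p. (1 / dp j) ^ CARD('d) * da j powr (- \<gamma> * CARD('d))))"
    using frequency_integral_le[OF \<alpha>(1) c less_imp_le[OF \<gamma>(1)], where p = p and 'd = 'd] by (elim exE conjE)
  show ?thesis
  proof (intro exI[of _ K] conjI K allI impI, elim conjE)
    fix \<epsilon> :: real and x :: "real^'d" and s :: "nat \<Rightarrow> real^'n"
    assume \<epsilon>: "0 < \<epsilon>" and s: "\<forall>j<p. s j \<in> cbox (\<chi> l. e) (\<chi> l. T)"
    have sn: "s j \<in> nonneg_orthant" if "j < p" for j
    proof -
      have "e \<le> s j $ l" for l using s that by (auto simp: mem_box_cart)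
      then show ?thesis using e by (auto simp: nonneg_orthant_def intro: order_trans[OF less_imp_le])
    qed
    have sn0: "0 \<le> s j $ l" if "j < p" for j l using sn[OF that] by (auto simp: nonneg_orthant_def)
    let ?A1 = "inv_dist_prod (<) (\<beta>1 * (1 + \<kappa>)) \<eta> {..<p} s" and ?A2 = "inv_dist_prod (>) (\<beta>2 * (1 + 1 / \<kappa>)) \<eta> {..<p} s"
    have "ennreal \<bar>(LINT w|M. (\<Prod>j<p. mollifier_diff \<epsilon> (path_val X (s j) w - x)))\<bar> \<le>
      ennreal (K * \<epsilon> powr (\<gamma> * p)) * (?A1 + ?A2)"
    \<comment> \<open>If two points share a coordinate the right-hand side is infinite. Otherwise
      all gaps are positive and the times are distinct, as the formula for the characteristic
      function requires.\<close>
    proof (cases "\<exists>i j l. i < j \<and> j < p \<and> s i $ l = s j $ l")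
      case True
      then obtain i j l where "i < j" "j < p" "s i $ l = s j $ l" by blast
      then have "?A1 = \<top>" using \<eta> by (intro inv_dist_prod_eq_top[of _ _ i j]) auto
      then show ?thesis using K \<epsilon> by (simp add: ennreal_mult_top)
    next
      case False
      have distinct: "s i $ l \<noteq> s j $ l" if "i \<noteq> j" "i < p" "j < p" for i j l
      proof (cases "i < j")
        case True
        then show ?thesis using False that by blast
      next
        case ij: False
        then have "s j $ l \<noteq> s i $ l" using False that by (metis linorder_neqE_nat)
        then show ?thesis by simp
      qed
      have inj: "inj_on s {..<p}"
        by (rule inj_onI) (metis distinct lessThan_iff)
      define mp where "mp j l = Min (insert \<eta> ((\<lambda>i. \<bar>s j $ l - s i $ l\<bar>) ` {i\<in>{..<p}. i < j}))" for j l
      define mf where "mf j l = Min (insert \<eta> ((\<lambda>i. \<bar>s j $ l - s i $ l\<bar>) ` {i\<in>{..<p}. i > j}))" for j l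
      have mpb: "0 < mp j l" "mp j l \<le> \<eta>" "\<And>i. i < j \<Longrightarrow> mp j l \<le> \<bar>s j $ l - s i $ l\<bar>" if "j < p" for j l
        unfolding mp_def using \<eta> distinct that by (auto intro!: Min_insert_powr_le(1,2,3))
      have mfb: "0 < mf j l" "mf j l \<le> \<eta>" "\<And>i. j < i \<Longrightarrow> i < p \<Longrightarrow> mf j l \<le> \<bar>s j $ l - s i $ l\<bar>" if "j < p" for j l
        unfolding mf_def using \<eta> distinct that by (auto intro!: Min_insert_powr_le(1,2,3))
      define P where "P j = (\<Prod>l\<in>UNIV. mp j l)" for j
      define F where "F j = (\<Prod>l\<in>UNIV. mf j l)" for j
      have P: "0 < P j" "P j \<le> 1" if "j < p" for j
      proof -
        show "0 < P j" unfolding P_def by (rule prod_pos) (use mpb[OF that] in blast)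
        show "P j \<le> 1" unfolding P_def
          by (rule prod_le_1) (use mpb(1,2)[OF that] \<eta> in \<open>auto intro: order_trans less_imp_le\<close>)
      qed
      have F: "0 < F j" "F j \<le> 1" if "j < p" for j
      proof -
        show "0 < F j" unfolding F_def by (rule prod_pos) (use mfb[OF that] in blast)
        show "F j \<le> 1" unfolding F_def
          by (rule prod_le_1) (use mfb(1,2)[OF that] \<eta> in \<open>auto intro: order_trans less_imp_le\<close>)
      qed
      \<comment> \<open>The exponent \<open>1 / S\<close> makes
        \<open>(dp j * \<bar>x j\<bar>) powr \<alpha>\<close> match the lower bound of
        \<open>lmss_form_ge\<close>; dp uses the gaps to smaller indices, da those to all other
        indices.\<close>
      define dp where "dp j = P j powr (1 / S)" for j
      define da where "da j = (P j * F j) powr (1 / S)" for j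
      have PF: "0 < P j * F j" "P j * F j \<le> 1" if "j < p" for j
        using P[OF that] F[OF that] by (auto intro: mult_le_one)
      let ?Q = "lmss_form \<alpha> H p s"
      have bound: "(\<integral>\<^sup>+ \<xi>. ennreal (\<Prod>k\<in>UNIV. (\<Prod>j<p. (1 + \<bar>\<xi> j k\<bar>) powr \<gamma>) * exp (- ?Q (\<lambda>j. \<xi> j k)))
        \<partial>PiM {..<p} (\<lambda>_. coord_measure :: ('d::finite \<Rightarrow> real) measure)) \<le>
        ennreal (K * (\<Prod>j<p. (1 / dp j) ^ CARD('d) * da j powr (- \<gamma> * CARD('d))))"
      proof (rule freq0[THEN spec[of _ ?Q], THEN spec[of _ dp], THEN spec[of _ da], THEN mp], intro conjI allI impI)
        show "?Q (\<lambda>i. x i + y i) \<le> 4 * (?Q x + ?Q y)" for x y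
          using H[OF sn] sn0 by (intro lmss_form_add[OF \<alpha>]) auto
        show "?Q (\<lambda>i. if i < p then x i else 0) = ?Q x" for x
          unfolding lmss_form_def by (intro Bochner_Integration.integral_cong refl arg_cong[where f = "\<lambda>t. \<bar>t\<bar> powr \<alpha>"] sum.cong) auto
        show "da j \<le> 1" if "j < p" for j unfolding da_def using PF[OF that] S by (intro powr_le1) auto
        fix j x assume j: "j < p"
        show "c * (da j * \<bar>x j\<bar>) powr \<alpha> \<le> ?Q x"
        proof -
          \<comment> \<open>Both gaps are at most 1, so their product lies below each and is an
            admissible gap to all other points. Unlike the minimum it splits into the factors P and
            F.\<close>
          have le: "mp j l * mf j l \<le> mp j l" "mp j l * mf j l \<le> mf j l" for l
            using mpb(1,2)[OF j, of l] mfb(1,2)[OF j, of l] \<eta> by (auto simp: mult_le_cancel_left2 mult_le_cancel_right2)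
          have "c * (\<Prod>l\<in>UNIV. mp j l * mf j l) powr (\<alpha> / S) * \<bar>x j\<bar> powr \<alpha> \<le> ?Q x"
          proof (rule low[OF j s], intro allI conjI, goal_cases)
            case (1 l) then show ?case using mpb(1,2)[OF j, of l] mfb(1,2)[OF j, of l] by simp
          next
            case (2 l) then show ?case using le[of l] mpb(1,2)[OF j, of l] \<eta> by linarith
          next
            case (3 l) then show ?case using le[of l] mpb(1,2)[OF j, of l] \<eta> by linarith
          next
            case 4
            show ?case
            proof (intro allI impI)
              fix i l assume i: "i < p" "i \<noteq> j"
              show "mp j l * mf j l \<le> \<bar>s i $ l - s j $ l\<bar>"
                using le[of l] mpb(3)[OF j, of i l] mfb(3)[OF j, of i l] i by (cases "i < j") (auto simp: abs_minus_commute)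
            qed
          qed
          moreover have "(\<Prod>l\<in>UNIV. mp j l * mf j l) = P j * F j" by (simp add: P_def F_def prod.distrib)
          ultimately show ?thesis using PF[OF j] by (simp add: da_def powr_mult powr_powr mult.assoc)
        qed
        show "c * (dp j * \<bar>x j\<bar>) powr \<alpha> \<le> ?Q x" if x: "\<forall>i>j. x i = 0"
        proof -
          have "c * (\<Prod>l\<in>UNIV. mp j l) powr (\<alpha> / S) * \<bar>x j\<bar> powr \<alpha> \<le> ?Q x"
          proof (rule low[OF j s], intro allI conjI, goal_cases)
            case (1 l) then show ?case using mpb(1,2)[OF j, of l] by simp
          next
            case (2 l) then show ?case using mpb(1,2)[OF j, of l] \<eta> by linarith
          next
            case (3 l) then show ?case using mpb(1,2)[OF j, of l] \<eta> by linarith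
          next
            case 4
            show ?case
            proof (intro allI impI)
              fix i l assume i: "i < p" "i \<noteq> j" "x i \<noteq> 0"
              then have "i < j" using x by (metis linorder_neqE_nat)
              then show "mp j l \<le> \<bar>s i $ l - s j $ l\<bar>" using mpb(3)[OF j, of i l] by (simp add: abs_minus_commute)
            qed
          qed
          then show ?thesis using P[OF j] by (simp add: dp_def powr_mult powr_powr mult.assoc P_def)
        qed
      qed (use P F PF in \<open>auto simp: lmss_form_nonneg lmss_form_scale dp_def da_def less_imp_neq[symmetric] dest: less_imp_neq\<close>)
      define A where "A = (\<Prod>j<p. P j powr (- \<beta>1))"
      define B where "B = (\<Prod>j<p. F j powr (- \<beta>2))"
      \<comment> \<open>The Jacobian contributes P to the power -d/S and the weights contribute P *
        F to the power -d\<gamma>/S, with d the number of components; this is the origin of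
        \<open>\<beta>1\<close> and \<open>\<beta>2\<close>.\<close>
      have AB: "(\<Prod>j<p. (1 / dp j) ^ CARD('d) * da j powr (- \<gamma> * CARD('d))) = A * B"
        unfolding A_def B_def prod.distrib[symmetric]
      proof (intro prod.cong refl)
        fix j assume "j \<in> {..<p}"
        then have j: "P j > 0" "F j > 0" using P F by auto
        have "(1 / dp j) ^ CARD('d) = P j powr (- (?d / S))"
          using j by (simp add: dp_def powr_minus_divide[symmetric] powr_power)
        moreover have "da j powr (- \<gamma> * CARD('d)) = P j powr (- \<beta>2) * F j powr (- \<beta>2)"
          using j by (simp add: da_def powr_powr powr_mult \<beta>2_def mult_ac)
        moreover have "P j powr (- (?d / S)) * P j powr (- \<beta>2) = P j powr (- \<beta>1)"
          by (simp add: powr_add[symmetric] \<beta>1_def \<beta>2_def algebra_simps add_divide_distrib)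
        ultimately show "(1 / dp j) ^ CARD('d) * da j powr (- \<gamma> * CARD('d)) = P j powr (- \<beta>1) * F j powr (- \<beta>2)"
          by (simp add: mult.assoc[symmetric])
      qed
      have ABpos: "0 < A" "0 < B" unfolding A_def B_def
        by (rule prod_pos, metis P(1) lessThan_iff powr_gt_zero less_irrefl)
          (rule prod_pos, metis F(1) lessThan_iff powr_gt_zero less_irrefl)
      have A1: "ennreal (A powr (1 + \<kappa>)) \<le> ?A1"
      proof -
        have "A powr (1 + \<kappa>) = (\<Prod>j<p. \<Prod>l\<in>UNIV. mp j l powr (- (\<beta>1 * (1 + \<kappa>))))"
          unfolding A_def P_def prod_powr_distrib by (intro prod.cong refl) (simp add: powr_powr)
        then show ?thesis unfolding mp_def using \<eta> distinct by (simp only:) (intro inv_dist_prod_ge, auto)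
      qed
      have A2: "ennreal (B powr (1 + 1 / \<kappa>)) \<le> ?A2"
      proof -
        have "B powr (1 + 1 / \<kappa>) = (\<Prod>j<p. \<Prod>l\<in>UNIV. mf j l powr (- (\<beta>2 * (1 + 1 / \<kappa>))))"
          unfolding B_def F_def prod_powr_distrib by (intro prod.cong refl) (simp add: powr_powr)
        then show ?thesis unfolding mf_def using \<eta> distinct by (simp only:) (intro inv_dist_prod_ge, auto)
      qed
      have "ennreal \<bar>(LINT w|M. (\<Prod>j<p. mollifier_diff \<epsilon> (path_val X (s j) w - x)))\<bar> \<le>
        (\<integral>\<^sup>+ \<xi>. ennreal ((\<Prod>j<p. \<bar>mollifier_diff_ft \<epsilon> (\<xi> j)\<bar>) * (\<Prod>k\<in>UNIV. exp (- ?Q (\<lambda>j. \<xi> j k))))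
          \<partial>PiM {..<p} (\<lambda>_. coord_measure :: ('d \<Rightarrow> real) measure))"
        by (rule expectation_prod_mollifier_diff_le[OF X inj sn \<epsilon>])
      also have "\<dots> \<le> (\<integral>\<^sup>+ \<xi>. ennreal (\<epsilon> powr (\<gamma> * p)) * ennreal (\<Prod>k\<in>UNIV. (\<Prod>j<p. (1 + \<bar>\<xi> j k\<bar>) powr \<gamma>) * exp (- ?Q (\<lambda>j. \<xi> j k)))
          \<partial>PiM {..<p} (\<lambda>_. coord_measure :: ('d \<Rightarrow> real) measure))"
      proof (rule nn_integral_mono)
        fix \<xi> :: "nat \<Rightarrow> 'd \<Rightarrow> real"
        have "(\<Prod>j<p. \<bar>mollifier_diff_ft \<epsilon> (\<xi> j)\<bar>) \<le> (\<Prod>j<p. \<epsilon> powr \<gamma> * (\<Prod>k\<in>UNIV. (1 + \<bar>\<xi> j k\<bar>) powr \<gamma>))"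
          using abs_mollifier_diff_ft_le[OF \<epsilon> \<gamma>] by (intro prod_mono) auto
        also have "\<dots> = \<epsilon> powr (\<gamma> * p) * (\<Prod>k\<in>UNIV. \<Prod>j<p. (1 + \<bar>\<xi> j k\<bar>) powr \<gamma>)"
          using \<epsilon> by (subst prod.swap) (simp add: prod.distrib powr_power mult.commute)
        finally have "(\<Prod>j<p. \<bar>mollifier_diff_ft \<epsilon> (\<xi> j)\<bar>) * (\<Prod>k\<in>UNIV. exp (- ?Q (\<lambda>j. \<xi> j k))) \<le>
          \<epsilon> powr (\<gamma> * p) * (\<Prod>k\<in>UNIV. \<Prod>j<p. (1 + \<bar>\<xi> j k\<bar>) powr \<gamma>) * (\<Prod>k\<in>UNIV. exp (- ?Q (\<lambda>j. \<xi> j k)))"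
          by (intro mult_right_mono prod_nonneg) auto
        then show "ennreal ((\<Prod>j<p. \<bar>mollifier_diff_ft \<epsilon> (\<xi> j)\<bar>) * (\<Prod>k\<in>UNIV. exp (- ?Q (\<lambda>j. \<xi> j k)))) \<le>
          ennreal (\<epsilon> powr (\<gamma> * p)) * ennreal (\<Prod>k\<in>UNIV. (\<Prod>j<p. (1 + \<bar>\<xi> j k\<bar>) powr \<gamma>) * exp (- ?Q (\<lambda>j. \<xi> j k)))"
          by (subst ennreal_mult[symmetric]) (auto simp: prod.distrib mult.assoc intro!: prod_nonneg mult_nonneg_nonneg ennreal_leI)
      qed
      also have "\<dots> \<le> ennreal (\<epsilon> powr (\<gamma> * p)) * ennreal (K * (A * B))"
      proof -
        have comp: "(\<lambda>z. fst z j k) \<in> borel_measurable (PiM {..<p} (\<lambda>_. coord_measure :: ('d \<Rightarrow> real) measure) \<Otimes>\<^sub>M (lborel :: (real^'n) measure))"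
          if "j \<in> {..<p}" for j k
          by (rule measurable_compose[OF measurable_fst PiM_coord_measurable[OF that]])
        have Qm: "(\<lambda>\<xi>. ?Q (\<lambda>j. \<xi> j k)) \<in> borel_measurable (PiM {..<p} (\<lambda>_. coord_measure :: ('d \<Rightarrow> real) measure))" for k
          unfolding lmss_form_def
        proof (rule lborel.borel_measurable_lebesgue_integral)
          have "(\<lambda>z. \<bar>\<Sum>i<p. fst z i k * lmss_kernel \<alpha> H (s i) (snd z)\<bar> powr \<alpha>)
            \<in> borel_measurable (PiM {..<p} (\<lambda>_. coord_measure :: ('d \<Rightarrow> real) measure) \<Otimes>\<^sub>M lborel)"
            by (intro powr_real_measurable borel_measurable_abs borel_measurable_sum borel_measurable_times comp
                borel_measurable_const) measurable
          then show "(\<lambda>(\<xi>, v). \<bar>\<Sum>i<p. \<xi> i k * lmss_kernel \<alpha> H (s i) v\<bar> powr \<alpha>)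
            \<in> borel_measurable (PiM {..<p} (\<lambda>_. coord_measure :: ('d \<Rightarrow> real) measure) \<Otimes>\<^sub>M lborel)"
            by (simp add: split_beta')
        qed
        have "(\<integral>\<^sup>+ \<xi>. ennreal (\<epsilon> powr (\<gamma> * p)) * ennreal (\<Prod>k\<in>UNIV. (\<Prod>j<p. (1 + \<bar>\<xi> j k\<bar>) powr \<gamma>) * exp (- ?Q (\<lambda>j. \<xi> j k)))
          \<partial>PiM {..<p} (\<lambda>_. coord_measure :: ('d \<Rightarrow> real) measure)) =
          ennreal (\<epsilon> powr (\<gamma> * p)) * (\<integral>\<^sup>+ \<xi>. ennreal (\<Prod>k\<in>UNIV. (\<Prod>j<p. (1 + \<bar>\<xi> j k\<bar>) powr \<gamma>) * exp (- ?Q (\<lambda>j. \<xi> j k)))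
          \<partial>PiM {..<p} (\<lambda>_. coord_measure :: ('d \<Rightarrow> real) measure))"
          by (intro nn_integral_cmult measurable_compose[OF _ measurable_ennreal] borel_measurable_prod borel_measurable_times
              powr_real_measurable borel_measurable_add borel_measurable_abs borel_measurable_const PiM_coord_measurable
              borel_measurable_exp borel_measurable_uminus Qm measurable_compose[OF _ borel_measurable_exp]) auto
        then show ?thesis using bound unfolding AB by (simp add: mult_left_mono)
      qed
      also have "\<dots> \<le> ennreal (K * \<epsilon> powr (\<gamma> * p)) * ennreal (A powr (1 + \<kappa>) + B powr (1 + 1 / \<kappa>))"
      proof -
        have "(K * \<epsilon> powr (\<gamma> * p)) * (A * B) \<le> (K * \<epsilon> powr (\<gamma> * p)) * (A powr (1 + \<kappa>) + B powr (1 + 1 / \<kappa>))"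
          using K by (intro mult_left_mono mult_le_powr_add_powr[OF ABpos \<kappa>]) auto
        then have "ennreal (\<epsilon> powr (\<gamma> * p) * (K * (A * B))) \<le> ennreal ((K * \<epsilon> powr (\<gamma> * p)) * (A powr (1 + \<kappa>) + B powr (1 + 1 / \<kappa>)))"
          by (intro ennreal_leI) (simp add: mult_ac)
        then show ?thesis using K ABpos by (simp add: ennreal_mult)
      qed
      also have "\<dots> \<le> ennreal (K * \<epsilon> powr (\<gamma> * p)) * (?A1 + ?A2)"
        using A1 A2 by (intro mult_left_mono) (auto simp: ennreal_plus intro: add_mono)
      finally show ?thesis .
    qed
    then show "ennreal \<bar>(LINT w|M. (\<Prod>j<p. mollifier_diff \<epsilon> (path_val X (s j) w - x)))\<bar> \<le>
      ennreal (K * \<epsilon> powr (\<gamma> * p)) *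
      (inv_dist_prod (<) (CARD('d) / S * (1 + \<gamma>) * (1 + \<kappa>)) (min 1 (e / 2)) {..<p} s
      + inv_dist_prod (>) (CARD('d) / S * \<gamma> * (1 + 1 / \<kappa>)) (min 1 (e / 2)) {..<p} s)"
      by (simp add: \<beta>1_def \<beta>2_def \<eta>_def)
  qed
qed

section \<open>Bounds and measurability of mollified occupation densities\<close>

lemma mollifier_nonneg: "0 \<le> mollifier \<epsilon> y"
  unfolding mollifier_def by (intro prod_nonneg) auto

lemma mollifier_measurable [measurable]: "mollifier \<epsilon> \<in> borel_measurable (borel :: (real^'d::finite) measure)"
  unfolding mollifier_def[abs_def] by measurable

lemma mollifier_diff_measurable [measurable]: "mollifier_diff \<epsilon> \<in> borel_measurable (borel :: (real^'d::finite) measure)"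
  unfolding mollifier_diff_def[abs_def] by measurable

lemma normal_density_le:
  assumes "\<epsilon> > 0"
  shows "normal_density 0 \<epsilon> y \<le> 1 / \<epsilon>"
proof -
  have "1 \<le> sqrt (2 * pi)" using pi_gt3 by simp
  then have "\<epsilon> * 1 \<le> \<epsilon> * sqrt (2 * pi)" using assms by (intro mult_left_mono) auto
  then have "1 / (\<epsilon> * sqrt (2 * pi)) * exp (- (y\<^sup>2 / (2 * \<epsilon>\<^sup>2))) \<le> 1 / (\<epsilon> * 1) * 1"
    using assms by (intro mult_mono divide_left_mono) auto
  then show ?thesis using assms by (simp add: normal_density_def real_sqrt_mult mult_ac)
qed

lemma mollifier_le:
  assumes "\<epsilon> > 0"
  shows "mollifier \<epsilon> (y :: real^'d::finite) \<le> (1 / \<epsilon>) ^ CARD('d)"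
proof -
  have "mollifier \<epsilon> y \<le> (\<Prod>k\<in>(UNIV :: 'd set). 1 / \<epsilon>)"
    unfolding mollifier_def using normal_density_le[OF assms] by (intro prod_mono) auto
  then show ?thesis by simp
qed

lemma abs_mollifier_diff_le:
  assumes "\<epsilon> > 0"
  shows "\<bar>mollifier_diff \<epsilon> (y :: real^'d::finite)\<bar> \<le> (2 / \<epsilon>) ^ CARD('d)"
proof -
  have "(1 / \<epsilon>) ^ CARD('d) \<le> (2 / \<epsilon>) ^ CARD('d)" using assms by (intro power_mono divide_right_mono) auto
  moreover have "mollifier (\<epsilon> / 2) y \<le> (2 / \<epsilon>) ^ CARD('d)" using mollifier_le[of "\<epsilon> / 2" y] assms by simp
  ultimately show ?thesis
    using mollifier_le[OF assms, of y] mollifier_nonneg[of \<epsilon> y] mollifier_nonneg[of "\<epsilon> / 2" y]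
    unfolding mollifier_diff_def by linarith
qed

lemma measurable_vec_lambda [measurable (raw)]:
  fixes f :: "'a \<Rightarrow> 'd::finite \<Rightarrow> real"
  assumes "\<And>k. (\<lambda>x. f x k) \<in> borel_measurable M"
  shows "(\<lambda>x. \<chi> k. f x k) \<in> borel_measurable M"
proof (subst borel_measurable_euclidean_space, intro ballI)
  fix b :: "real^'d" assume "b \<in> Basis"
  then obtain k where "b = axis k 1" by (auto simp: Basis_vec_def)
  then show "(\<lambda>x. (\<chi> k. f x k) \<bullet> b) \<in> borel_measurable M" using assms[of k] by (simp add: inner_axis)
qed

lemma path_val_measurable:
  fixes X :: "'d::finite \<Rightarrow> real^'n \<Rightarrow> 'w \<Rightarrow> real"
  assumes "is_LMSS M \<alpha> H X"
  shows "(\<lambda>(u, w). path_val X u w) \<in> borel_measurable (lborel \<Otimes>\<^sub>M M)"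
proof -
  have "(\<lambda>z. X k (fst z) (snd z)) \<in> borel_measurable (lborel \<Otimes>\<^sub>M M)" for k
    using assms by (auto simp: is_LMSS_def split_beta')
  then show ?thesis unfolding path_val_def split_beta' by measurable
qed

lemma path_val_measurable_section:
  fixes X :: "'d::finite \<Rightarrow> real^'n \<Rightarrow> 'w \<Rightarrow> real"
  assumes "is_LMSS M \<alpha> H X" "w \<in> space M"
  shows "(\<lambda>u. path_val X u w) \<in> borel_measurable borel"
  using measurable_Pair1[OF path_val_measurable[OF assms(1)] assms(2)] by simp

text \<open>The test function stays general so that a mollifier and the difference of two scales are
  treated alike.\<close>

definition box_mollified :: "('d::finite \<Rightarrow> real^'n \<Rightarrow> 'w \<Rightarrow> real) \<Rightarrow> (real^'d \<Rightarrow> real) \<Rightarrow> (real^'n) set \<Rightarrow> 'w \<Rightarrow> real^'d \<Rightarrow> real" where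
  "box_mollified X \<phi> A w x = (LINT s|lborel. indicator A s * \<phi> (path_val X s w - x))"

text \<open>The p-th power of an integral over A is an integral over p time variables, and Fubini
  moves the expectation inside. The two conditions \<open>b\<close> say that both majorants have
  integrable singularities in each coordinate. The constant is uniform in \<epsilon>, x and
  A.\<close>

lemma moment_bound_fixed_exponents:
  fixes X :: "'d::finite \<Rightarrow> real^'n \<Rightarrow> 'w \<Rightarrow> real" and p :: nat and e T S \<gamma> \<kappa> :: real
  assumes X: "is_LMSS M \<alpha> H X" and \<alpha>: "0 < \<alpha>" "\<alpha> \<le> 2" and e: "0 < e" and S: "0 < S"
    and H: "\<And>u l. u \<in> nonneg_orthant \<Longrightarrow> 0 < H u $ l \<and> H u $ l < 1"
    and SH: "\<And>u. u \<in> cbox (\<chi> l. e) (\<chi> l. T) \<Longrightarrow> S \<le> (\<Sum>l\<in>UNIV. 1 / H u $ l)"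
    and \<gamma>: "0 < \<gamma>" "\<gamma> \<le> 1" and \<kappa>: "0 < \<kappa>"
    and b: "CARD('d) / S * (1 + \<gamma>) * (1 + \<kappa>) < 1" "CARD('d) / S * \<gamma> * (1 + 1 / \<kappa>) < 1"
  shows "\<exists>C\<ge>0. \<forall>\<epsilon> x A. 0 < \<epsilon> \<and> A \<in> sets borel \<and> A \<subseteq> cbox (\<chi> l. e) (\<chi> l. T) \<longrightarrow>
    \<bar>(LINT w|M. box_mollified X (mollifier_diff \<epsilon>) A w x ^ p)\<bar> \<le> C * \<epsilon> powr (\<gamma> * p)"
proof -
  let ?I = "cbox (\<chi> l. e) (\<chi> l. T) :: (real^'n) set"
  let ?\<eta> = "min 1 (e / 2)"
  let ?b1 = "CARD('d) / S * (1 + \<gamma>) * (1 + \<kappa>)" and ?b2 = "CARD('d) / S * \<gamma> * (1 + 1 / \<kappa>)"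
  let ?V1 = "inv_dist_prod (<) ?b1 ?\<eta> {..<p}" and ?V2 = "inv_dist_prod (>) ?b2 ?\<eta> {..<p}"
  interpret M: prob_space M using X by (simp add: is_LMSS_def)
  interpret P: product_sigma_finite "\<lambda>_::nat. lborel :: (real^'n) measure" by (rule product_sigma_finite_lborel)
  let ?P = "PiM {..<p} (\<lambda>_. lborel :: (real^'n) measure)"
  interpret PS: sigma_finite_measure ?P by (rule P.sigma_finite) simp
  interpret MP: pair_sigma_finite M ?P ..
  have "\<exists>K>0. \<forall>\<epsilon> x s. 0 < \<epsilon> \<and> (\<forall>j<p. s j \<in> ?I) \<longrightarrow>
    ennreal \<bar>(LINT w|M. (\<Prod>j<p. mollifier_diff \<epsilon> (path_val X (s j) w - x)))\<bar> \<le>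
    ennreal (K * \<epsilon> powr (\<gamma> * p)) * (?V1 s + ?V2 s)"
    by (rule expectation_prod_mollifier_diff_bound[OF X \<alpha> e S _ _ \<gamma> \<kappa>]) (use H SH in auto)
  then obtain K where K: "K > 0" and bound0: "\<forall>\<epsilon> x s. 0 < \<epsilon> \<and> (\<forall>j<p. s j \<in> ?I) \<longrightarrow>
    ennreal \<bar>(LINT w|M. (\<Prod>j<p. mollifier_diff \<epsilon> (path_val X (s j) w - x)))\<bar> \<le>
    ennreal (K * \<epsilon> powr (\<gamma> * p)) * (?V1 s + ?V2 s)"
    by (elim exE conjE)
  \<comment> \<open>For \<open><\<close> the variable to be integrated out is the one with the
    largest index, for \<open>>\<close> the one with the smallest.\<close>
  have max: "\<exists>b\<in>K. \<forall>i\<in>K. \<not> b < i" if "finite K" "K \<noteq> {}" for K :: "nat set"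
    using Max_in[OF that] Max_ge[OF that(1)] by (intro bexI[of _ "Max K"]) (auto simp: not_less)
  have min: "\<exists>b\<in>K. \<forall>i\<in>K. \<not> b > i" if "finite K" "K \<noteq> {}" for K :: "nat set"
    using Min_in[OF that] Min_le[OF that(1)] by (intro bexI[of _ "Min K"]) (auto simp: not_less)
  have b0: "0 \<le> ?b1" "0 \<le> ?b2" using S \<gamma> \<kappa> by auto
  let ?G = "\<lambda>R b K. \<integral>\<^sup>+ s. (\<Prod>j\<in>K. indicator ?I (s j)) * inv_dist_prod R b ?\<eta> K s \<partial>PiM K (\<lambda>_. lborel)"
  have "\<exists>C. \<forall>K. finite K \<and> card K = p \<longrightarrow> ?G (<) ?b1 K \<le> ennreal C"
    by (rule nn_integral_inv_dist_prod[OF b0(1) b(1)]) (rule max)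
  then obtain C1 where "\<forall>K. finite K \<and> card K = p \<longrightarrow> ?G (<) ?b1 K \<le> ennreal C1" ..
  then have C1: "?G (<) ?b1 {..<p} \<le> ennreal C1" by (rule allE[of _ "{..<p}"]) simp
  have "\<exists>C. \<forall>K. finite K \<and> card K = p \<longrightarrow> ?G (>) ?b2 K \<le> ennreal C"
    by (rule nn_integral_inv_dist_prod[OF b0(2) b(2)]) (rule min)
  then obtain C2 where "\<forall>K. finite K \<and> card K = p \<longrightarrow> ?G (>) ?b2 K \<le> ennreal C2" ..
  then have C2: "?G (>) ?b2 {..<p} \<le> ennreal C2" by (rule allE[of _ "{..<p}"]) simp
  define C where "C = K * (max 0 C1 + max 0 C2)"
  have C: "C \<ge> 0" using K by (simp add: C_def)
  show ?thesis
  proof (intro exI[of _ C] conjI C allI impI, elim conjE)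
    fix \<epsilon> :: real and x :: "real^'d" and A :: "(real^'n) set"
    assume \<epsilon>: "0 < \<epsilon>" and A [measurable]: "A \<in> sets borel" and AI: "A \<subseteq> ?I"
    let ?B = "(2 / \<epsilon>) ^ CARD('d)"
    define h where "h w s = indicator A s * mollifier_diff \<epsilon> (path_val X s w - x)" for w s
    \<comment> \<open>A crude bound depending on \<epsilon>; it justifies integrability and Fubini
      and does not enter the final constant.\<close>
    have h_le: "\<bar>h w s\<bar> \<le> ?B * indicator ?I s" for w s
      using abs_mollifier_diff_le[OF \<epsilon>, of "path_val X s w - x"] AI by (auto simp: h_def indicator_def)
    have pm: "(\<lambda>z. path_val X (snd z j) (fst z)) \<in> borel_measurable (M \<Otimes>\<^sub>M ?P)" if "j < p" for j
    proof -
      have "(\<lambda>z. (snd z j, fst z)) \<in> measurable (M \<Otimes>\<^sub>M ?P) (lborel \<Otimes>\<^sub>M M)"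
        using that by (intro measurable_Pair measurable_fst measurable_compose[OF measurable_snd measurable_component_singleton]) auto
      from measurable_compose[OF this path_val_measurable[OF X]] show ?thesis by simp
    qed
    have sm: "(\<lambda>z. snd z j) \<in> measurable (M \<Otimes>\<^sub>M ?P) borel" if "j < p" for j
      using that measurable_compose[OF measurable_snd measurable_component_singleton, of j "{..<p}" M "\<lambda>_. lborel :: (real^'n) measure"] by simp
    define g where "g w s = (\<Prod>j<p. h w (s j))" for w s
    have g_m: "(\<lambda>(w, s). g w s) \<in> borel_measurable (M \<Otimes>\<^sub>M ?P)"
      unfolding g_def h_def split_beta'
      by (intro borel_measurable_prod borel_measurable_times measurable_compose[OF _ mollifier_diff_measurable]
          borel_measurable_diff borel_measurable_const pm measurable_compose[OF sm borel_measurable_indicator]) (auto intro: A)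
    have I_int: "integrable lborel (\<lambda>s. ?B * indicator ?I s :: real)"
      by (intro integrable_mult_right integrable_real_indicator) (auto simp: emeasure_lborel_cbox_eq)
    have dom_int: "integrable ?P (\<lambda>s. \<Prod>j<p. ?B * indicator ?I (s j) :: real)"
      using I_int by (intro P.product_integrable_prod) auto
    have g_le: "\<bar>g w s\<bar> \<le> (\<Prod>j<p. ?B * indicator ?I (s j))" for w s
      unfolding g_def abs_prod using h_le by (intro prod_mono) auto
    have g_int: "integrable (M \<Otimes>\<^sub>M ?P) (\<lambda>(w, s). g w s)"
    proof (rule Bochner_Integration.integrable_bound)
      show "integrable (M \<Otimes>\<^sub>M ?P) (\<lambda>(w, s). \<Prod>j<p. ?B * indicator ?I (s j) :: real)"
      proof (rule MP.Fubini_integrable)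
        have "(\<lambda>s. \<Prod>j<p. ?B * indicator ?I (s j) :: real) \<in> borel_measurable ?P" using dom_int by auto
        from measurable_compose[OF measurable_snd this] show "(\<lambda>(w, s). \<Prod>j<p. ?B * indicator ?I (s j) :: real) \<in> borel_measurable (M \<Otimes>\<^sub>M ?P)"
          by (simp add: split_beta')
      qed (use dom_int in auto)
      show "(\<lambda>(w, s). g w s) \<in> borel_measurable (M \<Otimes>\<^sub>M ?P)" by (rule g_m)
      show "AE z in M \<Otimes>\<^sub>M ?P. norm ((\<lambda>(w, s). g w s) z) \<le> norm ((\<lambda>(w, s). \<Prod>j<p. ?B * indicator ?I (s j) :: real) z)"
        using order_trans[OF g_le abs_ge_self] by (intro AE_I2) (simp add: split_beta')
    qed
    have hint: "integrable lborel (h w)" if w: "w \<in> space M" for w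
    proof (rule Bochner_Integration.integrable_bound[OF I_int])
      note [measurable] = path_val_measurable_section[OF X w]
      show "h w \<in> borel_measurable lborel" unfolding h_def[abs_def] by measurable
      show "AE s in lborel. norm (h w s) \<le> norm (?B * indicator ?I s :: real)"
        using h_le \<epsilon> by (auto simp: abs_mult)
    qed
    have pow: "box_mollified X (mollifier_diff \<epsilon>) A w x ^ p = (LINT s|?P. g w s)" if w: "w \<in> space M" for w
    proof -
      have "(LINT s|?P. g w s) = (\<Prod>j<p. (LINT s|lborel. h w s))"
        unfolding g_def using hint[OF w] by (intro P.product_integral_prod) auto
      then show ?thesis by (simp add: box_mollified_def h_def)
    qed
    have "(LINT w|M. box_mollified X (mollifier_diff \<epsilon>) A w x ^ p) = (LINT w|M. LINT s|?P. g w s)"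
      by (intro Bochner_Integration.integral_cong refl pow)
    also have "\<dots> = (LINT s|?P. LINT w|M. g w s)" by (rule MP.Fubini_integral[OF g_int, symmetric])
    finally have "ennreal \<bar>(LINT w|M. box_mollified X (mollifier_diff \<epsilon>) A w x ^ p)\<bar> = ennreal (norm (LINT s|?P. LINT w|M. g w s))" by simp
    also have "\<dots> \<le> (\<integral>\<^sup>+ s. norm (LINT w|M. g w s) \<partial>?P)"
      using MP.integrable_snd[OF g_int] by (intro integral_norm_bound_ennreal) simp
    also have "\<dots> \<le> (\<integral>\<^sup>+ s. ennreal (K * \<epsilon> powr (\<gamma> * p)) * ((\<Prod>j<p. indicator ?I (s j)) * ?V1 s + (\<Prod>j<p. indicator ?I (s j)) * ?V2 s) \<partial>?P)"
    proof (rule nn_integral_mono)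
      fix s :: "nat \<Rightarrow> real^'n"
      show "ennreal (norm (LINT w|M. g w s)) \<le> ennreal (K * \<epsilon> powr (\<gamma> * p)) * ((\<Prod>j<p. indicator ?I (s j)) * ?V1 s + (\<Prod>j<p. indicator ?I (s j)) * ?V2 s)"
      proof (cases "\<forall>j<p. s j \<in> A")
        case True
        then have sI: "\<forall>j<p. s j \<in> ?I" using AI by auto
        have "g w s = (\<Prod>j<p. mollifier_diff \<epsilon> (path_val X (s j) w - x))" for w
          unfolding g_def h_def using True by (intro prod.cong) auto
        then have "ennreal (norm (LINT w|M. g w s)) \<le> ennreal (K * \<epsilon> powr (\<gamma> * p)) * (?V1 s + ?V2 s)"
          using bound0 sI \<epsilon> by simp
        moreover have "(\<Prod>j<p. indicator ?I (s j)) = (1 :: ennreal)" using sI by (intro prod.neutral) auto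
        ultimately show ?thesis by simp
      next
        case False
        then obtain j where "j < p" "s j \<notin> A" by auto
        then have "g w s = 0" for w unfolding g_def h_def by (intro prod_zero) (auto intro!: bexI[of _ j])
        then show ?thesis by simp
      qed
    qed
    also have "\<dots> = ennreal (K * \<epsilon> powr (\<gamma> * p)) * ((\<integral>\<^sup>+ s. (\<Prod>j<p. indicator ?I (s j)) * ?V1 s \<partial>?P) + (\<integral>\<^sup>+ s. (\<Prod>j<p. indicator ?I (s j)) * ?V2 s \<partial>?P))"
    proof -
      have m: "(\<lambda>s. (\<Prod>j<p. indicator ?I (s j)) * inv_dist_prod R \<beta> \<eta> {..<p} s) \<in> borel_measurable ?P" for R \<beta> \<eta>
        by (intro borel_measurable_times_ennreal inv_dist_prod_measurable borel_measurable_prod_ennreal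
          measurable_compose[OF measurable_component_singleton]) auto
      show ?thesis using m by (simp add: nn_integral_cmult nn_integral_add)
    qed
    also have "\<dots> \<le> ennreal (K * \<epsilon> powr (\<gamma> * p)) * (ennreal (max 0 C1) + ennreal (max 0 C2))"
      using C1 C2 by (intro mult_left_mono add_mono) (auto simp: ennreal_max_0' max.commute)
    also have "\<dots> = ennreal (C * \<epsilon> powr (\<gamma> * p))"
      by (subst ennreal_plus[symmetric], simp, simp, subst ennreal_mult[symmetric]) (use K in \<open>auto simp: C_def mult_ac\<close>)
    finally show "\<bar>(LINT w|M. box_mollified X (mollifier_diff \<epsilon>) A w x ^ p)\<bar> \<le> C * \<epsilon> powr (\<gamma> * p)"
      using C by (simp add: ennreal_le_iff)
  qed
qed

text \<open>Divides the slack 1 - \<rho>, where \<rho> = d/S: \<kappa> raises the exponent \<rho> to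
  the midpoint (1 + \<rho>)/2, and \<gamma> is small enough to keep both exponents below 1. It is
  essential that \<gamma> is fixed before p, because p is later chosen large relative to
  1/\<gamma>.\<close>

lemma moment_bound:
  fixes X :: "'d::finite \<Rightarrow> real^'n \<Rightarrow> 'w \<Rightarrow> real" and e T S :: real
  assumes X: "is_LMSS M \<alpha> H X" and \<alpha>: "0 < \<alpha>" "\<alpha> \<le> 2" and e: "0 < e" and S: "CARD('d) < S"
    and H: "\<And>u l. u \<in> nonneg_orthant \<Longrightarrow> 0 < H u $ l \<and> H u $ l < 1"
    and SH: "\<And>u. u \<in> cbox (\<chi> l. e) (\<chi> l. T) \<Longrightarrow> S \<le> (\<Sum>l\<in>UNIV. 1 / H u $ l)"
  shows "\<exists>\<gamma>>0. \<forall>p::nat. \<exists>C\<ge>0. \<forall>\<epsilon> x A. 0 < \<epsilon> \<and> A \<in> sets borel \<and> A \<subseteq> cbox (\<chi> l. e) (\<chi> l. T) \<longrightarrow>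
    \<bar>(LINT w|M. box_mollified X (mollifier_diff \<epsilon>) A w x ^ p)\<bar> \<le> C * \<epsilon> powr (\<gamma> * real p)"
proof -
  define \<rho> where "\<rho> = CARD('d) / S"
  have S0: "0 < S" using S by (meson le_less_trans of_nat_0_le_iff)
  have \<rho>: "0 < \<rho>" "\<rho> < 1" using S S0 by (auto simp: \<rho>_def)
  define \<kappa> where "\<kappa> = (1 / \<rho> - 1) / 2"
  have \<kappa>: "0 < \<kappa>" using \<rho> by (simp add: \<kappa>_def)
  have \<rho>\<kappa>: "\<rho> * (1 + \<kappa>) = (1 + \<rho>) / 2" using \<rho> by (simp add: \<kappa>_def field_simps)
  define \<gamma> where "\<gamma> = min (min 1 ((1 - \<rho>) / 2)) (1 / (2 * (1 + 1 / \<kappa>)))"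
  have "0 < \<gamma>" using \<rho> \<kappa> by (auto simp: \<gamma>_def intro!: divide_pos_pos add_pos_pos)
  moreover have "\<gamma> \<le> 1" by (simp add: \<gamma>_def min_le_iff_disj)
  ultimately have \<gamma>: "0 < \<gamma>" "\<gamma> \<le> 1" by auto
  have b1: "CARD('d) / S * (1 + \<gamma>) * (1 + \<kappa>) < 1"
  proof -
    have "CARD('d) / S * (1 + \<gamma>) * (1 + \<kappa>) = (1 + \<gamma>) * ((1 + \<rho>) / 2)"
      unfolding \<rho>\<kappa>[symmetric] \<rho>_def[symmetric] by (simp add: mult_ac)
    also have "\<dots> \<le> (1 + (1 - \<rho>) / 2) * ((1 + \<rho>) / 2)"
    proof (intro mult_right_mono add_left_mono)
      show "\<gamma> \<le> (1 - \<rho>) / 2" unfolding \<gamma>_def by (rule order_trans[OF min.cobounded1 min.cobounded2])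
    qed (use \<rho> in simp)
    also have "\<dots> < 1"
    proof -
      \<comment> \<open>The claim amounts to (3 - \<rho>)(1 + \<rho>) < 4, that is, (1 - \<rho>)^2 >
        0.\<close>
      have "0 < (1 - \<rho>) * (1 - \<rho>)" using \<rho> by (intro mult_pos_pos) auto
      then show ?thesis by (simp add: field_simps)
    qed
    finally show ?thesis .
  qed
  have b2: "CARD('d) / S * \<gamma> * (1 + 1 / \<kappa>) < 1"
  proof -
    have q: "0 < 1 + 1 / \<kappa>" using \<kappa> by (intro add_pos_pos) auto
    have "\<gamma> \<le> 1 / (2 * (1 + 1 / \<kappa>))" by (simp add: \<gamma>_def)
    then have "\<gamma> * (1 + 1 / \<kappa>) \<le> 1 / (2 * (1 + 1 / \<kappa>)) * (1 + 1 / \<kappa>)" using q by (intro mult_right_mono) auto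
    also have "\<dots> = 1 / 2" using q by simp
    finally have "\<gamma> * (1 + 1 / \<kappa>) \<le> 1 / 2" .
    then have "\<rho> * (\<gamma> * (1 + 1 / \<kappa>)) \<le> 1 * (1 / 2)" using \<rho> \<gamma> q by (intro mult_mono) auto
    moreover have "CARD('d) / S * \<gamma> * (1 + 1 / \<kappa>) = \<rho> * (\<gamma> * (1 + 1 / \<kappa>))" by (simp only: \<rho>_def mult.assoc)
    ultimately show ?thesis by linarith
  qed
  show ?thesis
  proof (rule exI[of _ \<gamma>], intro conjI allI \<gamma>(1))
    fix p :: nat
    show "\<exists>C\<ge>0. \<forall>\<epsilon> x A. 0 < \<epsilon> \<and> A \<in> sets borel \<and> A \<subseteq> cbox (\<chi> l. e) (\<chi> l. T) \<longrightarrow>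
      \<bar>(LINT w|M. box_mollified X (mollifier_diff \<epsilon>) A w x ^ p)\<bar> \<le> C * \<epsilon> powr (\<gamma> * real p)"
      by (rule moment_bound_fixed_exponents[OF X \<alpha> e S0 _ _ \<gamma> \<kappa> b1 b2]) (use H SH in auto)
  qed
qed

section \<open>Uniform convergence of the mollified densities\<close>

lemma normal_density_lipschitz:
  assumes \<epsilon>: "\<epsilon> > 0"
  shows "\<bar>normal_density 0 \<epsilon> y - normal_density 0 \<epsilon> z\<bar> \<le> \<bar>y - z\<bar> / \<epsilon>\<^sup>2"
proof -
  have der: "(normal_density 0 \<epsilon> has_real_derivative (- u / \<epsilon>\<^sup>2 * normal_density 0 \<epsilon> u)) (at u)" for u
    unfolding normal_density_def using \<epsilon>
    by (auto intro!: derivative_eq_intros simp: power2_eq_square field_simps)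
  have bound: "\<bar>- u / \<epsilon>\<^sup>2 * normal_density 0 \<epsilon> u\<bar> \<le> 1 / \<epsilon>\<^sup>2" for u
  proof -
    have "\<bar>u\<bar> / \<epsilon> \<le> 1 + (\<bar>u\<bar> / \<epsilon>)\<^sup>2 / 2"
    proof -
      have "z \<le> 1 + z\<^sup>2 / 2" for z :: real
        using zero_le_power2[of "z - 1"] by (simp add: power2_diff)
      then show ?thesis .
    qed
    also have "\<dots> \<le> exp ((\<bar>u\<bar> / \<epsilon>)\<^sup>2 / 2)" by (rule exp_ge_add_one_self)
    finally have "\<bar>u\<bar> / \<epsilon> * exp (- ((\<bar>u\<bar> / \<epsilon>)\<^sup>2 / 2)) \<le> exp ((\<bar>u\<bar> / \<epsilon>)\<^sup>2 / 2) * exp (- ((\<bar>u\<bar> / \<epsilon>)\<^sup>2 / 2))"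
      by (rule mult_right_mono) simp
    then have "\<bar>u\<bar> / \<epsilon> * exp (- ((\<bar>u\<bar> / \<epsilon>)\<^sup>2 / 2)) \<le> 1"
      by (simp only: exp_minus_inverse)
    moreover have "1 \<le> sqrt (2 * pi)" using pi_gt3 by simp
    ultimately have "\<bar>u\<bar> / \<epsilon> * exp (- ((\<bar>u\<bar> / \<epsilon>)\<^sup>2 / 2)) / sqrt (2 * pi) \<le> 1 / 1"
      by (intro frac_le) auto
    then have le: "\<bar>u\<bar> / \<epsilon> * exp (- ((\<bar>u\<bar> / \<epsilon>)\<^sup>2 / 2)) / sqrt (2 * pi) \<le> 1" by (simp only: div_by_1)
    have eq: "\<bar>- u / \<epsilon>\<^sup>2 * normal_density 0 \<epsilon> u\<bar> = \<bar>u\<bar> / \<epsilon> * exp (- ((\<bar>u\<bar> / \<epsilon>)\<^sup>2 / 2)) / sqrt (2 * pi) / \<epsilon>\<^sup>2"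
      using \<epsilon> by (simp add: normal_density_def abs_mult real_sqrt_mult power_divide power2_eq_square field_simps)
    show ?thesis unfolding eq by (rule divide_right_mono[OF le]) simp
  qed
  have "norm (normal_density 0 \<epsilon> y - normal_density 0 \<epsilon> z) \<le> 1 / \<epsilon>\<^sup>2 * norm (y - z)"
  proof (rule field_differentiable_bound[of UNIV])
    show "(normal_density 0 \<epsilon> has_field_derivative (- u / \<epsilon>\<^sup>2 * normal_density 0 \<epsilon> u)) (at u within UNIV)" for u
      using der by simp
    show "norm (- u / \<epsilon>\<^sup>2 * normal_density 0 \<epsilon> u) \<le> 1 / \<epsilon>\<^sup>2" for u using bound by simp
  qed auto
  then show ?thesis by simp
qed

text \<open>Each factor is multiplied by \<epsilon> to have modulus at most 1, as the telescoping
  bound for differences of products requires; undoing this produces the power d + 1 of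
  \<epsilon>.\<close>

lemma mollifier_lipschitz:
  fixes y z :: "real^'d::finite"
  assumes \<epsilon>: "0 < \<epsilon>" and r: "\<And>k. \<bar>y $ k - z $ k\<bar> \<le> r"
  shows "\<bar>mollifier \<epsilon> y - mollifier \<epsilon> z\<bar> \<le> CARD('d) * (r / \<epsilon> ^ (CARD('d) + 1))"
proof -
  let ?n = "\<lambda>y. \<epsilon> * normal_density 0 \<epsilon> y"
  have le1: "norm (?n u) \<le> 1" for u using normal_density_le[OF \<epsilon>, of u] \<epsilon> by (simp add: field_simps)
  have "norm ((\<Prod>k\<in>UNIV. ?n (y $ k)) - (\<Prod>k\<in>UNIV. ?n (z $ k))) \<le> (\<Sum>k\<in>UNIV. norm (?n (y $ k) - ?n (z $ k)))"
    by (rule norm_prod_diff) (use le1 in auto)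
  also have "\<dots> \<le> (\<Sum>k\<in>(UNIV::'d set). r / \<epsilon>)"
  proof (rule sum_mono)
    fix k
    have "norm (?n (y $ k) - ?n (z $ k)) = \<epsilon> * \<bar>normal_density 0 \<epsilon> (y $ k) - normal_density 0 \<epsilon> (z $ k)\<bar>"
      using \<epsilon> by (simp add: abs_mult flip: right_diff_distrib)
    also have "\<dots> \<le> \<epsilon> * (r / \<epsilon>\<^sup>2)"
      using normal_density_lipschitz[OF \<epsilon>, of "y $ k" "z $ k"] r[of k] \<epsilon>
      by (intro mult_left_mono order_trans[OF _ divide_right_mono[OF r]]) auto
    finally show "norm (?n (y $ k) - ?n (z $ k)) \<le> r / \<epsilon>" using \<epsilon> by (simp add: power2_eq_square)
  qed
  also have "(\<Prod>k\<in>UNIV. ?n (y $ k)) - (\<Prod>k\<in>UNIV. ?n (z $ k)) = \<epsilon> ^ CARD('d) * (mollifier \<epsilon> y - mollifier \<epsilon> z)"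
    by (simp add: mollifier_def prod.distrib right_diff_distrib)
  finally have "\<epsilon> ^ CARD('d) * \<bar>mollifier \<epsilon> y - mollifier \<epsilon> z\<bar> \<le> CARD('d) * (r / \<epsilon>)"
    using \<epsilon> by (simp add: abs_mult)
  then have "\<bar>mollifier \<epsilon> y - mollifier \<epsilon> z\<bar> \<le> CARD('d) * (r / \<epsilon>) / \<epsilon> ^ CARD('d)"
    using \<epsilon> by (simp add: pos_le_divide_eq mult.commute)
  then show ?thesis by simp
qed

lemma integrable_box_mollified:
  fixes X :: "'d::finite \<Rightarrow> real^'n \<Rightarrow> 'w \<Rightarrow> real"
  assumes X: "is_LMSS M \<alpha> H X" "w \<in> space M" and [measurable]: "A \<in> sets borel" "\<phi> \<in> borel_measurable borel"
    and A: "emeasure lborel A < \<infinity>" and b: "\<And>y. \<bar>\<phi> y\<bar> \<le> B"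
  shows "integrable lborel (\<lambda>s. indicator A s * \<phi> (path_val X s w - x) :: real)"
proof (rule Bochner_Integration.integrable_bound)
  note [measurable] = path_val_measurable_section[OF X]
  show "integrable lborel (\<lambda>s. B * indicator A s :: real)"
    using A by (intro integrable_mult_right integrable_real_indicator) auto
  show "(\<lambda>s. indicator A s * \<phi> (path_val X s w - x)) \<in> borel_measurable lborel" by measurable
  have "0 \<le> B" using b[of 0] by linarith
  then show "AE s in lborel. norm (indicator A s * \<phi> (path_val X s w - x)) \<le> norm (B * indicator A s :: real)"
    using b by (auto simp: indicator_def)
qed

text \<open>Bounds the volume swept when one face of a box moves from u to v. The
  \<open>max 1\<close> allows the exponent to be raised to the full dimension even for sides shorter
  than 1.\<close>

lemma emeasure_slab:
  fixes e T u v :: real and l :: "'n::finite"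
  assumes uv: "u \<le> v" and eT: "e \<le> T"
  shows "emeasure lborel {s :: real^'n. s \<in> cbox (\<chi> k. e) (\<chi> k. T) \<and> u \<le> s $ l \<and> s $ l \<le> v}
    \<le> ennreal ((v - u) * (max 1 (T - e)) ^ CARD('n))"
proof -
  let ?S = "{s :: real^'n. s \<in> cbox (\<chi> k. e) (\<chi> k. T) \<and> u \<le> s $ l \<and> s $ l \<le> v}"
  let ?J = "\<lambda>k. if k = l then {u..v} else {e..T}"
  have Sm: "?S \<in> sets lborel" by measurable
  have "emeasure lborel ?S = (\<integral>\<^sup>+ s. indicator ?S s \<partial>lborel)" using Sm by simp
  also have "\<dots> \<le> (\<integral>\<^sup>+ s. (\<Prod>k\<in>UNIV. indicator (?J k) (s $ k)) \<partial>lborel)"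
  proof (rule nn_integral_mono)
    fix s :: "real^'n"
    show "indicator ?S s \<le> (\<Prod>k\<in>UNIV. indicator (?J k) (s $ k) :: ennreal)"
    proof (cases "s \<in> ?S")
      case True
      then have "(\<Prod>k\<in>UNIV. indicator (?J k) (s $ k) :: ennreal) = 1"
        by (intro prod.neutral) (auto simp: mem_box_cart)
      then show ?thesis by (simp add: indicator_def)
    qed simp
  qed
  also have "\<dots> = (\<Prod>k\<in>(UNIV::'n set). \<integral>\<^sup>+ r. indicator (?J k) r \<partial>lborel)"
    by (rule nn_integral_lborel_vec_prod) auto
  also have "\<dots> = (\<integral>\<^sup>+ r. indicator (?J l) r \<partial>lborel) * (\<Prod>k\<in>UNIV - {l}. \<integral>\<^sup>+ r. indicator (?J k) r \<partial>lborel)"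
    by (rule prod.remove) auto
  also have "\<dots> = ennreal (v - u) * (\<Prod>k\<in>UNIV - {l}. ennreal (T - e))"
    using uv eT by (intro arg_cong2[where f = "(*)"] prod.cong) auto
  also have "\<dots> = ennreal ((v - u) * (T - e) ^ card (UNIV - {l}))"
    using uv eT by (simp add: ennreal_power ennreal_mult)
  also have "\<dots> \<le> ennreal ((v - u) * (max 1 (T - e)) ^ CARD('n))"
  proof (intro ennreal_leI mult_left_mono)
    have "(T - e) ^ card (UNIV - {l}) \<le> (max 1 (T - e)) ^ card (UNIV - {l})" using eT by (intro power_mono) auto
    also have "\<dots> \<le> (max 1 (T - e)) ^ CARD('n)" by (intro power_increasing card_mono) auto
    finally show "(T - e) ^ card (UNIV - {l}) \<le> (max 1 (T - e)) ^ CARD('n)" .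
  qed (use uv in auto)
  finally show ?thesis .
qed

text \<open>Changing x shifts the mollifier; changing t alters the box by a set covered by slabs,
  one for each coordinate. The constant is deterministic and the loss only polynomial in
  1/\<epsilon>, so a grid of polynomially fine mesh controls all points.\<close>

lemma box_mollified_lipschitz:
  fixes X :: "'d::finite \<Rightarrow> real^'n \<Rightarrow> 'w \<Rightarrow> real" and e T :: real
  assumes X: "is_LMSS M \<alpha> H X" and eT: "e \<le> T"
  shows "\<exists>\<Lambda>\<ge>0. \<forall>w\<in>space M. \<forall>\<epsilon> x y t u r. 0 < \<epsilon> \<and> \<epsilon> \<le> 1 \<and> t \<in> cbox (\<chi> l. e) (\<chi> l. T) \<and> u \<in> cbox (\<chi> l. e) (\<chi> l. T) \<and>
      (\<forall>k. \<bar>x $ k - y $ k\<bar> \<le> r) \<and> (\<forall>l. \<bar>t $ l - u $ l\<bar> \<le> r) \<longrightarrow>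
    \<bar>box_mollified X (mollifier \<epsilon>) (cbox (\<chi> l. e) t) w x - box_mollified X (mollifier \<epsilon>) (cbox (\<chi> l. e) u) w y\<bar>
      \<le> \<Lambda> * (r / \<epsilon> ^ (CARD('d) + 1))"
proof -
  let ?a = "(\<chi> l. e) :: real^'n"
  let ?I = "cbox ?a (\<chi> l. T)"
  define W where "W = (max 1 (T - e)) ^ CARD('n)"
  have W: "W \<ge> 0" by (simp add: W_def)
  define V where "V = measure lborel ?I"
  have V: "V \<ge> 0" by (simp add: V_def)
  define \<Lambda> where "\<Lambda> = V * CARD('d) + CARD('n) * W"
  show ?thesis
  proof (intro exI[of _ \<Lambda>] conjI ballI allI impI, goal_cases)
    case 1
    show ?case using V W by (simp add: \<Lambda>_def)
  next
    case (2 w \<epsilon> x y t u r)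
    then have w: "w \<in> space M" and \<epsilon>: "0 < \<epsilon>" "\<epsilon> \<le> 1" and t: "t \<in> ?I" and u: "u \<in> ?I"
      and xy: "\<And>k. \<bar>x $ k - y $ k\<bar> \<le> r" and tu: "\<And>l. \<bar>t $ l - u $ l\<bar> \<le> r" by auto
    have r: "0 \<le> r" using xy[of undefined] by linarith
    note [measurable] = path_val_measurable_section[OF X w]
    let ?f = "\<lambda>A x s. indicator A s * mollifier \<epsilon> (path_val X s w - x) :: real"
    let ?B = "(1 / \<epsilon>) ^ CARD('d)"
    have bd: "\<bar>mollifier \<epsilon> z\<bar> \<le> ?B" for z :: "real^'d"
      using mollifier_le[OF \<epsilon>(1), of z] mollifier_nonneg[of \<epsilon> z] by simp
    have int: "integrable lborel (?f (cbox ?a t) x)" for t x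
      by (rule integrable_box_mollified[OF X w _ _ _ bd]) (auto simp: emeasure_lborel_cbox_eq)
    have sub: "cbox ?a t \<subseteq> ?I" "cbox ?a u \<subseteq> ?I" using t u by (auto simp: mem_box_cart) (metis order_trans)+
    \<comment> \<open>A time in exactly one of the two boxes has some coordinate between those of t
      and u, hence lies in one of these slabs.\<close>
    let ?slab = "\<lambda>l. {s. s \<in> ?I \<and> min (t $ l) (u $ l) \<le> s $ l \<and> s $ l \<le> max (t $ l) (u $ l)}"
    have slab_fin: "emeasure lborel (?slab l) < \<infinity>" for l
    proof -
      have "min (t $ l) (u $ l) \<le> max (t $ l) (u $ l)" by simp
      from emeasure_slab[OF this eT, of l] show ?thesis by (rule order_le_less_trans) simp
    qed
    have slab_le: "measure lborel (?slab l) \<le> r * W" for l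
    proof -
      have "emeasure lborel (?slab l) \<le> ennreal ((max (t $ l) (u $ l) - min (t $ l) (u $ l)) * W)"
        unfolding W_def by (rule emeasure_slab[OF _ eT]) auto
      also have "\<dots> \<le> ennreal (r * W)" using tu[of l] W by (intro ennreal_leI mult_right_mono) auto
      finally have "enn2real (emeasure lborel (?slab l)) \<le> enn2real (ennreal (r * W))" by (intro enn2real_mono) auto
      then show ?thesis using r W by (simp add: measure_def)
    qed
    have slab_m: "?slab l \<in> sets lborel" for l by measurable
    define ind :: "'n \<Rightarrow> real^'n \<Rightarrow> real" where "ind l = indicator (?slab l)" for l
    let ?g = "\<lambda>s. indicator ?I s * (CARD('d) * (r / \<epsilon> ^ (CARD('d) + 1))) + (\<Sum>l\<in>UNIV. ind l s * ?B)"
    have I_int: "integrable lborel (\<lambda>s. indicator ?I s :: real)"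
      by (intro integrable_real_indicator) (auto simp: emeasure_lborel_cbox_eq)
    have slab_int: "integrable lborel (ind l)" for l
      unfolding ind_def using slab_fin[of l] slab_m by (intro integrable_real_indicator) auto
    have ind_lint: "(LINT s|lborel. ind l s) = measure lborel (?slab l)" for l
      unfolding ind_def using slab_m[of l] by simp
    have "\<bar>box_mollified X (mollifier \<epsilon>) (cbox ?a t) w x - box_mollified X (mollifier \<epsilon>) (cbox ?a u) w y\<bar>
      = \<bar>(LINT s|lborel. ?f (cbox ?a t) x s - ?f (cbox ?a u) y s)\<bar>"
      unfolding box_mollified_def using int by simp
    also have "\<dots> \<le> (LINT s|lborel. \<bar>?f (cbox ?a t) x s - ?f (cbox ?a u) y s\<bar>)"
      using integral_norm_bound[of lborel "\<lambda>s. ?f (cbox ?a t) x s - ?f (cbox ?a u) y s"] by simp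
    also have "\<dots> \<le> (LINT s|lborel. ?g s)"
    proof (rule integral_mono)
      show "integrable lborel (\<lambda>s. \<bar>?f (cbox ?a t) x s - ?f (cbox ?a u) y s\<bar>)" using int by auto
      show "integrable lborel ?g" using I_int slab_int by auto
      fix s
      let ?mx = "mollifier \<epsilon> (path_val X s w - x)" and ?my = "mollifier \<epsilon> (path_val X s w - y)"
      have slabs: "0 \<le> (\<Sum>l\<in>UNIV. ind l s * ?B)" using \<epsilon> by (intro sum_nonneg) (auto simp: ind_def)
      have lip: "\<bar>?mx - ?my\<bar> \<le> CARD('d) * (r / \<epsilon> ^ (CARD('d) + 1))"
        using xy by (intro mollifier_lipschitz[OF \<epsilon>(1)]) (simp add: abs_minus_commute)
      have lip0: "0 \<le> CARD('d) * (r / \<epsilon> ^ (CARD('d) + 1))" using r \<epsilon> by simp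
      show "\<bar>?f (cbox ?a t) x s - ?f (cbox ?a u) y s\<bar> \<le> ?g s"
      proof (cases "s \<in> cbox ?a t \<longleftrightarrow> s \<in> cbox ?a u")
        case True
        then show ?thesis using lip lip0 slabs sub by (cases "s \<in> cbox ?a t") (auto simp: indicator_def)
      next
        case False
        then have sI: "s \<in> ?I" using sub by auto
        have "\<exists>l. s \<in> ?slab l"
        proof -
          obtain l where "\<not> (s $ l \<le> t $ l \<longleftrightarrow> s $ l \<le> u $ l)" using False sI by (auto simp: mem_box_cart)
          then show ?thesis using sI by (intro exI[of _ l]) (auto simp: min_def max_def)
        qed
        then obtain l where l: "s \<in> ?slab l" by blast
        have "\<bar>?f (cbox ?a t) x s - ?f (cbox ?a u) y s\<bar> \<le> ?B"
          using False bd[of "path_val X s w - x"] bd[of "path_val X s w - y"] by (cases "s \<in> cbox ?a t") auto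
        also have "\<dots> = ind l s * ?B" using l by (simp add: ind_def)
        also have "\<dots> \<le> (\<Sum>l\<in>UNIV. ind l s * ?B)" using \<epsilon> by (intro member_le_sum) (auto simp: ind_def)
        also have "\<dots> \<le> ?g s"
        proof -
          have "0 \<le> indicator ?I s * (CARD('d) * (r / \<epsilon> ^ (CARD('d) + 1)))"
            by (rule mult_nonneg_nonneg[OF _ lip0]) simp
          then show ?thesis by linarith
        qed
        finally show ?thesis .
      qed
    qed
    also have "\<dots> = V * (CARD('d) * (r / \<epsilon> ^ (CARD('d) + 1))) + (\<Sum>l\<in>UNIV. measure lborel (?slab l) * ?B)"
      using I_int slab_int by (simp add: V_def ind_lint)
    also have "\<dots> \<le> V * (CARD('d) * (r / \<epsilon> ^ (CARD('d) + 1))) + (\<Sum>l\<in>(UNIV::'n set). r * W * (1 / \<epsilon> ^ (CARD('d) + 1)))"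
    proof (intro add_left_mono sum_mono mult_mono slab_le)
      have "\<epsilon> ^ (CARD('d) + 1) \<le> \<epsilon> ^ CARD('d)" using \<epsilon> by (intro power_decreasing) auto
      then show "?B \<le> 1 / \<epsilon> ^ (CARD('d) + 1)" using \<epsilon> by (simp add: power_one_over frac_le)
    qed (use r W \<epsilon> in auto)
    also have "\<dots> = \<Lambda> * (r / \<epsilon> ^ (CARD('d) + 1))" by (simp add: \<Lambda>_def algebra_simps)
    finally show ?case .
  qed
qed

lemma box_mollified_measurable:
  fixes X :: "'d::finite \<Rightarrow> real^'n \<Rightarrow> 'w \<Rightarrow> real"
  assumes X: "is_LMSS M \<alpha> H X" and [measurable]: "A \<in> sets borel" "\<phi> \<in> borel_measurable borel"
  shows "(\<lambda>w. box_mollified X \<phi> A w x) \<in> borel_measurable M"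
  unfolding box_mollified_def
proof (rule lborel.borel_measurable_lebesgue_integral)
  have [measurable]: "(\<lambda>z. path_val X (snd z) (fst z)) \<in> borel_measurable (M \<Otimes>\<^sub>M lborel)"
  proof -
    have "(\<lambda>z. (snd z, fst z)) \<in> measurable (M \<Otimes>\<^sub>M lborel) (lborel \<Otimes>\<^sub>M M)" by measurable
    from measurable_compose[OF this path_val_measurable[OF X]] show ?thesis by simp
  qed
  show "(\<lambda>(w, s). indicator A s * \<phi> (path_val X s w - x)) \<in> borel_measurable (M \<Otimes>\<^sub>M lborel)"
    unfolding split_beta' by measurable
qed

lemma abs_box_mollified_le:
  fixes X :: "'d::finite \<Rightarrow> real^'n \<Rightarrow> 'w \<Rightarrow> real"
  assumes X: "is_LMSS M \<alpha> H X" "w \<in> space M" and m: "A \<in> sets borel" "\<phi> \<in> borel_measurable borel"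
    and A: "emeasure lborel A < \<infinity>" and b: "\<And>y. \<bar>\<phi> y\<bar> \<le> B"
  shows "\<bar>box_mollified X \<phi> A w x\<bar> \<le> B * measure lborel A"
proof -
  have i: "integrable lborel (\<lambda>s. B * indicator A s :: real)"
    using A m by (intro integrable_mult_right integrable_real_indicator) auto
  have "\<bar>box_mollified X \<phi> A w x\<bar> \<le> (LINT s|lborel. \<bar>indicator A s * \<phi> (path_val X s w - x)\<bar>)"
    unfolding box_mollified_def using integral_norm_bound[of lborel "\<lambda>s. indicator A s * \<phi> (path_val X s w - x)"] by simp
  also have "\<dots> \<le> (LINT s|lborel. B * indicator A s)"
    using integrable_box_mollified[OF X m A b, of x] i b by (intro integral_mono) (auto simp: indicator_def)
  also have "\<dots> = B * measure lborel A" using m by simp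
  finally show ?thesis .
qed

text \<open>The normalised p-th powers over all grid points and all n have a finite expected sum, so
  their sum is almost surely finite and bounds each of them. Of the decay
  \<open>\<epsilon> powr (\<gamma> * p)\<close> one half gives the rate q per level, the other half
  beats the number of grid points.\<close>

lemma AE_grid_bound:
  fixes X :: "'d::finite \<Rightarrow> real^'n \<Rightarrow> 'w \<Rightarrow> real" and e T \<gamma> :: real and G :: "nat \<Rightarrow> ((real^'d) \<times> (real^'n)) set" and N p :: nat
  assumes X: "is_LMSS M \<alpha> H X" and p: "even p" "0 < p" and \<gamma>: "real N + 1 \<le> \<gamma> * real p / 2"
    and mom: "\<And>\<epsilon> x A. 0 < \<epsilon> \<Longrightarrow> A \<in> sets borel \<Longrightarrow> A \<subseteq> cbox (\<chi> l. e) (\<chi> l. T) \<Longrightarrow>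
      \<bar>(LINT w|M. box_mollified X (mollifier_diff \<epsilon>) A w x ^ p)\<bar> \<le> C * \<epsilon> powr (\<gamma> * real p)"
    and G: "\<And>n. finite (G n)" "\<And>n. real (card (G n)) \<le> C0 * 2 ^ (N * n)" "\<And>n x t. (x, t) \<in> G n \<Longrightarrow> t \<in> cbox (\<chi> l. e) (\<chi> l. T)"
    and C: "0 \<le> C" "0 \<le> C0"
  shows "AE w in M. \<exists>B\<ge>0. \<forall>n. \<forall>(x, t)\<in>G n.
    \<bar>box_mollified X (mollifier_diff ((1/2) ^ n)) (cbox (\<chi> l. e) t) w x\<bar> \<le> B * ((1/2) powr (\<gamma> / 2)) ^ n"
proof -
  interpret M: prob_space M using X by (simp add: is_LMSS_def)
  let ?D = "\<lambda>n x t w. box_mollified X (mollifier_diff ((1/2) ^ n)) (cbox (\<chi> l. e) t) w x"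
  define q :: real where "q = (1/2) powr (\<gamma> / 2)"
  have q: "0 < q" by (simp add: q_def)
  \<comment> \<open>Per level, \<open>q ^ p\<close> outweighs the growth \<open>2 ^ N\<close> of the
    grid with a factor 1/2 to spare, which makes the series over n geometric.\<close>
  have qp: "q ^ p \<le> (1/2) ^ Suc N"
  proof -
    have "q ^ p = (1/2) powr (\<gamma> * real p / 2)" by (simp add: q_def powr_power mult.commute)
    also have "\<dots> \<le> (1/2) powr (real (Suc N))" using \<gamma> by (intro powr_mono') auto
    also have "\<dots> = (1/2) ^ Suc N" by (rule powr_realpow) simp
    finally show ?thesis .
  qed
  have Dm [measurable]: "?D n x t \<in> borel_measurable M" for n x t
    by (rule box_mollified_measurable[OF X]) auto
  define Y where "Y n w = (\<Sum>(x, t)\<in>G n. (?D n x t w / q ^ n) ^ p)" for n w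
  have [measurable]: "Y n \<in> borel_measurable M" for n unfolding Y_def[abs_def] split_beta' by measurable
  have trm: "(\<integral>\<^sup>+ w. ennreal ((?D n x t w / q ^ n) ^ p) \<partial>M) \<le> ennreal (C * (q ^ p) ^ n)" if t: "t \<in> cbox (\<chi> l. e) (\<chi> l. T)" for n x t
  proof -
    have "integrable M (\<lambda>w. (?D n x t w / q ^ n) ^ p)"
    proof (rule M.integrable_const_bound)
      let ?B = "(2 / (1/2) ^ n) ^ CARD('d) * measure lborel (cbox (\<chi> l. e) t)"
      have "\<bar>?D n x t w\<bar> \<le> ?B" if "w \<in> space M" for w
        by (rule abs_box_mollified_le[OF X that]) (auto simp: emeasure_lborel_cbox_eq intro!: abs_mollifier_diff_le)
      then have "norm ((?D n x t w / q ^ n) ^ p) \<le> (?B / q ^ n) ^ p" if "w \<in> space M" for w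
        using that q by (auto simp: power_abs abs_divide intro!: power_mono divide_right_mono)
      then show "AE w in M. norm ((?D n x t w / q ^ n) ^ p) \<le> (?B / q ^ n) ^ p" by (intro AE_I2)
    qed measurable
    then have "(\<integral>\<^sup>+ w. ennreal ((?D n x t w / q ^ n) ^ p) \<partial>M) = ennreal (LINT w|M. (?D n x t w / q ^ n) ^ p)"
      using p(1) by (intro nn_integral_eq_integral) (auto simp: zero_le_even_power)
    also have "(LINT w|M. (?D n x t w / q ^ n) ^ p) = (LINT w|M. ?D n x t w ^ p) / (q ^ n) ^ p"
      by (simp add: power_divide)
    also have "\<dots> \<le> C * ((1/2) ^ n) powr (\<gamma> * real p) / (q ^ n) ^ p"
    proof (intro divide_right_mono order_trans[OF abs_ge_self mom])
      show "cbox (\<chi> l. e) t \<subseteq> cbox (\<chi> l. e) (\<chi> l. T)" using t by (auto simp: mem_box_cart) (metis order_trans)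
    qed (use q in auto)
    also have "((1/2) ^ n) powr (\<gamma> * real p) = (q ^ n) ^ p * (q ^ n) ^ p"
    proof -
      have "(q ^ n) ^ p * (q ^ n) ^ p = (1/2) powr (real n * (\<gamma> / 2) * real p + real n * (\<gamma> / 2) * real p)"
        unfolding powr_add by (simp add: q_def powr_power mult_ac)
      also have "\<dots> = ((1/2) powr real n) powr (\<gamma> * real p)" by (simp add: powr_powr field_simps)
      finally show ?thesis by (simp add: powr_realpow)
    qed
    also have "C * ((q ^ n) ^ p * (q ^ n) ^ p) / (q ^ n) ^ p = C * (q ^ p) ^ n"
      using q by (simp add: power_mult[symmetric] mult.commute)
    finally show ?thesis by (simp add: ennreal_leI)
  qed
  have Yint: "(\<integral>\<^sup>+ w. ennreal (Y n w) \<partial>M) \<le> ennreal (C0 * C * (1/2) ^ n)" for n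
  proof -
    have "(\<integral>\<^sup>+ w. ennreal (Y n w) \<partial>M) = (\<integral>\<^sup>+ w. (\<Sum>(x, t)\<in>G n. ennreal ((?D n x t w / q ^ n) ^ p)) \<partial>M)"
      unfolding Y_def using p(1) by (intro nn_integral_cong, subst sum_ennreal[symmetric]) (auto simp: zero_le_even_power split_beta')
    also have "\<dots> = (\<Sum>(x, t)\<in>G n. \<integral>\<^sup>+ w. ennreal ((?D n x t w / q ^ n) ^ p) \<partial>M)"
      unfolding split_beta' by (intro nn_integral_sum) measurable
    also have "\<dots> \<le> (\<Sum>(x, t)\<in>G n. ennreal (C * (q ^ p) ^ n))"
      using G(3) trm by (intro sum_mono) auto
    also have "\<dots> = ennreal (real (card (G n)) * (C * (q ^ p) ^ n))"
      using C q by (simp add: ennreal_mult ennreal_of_nat_eq_real_of_nat split_beta' less_imp_le)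
    also have "\<dots> \<le> ennreal (C0 * C * (1/2) ^ n)"
    proof (intro ennreal_leI)
      have "real (card (G n)) * (C * (q ^ p) ^ n) \<le> (C0 * 2 ^ (N * n)) * (C * ((1/2) ^ Suc N) ^ n)"
        using G(2) C q qp by (intro mult_mono mult_left_mono power_mono) auto
      also have "\<dots> = C0 * C * ((2 ^ N * (1/2) ^ Suc N) ^ n)"
        by (simp only: power_mult power_mult_distrib mult_ac)
      also have "(2 ^ N * (1/2) ^ Suc N :: real) = 1/2" by (simp add: power_one_over)
      finally show "real (card (G n)) * (C * (q ^ p) ^ n) \<le> C0 * C * (1/2) ^ n" .
    qed
    finally show ?thesis .
  qed
  have "(\<integral>\<^sup>+ w. (\<Sum>n. ennreal (Y n w)) \<partial>M) = (\<Sum>n. \<integral>\<^sup>+ w. ennreal (Y n w) \<partial>M)"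
    by (rule nn_integral_suminf) measurable
  also have "\<dots> \<le> (\<Sum>n. ennreal (C0 * C * (1/2) ^ n))"
    by (intro suminf_le Yint) auto
  also have "\<dots> = ennreal (\<Sum>n. C0 * C * (1/2) ^ n)"
    using C by (intro suminf_ennreal2) (auto intro!: summable_mult summable_geometric)
  also have "\<dots> < \<infinity>" by simp
  finally have "AE w in M. (\<Sum>n. ennreal (Y n w)) \<noteq> \<infinity>"
    by (intro nn_integral_noteq_infinite) auto
  then show ?thesis
  proof (rule AE_mp, intro AE_I2 impI)
    fix w assume "(\<Sum>n. ennreal (Y n w)) \<noteq> \<infinity>"
    then obtain S where S: "S \<ge> 0" "(\<Sum>n. ennreal (Y n w)) = ennreal S"
      by (cases "\<Sum>n. ennreal (Y n w)") auto
    have "\<bar>?D n x t w\<bar> \<le> max 1 S * q ^ n" if z: "(x, t) \<in> G n" for n x t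
    proof -
      have nn: "0 \<le> (?D n x t w / q ^ n) ^ p" for n x t using p(1) by (simp add: zero_le_even_power)
      have "(?D n x t w / q ^ n) ^ p \<le> Y n w"
        unfolding Y_def using nn member_le_sum[OF z, of "\<lambda>(x, t). (?D n x t w / q ^ n) ^ p"] G(1) by auto
      moreover have "ennreal (Y n w) \<le> ennreal S"
        unfolding S(2)[symmetric] using sum_le_suminf[of "\<lambda>n. ennreal (Y n w)" "{n}"] by simp
      ultimately have le: "(?D n x t w / q ^ n) ^ p \<le> S" using S(1) by (simp add: ennreal_le_iff)
      define y where "y = \<bar>?D n x t w\<bar> / q ^ n"
      have yp: "y ^ p \<le> S" using le p(1) q unfolding y_def by (metis abs_divide abs_of_pos power_even_abs zero_less_power)
      \<comment> \<open>A value above 1 is at most its p-th power; the maximum with 1 covers the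
        rest and avoids extracting a root.\<close>
      have "y \<le> max 1 S"
      proof (cases "y \<le> 1")
        case False
        then have "y ^ 1 \<le> y ^ p" using p(2) by (intro power_increasing) auto
        then show ?thesis using yp by simp
      qed simp
      then show ?thesis unfolding y_def using q by (simp add: pos_divide_le_eq)
    qed
    then show "\<exists>B\<ge>0. \<forall>n. \<forall>(x, t)\<in>G n. \<bar>?D n x t w\<bar> \<le> B * ((1/2) powr (\<gamma> / 2)) ^ n"
      unfolding q_def[symmetric] by (intro exI[of _ "max 1 S"]) auto
  qed
qed

section \<open>Finite grids in boxes\<close>

lemma interval_grid:
  fixes lo hi r :: real
  assumes "lo \<le> hi" "0 < r" "r \<le> 1"
  shows "\<exists>g. finite g \<and> g \<subseteq> {lo..hi} \<and> real (card g) \<le> (hi - lo + 1) / r \<and> (\<forall>x\<in>{lo..hi}. \<exists>y\<in>g. \<bar>x - y\<bar> \<le> r)"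
proof -
  define m where "m = nat \<lfloor>(hi - lo) / r\<rfloor>"
  define g where "g = (\<lambda>i. lo + r * real i) ` {..m}"
  have m: "real m \<le> (hi - lo) / r" using assms by (simp add: m_def)
  show ?thesis
  proof (intro exI[of _ g] conjI ballI)
    show "finite g" by (simp add: g_def)
    show "g \<subseteq> {lo..hi}"
    proof
      fix y assume "y \<in> g"
      then obtain i where i: "i \<le> m" "y = lo + r * real i" by (auto simp: g_def)
      then have "real i \<le> (hi - lo) / r" using m by linarith
      then have "r * real i \<le> hi - lo" using assms by (simp add: pos_le_divide_eq mult.commute)
      then show "y \<in> {lo..hi}" using i assms by auto
    qed
    have "real (card g) \<le> real m + 1" unfolding g_def using card_image_le[of "{..m}" "\<lambda>i. lo + r * real i"] by simp
    also have "\<dots> \<le> (hi - lo) / r + 1 / r" using m assms by (intro add_mono) auto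
    finally show "real (card g) \<le> (hi - lo + 1) / r" by (simp add: add_divide_distrib)
    fix x assume x: "x \<in> {lo..hi}"
    define i where "i = nat \<lfloor>(x - lo) / r\<rfloor>"
    have "real i \<le> (x - lo) / r" "(x - lo) / r < real i + 1" using x assms by (auto simp: i_def)
    then have "r * real i \<le> x - lo" "x - lo < r * (real i + 1)" using assms
      by (auto simp: pos_le_divide_eq pos_divide_less_eq mult.commute)
    moreover have "i \<le> m" unfolding i_def m_def using x assms by (intro nat_mono floor_mono divide_right_mono) auto
    ultimately show "\<exists>y\<in>g. \<bar>x - y\<bar> \<le> r"
      by (intro bexI[of _ "lo + r * real i"]) (auto simp: g_def distrib_left)
  qed
qed

lemma box_grid:
  fixes lo hi r :: real
  assumes "lo \<le> hi" "0 < r" "r \<le> 1"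
  shows "\<exists>g :: (real^'k::finite) set. finite g \<and> g \<subseteq> cbox (\<chi> k. lo) (\<chi> k. hi) \<and> real (card g) \<le> ((hi - lo + 1) / r) ^ CARD('k) \<and>
    (\<forall>x\<in>cbox (\<chi> k. lo) (\<chi> k. hi). \<exists>y\<in>g. \<forall>k. \<bar>x $ k - y $ k\<bar> \<le> r)"
proof -
  obtain g0 where g0: "finite g0" "g0 \<subseteq> {lo..hi}" "real (card g0) \<le> (hi - lo + 1) / r" "\<And>x. x\<in>{lo..hi} \<Longrightarrow> \<exists>y\<in>g0. \<bar>x - y\<bar> \<le> r"
    using interval_grid[OF assms] by blast
  define g :: "(real^'k) set" where "g = (\<lambda>f. \<chi> k. f k) ` PiE UNIV (\<lambda>_. g0)"
  have fin: "finite (PiE (UNIV :: 'k set) (\<lambda>_. g0))" using g0 by (intro finite_PiE) auto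
  show ?thesis
  proof (intro exI[of _ g] conjI ballI)
    show "finite g" unfolding g_def using fin by simp
    show "g \<subseteq> cbox (\<chi> k. lo) (\<chi> k. hi)" unfolding g_def using g0(2) by (fastforce simp: mem_box_cart PiE_def Pi_def)
    have "real (card g) \<le> real (card (PiE (UNIV :: 'k set) (\<lambda>_. g0)))" unfolding g_def using card_image_le[OF fin] by simp
    also have "\<dots> = real (card g0) ^ CARD('k)" by (simp add: card_PiE)
    also have "\<dots> \<le> ((hi - lo + 1) / r) ^ CARD('k)" using g0(3) by (intro power_mono) auto
    finally show "real (card g) \<le> ((hi - lo + 1) / r) ^ CARD('k)" .
    fix x :: "real^'k" assume "x \<in> cbox (\<chi> k. lo) (\<chi> k. hi)"
    then have "\<exists>y\<in>g0. \<bar>x $ k - y\<bar> \<le> r" for k using g0(4)[of "x $ k"] by (auto simp: mem_box_cart)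
    then obtain f where f: "\<And>k. f k \<in> g0" "\<And>k. \<bar>x $ k - f k\<bar> \<le> r" by metis
    then show "\<exists>y\<in>g. \<forall>k. \<bar>x $ k - y $ k\<bar> \<le> r"
      by (intro bexI[of _ "\<chi> k. f k"]) (auto simp: g_def)
  qed
qed

lemma box_mollified_diff:
  fixes X :: "'d::finite \<Rightarrow> real^'n \<Rightarrow> 'w \<Rightarrow> real"
  assumes X: "is_LMSS M \<alpha> H X" "w \<in> space M" and \<epsilon>: "0 < \<epsilon>"
  shows "box_mollified X (mollifier_diff \<epsilon>) (cbox a t) w x =
    box_mollified X (mollifier \<epsilon>) (cbox a t) w x - box_mollified X (mollifier (\<epsilon> / 2)) (cbox a t) w x"
proof -
  have int: "integrable lborel (\<lambda>s. indicator (cbox a t) s * mollifier e (path_val X s w - x) :: real)" if "e > 0" for e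
  proof (rule integrable_box_mollified[OF X])
    show "\<bar>mollifier e z\<bar> \<le> (1 / e) ^ CARD('d)" for z :: "real^'d"
      using mollifier_le[OF that, of z] mollifier_nonneg[of e z] by simp
  qed (auto simp: emeasure_lborel_cbox_eq)
  show ?thesis
    unfolding box_mollified_def mollifier_diff_def right_diff_distrib
    using int[OF \<epsilon>] int[of "\<epsilon> / 2"] \<epsilon> by (intro Bochner_Integration.integral_diff) auto
qed

text \<open>The grid of level n has mesh \<open>(1/2) ^ ((d + 2) * n)\<close> with d the number of
  components. The Lipschitz constant is of order \<open>2 ^ ((d + 1) * n)\<close>, so passing to a
  nearby grid point costs a multiple of \<open>(1/2) ^ n\<close>, while the number of grid points is
  of order \<open>2 ^ (N * n)\<close>, against which p is chosen.\<close>

lemma AE_uniform_bound: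
  fixes X :: "'d::finite \<Rightarrow> real^'n \<Rightarrow> 'w \<Rightarrow> real" and e T \<gamma> R :: real
  assumes X: "is_LMSS M \<alpha> H X" and eT: "e \<le> T" and R: "0 \<le> R" and \<gamma>: "0 < \<gamma>"
    and mom: "\<forall>p::nat. \<exists>C\<ge>0. \<forall>\<epsilon> x A. 0 < \<epsilon> \<and> A \<in> sets borel \<and> A \<subseteq> cbox (\<chi> l. e) (\<chi> l. T) \<longrightarrow>
      \<bar>(LINT w|M. box_mollified X (mollifier_diff \<epsilon>) A w x ^ p)\<bar> \<le> C * \<epsilon> powr (\<gamma> * real p)"
  shows "AE w in M. \<exists>u. summable u \<and> (\<forall>n. \<forall>x\<in>cbox (\<chi> k. -R) (\<chi> k. R). \<forall>t\<in>cbox (\<chi> l. e) (\<chi> l. T).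
    \<bar>box_mollified X (mollifier_diff ((1/2) ^ n)) (cbox (\<chi> l. e) t) w x\<bar> \<le> u n)"
proof -
  let ?m = "CARD('d) + 2"
  let ?r = "\<lambda>n. (1/2 :: real) ^ (?m * n)"
  let ?I = "cbox (\<chi> l. e) (\<chi> l. T) :: (real^'n) set"
  let ?K = "cbox (\<chi> k. -R) (\<chi> k. R) :: (real^'d) set"
  let ?D = "\<lambda>n x t w. box_mollified X (mollifier_diff ((1/2) ^ n)) (cbox (\<chi> l. e) t) w x"
  define N where "N = ?m * (CARD('d) + CARD('n))"
  obtain p0 :: nat where p0: "2 * (real N + 1) / \<gamma> \<le> real p0" using real_arch_simple by blast
  \<comment> \<open>Even, so that the p-th power needs no absolute value, and large enough for the
    moment decay to beat the grid.\<close>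
  define p where "p = 2 * (p0 + 1)"
  have p: "even p" "0 < p" "real N + 1 \<le> \<gamma> * real p / 2"
  proof -
    have "2 * (real N + 1) \<le> \<gamma> * real p0" using p0 \<gamma> by (simp add: pos_divide_le_eq mult.commute)
    also have "\<dots> \<le> \<gamma> * real p" using \<gamma> by (intro mult_left_mono) (auto simp: p_def)
    finally show "real N + 1 \<le> \<gamma> * real p / 2" by simp
  qed (auto simp: p_def)
  obtain C where C: "C \<ge> 0" and Cb: "\<And>\<epsilon> x A. 0 < \<epsilon> \<Longrightarrow> A \<in> sets borel \<Longrightarrow> A \<subseteq> ?I \<Longrightarrow>
      \<bar>(LINT w|M. box_mollified X (mollifier_diff \<epsilon>) A w x ^ p)\<bar> \<le> C * \<epsilon> powr (\<gamma> * real p)"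
    using mom[rule_format, of p] by auto
  have r: "0 < ?r n" "?r n \<le> 1" for n by (auto simp: power_le_one)
  have "\<exists>g :: (real^'d) set. finite g \<and> g \<subseteq> ?K \<and> real (card g) \<le> ((R - (- R) + 1) / ?r n) ^ CARD('d) \<and>
    (\<forall>x\<in>?K. \<exists>y\<in>g. \<forall>k. \<bar>x $ k - y $ k\<bar> \<le> ?r n)" for n
    by (rule box_grid) (use R r in auto)
  then obtain gx where gx: "\<And>n. finite (gx n)" "\<And>n. real (card (gx n)) \<le> ((R - (- R) + 1) / ?r n) ^ CARD('d)"
    "\<And>n x. x \<in> ?K \<Longrightarrow> \<exists>y\<in>gx n. \<forall>k. \<bar>x $ k - y $ k\<bar> \<le> ?r n" by metis
  have "\<exists>g :: (real^'n) set. finite g \<and> g \<subseteq> ?I \<and> real (card g) \<le> ((T - e + 1) / ?r n) ^ CARD('n) \<and>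
    (\<forall>x\<in>?I. \<exists>y\<in>g. \<forall>k. \<bar>x $ k - y $ k\<bar> \<le> ?r n)" for n
    by (rule box_grid) (use eT r in auto)
  then obtain gt where gt: "\<And>n. finite (gt n)" "\<And>n. gt n \<subseteq> ?I" "\<And>n. real (card (gt n)) \<le> ((T - e + 1) / ?r n) ^ CARD('n)"
    "\<And>n t. t \<in> ?I \<Longrightarrow> \<exists>u\<in>gt n. \<forall>l. \<bar>t $ l - u $ l\<bar> \<le> ?r n" by metis
  define C0 where "C0 = (R - (- R) + 1) ^ CARD('d) * (T - e + 1) ^ CARD('n)"
  have C0: "C0 \<ge> 0" using R eT by (simp add: C0_def)
  have cardG: "real (card (gx n \<times> gt n)) \<le> C0 * 2 ^ (N * n)" for n
  proof -
    have "real (card (gx n \<times> gt n)) \<le> ((R - (- R) + 1) / ?r n) ^ CARD('d) * ((T - e + 1) / ?r n) ^ CARD('n)"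
      unfolding card_cartesian_product of_nat_mult using gx(2) gt(3) R r by (intro mult_mono) auto
    also have "\<dots> = C0 * (1 / ?r n) ^ (CARD('d) + CARD('n))"
    proof -
      have "(A / r) ^ a * (B / r) ^ b = A ^ a * B ^ b * (1 / r) ^ (a + b)" for A B r :: real and a b :: nat
        by (simp add: power_divide power_add)
      then show ?thesis by (simp only: C0_def)
    qed
    also have "(1 / ?r n) ^ (CARD('d) + CARD('n)) = 2 ^ (N * n)"
      by (simp add: N_def power_one_over flip: power_mult) (simp add: algebra_simps)
    finally show ?thesis .
  qed
  have ae: "AE w in M. \<exists>B\<ge>0. \<forall>n. \<forall>(x, t)\<in>gx n \<times> gt n. \<bar>?D n x t w\<bar> \<le> B * ((1/2) powr (\<gamma> / 2)) ^ n"
  proof (rule AE_grid_bound[OF X p Cb _ cardG _ C C0])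
    show "finite (gx n \<times> gt n)" for n using gx(1) gt(1) by simp
    show "t \<in> ?I" if "(x, t) \<in> gx n \<times> gt n" for n x t using that gt(2) by blast
  qed
  obtain \<Lambda> where \<Lambda>: "\<Lambda> \<ge> 0" and lip: "\<forall>w\<in>space M. \<forall>\<epsilon> x y t u r. 0 < \<epsilon> \<and> \<epsilon> \<le> 1 \<and> t \<in> ?I \<and> u \<in> ?I \<and>
      (\<forall>k. \<bar>x $ k - y $ k\<bar> \<le> r) \<and> (\<forall>l. \<bar>t $ l - u $ l\<bar> \<le> r) \<longrightarrow>
    \<bar>box_mollified X (mollifier \<epsilon>) (cbox (\<chi> l. e) t) w x - box_mollified X (mollifier \<epsilon>) (cbox (\<chi> l. e) u) w y\<bar>
      \<le> \<Lambda> * (r / \<epsilon> ^ (CARD('d) + 1))"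
    using box_mollified_lipschitz[OF X eT] by blast
  define q :: real where "q = (1/2) powr (\<gamma> / 2)"
  have q: "0 < q" "q < 1"
  proof -
    have "(1/2) powr (\<gamma> / 2) < (1/2::real) powr 0" using \<gamma> by (intro powr_less_mono') auto
    then show "q < 1" by (simp add: q_def)
  qed (simp add: q_def)
  show ?thesis
    using ae
  proof (rule AE_mp, intro AE_I2 impI)
    fix w assume w: "w \<in> space M" and "\<exists>B\<ge>0. \<forall>n. \<forall>(x, t)\<in>gx n \<times> gt n. \<bar>?D n x t w\<bar> \<le> B * ((1/2) powr (\<gamma> / 2)) ^ n"
    then obtain B where B: "B \<ge> 0" "\<And>n x t. x \<in> gx n \<Longrightarrow> t \<in> gt n \<Longrightarrow> \<bar>?D n x t w\<bar> \<le> B * q ^ n"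
      unfolding q_def by auto
    \<comment> \<open>The bound at the grid points plus the two Lipschitz errors, at the scales
      \<open>(1/2) ^ n\<close> and \<open>(1/2) ^ n / 2\<close>.\<close>
    define u where "u n = B * q ^ n + (\<Lambda> + \<Lambda> * 2 ^ (CARD('d) + 1)) * (1/2) ^ n" for n
    have "summable u" unfolding u_def using q
      by (intro summable_add summable_mult summable_geometric) auto
    moreover have "\<bar>?D n x t w\<bar> \<le> u n" if x: "x \<in> ?K" and t: "t \<in> ?I" for n x t
    proof -
      obtain y where y: "y \<in> gx n" "\<And>k. \<bar>x $ k - y $ k\<bar> \<le> ?r n" using gx(3)[OF x] by blast
      obtain v where v: "v \<in> gt n" "\<And>l. \<bar>t $ l - v $ l\<bar> \<le> ?r n" using gt(4)[OF t] by blast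
      have vI: "v \<in> ?I" using v gt(2) by blast
      let ?F = "\<lambda>\<epsilon> x t. box_mollified X (mollifier \<epsilon>) (cbox (\<chi> l. e) t) w x"
      have L: "\<bar>?F \<epsilon> x t - ?F \<epsilon> y v\<bar> \<le> \<Lambda> * (?r n / \<epsilon> ^ (CARD('d) + 1))" if "0 < \<epsilon>" "\<epsilon> \<le> 1" for \<epsilon>
        using lip[rule_format, OF w, of \<epsilon> t v x y "?r n"] that t vI y v by blast
      have e1: "?r n / ((1/2) ^ n) ^ (CARD('d) + 1) = (1/2) ^ n"
      proof -
        have "?m * n = n * (CARD('d) + 1) + n" by (simp add: algebra_simps)
        then have "?r n = ((1/2) ^ n) ^ (CARD('d) + 1) * (1/2) ^ n" by (simp only: power_add power_mult)
        then show ?thesis by simp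
      qed
      have e2: "?r n / ((1/2) ^ n / 2) ^ (CARD('d) + 1) = 2 ^ (CARD('d) + 1) * (1/2) ^ n"
      proof -
        have "x / (y / b) = b * (x / y)" for x y b :: real by simp
        then show ?thesis by (simp only: power_divide[of "(1/2) ^ n" 2] e1)
      qed
      have l1: "\<bar>?F ((1/2) ^ n) x t - ?F ((1/2) ^ n) y v\<bar> \<le> \<Lambda> * (1/2) ^ n"
        using L[of "(1/2) ^ n"] unfolding e1 by (simp add: power_le_one)
      have l2: "\<bar>?F ((1/2) ^ n / 2) x t - ?F ((1/2) ^ n / 2) y v\<bar> \<le> \<Lambda> * (2 ^ (CARD('d) + 1) * (1/2) ^ n)"
      proof -
        have "(1/2 :: real) ^ n \<le> 1" by (simp add: power_le_one)
        then have "0 < (1/2 :: real) ^ n / 2" "(1/2 :: real) ^ n / 2 \<le> 1" by auto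
        then show ?thesis using L[of "(1/2) ^ n / 2"] unfolding e2 by blast
      qed
      have "?D n x t w = ?F ((1/2) ^ n) x t - ?F ((1/2) ^ n / 2) x t" "?D n y v w = ?F ((1/2) ^ n) y v - ?F ((1/2) ^ n / 2) y v"
        by (rule box_mollified_diff[OF X w], simp)+
      then have "\<bar>?D n x t w\<bar> \<le> \<bar>?D n y v w\<bar> + \<Lambda> * (1/2) ^ n + \<Lambda> * (2 ^ (CARD('d) + 1) * (1/2) ^ n)"
        using l1 l2 by linarith
      also have "\<dots> \<le> u n" unfolding u_def using B(2)[OF y(1) v(1)] by (simp add: algebra_simps)
      finally show ?thesis .
    qed
    ultimately show "\<exists>u. summable u \<and> (\<forall>n. \<forall>x\<in>?K. \<forall>t\<in>?I. \<bar>?D n x t w\<bar> \<le> u n)" by blast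
  qed
qed

text \<open>Telescoping over the scales and the Weierstrass M-test. The limit is written with
  \<open>lim\<close> because that expression does not involve K, so the limits on different compact
  sets are restrictions of one function.\<close>

lemma uniform_limit_mollified:
  fixes X :: "'d::finite \<Rightarrow> real^'n \<Rightarrow> 'w \<Rightarrow> real" and K :: "(real^'d) set" and I :: "(real^'n) set"
  assumes X: "is_LMSS M \<alpha> H X" "w \<in> space M" and u: "summable u"
    and b: "\<And>n x t. x \<in> K \<Longrightarrow> t \<in> I \<Longrightarrow> \<bar>box_mollified X (mollifier_diff ((1/2) ^ n)) (cbox a t) w x\<bar> \<le> u n"
  shows "uniform_limit (K \<times> I) (\<lambda>n (x, t). box_mollified X (mollifier ((1/2) ^ n)) (cbox a t) w x)
    (\<lambda>(x, t). lim (\<lambda>n. box_mollified X (mollifier ((1/2) ^ n)) (cbox a t) w x)) sequentially"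
proof -
  let ?F = "\<lambda>n z. case z of (x, t) \<Rightarrow> box_mollified X (mollifier ((1/2) ^ n)) (cbox a t) w x"
  let ?D = "\<lambda>n z. ?F (Suc n) z - ?F n z"
  have D: "norm (?D n z) \<le> u n" if zKI: "z \<in> K \<times> I" for n z
  proof -
    obtain x t where z: "z = (x, t)" "x \<in> K" "t \<in> I" using zKI by auto
    have "?D n z = - box_mollified X (mollifier_diff ((1/2) ^ n)) (cbox a t) w x"
      unfolding z by (subst box_mollified_diff[OF X]) (auto simp: field_simps)
    then show ?thesis using b[OF z(2,3), of n] by simp
  qed
  define L where "L z = ?F 0 z + (\<Sum>n. ?D n z)" for z
  have "uniform_limit (K \<times> I) (\<lambda>n z. \<Sum>i<n. ?D i z) (\<lambda>z. \<Sum>n. ?D n z) sequentially"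
    by (rule Weierstrass_m_test[OF D u])
  then have "uniform_limit (K \<times> I) (\<lambda>n z. ?F 0 z + (\<Sum>i<n. ?D i z)) (\<lambda>z. ?F 0 z + (\<Sum>n. ?D n z)) sequentially"
    by (intro uniform_limit_add uniform_limit_const)
  moreover have "?F 0 z + (\<Sum>i<n. ?D i z) = ?F n z" for n z
    using sum_lessThan_telescope[of "\<lambda>n. ?F n z" n] by linarith
  ultimately have ul: "uniform_limit (K \<times> I) ?F L sequentially" unfolding L_def by simp
  have Leq: "(case z of (x, t) \<Rightarrow> lim (\<lambda>n. box_mollified X (mollifier ((1/2) ^ n)) (cbox a t) w x)) = L z" if zKI: "z \<in> K \<times> I" for z
  proof -
    obtain x t where z: "z = (x, t)" by (cases z)
    have "(\<lambda>n. ?F n z) \<longlonglongrightarrow> L z" by (rule tendsto_uniform_limitI[OF ul zKI])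
    then show ?thesis unfolding z by (simp add: limI)
  qed
  have "uniform_limit (K \<times> I) ?F (\<lambda>(x, t). lim (\<lambda>n. box_mollified X (mollifier ((1/2) ^ n)) (cbox a t) w x)) sequentially
    \<longleftrightarrow> uniform_limit (K \<times> I) ?F L sequentially"
    by (rule uniform_limit_cong'[OF refl Leq])
  then show ?thesis using ul by blast
qed

section \<open>Occupation formula\<close>

lemma nn_integral_normal_density_real: "(\<integral>\<^sup>+ r. ennreal (normal_density 0 1 r) \<partial>lborel) = 1"
  using integral_normal_density[of 1 0] integrable_normal_density[of 1 0]
  by (subst nn_integral_eq_integral) auto

lemma nn_integral_mollifier: "(\<integral>\<^sup>+ z. ennreal (mollifier 1 z) \<partial>(lborel :: (real^'d::finite) measure)) = 1"
proof -
  have "(\<integral>\<^sup>+ z. ennreal (mollifier 1 z) \<partial>(lborel :: (real^'d) measure)) =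
    (\<integral>\<^sup>+ z. (\<Prod>k\<in>UNIV. ennreal (normal_density 0 1 (z $ k))) \<partial>(lborel :: (real^'d) measure))"
    by (simp add: mollifier_def prod_ennreal)
  also have "\<dots> = (\<Prod>k\<in>(UNIV::'d set). \<integral>\<^sup>+ r. ennreal (normal_density 0 1 r) \<partial>lborel)"
    by (rule nn_integral_lborel_vec_prod) measurable
  finally show ?thesis by (simp add: nn_integral_normal_density_real)
qed

lemma mollifier_scale:
  fixes z :: "real^'d::finite"
  assumes "\<epsilon> > 0"
  shows "mollifier \<epsilon> (\<epsilon> *\<^sub>R z) = mollifier 1 z / \<epsilon> ^ CARD('d)"
proof -
  have "normal_density 0 \<epsilon> (\<epsilon> * r) = normal_density 0 1 r / \<epsilon>" for r
    using assms by (simp add: normal_density_def power_mult_distrib real_sqrt_mult)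
  then show ?thesis by (simp add: mollifier_def prod_dividef)
qed

text \<open>The substitution \<open>x = y - \<epsilon> *\<^sub>R z\<close> moves the scale from the
  kernel into g, so that letting \<epsilon> tend to 0 becomes a dominated limit against a fixed
  probability density.\<close>

lemma nn_integral_mollifier_convolution:
  fixes g :: "real^'d::finite \<Rightarrow> ennreal"
  assumes \<epsilon>: "\<epsilon> > 0" and [measurable]: "g \<in> borel_measurable borel"
  shows "(\<integral>\<^sup>+ x. g x * ennreal (mollifier \<epsilon> (y - x)) \<partial>lborel) = (\<integral>\<^sup>+ z. g (y - \<epsilon> *\<^sub>R z) * ennreal (mollifier 1 z) \<partial>lborel)"
proof -
  have "(\<integral>\<^sup>+ x. g x * ennreal (mollifier \<epsilon> (y - x)) \<partial>lborel) =
    (\<integral>\<^sup>+ x. g x * ennreal (mollifier \<epsilon> (y - x)) \<partial>density (distr lborel borel (\<lambda>z. y + (- \<epsilon>) *\<^sub>R z)) (\<lambda>_. \<bar>- \<epsilon>\<bar> ^ DIM(real^'d)))"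
    using \<epsilon> by (subst lborel_affine[of "- \<epsilon>" y]) auto
  also have "\<dots> = (\<integral>\<^sup>+ z. ennreal (\<epsilon> ^ CARD('d)) * (g (y - \<epsilon> *\<^sub>R z) * ennreal (mollifier \<epsilon> (\<epsilon> *\<^sub>R z))) \<partial>lborel)"
    using \<epsilon> by (subst nn_integral_density) (auto simp: nn_integral_distr)
  also have "\<dots> = (\<integral>\<^sup>+ z. g (y - \<epsilon> *\<^sub>R z) * ennreal (mollifier 1 z) \<partial>lborel)"
  proof (rule nn_integral_cong)
    fix z :: "real^'d"
    have "ennreal (\<epsilon> ^ CARD('d)) * ennreal (mollifier \<epsilon> (\<epsilon> *\<^sub>R z)) = ennreal (mollifier 1 z)"
      using \<epsilon> by (simp add: mollifier_scale ennreal_mult[symmetric] mollifier_nonneg)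
    then show "ennreal (\<epsilon> ^ CARD('d)) * (g (y - \<epsilon> *\<^sub>R z) * ennreal (mollifier \<epsilon> (\<epsilon> *\<^sub>R z))) = g (y - \<epsilon> *\<^sub>R z) * ennreal (mollifier 1 z)"
      by (metis mult.left_commute)
  qed
  finally show ?thesis .
qed

lemma mollifier_convolution_tendsto:
  fixes g :: "real^'d::finite \<Rightarrow> real"
  assumes g: "continuous_on UNIV g" "\<And>x. 0 \<le> g x" "\<And>x. g x \<le> 1"
  shows "(\<lambda>n. \<integral>\<^sup>+ x. ennreal (g x) * ennreal (mollifier ((1/2) ^ n) (y - x)) \<partial>lborel) \<longlonglongrightarrow> ennreal (g y)"
proof -
  have [measurable]: "g \<in> borel_measurable borel" by (rule borel_measurable_continuous_onI[OF g(1)])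
  have "(\<lambda>n. \<integral>\<^sup>+ z. ennreal (g (y - (1/2) ^ n *\<^sub>R z)) * ennreal (mollifier 1 z) \<partial>(lborel :: (real^'d) measure))
    \<longlonglongrightarrow> (\<integral>\<^sup>+ z. ennreal (g y) * ennreal (mollifier 1 z) \<partial>(lborel :: (real^'d) measure))"
  proof (rule nn_integral_dominated_convergence[where w = "\<lambda>z :: real^'d. ennreal (mollifier 1 z)"])
    show "AE z in lborel. ennreal (g (y - (1/2) ^ n *\<^sub>R z)) * ennreal (mollifier 1 z) \<le> ennreal (mollifier 1 z)" for n
    proof (rule AE_I2)
      fix z
      have "ennreal (g (y - (1/2) ^ n *\<^sub>R z)) * ennreal (mollifier 1 z) \<le> 1 * ennreal (mollifier 1 z)"
        using g(3) by (intro mult_right_mono) (auto simp: ennreal_le_1)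
      then show "ennreal (g (y - (1/2) ^ n *\<^sub>R z)) * ennreal (mollifier 1 z) \<le> ennreal (mollifier 1 z)" by simp
    qed
    show "AE z in lborel. (\<lambda>n. ennreal (g (y - (1/2) ^ n *\<^sub>R z)) * ennreal (mollifier 1 z)) \<longlonglongrightarrow> ennreal (g y) * ennreal (mollifier 1 z)"
    proof (rule AE_I2)
      fix z
      have "(\<lambda>n. y - (1/2) ^ n *\<^sub>R z) \<longlonglongrightarrow> y - 0 *\<^sub>R z"
        by (intro tendsto_diff tendsto_scaleR tendsto_const LIMSEQ_power_zero) simp
      moreover have "isCont g y" using g(1) by (simp add: continuous_on_eq_continuous_at)
      ultimately have "(\<lambda>n. g (y - (1/2) ^ n *\<^sub>R z)) \<longlonglongrightarrow> g y"
        by (intro isCont_tendsto_compose[of y g]) auto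
      then have "(\<lambda>n. ennreal (g (y - (1/2) ^ n *\<^sub>R z) * mollifier 1 z)) \<longlonglongrightarrow> ennreal (g y * mollifier 1 z)"
        by (rule tendsto_ennrealI[OF tendsto_mult[OF _ tendsto_const]])
      then show "(\<lambda>n. ennreal (g (y - (1/2) ^ n *\<^sub>R z)) * ennreal (mollifier 1 z)) \<longlonglongrightarrow> ennreal (g y) * ennreal (mollifier 1 z)"
        using g(2) by (simp add: ennreal_mult mollifier_nonneg)
    qed
  qed (auto simp: nn_integral_mollifier)
  then show ?thesis
    by (simp add: nn_integral_mollifier_convolution nn_integral_cmult nn_integral_mollifier)
qed

text \<open>Two limits of the same sequence \<open>?J\<close>. After Fubini it consists of integrals
  over s of mollified values of g, which tend to \<open>g (Y s)\<close>; as integrals over x it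
  tends to the integral of g * L, because the mollified densities converge uniformly on a cube
  outside which g vanishes.\<close>

lemma nn_integral_local_time:
  fixes Y :: "'a::euclidean_space \<Rightarrow> real^'d::finite" and g L :: "real^'d \<Rightarrow> real" and A :: "'a set"
  assumes Y [measurable]: "Y \<in> borel_measurable borel" and A [measurable]: "A \<in> sets borel" and fin: "emeasure lborel A < \<infinity>"
    and F: "\<And>n x. F n x = (LINT s|lborel. indicator A s * mollifier ((1/2) ^ n) (Y s - x))"
    and L: "continuous_on UNIV L" "\<And>x. 0 \<le> L x"
    and lim: "uniform_limit (cbox (\<chi> k. -R) (\<chi> k. R)) F L sequentially"
    and g: "continuous_on UNIV g" "\<And>x. 0 \<le> g x" "\<And>x. g x \<le> 1" "\<And>x. x \<notin> cbox (\<chi> k. -R) (\<chi> k. R) \<Longrightarrow> g x = 0"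
  shows "(\<integral>\<^sup>+ s. ennreal (g (Y s)) * indicator A s \<partial>lborel) = (\<integral>\<^sup>+ x. ennreal (g x) * ennreal (L x) \<partial>lborel)"
proof (rule LIMSEQ_unique)
  let ?K = "cbox (\<chi> k. -R) (\<chi> k. R) :: (real^'d) set"
  let ?J = "\<lambda>n. \<integral>\<^sup>+ x. ennreal (g x) * ennreal (F n x) \<partial>lborel"
  have [measurable]: "g \<in> borel_measurable borel" "L \<in> borel_measurable borel"
    using g(1) L(1) by (auto intro: borel_measurable_continuous_onI)
  have nnF: "ennreal (F n x) = (\<integral>\<^sup>+ s. indicator A s * ennreal (mollifier ((1/2) ^ n) (Y s - x)) \<partial>lborel)" for n x
  proof -
    have "integrable lborel (\<lambda>s. indicator A s * mollifier ((1/2) ^ n) (Y s - x) :: real)"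
    proof (rule Bochner_Integration.integrable_bound)
      show "integrable lborel (\<lambda>s. (1 / (1/2) ^ n) ^ CARD('d) * indicator A s :: real)"
        using fin by (intro integrable_mult_right integrable_real_indicator) auto
      show "AE s in lborel. norm (indicator A s * mollifier ((1/2) ^ n) (Y s - x)) \<le> norm ((1 / (1/2) ^ n) ^ CARD('d) * indicator A s :: real)"
        using mollifier_le[of "(1/2) ^ n"] by (auto simp: indicator_def mollifier_nonneg)
    qed measurable
    then have "ennreal (F n x) = (\<integral>\<^sup>+ s. ennreal (indicator A s * mollifier ((1/2) ^ n) (Y s - x)) \<partial>lborel)"
      unfolding F by (intro nn_integral_eq_integral[symmetric]) (auto simp: mollifier_nonneg)
    then show ?thesis by (simp add: ennreal_mult' ennreal_indicator)
  qed
  have Fm [measurable]: "F n \<in> borel_measurable borel" for n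
    unfolding F[abs_def] by (intro lborel.borel_measurable_lebesgue_integral) measurable
  have J: "?J n = (\<integral>\<^sup>+ s. indicator A s * (\<integral>\<^sup>+ x. ennreal (g x) * ennreal (mollifier ((1/2) ^ n) (Y s - x)) \<partial>lborel) \<partial>lborel)" for n
  proof -
    have "?J n = (\<integral>\<^sup>+ x. \<integral>\<^sup>+ s. indicator A s * (ennreal (g x) * ennreal (mollifier ((1/2) ^ n) (Y s - x))) \<partial>lborel \<partial>lborel)"
      unfolding nnF by (subst nn_integral_cmult[symmetric]) (auto intro!: nn_integral_cong simp: mult_ac)
    also have "\<dots> = (\<integral>\<^sup>+ s. \<integral>\<^sup>+ x. indicator A s * (ennreal (g x) * ennreal (mollifier ((1/2) ^ n) (Y s - x))) \<partial>lborel \<partial>lborel)"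
      by (rule lborel_pair.Fubini') measurable
    also have "\<dots> = (\<integral>\<^sup>+ s. indicator A s * (\<integral>\<^sup>+ x. ennreal (g x) * ennreal (mollifier ((1/2) ^ n) (Y s - x)) \<partial>lborel) \<partial>lborel)"
      by (intro nn_integral_cong nn_integral_cmult) measurable
    finally show ?thesis .
  qed
  have hle: "(\<integral>\<^sup>+ x. ennreal (g x) * ennreal (mollifier ((1/2) ^ n) (y - x)) \<partial>lborel) \<le> 1" for n y
  proof -
    have "(\<integral>\<^sup>+ x. ennreal (g x) * ennreal (mollifier ((1/2) ^ n) (y - x)) \<partial>lborel) \<le>
      (\<integral>\<^sup>+ x. 1 * ennreal (mollifier ((1/2) ^ n) (y - x)) \<partial>lborel)"
      using g(3) by (intro nn_integral_mono mult_right_mono) (auto simp: ennreal_le_1)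
    also have "\<dots> = 1" by (subst nn_integral_mollifier_convolution) (auto simp: nn_integral_mollifier)
    finally show ?thesis .
  qed
  have "(\<lambda>n. \<integral>\<^sup>+ s. indicator A s * (\<integral>\<^sup>+ x. ennreal (g x) * ennreal (mollifier ((1/2) ^ n) (Y s - x)) \<partial>lborel) \<partial>lborel)
    \<longlonglongrightarrow> (\<integral>\<^sup>+ s. indicator A s * ennreal (g (Y s)) \<partial>lborel)"
  proof (rule nn_integral_dominated_convergence[where w = "indicator A"])
    show "AE s in lborel. indicator A s * (\<integral>\<^sup>+ x. ennreal (g x) * ennreal (mollifier ((1/2) ^ n) (Y s - x)) \<partial>lborel) \<le> indicator A s" for n
      using hle by (intro AE_I2) (auto simp: indicator_def)
    show "AE s in lborel. (\<lambda>n. indicator A s * (\<integral>\<^sup>+ x. ennreal (g x) * ennreal (mollifier ((1/2) ^ n) (Y s - x)) \<partial>lborel))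
      \<longlonglongrightarrow> indicator A s * ennreal (g (Y s))"
    proof (rule AE_I2)
      fix s
      have "(\<lambda>n. \<integral>\<^sup>+ x. ennreal (g x) * ennreal (mollifier ((1/2) ^ n) (Y s - x)) \<partial>lborel) \<longlonglongrightarrow> ennreal (g (Y s))"
        by (rule mollifier_convolution_tendsto[OF g(1-3)])
      then show "(\<lambda>n. indicator A s * (\<integral>\<^sup>+ x. ennreal (g x) * ennreal (mollifier ((1/2) ^ n) (Y s - x)) \<partial>lborel))
        \<longlonglongrightarrow> indicator A s * ennreal (g (Y s))"
        by (cases "s \<in> A") auto
    qed
  qed (use fin in auto)
  then show "?J \<longlonglongrightarrow> (\<integral>\<^sup>+ s. ennreal (g (Y s)) * indicator A s \<partial>lborel)" by (simp add: J mult.commute)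
  have "bounded (L ` ?K)" 
    by (intro compact_imp_bounded compact_continuous_image continuous_on_subset[OF L(1)] compact_cbox subset_UNIV)
  then obtain B where B: "\<And>x. x \<in> ?K \<Longrightarrow> \<bar>L x\<bar> \<le> B"
    unfolding bounded_iff by (metis imageI real_norm_def)
  \<comment> \<open>From N on the approximations are within 1 of L on the cube, which supplies an
    integrable majorant; the earlier terms are dropped by an offset.\<close>
  obtain N where N: "\<And>n x. n \<ge> N \<Longrightarrow> x \<in> ?K \<Longrightarrow> dist (F n x) (L x) < 1"
    using uniform_limitD[OF lim zero_less_one] unfolding eventually_sequentially by blast
  have "(\<lambda>n. \<integral>\<^sup>+ x. ennreal (g x) * ennreal (F (n + N) x) \<partial>lborel) \<longlonglongrightarrow> (\<integral>\<^sup>+ x. ennreal (g x) * ennreal (L x) \<partial>lborel)"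
  proof (rule nn_integral_dominated_convergence[where w = "\<lambda>x. ennreal (B + 1) * indicator ?K x"])
    show "AE x in lborel. ennreal (g x) * ennreal (F (n + N) x) \<le> ennreal (B + 1) * indicator ?K x" for n
    proof (rule AE_I2)
      fix x
      show "ennreal (g x) * ennreal (F (n + N) x) \<le> ennreal (B + 1) * indicator ?K x"
      proof (cases "x \<in> ?K")
        case True
        have "F (n + N) x \<le> B + 1" using N[of "n + N" x] B[OF True] True by (auto simp: dist_real_def)
        then have "ennreal (g x) * ennreal (F (n + N) x) \<le> 1 * ennreal (B + 1)"
          using g(3) by (intro mult_mono ennreal_leI) (auto simp: ennreal_le_1)
        then show ?thesis using True by simp
      qed (use g(4) in auto)
    qed
    show "AE x in lborel. (\<lambda>n. ennreal (g x) * ennreal (F (n + N) x)) \<longlonglongrightarrow> ennreal (g x) * ennreal (L x)"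
    proof (rule AE_I2)
      fix x
      show "(\<lambda>n. ennreal (g x) * ennreal (F (n + N) x)) \<longlonglongrightarrow> ennreal (g x) * ennreal (L x)"
      proof (cases "x \<in> ?K")
        case True
        have "(\<lambda>n. F (n + N) x) \<longlonglongrightarrow> L x"
          using tendsto_uniform_limitI[OF lim True] by (rule LIMSEQ_ignore_initial_segment)
        then have "(\<lambda>n. ennreal (g x * F (n + N) x)) \<longlonglongrightarrow> ennreal (g x * L x)"
          by (rule tendsto_ennrealI[OF tendsto_mult[OF tendsto_const]])
        then show ?thesis using g(2) by (simp add: ennreal_mult' L(2))
      qed (use g(4) in auto)
    qed
  qed (auto simp: nn_integral_cmult_indicator ennreal_mult_less_top emeasure_lborel_cbox_eq)
  then show "?J \<longlonglongrightarrow> (\<integral>\<^sup>+ x. ennreal (g x) * ennreal (L x) \<partial>lborel)"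
    by (rule LIMSEQ_offset)
qed

text \<open>The formula for continuous test functions passes to open boxes by monotone limits. Boxes
  form an intersection-stable generator of the Borel sets and contain an exhausting sequence of
  finite occupation measure, so the two measures agree.\<close>

lemma occupation_density:
  fixes Y :: "'a::euclidean_space \<Rightarrow> real^'d::finite" and L :: "real^'d \<Rightarrow> real" and A :: "'a set"
  assumes Y [measurable]: "Y \<in> borel_measurable borel" and A [measurable]: "A \<in> sets borel" and fin: "emeasure lborel A < \<infinity>"
    and L: "continuous_on UNIV L" "\<And>x. 0 \<le> L x"
    and lim: "\<And>R :: nat. uniform_limit (cbox (\<chi> k. - real R) (\<chi> k. real R))
      (\<lambda>n x. LINT s|lborel. indicator A s * mollifier ((1/2) ^ n) (Y s - x)) L sequentially"
    and B: "B \<in> sets borel"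
  shows "emeasure lborel {s \<in> A. Y s \<in> B} = (\<integral>\<^sup>+ x\<in>B. ennreal (L x) \<partial>lborel)"
proof -
  have [measurable]: "L \<in> borel_measurable borel" using L(1) by (rule borel_measurable_continuous_onI)
  define \<mu> where "\<mu> = distr (density lborel (indicator A)) borel Y"
  define \<nu> where "\<nu> = density lborel (\<lambda>x. ennreal (L x))"
  have em\<mu>: "emeasure \<mu> U = (\<integral>\<^sup>+ s. indicator U (Y s) * indicator A s \<partial>lborel)" if [measurable]: "U \<in> sets borel" for U
  proof -
    have [measurable]: "Y -` U \<in> sets borel" using measurable_sets[OF Y that] by simp
    have "emeasure \<mu> U = emeasure (density lborel (indicator A)) (Y -` U)"
      unfolding \<mu>_def by (subst emeasure_distr) auto
    also have "\<dots> = (\<integral>\<^sup>+ s. indicator A s * indicator (Y -` U) s \<partial>lborel)"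
      by (rule emeasure_density) auto
    also have "\<dots> = (\<integral>\<^sup>+ s. indicator U (Y s) * indicator A s \<partial>lborel)"
      by (intro nn_integral_cong) (simp add: indicator_def)
    finally show ?thesis .
  qed
  have em\<nu>: "emeasure \<nu> U = (\<integral>\<^sup>+ x. indicator U x * ennreal (L x) \<partial>lborel)" if "U \<in> sets borel" for U
    using that by (simp add: \<nu>_def emeasure_density mult.commute)
  have box_eq: "emeasure \<mu> (box a b) = emeasure \<nu> (box a b)" for a b
  proof -
    let ?U = "box a b"
    define g where "g m x = min 1 (real m * infdist x (- ?U))" for m :: nat and x :: "real^'d"
    \<comment> \<open>\<open>infdist\<close> to the empty set is 0 by convention, so approximating
      the indicator by distances needs a nonempty complement.\<close>
    have ne: "- ?U \<noteq> {}" 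
    proof
      assume "- ?U = {}"
      then have "?U = UNIV" by blast
      then show False using bounded_box[of a b] not_bounded_UNIV by simp
    qed
    have out: "g m x = 0" if "x \<notin> ?U" for m x using that by (simp add: g_def)
    obtain R :: nat where R: "?U \<subseteq> cbox (\<chi> k. - real R) (\<chi> k. real R)"
    proof -
      obtain r where r: "\<And>x. x \<in> ?U \<Longrightarrow> norm x \<le> r" using bounded_box[of a b] by (auto simp: bounded_iff)
      obtain R :: nat where "r \<le> real R" using real_arch_simple by blast
      have "- real R \<le> x $ k \<and> x $ k \<le> real R" if "x \<in> ?U" for x k
        using r[OF that] \<open>r \<le> real R\<close> component_le_norm_cart[of x k] by linarith
      then have "?U \<subseteq> cbox (\<chi> k. - real R) (\<chi> k. real R)" by (simp add: mem_box_cart subset_iff)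
      then show thesis by (rule that)
    qed
    have gc: "continuous_on UNIV (g m)" for m unfolding g_def by (intro continuous_intros)
    have [measurable]: "g m \<in> borel_measurable borel" for m by (rule borel_measurable_continuous_onI[OF gc])
    have g01: "0 \<le> g m x" "g m x \<le> 1" for m x by (auto simp: g_def infdist_nonneg)
    have inc: "incseq (\<lambda>m. ennreal (g m x))" for x
      unfolding g_def by (intro incseq_SucI ennreal_leI min.mono mult_right_mono) (auto simp: infdist_nonneg)
    have glim: "(\<lambda>m. ennreal (g m x)) \<longlonglongrightarrow> indicator ?U x" for x
    proof (cases "x \<in> ?U")
      case True
      have pos: "infdist x (- ?U) > 0"
        using True ne by (intro infdist_pos_not_in_closed) (auto simp: closed_Compl)
      obtain m0 :: nat where "1 / infdist x (- ?U) \<le> real m0" using real_arch_simple by blast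
      then have "g m x = 1" if "m \<ge> m0" for m
      proof -
        have "1 / infdist x (- ?U) \<le> real m" using \<open>1 / infdist x (- ?U) \<le> real m0\<close> that by linarith
        then show ?thesis using pos by (simp add: g_def pos_divide_le_eq)
      qed
      then have "eventually (\<lambda>m. ennreal (g m x) = indicator ?U x) sequentially"
        using True by (auto simp: eventually_sequentially)
      then show ?thesis by (rule tendsto_eventually)
    qed (simp add: out)
    have eq: "(\<integral>\<^sup>+ s. ennreal (g m (Y s)) * indicator A s \<partial>lborel) = (\<integral>\<^sup>+ x. ennreal (g m x) * ennreal (L x) \<partial>lborel)" for m
      by (rule nn_integral_local_time[OF Y A fin refl L lim[of R] gc g01]) (use out R in blast)
    have 1: "(\<lambda>m. \<integral>\<^sup>+ s. ennreal (g m (Y s)) * indicator A s \<partial>lborel) \<longlonglongrightarrow> (\<integral>\<^sup>+ s. indicator ?U (Y s) * indicator A s \<partial>lborel)"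
    proof (rule nn_integral_LIMSEQ)
      show "incseq (\<lambda>m s. ennreal (g m (Y s)) * indicator A s)"
        using inc by (auto simp: incseq_def le_fun_def intro!: mult_right_mono)
      show "(\<lambda>m. ennreal (g m (Y s)) * indicator A s) \<longlonglongrightarrow> indicator ?U (Y s) * indicator A s" for s
        using glim[of "Y s"] by (cases "s \<in> A") auto
    qed measurable
    have 2: "(\<lambda>m. \<integral>\<^sup>+ x. ennreal (g m x) * ennreal (L x) \<partial>lborel) \<longlonglongrightarrow> (\<integral>\<^sup>+ x. indicator ?U x * ennreal (L x) \<partial>lborel)"
    proof (rule nn_integral_LIMSEQ)
      show "incseq (\<lambda>m x. ennreal (g m x) * ennreal (L x))"
        using inc by (auto simp: incseq_def le_fun_def intro!: mult_right_mono)
      show "(\<lambda>m. ennreal (g m x) * ennreal (L x)) \<longlonglongrightarrow> indicator ?U x * ennreal (L x)" for x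
        by (rule tendsto_mult_ennreal[OF glim tendsto_const]) (simp add: indicator_def)
    qed measurable
    show ?thesis unfolding em\<mu>[OF borel_open[OF open_box]] em\<nu>[OF borel_open[OF open_box]]
      using 1 2 unfolding eq by (rule LIMSEQ_unique)
  qed
  have "\<mu> = \<nu>"
  proof (rule measure_eqI_generator_eq)
    let ?E = "range (\<lambda>(a, b). box a b :: (real^'d) set)"
    show "Int_stable ?E" by (auto simp: Int_stable_def box_Int_box)
    show "?E \<subseteq> Pow UNIV" "sets \<mu> = sigma_sets UNIV ?E" "sets \<nu> = sigma_sets UNIV ?E"
      by (simp_all add: borel_eq_box \<mu>_def \<nu>_def)
    let ?A = "\<lambda>n::nat. box (- (real n *\<^sub>R One)) (real n *\<^sub>R One) :: (real^'d) set"
    show "range ?A \<subseteq> ?E" "(\<Union>i. ?A i) = UNIV" unfolding UN_box_eq_UNIV by auto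
    show "emeasure \<mu> (?A i) \<noteq> \<infinity>" for i
    proof -
      have "emeasure \<mu> (?A i) \<le> (\<integral>\<^sup>+ s. indicator A s \<partial>lborel)"
        unfolding em\<mu>[OF borel_open[OF open_box]] by (intro nn_integral_mono) (auto simp: indicator_def)
      also have "\<dots> < \<infinity>" using fin by simp
      finally show ?thesis by simp
    qed
    show "emeasure \<mu> U = emeasure \<nu> U" if "U \<in> ?E" for U using that box_eq by auto
  qed
  then have "emeasure \<mu> B = emeasure \<nu> B" by simp
  moreover have "emeasure \<mu> B = emeasure lborel {s \<in> A. Y s \<in> B}"
  proof -
    have [measurable]: "B \<in> sets borel" by (rule B)
    have "emeasure \<mu> B = (\<integral>\<^sup>+ s. indicator {s \<in> A. Y s \<in> B} s \<partial>lborel)"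
      unfolding em\<mu>[OF B] by (intro nn_integral_cong) (auto simp: indicator_def)
    then show ?thesis by simp
  qed
  ultimately show ?thesis unfolding em\<nu>[OF B] by (simp add: mult.commute)
qed

section \<open>Joint continuity and the local time of a single path\<close>

lemma continuous_on_box_mollified:
  fixes X :: "'d::finite \<Rightarrow> real^'n \<Rightarrow> 'w \<Rightarrow> real" and e T \<epsilon> :: real
  assumes X: "is_LMSS M \<alpha> H X" "w \<in> space M" and eT: "e \<le> T" and \<epsilon>: "0 < \<epsilon>" "\<epsilon> \<le> 1"
  shows "continuous_on (UNIV \<times> cbox (\<chi> l. e) (\<chi> l. T)) (\<lambda>(x, t). box_mollified X (mollifier \<epsilon>) (cbox (\<chi> l. e) t) w x)"
proof -
  let ?F = "\<lambda>x t. box_mollified X (mollifier \<epsilon>) (cbox (\<chi> l. e) t) w x"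
  let ?I = "cbox (\<chi> l. e) (\<chi> l. T) :: (real^'n) set"
  obtain \<Lambda> where \<Lambda>: "0 \<le> \<Lambda>" and lip: "\<forall>w\<in>space M. \<forall>\<epsilon> x y t u r. 0 < \<epsilon> \<and> \<epsilon> \<le> 1 \<and> t \<in> ?I \<and> u \<in> ?I \<and>
      (\<forall>k. \<bar>x $ k - y $ k\<bar> \<le> r) \<and> (\<forall>l. \<bar>t $ l - u $ l\<bar> \<le> r) \<longrightarrow>
    \<bar>box_mollified X (mollifier \<epsilon>) (cbox (\<chi> l. e) t) w x - box_mollified X (mollifier \<epsilon>) (cbox (\<chi> l. e) u) w y\<bar>
      \<le> \<Lambda> * (r / \<epsilon> ^ (CARD('d) + 1))"
    using box_mollified_lipschitz[OF X(1) eT] by blast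
  have "(\<Lambda> / \<epsilon> ^ (CARD('d) + 1))-lipschitz_on (UNIV \<times> ?I) (\<lambda>(x, t). ?F x t)"
  proof (rule lipschitz_onI)
    fix p q :: "(real^'d) \<times> (real^'n)" assume "p \<in> (UNIV :: (real^'d) set) \<times> ?I" "q \<in> UNIV \<times> ?I"
    then obtain x t y u where pq: "p = (x, t)" "q = (y, u)" "t \<in> ?I" "u \<in> ?I" by auto
    have "\<bar>x $ k - y $ k\<bar> \<le> dist p q" for k
      using component_le_norm_cart[of "x - y" k] dist_fst_le[of p q] by (simp add: pq dist_norm)
    moreover have "\<bar>t $ l - u $ l\<bar> \<le> dist p q" for l
      using component_le_norm_cart[of "t - u" l] dist_snd_le[of p q] by (simp add: pq dist_norm)
    ultimately have "\<bar>?F x t - ?F y u\<bar> \<le> \<Lambda> * (dist p q / \<epsilon> ^ (CARD('d) + 1))"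
      using lip[rule_format, OF X(2), of \<epsilon> t u x y "dist p q"] \<epsilon> pq(3,4) by blast
    then show "dist (case p of (x, t) \<Rightarrow> ?F x t) (case q of (x, t) \<Rightarrow> ?F x t) \<le> \<Lambda> / \<epsilon> ^ (CARD('d) + 1) * dist p q"
      by (simp add: pq(1,2) dist_real_def)
  qed (use \<Lambda> \<epsilon> in simp)
  then show ?thesis by (rule lipschitz_on_continuous_on)
qed

text \<open>Continuity is local, and every point is interior to some cube; inside the open cube the
  two relative neighbourhood filters coincide.\<close>

lemma continuous_on_UNIV_Times_cbox:
  fixes f :: "(real^'d::finite) \<times> 'a::t2_space \<Rightarrow> 'b::topological_space"
  assumes "\<And>R::nat. continuous_on (cbox (\<chi> k. - real R) (\<chi> k. real R) \<times> I) f"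
  shows "continuous_on (UNIV \<times> I) f"
  unfolding continuous_on_eq_continuous_within
proof (rule ballI)
  fix p assume p: "p \<in> (UNIV :: (real^'d) set) \<times> I"
  obtain x t where xt: "p = (x, t)" by (cases p)
  obtain R :: nat where R: "norm x < real R" using reals_Archimedean2 by blast
  have x: "- real R < x $ k \<and> x $ k < real R" for k
    using R component_le_norm_cart[of x k] by linarith
  let ?U = "box (\<chi> k. - real R) (\<chi> k. real R) :: (real^'d) set"
  let ?K = "cbox (\<chi> k. - real R) (\<chi> k. real R) :: (real^'d) set"
  have "p \<in> ?U \<times> UNIV" "open (?U \<times> (UNIV :: 'a set))" using x by (auto simp: xt mem_box_cart intro: open_Times)
  moreover have "UNIV \<times> I \<inter> ?U \<times> UNIV - {p} = ?K \<times> I \<inter> ?U \<times> UNIV - {p}"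
    using box_subset_cbox[of "(\<chi> k. - real R) :: real^'d" "\<chi> k. real R"] by blast
  ultimately have eq: "at p within (UNIV \<times> I) = at p within (?K \<times> I)"
    by (intro at_within_nhd)
  have "p \<in> ?K \<times> I" using p x by (auto simp: xt mem_box_cart less_imp_le)
  then have "continuous (at p within ?K \<times> I) f" 
    using assms[of R] unfolding continuous_on_eq_continuous_within by blast
  then show "continuous (at p within UNIV \<times> I) f" unfolding continuous_within eq .
qed

text \<open>Purely pathwise: for a fixed outcome the summable bounds give uniform convergence on
  compact sets, under which nonnegativity, continuity and the occupation formula all pass to the
  limit.\<close>

lemma joint_local_time:
  fixes X :: "'d::finite \<Rightarrow> real^'n \<Rightarrow> 'w \<Rightarrow> real" and e T :: real
  assumes X: "is_LMSS M \<alpha> H X" "w \<in> space M" and eT: "e \<le> T"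
    and u: "\<And>R :: nat. \<exists>u. summable u \<and> (\<forall>n. \<forall>x\<in>cbox (\<chi> k. - real R) (\<chi> k. real R). \<forall>t\<in>cbox (\<chi> l. e) (\<chi> l. T).
      \<bar>box_mollified X (mollifier_diff ((1/2) ^ n)) (cbox (\<chi> l. e) t) w x\<bar> \<le> u n)"
  defines "L \<equiv> \<lambda>x t. lim (\<lambda>n. box_mollified X (mollifier ((1/2) ^ n)) (cbox (\<chi> l. e) t) w x)"
  shows "\<And>x t. t \<in> cbox (\<chi> l. e) (\<chi> l. T) \<Longrightarrow> 0 \<le> L x t"
    and "\<And>t B. t \<in> cbox (\<chi> l. e) (\<chi> l. T) \<Longrightarrow> B \<in> sets borel \<Longrightarrow>
      occupation X w (cbox (\<chi> l. e) t) B = (\<integral>\<^sup>+ x\<in>B. ennreal (L x t) \<partial>lborel)"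
    and "continuous_on (UNIV \<times> cbox (\<chi> l. e) (\<chi> l. T)) (\<lambda>(x, t). L x t)"
proof -
  let ?I = "cbox (\<chi> l. e) (\<chi> l. T) :: (real^'n) set"
  let ?K = "\<lambda>R :: nat. cbox (\<chi> k. - real R) (\<chi> k. real R) :: (real^'d) set"
  let ?F = "\<lambda>n x t. box_mollified X (mollifier ((1/2) ^ n)) (cbox (\<chi> l. e) t) w x"
  have ul: "uniform_limit (?K R \<times> ?I) (\<lambda>n (x, t). ?F n x t) (\<lambda>(x, t). L x t) sequentially" for R
  proof -
    obtain u where u': "summable u" "\<And>n x t. x \<in> ?K R \<Longrightarrow> t \<in> ?I \<Longrightarrow> \<bar>box_mollified X (mollifier_diff ((1/2) ^ n)) (cbox (\<chi> l. e) t) w x\<bar> \<le> u n"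
      using u[of R] by blast
    show ?thesis unfolding L_def by (rule uniform_limit_mollified[OF X u'])
  qed
  have ul': "uniform_limit (?K R) (\<lambda>n x. ?F n x t) (\<lambda>x. L x t) sequentially" if "t \<in> ?I" for R t
    using ul[of R] that unfolding uniform_limit_iff
    by (elim all_forward imp_forward eventually_mono) (auto elim!: eventually_mono)
  show cont: "continuous_on (UNIV \<times> ?I) (\<lambda>(x, t). L x t)"
  proof (rule continuous_on_UNIV_Times_cbox)
    fix R :: nat
    have "continuous_on (?K R \<times> ?I) (\<lambda>(x, t). ?F n x t)" for n
      by (rule continuous_on_subset[OF continuous_on_box_mollified[OF X eT]]) (auto simp: power_le_one)
    then show "continuous_on (?K R \<times> ?I) (\<lambda>(x, t). L x t)"
      by (intro uniform_limit_theorem[OF _ ul]) auto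
  qed
  have F_nonneg: "0 \<le> ?F n x t" for n x t
    unfolding box_mollified_def by (intro integral_nonneg_AE AE_I2 mult_nonneg_nonneg mollifier_nonneg) auto
  show L_nonneg: "0 \<le> L x t" if t: "t \<in> ?I" for x t
  proof -
    obtain R :: nat where "norm x \<le> real R" using real_arch_simple by blast
    then have "- real R \<le> x $ k \<and> x $ k \<le> real R" for k
      using component_le_norm_cart[of x k] by linarith
    then have "x \<in> ?K R" by (simp add: mem_box_cart)
    then have "(\<lambda>n. ?F n x t) \<longlonglongrightarrow> L x t" by (rule tendsto_uniform_limitI[OF ul'[OF t]])
    then show ?thesis by (rule LIMSEQ_le_const) (use F_nonneg in blast)
  qed
  show "occupation X w (cbox (\<chi> l. e) t) B = (\<integral>\<^sup>+ x\<in>B. ennreal (L x t) \<partial>lborel)" if t: "t \<in> ?I" and B: "B \<in> sets borel" for t B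
  proof -
    have "continuous_on UNIV (\<lambda>x. L x t)"
    proof -
      have "continuous_on UNIV (\<lambda>x :: real^'d. (x, t))" by (intro continuous_intros)
      then show ?thesis using continuous_on_compose2[OF cont, of UNIV "\<lambda>x. (x, t)"] t by auto
    qed
    then show ?thesis
      unfolding occupation_def
      using ul'[OF t] unfolding box_mollified_def
      by (intro occupation_density[OF path_val_measurable_section[OF X] _ _ _ L_nonneg[OF t] _ B])
        (auto simp: emeasure_lborel_cbox_eq)
  qed
qed

theorem theorem3p1:
  fixes M :: "'w measure"
    and alpha :: real
    and H :: "real^'n \<Rightarrow> real^'n"
    and X :: "'d::finite \<Rightarrow> real^'n \<Rightarrow> 'w \<Rightarrow> real"
    and m Mx :: "real^'n"
    and eps T :: real
  assumes alpha: "0 < alpha" "alpha \<le> 2"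
    and H_range: "\<forall>u\<in>nonneg_orthant. \<forall>l. 0 < H u $ l \<and> H u $ l < 1"
    and H1: "\<forall>l. 0 < m$l \<and> m$l < Mx$l \<and> Mx$l < 1"
            "\<forall>u\<in>nonneg_orthant. \<forall>l. m$l \<le> H u $ l \<and> H u $ l \<le> Mx$l"
    and H2: "\<forall>K. compact K \<and> K \<subseteq> nonneg_orthant \<longrightarrow>
               (\<exists>c>0. \<forall>u\<in>K. \<forall>v\<in>K. \<forall>l. \<bar>H u $ l - H v $ l\<bar> \<le> c * rho_dist m Mx u v)"
    and X: "is_LMSS M alpha H X"
    and eps: "0 < eps" "eps < T"
    and dim: "real CARD('d) < (INF v\<in>cbox (\<chi> l. eps) (\<chi> l. T). \<Sum>l\<in>UNIV. 1 / H v $ l)"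
  shows "has_joint_cont_local_time M X (\<chi> l. eps) (\<chi> l. T)"
proof -
  let ?I = "cbox (\<chi> l. eps) (\<chi> l. T) :: (real^'n) set"
  have box: "u \<in> nonneg_orthant" if "u \<in> ?I" for u
  proof -
    have "0 \<le> u $ l" for l using that eps(1) by (metis less_imp_le mem_box_cart(2) order_trans vec_lambda_beta)
    then show ?thesis by (simp add: nonneg_orthant_def)
  qed
  \<comment> \<open>The infimum itself will serve as S; boundedness below makes it a genuine lower
    bound for the sums.\<close>
  have bdd: "bdd_below ((\<lambda>v. \<Sum>l\<in>UNIV. 1 / H v $ l) ` ?I)"
    using box H_range by (intro bdd_belowI2[where m = 0] sum_nonneg) (simp add: less_imp_le)
  have "\<exists>\<gamma>>0. \<forall>p::nat. \<exists>C\<ge>0. \<forall>\<epsilon> x A. 0 < \<epsilon> \<and> A \<in> sets borel \<and> A \<subseteq> ?I \<longrightarrow>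
      \<bar>(LINT w|M. box_mollified X (mollifier_diff \<epsilon>) A w x ^ p)\<bar> \<le> C * \<epsilon> powr (\<gamma> * real p)"
    by (rule moment_bound[OF X alpha eps(1) dim]) (use H_range cINF_lower[OF bdd] in auto)
  then obtain \<gamma> :: real where \<gamma>: "0 < \<gamma>" and mom: "\<forall>p::nat. \<exists>C\<ge>0. \<forall>\<epsilon> x A. 0 < \<epsilon> \<and> A \<in> sets borel \<and> A \<subseteq> ?I \<longrightarrow>
      \<bar>(LINT w|M. box_mollified X (mollifier_diff \<epsilon>) A w x ^ p)\<bar> \<le> C * \<epsilon> powr (\<gamma> * real p)"
    by blast
  \<comment> \<open>Countably many cubes exhaust the space of levels x, so one exceptional null set
    serves for all of them.\<close>
  have "AE w in M. \<forall>R :: nat. \<exists>u. summable u \<and> (\<forall>n. \<forall>x\<in>cbox (\<chi> k. - real R) (\<chi> k. real R). \<forall>t\<in>?I.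
      \<bar>box_mollified X (mollifier_diff ((1/2) ^ n)) (cbox (\<chi> l. eps) t) w x\<bar> \<le> u n)"
    unfolding AE_all_countable
    using AE_uniform_bound[OF X less_imp_le[OF eps(2)] _ \<gamma> mom] by simp
  then show ?thesis
    unfolding has_joint_cont_local_time_def
  proof (intro exI[where x = "\<lambda>w x t. lim (\<lambda>n. box_mollified X (mollifier ((1/2) ^ n)) (cbox (\<chi> l. eps) t) w x)"],
      elim AE_mp, intro AE_I2 impI)
    fix w assume "w \<in> space M" and "\<forall>R :: nat. \<exists>u. summable u \<and> (\<forall>n. \<forall>x\<in>cbox (\<chi> k. - real R) (\<chi> k. real R). \<forall>t\<in>?I.
      \<bar>box_mollified X (mollifier_diff ((1/2) ^ n)) (cbox (\<chi> l. eps) t) w x\<bar> \<le> u n)"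
    note * = joint_local_time[OF X this(1) less_imp_le[OF eps(2)] this(2)[rule_format]]
    let ?L = "\<lambda>x t. lim (\<lambda>n. box_mollified X (mollifier ((1/2) ^ n)) (cbox (\<chi> l. eps) t) w x)"
    show "(\<forall>t\<in>?I. \<forall>x. 0 \<le> ?L x t) \<and>
      (\<forall>t\<in>?I. \<forall>B\<in>sets borel. occupation X w (cbox (\<chi> l. eps) t) B = (\<integral>\<^sup>+ x\<in>B. ennreal (?L x t) \<partial>lborel)) \<and>
      continuous_on (UNIV \<times> ?I) (\<lambda>(x, t). ?L x t)"
      using * by blast
  qed
qed

end
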